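(* Let $X$ be the strictly $\alpha$-stable process described in the context with $(\alpha,\rho)\in\mathcal{A}$ and $\alpha\in(0,1]$, and let $\tau_{-1}^1=\inf\{t>0:X_t\in(-1,1)\}$. Let $x>1$ and $y>1$. Then \[ \mathrm{E}_x\int_0^{\tau_{-1}^1}\mathbf 1_{\{X_t\in\mathrm{d}y\}}\,\mathrm{d}t\Big/\mathrm{d}y=\begin{cases}\dfrac{1}{\Gamma(\alpha\rho)\Gamma(\alpha\hat\rho)}\Bigl(\dfrac{x-y}{2}\Bigr)^{\alpha-1}\displaystyle\int_1^{\frac{1-xy}{y-x}}(t-1)^{\alpha\rho-1}(t+1)^{\alpha\hat\rho-1}\,\mathrm{d}t, & 1<y<x,\\[1em] \dfrac{1}{\Gamma(\alpha\rho)\Gamma(\alpha\hat\rho)}\Bigl(\dfrac{y-x}{2}\Bigr)^{\alpha-1}\displaystyle\int_1^{\frac{1-xy}{x-y}}(t-1)^{\alpha\hat\rho-1}(t+1)^{\alpha\rho-1}\,\mathrm{d}t, & y>x.\end{cases} \]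
   Context: $X=(X_t)_{t\ge0}$ is a one-dimensional strictly $\alpha$-stable Lévy process: a Lévy process such that for every $c>0$, $(cX_{tc^{-\alpha}})_{t\ge0}$ has the same law as $X$. It has no Gaussian component and Lévy density $c_+x^{-(\alpha+1)}\mathbf 1_{\{x>0\}}+c_-|x|^{-(\alpha+1)}\mathbf 1_{\{x<0\}}$, normalised so that $c_+=\frac{\Gamma(\alpha+1)}{\Gamma(\alpha\rho)\Gamma(1-\alpha\rho)}$, $c_-=\frac{\Gamma(\alpha+1)}{\Gamma(\alpha\hat\rho)\Gamma(1-\alpha\hat\rho)}$, where $\rho=\mathrm{P}(X_t>0)$ and $\hat\rho=1-\rho$; when $\alpha=1$ the process is the symmetric Cauchy process. The admissible set is $\mathcal{A}=\{(\alpha,\rho):\alpha\in(0,1),\rho\in(0,1)\}\cup\{(\alpha,\rho):\alpha\in(1,2),\rho\in(1-1/\alpha,1/\alpha)\}\cup\{(1,1/2)\}$. $\mathrm{P}_x,\mathrm{E}_x$ refer to the law of $X+x$ when $X$ starts at $0$. *)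

theory Defs
  imports "HOL-Probability.Probability"
begin

definition admissible :: "real \<Rightarrow> real \<Rightarrow> bool" where
  "admissible \<alpha> \<rho> \<longleftrightarrow>
     (0 < \<alpha> \<and> \<alpha> < 1 \<and> 0 < \<rho> \<and> \<rho> < 1)
   \<or> (1 < \<alpha> \<and> \<alpha> < 2 \<and> 1 - 1/\<alpha> < \<rho> \<and> \<rho> < 1/\<alpha>)
   \<or> (\<alpha> = 1 \<and> \<rho> = 1/2)"

definition c_plus :: "real \<Rightarrow> real \<Rightarrow> real" where
  "c_plus \<alpha> \<rho> = Gamma (\<alpha> + 1) / (Gamma (\<alpha> * \<rho>) * Gamma (1 - \<alpha> * \<rho>))"

definition c_minus :: "real \<Rightarrow> real \<Rightarrow> real" where
  "c_minus \<alpha> \<rho> = Gamma (\<alpha> + 1) / (Gamma (\<alpha> * (1 - \<rho>)) * Gamma (1 - \<alpha> * (1 - \<rho>)))"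

definition levy_density :: "real \<Rightarrow> real \<Rightarrow> real \<Rightarrow> real" where
  "levy_density \<alpha> \<rho> x =
     (if x > 0 then c_plus \<alpha> \<rho> * x powr (-(\<alpha>+1))
      else if x < 0 then c_minus \<alpha> \<rho> * \<bar>x\<bar> powr (-(\<alpha>+1)) else 0)"

text \<open>Characteristic exponent (no Gaussian part, no drift), for alpha in (0,1]:
  Psi(theta) = lim_{eps -> 0+} int_{|x|>eps} (1 - e^{i theta x}) Pi(dx),
  so that E exp(i theta X_t) = exp(-t Psi(theta)).  For alpha < 1 the integral converges
  absolutely; for the symmetric Cauchy case the truncation is the symmetric principal value.\<close>
definition char_exponent :: "real \<Rightarrow> real \<Rightarrow> real \<Rightarrow> complex" where
  "char_exponent \<alpha> \<rho> \<theta> =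
     Lim (at_right 0) (\<lambda>\<epsilon>::real. CLINT x|lborel.
        indicator {x. \<epsilon> < \<bar>x\<bar>} x * complex_of_real (levy_density \<alpha> \<rho> x) * (1 - iexp (\<theta> * x)))"

definition stable_levy_process ::
  "'a measure \<Rightarrow> (real \<Rightarrow> 'a \<Rightarrow> real) \<Rightarrow> real \<Rightarrow> real \<Rightarrow> bool" where
  "stable_levy_process M X \<alpha> \<rho> \<longleftrightarrow>
     prob_space M
   \<and> (\<forall>t\<ge>0. X t \<in> borel_measurable M)
   \<and> (\<forall>\<omega>\<in>space M. X 0 \<omega> = 0)
   \<and> (\<forall>\<omega>\<in>space M. \<forall>t\<ge>0. continuous (at_right t) (\<lambda>s. X s \<omega>)
          \<and> (t > 0 \<longrightarrow> (\<exists>l. ((\<lambda>s. X s \<omega>) \<longlongrightarrow> l) (at_left t))))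
   \<and> (\<forall>n (ts::nat \<Rightarrow> real). 0 \<le> ts 0 \<and> (\<forall>i<n. ts i \<le> ts (Suc i)) \<longrightarrow>
          prob_space.indep_vars M (\<lambda>_. borel) (\<lambda>i \<omega>. X (ts (Suc i)) \<omega> - X (ts i) \<omega>) {..<n})
   \<and> (\<forall>s t \<theta>. 0 \<le> s \<and> s \<le> t \<longrightarrow>
          char (distr M borel (\<lambda>\<omega>. X t \<omega> - X s \<omega>)) \<theta>
            = exp (- complex_of_real (t - s) * char_exponent \<alpha> \<rho> \<theta>))"

definition entrance_time :: "(real \<Rightarrow> 'a \<Rightarrow> real) \<Rightarrow> real \<Rightarrow> 'a \<Rightarrow> ereal" where
  "entrance_time X x \<omega> = Inf (ereal ` {t. 0 < t \<and> x + X t \<omega> \<in> {-1<..<1}})"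

definition occupation :: "(real \<Rightarrow> 'a \<Rightarrow> real) \<Rightarrow> real \<Rightarrow> real set \<Rightarrow> 'a \<Rightarrow> ennreal" where
  "occupation X x A \<omega> =
     (\<integral>\<^sup>+ t. indicator {t. 0 \<le> t \<and> ereal t < entrance_time X x \<omega>} t
              * indicator A (x + X t \<omega>) \<partial>lborel)"

definition green_density :: "real \<Rightarrow> real \<Rightarrow> real \<Rightarrow> real \<Rightarrow> real" where
  "green_density \<alpha> \<rho> x y =
     (if y < x then
        1 / (Gamma (\<alpha> * \<rho>) * Gamma (\<alpha> * (1 - \<rho>))) * ((x - y) / 2) powr (\<alpha> - 1)
        * (LBINT t=1..((1 - x*y) / (y - x)). (t - 1) powr (\<alpha>*\<rho> - 1) * (t + 1) powr (\<alpha>*(1-\<rho>) - 1))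
      else
        1 / (Gamma (\<alpha> * \<rho>) * Gamma (\<alpha> * (1 - \<rho>))) * ((y - x) / 2) powr (\<alpha> - 1)
        * (LBINT t=1..((1 - x*y) / (x - y)). (t - 1) powr (\<alpha>*(1-\<rho>) - 1) * (t + 1) powr (\<alpha>*\<rho> - 1)))"

end

theory Submission
  imports Defs
begin

text \<open>
  Put \<open>a = \<alpha> \<rho>\<close> and \<open>b = \<alpha> (1 - \<rho>)\<close>. By the strong Markov property at the entrance time, the \<open>q\<close>-potential
  of a function at \<open>x\<close> is its killed potential plus the mean of its \<open>q\<close>-potential under the entrance law, which
  is carried by \<open>[-1,1]\<close>. For \<open>\<alpha> < 1\<close> and \<open>q = 0\<close> this is applied to the indicator of \<open>A\<close> and to the function
  \<open>z \<mapsto> \<integral>\<^bsub>A\<^esub> h(y,z) dy\<close>, where \<open>h(y,\<sqdot>)\<close> is a density on \<open>(-1,1)\<close> whose potential agrees on \<open>[-1,1]\<close> with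
  the potential of the unit mass at \<open>y\<close>. The second function has no killed potential and the entrance terms agree,
  so the killed potential of the indicator is the difference of the two potentials at \<open>x\<close>, which is an incomplete
  beta integral. The potential densities come from the representation of powers as mixtures of exponentials.

  For \<open>\<alpha> = 1\<close> the process is recurrent and potentials are infinite. As \<open>q\<close> tends to zero, differences of
  \<open>q\<close>-potentials of functions of equal mass converge to differences of logarithmic potentials. The logarithmic
  potentials of \<open>h(y,\<sqdot>)\<close> and of the unit mass at \<open>y\<close> differ by a constant on \<open>[-1,1]\<close>, which survives because the
  entrance time is almost surely finite; the constant is removed by comparing with the value at \<open>x\<close>.
\<close>

section \<open>Stieltjes transforms of powers\<close>

text \<open>The law of the entrance position is never computed: the two compared functions have
  potentials on the closed interval that agree or differ by a constant, so the term containing it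
  cancels or tends to a known value. The density \<open>h\<close> can be written down because
  Moebius maps carry the two pieces of the interval cut at \<open>x\<close> to half-lines and send
  \<open>y\<close> to \<open>-p'\<close> and \<open>-p\<close> with \<open>p + p' = 1\<close>; a
  partial fraction in two variables then evaluates the sum of both integrals.

  The process is given only through the characteristic functions of its independent increments. The
  strong Markov property and the potential densities are therefore obtained as identities of finite
  measures with equal characteristic functions. The potential measure for \<open>q = 0\<close> is
  infinite, which is why it is first damped by a Gaussian.

  Integrals take values in \<open>ennreal\<close>, where subtraction is unsafe. Identities are
  stated with sums, and a term is cancelled only after its finiteness is known; for exponent one the
  diverging part of the resolvent is split off as mass times its value at one, and the remainders
  are real.\<close>

lemma nn_integral_lborel_substitution:
  fixes f g h :: "real \<Rightarrow> real"
  assumes S: "S \<in> sets borel" and T: "T \<in> sets borel"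
    and f [measurable]: "f \<in> borel_measurable borel"
    and g [measurable]: "g \<in> borel_measurable borel"
    and h [measurable]: "h \<in> borel_measurable borel"
    and der: "\<And>x. x \<in> S \<Longrightarrow> (g has_field_derivative h x) (at x)"
    and inj: "inj_on g S" and img: "g ` S = T"
    and nonneg: "\<And>y. y \<in> T \<Longrightarrow> 0 \<le> f y"
  shows "(\<integral>\<^sup>+y\<in>T. ennreal (f y) \<partial>lborel) = (\<integral>\<^sup>+x\<in>S. ennreal (\<bar>h x\<bar> * f (g x)) \<partial>lborel)"
proof -
  \<comment> \<open>Dictionary between the two notions of integral: for a nonnegative function
    absolute integrability is finiteness of the nonnegative integral, and then the values
    agree.\<close>
  have key: "(F absolutely_integrable_on U \<longleftrightarrow> (\<integral>\<^sup>+x\<in>U. ennreal (F x) \<partial>lborel) < \<infinity>) \<and>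
      (F absolutely_integrable_on U \<longrightarrow> (\<integral>\<^sup>+x\<in>U. ennreal (F x) \<partial>lborel) = ennreal (integral U F))"
    if F [measurable]: "F \<in> borel_measurable borel" and U [measurable]: "U \<in> sets borel"
      and nn: "\<And>x. x \<in> U \<Longrightarrow> 0 \<le> F x" for F :: "real \<Rightarrow> real" and U
  proof -
    have eq: "(\<integral>\<^sup>+x\<in>U. ennreal (F x) \<partial>lborel) = (\<integral>\<^sup>+x. ennreal (norm (indicator U x *\<^sub>R F x)) \<partial>lborel)"
      using nn by (intro nn_integral_cong) (auto simp: indicator_def)
    have "F absolutely_integrable_on U \<longleftrightarrow> set_integrable lborel U F"
      unfolding set_integrable_def
      by (subst integrable_completion) auto
    also have "\<dots> \<longleftrightarrow> (\<integral>\<^sup>+x\<in>U. ennreal (F x) \<partial>lborel) < \<infinity>"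
      unfolding set_integrable_def integrable_iff_bounded eq by auto
    finally have 1: "F absolutely_integrable_on U \<longleftrightarrow> (\<integral>\<^sup>+x\<in>U. ennreal (F x) \<partial>lborel) < \<infinity>" .
    moreover have "(\<integral>\<^sup>+x\<in>U. ennreal (F x) \<partial>lborel) = ennreal (integral U F)"
      if "F absolutely_integrable_on U"
    proof (rule nn_integral_has_integral_lebesgue'[OF nn])
      show "(F has_integral integral U F) U"
        using that set_lebesgue_integral_eq_integral(1) by blast
    qed
    ultimately show ?thesis by blast
  qed
  have der': "\<And>x. x \<in> S \<Longrightarrow> (g has_field_derivative h x) (at x within S)"
    using der by (rule has_field_derivative_at_within)
  have cv: "(\<lambda>x. \<bar>h x\<bar> * f (g x)) absolutely_integrable_on S \<and> integral S (\<lambda>x. \<bar>h x\<bar> * f (g x)) = b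
      \<longleftrightarrow> f absolutely_integrable_on T \<and> integral T f = b" for b
    using has_absolute_integral_change_of_variables_1'[of S g h f b] S der' inj img by auto
  have kT: "f absolutely_integrable_on T \<longleftrightarrow> (\<integral>\<^sup>+x\<in>T. ennreal (f x) \<partial>lborel) < \<infinity>"
     "f absolutely_integrable_on T \<Longrightarrow> (\<integral>\<^sup>+x\<in>T. ennreal (f x) \<partial>lborel) = ennreal (integral T f)"
    using key[OF f T nonneg] by auto
  have m: "(\<lambda>x. \<bar>h x\<bar> * f (g x)) \<in> borel_measurable borel" by measurable
  have kS: "(\<lambda>x. \<bar>h x\<bar> * f (g x)) absolutely_integrable_on S \<longleftrightarrow> (\<integral>\<^sup>+x\<in>S. ennreal (\<bar>h x\<bar> * f (g x)) \<partial>lborel) < \<infinity>"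
     "(\<lambda>x. \<bar>h x\<bar> * f (g x)) absolutely_integrable_on S \<Longrightarrow> (\<integral>\<^sup>+x\<in>S. ennreal (\<bar>h x\<bar> * f (g x)) \<partial>lborel)
        = ennreal (integral S (\<lambda>x. \<bar>h x\<bar> * f (g x)))"
    using key[OF m S] nonneg img by auto
  show ?thesis
  proof (cases "f absolutely_integrable_on T")
    case True
    then have "(\<lambda>x. \<bar>h x\<bar> * f (g x)) absolutely_integrable_on S"
      "integral S (\<lambda>x. \<bar>h x\<bar> * f (g x)) = integral T f"
      using cv[of "integral T f"] by auto
    then show ?thesis using True kT(2) kS(2) by simp
  next
    \<comment> \<open>The change of variables preserves absolute integrability in both directions,
      so here both integrals are infinite.\<close>
    case False
    then have "\<not> (\<lambda>x. \<bar>h x\<bar> * f (g x)) absolutely_integrable_on S"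
      using cv by blast
    then show ?thesis using False kT(1) kS(1) by (simp add: not_less top_unique)
  qed
qed

lemma set_nn_integral_cong:
  assumes "\<And>x. x \<in> S \<Longrightarrow> f x = g x"
  shows "(\<integral>\<^sup>+x\<in>S. f x \<partial>M) = (\<integral>\<^sup>+x\<in>S. g x \<partial>M)"
  using assms by (intro nn_integral_cong) (auto simp: indicator_def)

text \<open>The substitution \<open>t = v / (1 + v)\<close> maps the half-line to the unit interval
  of the Euler integral.\<close>

lemma nn_integral_Beta_halfline:
  fixes p q :: real
  assumes p: "0 < p" and q: "0 < q"
  shows "(\<integral>\<^sup>+v\<in>{0<..}. ennreal (v powr (p-1) * (1+v) powr (-(p+q))) \<partial>lborel) = ennreal (Beta p q)"
proof -
  let ?f = "\<lambda>t::real. t powr (p-1) * (1-t) powr (q-1)"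
  have "ennreal (Beta p q) = (\<integral>\<^sup>+t\<in>{0..1}. ennreal (?f t) \<partial>lborel)"
    by (rule nn_integral_has_integral_lebesgue'[symmetric]) (use has_integral_Beta_real[OF p q] in auto)
  also have "\<dots> = (\<integral>\<^sup>+t\<in>{0<..<1}. ennreal (?f t) \<partial>lborel)"
  proof (rule nn_integral_cong_AE)
    have "AE t in lborel. t \<noteq> (0::real) \<and> t \<noteq> 1"
      using AE_lborel_singleton[of "0::real"] AE_lborel_singleton[of "1::real"] by auto
    then show "AE t in lborel. ennreal (?f t) * indicator {0..1} t = ennreal (?f t) * indicator {0<..<1} t"
      by eventually_elim (auto simp: indicator_def)
  qed
  also have "\<dots> = (\<integral>\<^sup>+v\<in>{0<..}. ennreal (\<bar>1 / (1+v)^2\<bar> * ?f (v / (1+v))) \<partial>lborel)"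
  proof (rule nn_integral_lborel_substitution)
    show "(\<lambda>v::real. v / (1+v)) ` {0<..} = {0<..<1}"
    proof safe
      fix t :: real assume "t \<in> {0<..<1}"
      then have "t = (t/(1-t)) / (1 + t/(1-t))" "t/(1-t) \<in> {0<..}" by (auto simp: field_simps)
      then show "t \<in> (\<lambda>v. v / (1+v)) ` {0<..}" by blast
    qed auto
    show "inj_on (\<lambda>v::real. v / (1+v)) {0<..}" by (auto simp: inj_on_def field_simps)
    show "((\<lambda>v. v / (1 + v)) has_real_derivative 1 / (1 + v)\<^sup>2) (at v)" if "v \<in> {0<..}" for v :: real
      using that by (auto intro!: derivative_eq_intros simp: field_simps power2_eq_square)
  qed auto
  also have "\<dots> = (\<integral>\<^sup>+v\<in>{0<..}. ennreal (v powr (p-1) * (1+v) powr (-(p+q))) \<partial>lborel)"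
  proof (rule set_nn_integral_cong)
    fix v :: real assume "v \<in> {0<..}"
    then have v: "v > 0" by simp
    have 1: "1 - v / (1+v) = 1 / (1+v)" using v by (simp add: field_simps)
    have "ln (\<bar>1 / (1+v)^2\<bar> * ?f (v / (1+v))) = ln (v powr (p-1) * (1+v) powr (-(p+q)))"
      unfolding 1 using v by (simp add: ln_mult ln_div ln_realpow) (simp add: algebra_simps)
    then have "\<bar>1 / (1+v)^2\<bar> * ?f (v / (1+v)) = v powr (p-1) * (1+v) powr (-(p+q))"
      using v 1 by (subst (asm) ln_inj_iff) auto
    then show "ennreal (\<bar>1 / (1+v)^2\<bar> * ?f (v / (1+v))) = ennreal (v powr (p-1) * (1+v) powr (-(p+q)))"
      by simp
  qed
  finally show ?thesis by simp
qed

lemma Gamma_reflection_real: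
  fixes a :: real assumes "0 < a" "a < 1"
  shows "Gamma a * Gamma (1 - a) = pi / sin (pi * a)"
proof -
  have "complex_of_real (Gamma a * Gamma (1 - a)) = complex_of_real (pi / sin (pi * a))"
    using Gamma_reflection_complex[of "complex_of_real a"]
    by (simp flip: Gamma_complex_of_real sin_of_real)
  then show ?thesis by (simp only: of_real_eq_iff)
qed

lemma sin_pi_pos:
  fixes a :: real assumes "0 < a" "a < 1" shows "0 < sin (pi * a)"
  using assms by (intro sin_gt_zero) auto

lemma sin_pi_over_pi_eq_Gamma:
  fixes a :: real assumes "0 < a" "a < 1"
  shows "sin (pi * a) / pi = 1 / (Gamma a * Gamma (1 - a))"
proof -
  have "Gamma a > 0" "Gamma (1 - a) > 0" using assms by auto
  then show ?thesis
    using Gamma_reflection_real[OF assms] sin_pi_pos[OF assms] by (simp add: field_simps)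
qed

text \<open>Scaling \<open>v\<close> by \<open>c\<close> leaves a Beta integral whose parameters add
  up to one, and the reflection formula evaluates it. It represents \<open>c powr (-a)\<close> as a
  mixture of the functions \<open>1 / (v + c)\<close>; the main integrals below are reduced to
  it.\<close>

lemma nn_integral_Stieltjes_powr:
  fixes a c :: real
  assumes a: "0 < a" "a < 1" and c: "0 < c"
  shows "(\<integral>\<^sup>+v\<in>{0<..}. ennreal (v powr (-a) / (v+c)) \<partial>lborel) = ennreal (pi / sin (pi*a) * c powr (-a))"
proof -
  have "(\<integral>\<^sup>+v\<in>{0<..}. ennreal (v powr (-a) / (v+c)) \<partial>lborel)
      = (\<integral>\<^sup>+v\<in>{0<..}. ennreal (\<bar>c\<bar> * ((c * v) powr (-a) / (c * v+c))) \<partial>lborel)"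
  proof (rule nn_integral_lborel_substitution)
    show "(\<lambda>v. c * v) ` {0<..} = {0<..}" using c by (auto simp: image_def intro!: bexI[of _ "_ / c"])
    show "inj_on (\<lambda>v. c * v) {0<..}" using c by (auto simp: inj_on_def)
    show "((\<lambda>v. c * v) has_real_derivative c) (at v)" for v by (auto intro!: derivative_eq_intros)
  qed (use c in auto)
  also have "\<dots> = (\<integral>\<^sup>+v\<in>{0<..}. ennreal (c powr (-a)) * ennreal (v powr ((1-a)-1) * (1+v) powr (-((1-a)+a))) \<partial>lborel)"
  proof (rule set_nn_integral_cong)
    fix v :: real assume "v \<in> {0<..}"
    then have v: "v > 0" by simp
    have "ln (\<bar>c\<bar> * ((c * v) powr (-a) / (c*(1+v)))) = ln (c powr (-a) * (v powr ((1-a)-1) * (1+v) powr (-((1-a)+a))))"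
      using v c by (simp add: ln_mult ln_div) (simp add: algebra_simps)
    then have "\<bar>c\<bar> * ((c * v) powr (-a) / (c*(1+v))) = c powr (-a) * (v powr ((1-a)-1) * (1+v) powr (-((1-a)+a)))"
      using v c by (subst (asm) ln_inj_iff) auto
    then show "ennreal (\<bar>c\<bar> * ((c * v) powr (-a) / (c * v+c))) = ennreal (c powr (-a)) *
         ennreal (v powr ((1-a)-1) * (1+v) powr (-((1-a)+a)))"
      using c by (simp add: ennreal_mult'[symmetric] distrib_left add.commute)
  qed
  also have "\<dots> = (\<integral>\<^sup>+v. ennreal (c powr (-a)) * (ennreal (v powr ((1-a)-1) * (1+v) powr (-((1-a)+a))) * indicator {0<..} v) \<partial>lborel)"
    by (simp only: mult.assoc)
  also have "\<dots> = ennreal (c powr (-a)) * ennreal (Beta (1-a) a)"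
    by (subst nn_integral_cmult) (use a nn_integral_Beta_halfline[of "1-a" a] in auto)
  also have "Beta (1-a) a = pi / sin (pi*a)"
    using Gamma_reflection_real[OF a] by (simp add: Beta_def mult.commute)
  finally show ?thesis using c sin_pi_pos[OF a] by (subst (asm) ennreal_mult'[symmetric]) (auto simp: mult.commute)
qed

text \<open>Bijectivity is certified by an explicit inverse \<open>k\<close>, which for the Moebius
  maps below is easier to verify than injectivity and an image.\<close>

lemma nn_integral_lborel_substitution_inverse:
  fixes f g h k :: "real \<Rightarrow> real"
  assumes "S \<in> sets borel" "T \<in> sets borel"
    and "f \<in> borel_measurable borel" "g \<in> borel_measurable borel" "h \<in> borel_measurable borel"
    and "\<And>x. x \<in> S \<Longrightarrow> (g has_field_derivative h x) (at x)"
    and gk: "\<And>x. x \<in> S \<Longrightarrow> g x \<in> T" "\<And>y. y \<in> T \<Longrightarrow> k y \<in> S"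
      "\<And>x. x \<in> S \<Longrightarrow> k (g x) = x" "\<And>y. y \<in> T \<Longrightarrow> g (k y) = y"
    and "\<And>y. y \<in> T \<Longrightarrow> 0 \<le> f y"
  shows "(\<integral>\<^sup>+y\<in>T. ennreal (f y) \<partial>lborel) = (\<integral>\<^sup>+x\<in>S. ennreal (\<bar>h x\<bar> * f (g x)) \<partial>lborel)"
proof (rule nn_integral_lborel_substitution)
  show "inj_on g S" using gk(3) by (metis inj_onI)
  show "g ` S = T" using gk by (force simp: image_def)
qed (use assms in auto)

lemma set_nn_integral_cmult:
  assumes "f \<in> borel_measurable M" "S \<in> sets M"
  shows "(\<integral>\<^sup>+x\<in>S. c * f x \<partial>M) = c * (\<integral>\<^sup>+x\<in>S. f x \<partial>M)"
  using assms by (simp add: mult.assoc nn_integral_cmult)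

lemma set_nn_integral_cong_cmult:
  assumes "\<And>x. x \<in> S \<Longrightarrow> f x = c * g x" "g \<in> borel_measurable M" "S \<in> sets M"
  shows "(\<integral>\<^sup>+x\<in>S. f x \<partial>M) = c * (\<integral>\<^sup>+x\<in>S. g x \<partial>M)"
  using set_nn_integral_cong[of S f "\<lambda>x. c * g x" M] set_nn_integral_cmult[of g M S c] assms by simp

lemma set_nn_integral_swap:
  fixes f :: "real \<Rightarrow> real \<Rightarrow> ennreal"
  assumes f [measurable]: "(\<lambda>(s, v). f s v) \<in> borel_measurable (lborel \<Otimes>\<^sub>M lborel)"
    and [measurable]: "A \<in> sets borel" "B \<in> sets borel"
  shows "(\<integral>\<^sup>+s\<in>A. (\<integral>\<^sup>+v\<in>B. f s v \<partial>lborel) \<partial>lborel) = (\<integral>\<^sup>+v\<in>B. (\<integral>\<^sup>+s\<in>A. f s v \<partial>lborel) \<partial>lborel)"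
proof -
  have "(\<integral>\<^sup>+s\<in>A. (\<integral>\<^sup>+v\<in>B. f s v \<partial>lborel) \<partial>lborel) = (\<integral>\<^sup>+s. (\<integral>\<^sup>+v. f s v * indicator B v * indicator A s \<partial>lborel) \<partial>lborel)"
    by (intro nn_integral_cong nn_integral_multc[symmetric]) measurable
  also have "\<dots> = (\<integral>\<^sup>+v. (\<integral>\<^sup>+s. f s v * indicator B v * indicator A s \<partial>lborel) \<partial>lborel)"
    by (rule lborel_pair.Fubini') measurable
  also have "\<dots> = (\<integral>\<^sup>+v. (\<integral>\<^sup>+s. (f s v * indicator A s) * indicator B v \<partial>lborel) \<partial>lborel)"
    by (simp add: mult_ac)
  also have "\<dots> = (\<integral>\<^sup>+v\<in>B. (\<integral>\<^sup>+s\<in>A. f s v \<partial>lborel) \<partial>lborel)"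
    by (intro nn_integral_cong nn_integral_multc) measurable
  finally show ?thesis .
qed

text \<open>Logarithms turn an identity between products of positive powers into a linear identity
  in the exponents, which rewriting decides. Most of the Jacobian computations below are done this
  way.\<close>

lemma ln_eqD: "ln x = ln y \<Longrightarrow> 0 < x \<Longrightarrow> 0 < y \<Longrightarrow> x = (y::real)"
  by simp

text \<open>Integrate \<open>s powr (-b) * v powr (-a) / ((s+p) * (v+p'))\<close> over the quadrant
  in two ways. It factorises into two Stieltjes integrals; and since \<open>p + p' = 1\<close>, the
  denominator splits by partial fractions with common factor \<open>1 + s + v\<close>, so that one
  variable of each part can be integrated by \<open>nn_integral_Stieltjes_powr\<close>.\<close>

lemma Stieltjes_product:
  fixes a b p p' :: real
  assumes a: "0 < a" "a < 1" and b: "0 < b" "b < 1" and p: "0 < p" "0 < p'" "p + p' = 1"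
  shows "ennreal (sin (pi*a)) * (\<integral>\<^sup>+v\<in>{0<..}. ennreal (v powr (-a) * (1+v) powr (-b) / (v+p')) \<partial>lborel)
       + ennreal (sin (pi*b)) * (\<integral>\<^sup>+v\<in>{0<..}. ennreal (v powr (-b) * (1+v) powr (-a) / (v+p)) \<partial>lborel)
       = ennreal (pi * p powr (-b) * p' powr (-a))"
proof -
  define IA where "IA = (\<integral>\<^sup>+v\<in>{0<..}. ennreal (v powr (-a) * (1+v) powr (-b) / (v+p')) \<partial>lborel)"
  define IB where "IB = (\<integral>\<^sup>+v\<in>{0<..}. ennreal (v powr (-b) * (1+v) powr (-a) / (v+p)) \<partial>lborel)"
  have sa: "0 < sin (pi*a)" and sb: "0 < sin (pi*b)" using a b by (auto intro: sin_pi_pos)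
  let ?D = "\<lambda>s v. ennreal (s powr (-b) * v powr (-a) / ((s+p) * (v+p')))"
  let ?D1 = "\<lambda>s v. ennreal (s powr (-b) * v powr (-a) / ((1+s+v) * (s+p)))"
  let ?D2 = "\<lambda>s v. ennreal (s powr (-b) * v powr (-a) / ((1+s+v) * (v+p')))"
  have D: "(\<integral>\<^sup>+s\<in>{0<..}. (\<integral>\<^sup>+v\<in>{0<..}. ?D s v \<partial>lborel) \<partial>lborel)
      = ennreal (pi / sin (pi*b) * p powr (-b)) * ennreal (pi / sin (pi*a) * p' powr (-a))"
  proof -
    have "(\<integral>\<^sup>+s\<in>{0<..}. (\<integral>\<^sup>+v\<in>{0<..}. ?D s v \<partial>lborel) \<partial>lborel)
        = ennreal (pi / sin (pi*a) * p' powr (-a)) * (\<integral>\<^sup>+s\<in>{0<..}. ennreal (s powr (-b) / (s+p)) \<partial>lborel)"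
    proof (rule set_nn_integral_cong_cmult)
      fix s :: real assume "s \<in> {0<..}"
      have "(\<integral>\<^sup>+v\<in>{0<..}. ?D s v \<partial>lborel) = ennreal (s powr (-b) / (s+p)) * (\<integral>\<^sup>+v\<in>{0<..}. ennreal (v powr (-a) / (v+p')) \<partial>lborel)"
        using \<open>s \<in> {0<..}\<close> p by (intro set_nn_integral_cong_cmult) (auto simp: ennreal_mult'[symmetric])
      then show "(\<integral>\<^sup>+v\<in>{0<..}. ?D s v \<partial>lborel) = ennreal (pi / sin (pi*a) * p' powr (-a)) * ennreal (s powr (-b) / (s+p))"
        unfolding nn_integral_Stieltjes_powr[OF a p(2)] by (simp add: mult.commute)
    qed auto
    then show ?thesis unfolding nn_integral_Stieltjes_powr[OF b p(1)] by (simp add: mult.commute)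
  qed
  have D1: "(\<integral>\<^sup>+s\<in>{0<..}. (\<integral>\<^sup>+v\<in>{0<..}. ?D1 s v \<partial>lborel) \<partial>lborel) = ennreal (pi / sin (pi*a)) * IB"
    unfolding IB_def
  proof (rule set_nn_integral_cong_cmult)
    fix s :: real assume s: "s \<in> {0<..}"
    have "(\<integral>\<^sup>+v\<in>{0<..}. ?D1 s v \<partial>lborel) = ennreal (s powr (-b) / (s+p)) * (\<integral>\<^sup>+v\<in>{0<..}. ennreal (v powr (-a) / (v+(1+s))) \<partial>lborel)"
      using s p by (intro set_nn_integral_cong_cmult) (auto simp: ennreal_mult'[symmetric] ac_simps)
    also have "\<dots> = ennreal (s powr (-b) / (s+p)) * ennreal (pi / sin (pi*a) * (1+s) powr (-a))"
      using s by (subst nn_integral_Stieltjes_powr[OF a]) auto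
    finally show "(\<integral>\<^sup>+v\<in>{0<..}. ?D1 s v \<partial>lborel) = ennreal (pi / sin (pi*a)) * ennreal (s powr (-b) * (1+s) powr (-a) / (s+p))"
      using s p sa by (simp add: ennreal_mult'[symmetric] ac_simps)
  qed auto
  have D2: "(\<integral>\<^sup>+s\<in>{0<..}. (\<integral>\<^sup>+v\<in>{0<..}. ?D2 s v \<partial>lborel) \<partial>lborel) = ennreal (pi / sin (pi*b)) * IA"
  proof -
    have "(\<integral>\<^sup>+s\<in>{0<..}. (\<integral>\<^sup>+v\<in>{0<..}. ?D2 s v \<partial>lborel) \<partial>lborel) = (\<integral>\<^sup>+v\<in>{0<..}. (\<integral>\<^sup>+s\<in>{0<..}. ?D2 s v \<partial>lborel) \<partial>lborel)"
      by (rule set_nn_integral_swap) auto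
    also have "\<dots> = ennreal (pi / sin (pi*b)) * IA"
      unfolding IA_def
    proof (rule set_nn_integral_cong_cmult)
      fix v :: real assume v: "v \<in> {0<..}"
      have "(\<integral>\<^sup>+s\<in>{0<..}. ?D2 s v \<partial>lborel) = ennreal (v powr (-a) / (v+p')) * (\<integral>\<^sup>+s\<in>{0<..}. ennreal (s powr (-b) / (s+(1+v))) \<partial>lborel)"
        using v p by (intro set_nn_integral_cong_cmult) (auto simp: ennreal_mult'[symmetric] ac_simps)
      also have "\<dots> = ennreal (v powr (-a) / (v+p')) * ennreal (pi / sin (pi*b) * (1+v) powr (-b))"
        using v by (subst nn_integral_Stieltjes_powr[OF b]) auto
      finally show "(\<integral>\<^sup>+s\<in>{0<..}. ?D2 s v \<partial>lborel) = ennreal (pi / sin (pi*b)) * ennreal (v powr (-a) * (1+v) powr (-b) / (v+p'))"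
        using v p sb by (simp add: ennreal_mult'[symmetric] ac_simps)
    qed auto
    finally show ?thesis .
  qed
  have split: "?D s v = ?D1 s v + ?D2 s v" if "s > 0" "v > 0" for s v
  proof -
    have pf: "1 / (X * Y) = 1 / ((X + Y) * X) + 1 / ((X + Y) * Y)" if "X > 0" "Y > 0" for X Y :: real
      using that by (simp add: divide_simps)
    \<comment> \<open>Here \<open>p + p' = 1\<close> enters.\<close>
    have "1 + s + v = (s + p) + (v + p')" using p by simp
    then have "1 / ((s+p) * (v+p')) = 1 / ((1+s+v) * (s+p)) + 1 / ((1+s+v) * (v+p'))"
      using pf[of "s+p" "v+p'"] that p by (simp only:)
    then have "s powr (-b) * v powr (-a) * (1 / ((s+p) * (v+p')))
       = s powr (-b) * v powr (-a) * (1 / ((1+s+v) * (s+p))) + s powr (-b) * v powr (-a) * (1 / ((1+s+v) * (v+p')))"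
      by (simp only: distrib_left)
    then show ?thesis using that p by (subst ennreal_plus[symmetric]) auto
  qed
  have "(\<integral>\<^sup>+s\<in>{0<..}. (\<integral>\<^sup>+v\<in>{0<..}. ?D s v \<partial>lborel) \<partial>lborel)
     = (\<integral>\<^sup>+s\<in>{0<..}. ((\<integral>\<^sup>+v\<in>{0<..}. ?D1 s v \<partial>lborel) + (\<integral>\<^sup>+v\<in>{0<..}. ?D2 s v \<partial>lborel)) \<partial>lborel)"
  proof (rule set_nn_integral_cong)
    fix s :: real assume s: "s \<in> {0<..}"
    have "(\<integral>\<^sup>+v\<in>{0<..}. ?D s v \<partial>lborel) = (\<integral>\<^sup>+v\<in>{0<..}. (?D1 s v + ?D2 s v) \<partial>lborel)"
      using split s by (intro set_nn_integral_cong) auto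
    then show "(\<integral>\<^sup>+v\<in>{0<..}. ?D s v \<partial>lborel) = (\<integral>\<^sup>+v\<in>{0<..}. ?D1 s v \<partial>lborel) + (\<integral>\<^sup>+v\<in>{0<..}. ?D2 s v \<partial>lborel)"
      by (simp add: distrib_right nn_integral_add)
  qed
  also have "\<dots> = (\<integral>\<^sup>+s\<in>{0<..}. (\<integral>\<^sup>+v\<in>{0<..}. ?D1 s v \<partial>lborel) \<partial>lborel) + (\<integral>\<^sup>+s\<in>{0<..}. (\<integral>\<^sup>+v\<in>{0<..}. ?D2 s v \<partial>lborel) \<partial>lborel)"
    by (simp add: distrib_right nn_integral_add)
  finally have main: "ennreal (pi / sin (pi*a)) * IB + ennreal (pi / sin (pi*b)) * IA
      = ennreal (pi / sin (pi*b) * p powr (-b) * (pi / sin (pi*a) * p' powr (-a)))"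
    unfolding D D1 D2 using p sa sb by (simp add: ennreal_mult'[symmetric])
  have "ennreal (sin (pi*a)) * IA + ennreal (sin (pi*b)) * IB
      = ennreal (sin (pi*a) * sin (pi*b) / pi) * (ennreal (pi / sin (pi*a)) * IB + ennreal (pi / sin (pi*b)) * IA)"
    using sa sb by (simp add: distrib_left mult.assoc[symmetric] ennreal_mult'[symmetric] add.commute)
  also have "\<dots> = ennreal (pi * p powr (-b) * p' powr (-a))"
    unfolding main using sa sb p by (subst ennreal_mult'[symmetric]) (auto simp: field_simps)
  finally show ?thesis unfolding IA_def IB_def .
qed

section \<open>Balayage onto the interval\<close>

text \<open>In the application \<open>hit_kernel a b y\<close> is the density of the position at which the dual process
  started at \<open>y\<close> enters the interval, and \<open>riesz_kernel a b\<close> is the potential density of the process.\<close>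
definition hit_kernel :: "real \<Rightarrow> real \<Rightarrow> real \<Rightarrow> real \<Rightarrow> real" where
  "hit_kernel a b y z = sin (pi*a) / pi * (y-1) powr a * (y+1) powr b * ((1-z) powr (-a) * (1+z) powr (-b) / (y-z))"

definition riesz_kernel :: "real \<Rightarrow> real \<Rightarrow> real \<Rightarrow> real" where
  "riesz_kernel a b w = Gamma (1-a-b) / pi * (if w > 0 then sin (pi*a) else sin (pi*b)) * \<bar>w\<bar> powr (a+b-1)"

lemma hit_kernel_nonneg:
  assumes "0 < a" "a < 1" "1 < y" "-1 < z" "z < 1"
  shows "0 \<le> hit_kernel a b y z"
  using assms sin_pi_pos[of a] by (auto simp: hit_kernel_def intro!: mult_nonneg_nonneg divide_nonneg_nonneg)

lemma borel_measurable_hit_kernel [measurable]: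
  "(\<lambda>(y, z). hit_kernel a b y z) \<in> borel_measurable (borel \<Otimes>\<^sub>M borel)"
  unfolding hit_kernel_def by measurable

lemma borel_measurable_riesz_kernel [measurable]: "riesz_kernel a b \<in> borel_measurable borel"
  unfolding riesz_kernel_def by measurable

text \<open>Fractional linear substitutions, one for each side of \<open>x\<close>, carry
  \<open>(x,1)\<close> and \<open>(-1,x)\<close> onto the half-line and turn the two integrals into
  those of \<open>Stieltjes_product\<close>, up to the same factor \<open>C\<close>.\<close>

lemma balayage_interior:
  fixes a b x y :: real
  assumes a: "0 < a" "a < 1" and b: "0 < b" "b < 1" and x: "-1 < x" "x < 1" and y: "1 < y"
  shows "ennreal (sin (pi*a)) * (\<integral>\<^sup>+z\<in>{x<..<1}. ennreal ((1-z) powr (-a) * (1+z) powr (-b) / (y-z) * (z-x) powr (a+b-1)) \<partial>lborel)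
       + ennreal (sin (pi*b)) * (\<integral>\<^sup>+z\<in>{-1<..<x}. ennreal ((1-z) powr (-a) * (1+z) powr (-b) / (y-z) * (x-z) powr (a+b-1)) \<partial>lborel)
       = ennreal (pi * (y+1) powr (-b) * (y-1) powr (-a) * (y-x) powr (a+b-1))" (is "_ * ?I1 + _ * ?I2 = _")
proof -
  \<comment> \<open>\<open>- p'\<close> and \<open>- p\<close> are the images of \<open>y\<close>
    under the two substitutions below, so that the factor \<open>y - z\<close> arises from
    \<open>v + p'\<close> respectively \<open>v + p\<close>.\<close>
  define p where "p = (1+y) * (1-x) / (2 * (y-x))"
  define p' where "p' = (1+x) * (y-1) / (2 * (y-x))"
  define C where "C = (1+x) powr (-a) * (1-x) powr (-b) * 2 powr (a+b) * (y-x)"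
  have pp: "p > 0" "p' > 0" "p + p' = 1"
  proof -
    have "(1+y) * (1-x) + (1+x) * (y-1) = 2 * (y-x)" by (simp add: algebra_simps)
    then show "p + p' = 1" unfolding p_def p'_def using x y by (simp add: add_divide_distrib[symmetric])
  qed (use x y in \<open>auto simp: p_def p'_def\<close>)
  have C: "C > 0" using x y by (auto simp: C_def)
  \<comment> \<open>Common Jacobian identity for both sides, with \<open>A = 1-z\<close>,
    \<open>B = 1+z\<close>, \<open>D = \<bar>z-x\<bar>\<close>, \<open>E = y-x\<close> and
    \<open>F = y-z\<close>.\<close>
  have alg: "(P*Q / (2*D\<^sup>2)) * ((P*A/(2*D)) powr (-a) * (Q*B/(2*D)) powr (-b) / (P*Q*F/(2*D*E)))
      = (P powr (-a) * Q powr (-b) * 2 powr (a+b) * E) * (A powr (-a) * B powr (-b) / F * D powr (a+b-1))"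
    if "P > 0" "Q > 0" "A > 0" "B > 0" "D > 0" "E > 0" "F > 0" for P Q A B D E F :: real
  proof (rule ln_eqD)
    show "ln ((P*Q / (2*D\<^sup>2)) * ((P*A/(2*D)) powr (-a) * (Q*B/(2*D)) powr (-b) / (P*Q*F/(2*D*E))))
      = ln ((P powr (-a) * Q powr (-b) * 2 powr (a+b) * E) * (A powr (-a) * B powr (-b) / F * D powr (a+b-1)))"
      using that by (simp add: ln_mult ln_div ln_realpow) (simp add: algebra_simps)
  qed (use that in auto)
  have I1: "(\<integral>\<^sup>+v\<in>{0<..}. ennreal (v powr (-a) * (1+v) powr (-b) / (v+p')) \<partial>lborel) = ennreal C * ?I1"
  proof -
    have "(\<integral>\<^sup>+v\<in>{0<..}. ennreal (v powr (-a) * (1+v) powr (-b) / (v+p')) \<partial>lborel)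
        = (\<integral>\<^sup>+z\<in>{x<..<1}. ennreal (\<bar>- ((1-x)*(1+x) / (2*(z-x)\<^sup>2))\<bar> *
           (((1+x)*(1-z)/(2*(z-x))) powr (-a) * (1+(1+x)*(1-z)/(2*(z-x))) powr (-b) / ((1+x)*(1-z)/(2*(z-x))+p'))) \<partial>lborel)"
    proof (rule nn_integral_lborel_substitution_inverse[where k = "\<lambda>v. (1+x+2 * v * x) / (2 * v+1+x)"])
      fix z assume z: "z \<in> {x<..<1}"
      show "((\<lambda>z. (1+x)*(1-z)/(2*(z-x))) has_real_derivative - ((1-x)*(1+x) / (2*(z-x)\<^sup>2))) (at z)"
        using z by (auto intro!: derivative_eq_intros simp: divide_simps power2_eq_square) (simp add: algebra_simps)
      show "(1+x)*(1-z)/(2*(z-x)) \<in> {0<..}" using z x by auto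
      have "2*((1+x)*(1-z)/(2*(z-x)))+1+x = (1+x)*(1-x)/(z-x)"
        "1+x+2*((1+x)*(1-z)/(2*(z-x)))*x = (1+x)*(1-x)*z/(z-x)"
        using z by (simp_all add: divide_simps) (simp_all add: algebra_simps)
      then show "(1+x+2*((1+x)*(1-z)/(2*(z-x)))*x) / (2*((1+x)*(1-z)/(2*(z-x)))+1+x) = z"
        using z x by simp
    next
      fix v :: real assume v: "v \<in> {0<..}"
      define d where "d = 2 * v+1+x"
      have d: "d > 0" using v x by (simp add: d_def)
      have e: "(1+x+2 * v * x) / d - x = (1-x)*(1+x)/d" "1 - (1+x+2 * v * x) / d = 2 * v * (1-x)/d"
        using d by (simp_all add: divide_simps) (simp_all add: d_def algebra_simps)
      have "(1-x)*(1+x)/d > 0" "2 * v * (1-x)/d > 0" using d x v by auto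
      with e show "(1+x+2 * v * x) / (2 * v+1+x) \<in> {x<..<1}"
        by (auto simp: d_def[symmetric])
      show "(1+x)*(1-(1+x+2 * v * x) / (2 * v+1+x))/(2*((1+x+2 * v * x) / (2 * v+1+x)-x)) = v"
        unfolding d_def[symmetric] e using d x by (simp add: divide_simps)
    qed (use pp in auto)
    also have "\<dots> = ennreal C * ?I1"
    proof (rule set_nn_integral_cong_cmult)
      fix z assume z: "z \<in> {x<..<1}"
      have e1: "1+(1+x)*(1-z)/(2*(z-x)) = (1-x)*(1+z)/(2*(z-x))"
        using z by (simp add: divide_simps) (simp add: algebra_simps)
      have e2: "(1+x)*(1-z)/(2*(z-x))+p' = (1+x)*(1-x)*(y-z)/(2*(z-x)*(y-x))"
        using z x y unfolding p'_def by (simp add: divide_simps) (simp add: algebra_simps)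
      have e3: "\<bar>- ((1-x)*(1+x) / (2*(z-x)\<^sup>2))\<bar> = (1+x)*(1-x) / (2*(z-x)\<^sup>2)"
        using z x by (simp add: abs_mult)
      show "ennreal (\<bar>- ((1-x)*(1+x) / (2*(z-x)\<^sup>2))\<bar> *
           (((1+x)*(1-z)/(2*(z-x))) powr (-a) * (1+(1+x)*(1-z)/(2*(z-x))) powr (-b) / ((1+x)*(1-z)/(2*(z-x))+p')))
         = ennreal C * ennreal ((1-z) powr (-a) * (1+z) powr (-b) / (y-z) * (z-x) powr (a+b-1))"
        unfolding e1 e2 e3 using alg[of "1+x" "1-x" "1-z" "1+z" "z-x" "y-x" "y-z"] z x y C
        by (subst ennreal_mult'[symmetric]) (auto simp: C_def)
    qed auto
    finally show ?thesis .
  qed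
  have I2: "(\<integral>\<^sup>+v\<in>{0<..}. ennreal (v powr (-b) * (1+v) powr (-a) / (v+p)) \<partial>lborel) = ennreal C * ?I2"
  proof -
    have "(\<integral>\<^sup>+v\<in>{0<..}. ennreal (v powr (-b) * (1+v) powr (-a) / (v+p)) \<partial>lborel)
        = (\<integral>\<^sup>+z\<in>{-1<..<x}. ennreal (\<bar>(1-x)*(1+x) / (2*(x-z)\<^sup>2)\<bar> *
           (((1-x)*(1+z)/(2*(x-z))) powr (-b) * (1+(1-x)*(1+z)/(2*(x-z))) powr (-a) / ((1-x)*(1+z)/(2*(x-z))+p))) \<partial>lborel)"
    proof (rule nn_integral_lborel_substitution_inverse[where k = "\<lambda>v. (2 * v * x-(1-x)) / (2 * v+1-x)"])
      fix z assume z: "z \<in> {-1<..<x}"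
      show "((\<lambda>z. (1-x)*(1+z)/(2*(x-z))) has_real_derivative ((1-x)*(1+x) / (2*(x-z)\<^sup>2))) (at z)"
        using z by (auto intro!: derivative_eq_intros simp: divide_simps power2_eq_square) (simp add: algebra_simps)
      show "(1-x)*(1+z)/(2*(x-z)) \<in> {0<..}" using z x by auto
      have "2*((1-x)*(1+z)/(2*(x-z)))+1-x = (1+x)*(1-x)/(x-z)"
        "2*((1-x)*(1+z)/(2*(x-z)))*x-(1-x) = (1+x)*(1-x)*z/(x-z)"
        using z by (simp_all add: divide_simps) (simp_all add: algebra_simps)
      then show "(2*((1-x)*(1+z)/(2*(x-z)))*x-(1-x)) / (2*((1-x)*(1+z)/(2*(x-z)))+1-x) = z"
        using z x by simp
    next
      fix v :: real assume v: "v \<in> {0<..}"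
      define d where "d = 2 * v+1-x"
      have d: "d > 0" using v x by (simp add: d_def)
      have e: "x - (2 * v * x-(1-x)) / d = (1-x)*(1+x)/d" "1 + (2 * v * x-(1-x)) / d = 2 * v * (1+x)/d"
        using d by (simp_all add: divide_simps) (simp_all add: d_def algebra_simps)
      have "(1-x)*(1+x)/d > 0" "2 * v * (1+x)/d > 0" using d x v by auto
      with e show "(2 * v * x-(1-x)) / (2 * v+1-x) \<in> {-1<..<x}"
        by (auto simp: d_def[symmetric])
      show "(1-x)*(1+(2 * v * x-(1-x)) / (2 * v+1-x))/(2*(x-(2 * v * x-(1-x)) / (2 * v+1-x))) = v"
        unfolding d_def[symmetric] e using d x by (simp add: divide_simps)
    qed (use pp in auto)
    also have "\<dots> = ennreal C * ?I2"
    proof (rule set_nn_integral_cong_cmult)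
      fix z assume z: "z \<in> {-1<..<x}"
      have e1: "1+(1-x)*(1+z)/(2*(x-z)) = (1+x)*(1-z)/(2*(x-z))"
        using z by (simp add: divide_simps) (simp add: algebra_simps)
      have e2: "(1-x)*(1+z)/(2*(x-z))+p = (1+x)*(1-x)*(y-z)/(2*(x-z)*(y-x))"
        using z x y unfolding p_def by (simp add: divide_simps) (simp add: algebra_simps)
      have e3: "\<bar>(1-x)*(1+x) / (2*(x-z)\<^sup>2)\<bar> = (1+x)*(1-x) / (2*(x-z)\<^sup>2)"
        using z x by (simp add: abs_mult)
      show "ennreal (\<bar>(1-x)*(1+x) / (2*(x-z)\<^sup>2)\<bar> *
           (((1-x)*(1+z)/(2*(x-z))) powr (-b) * (1+(1-x)*(1+z)/(2*(x-z))) powr (-a) / ((1-x)*(1+z)/(2*(x-z))+p)))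
         = ennreal C * ennreal ((1-z) powr (-a) * (1+z) powr (-b) / (y-z) * (x-z) powr (a+b-1))"
        unfolding e1 e2 e3 using alg[of "1+x" "1-x" "1-z" "1+z" "x-z" "y-x" "y-z"] z x y C
        by (subst ennreal_mult'[symmetric]) (auto simp: C_def mult.commute)
    qed auto
    finally show ?thesis .
  qed
  have fin: "pi * p powr (-b) * p' powr (-a) = C * (pi * (y+1) powr (-b) * (y-1) powr (-a) * (y-x) powr (a+b-1))"
  proof -
    have "pi * (R*Q/(2*E)) powr (-b) * (P*S/(2*E)) powr (-a)
       = P powr (-a) * Q powr (-b) * 2 powr (a+b) * E * (pi * R powr (-b) * S powr (-a) * E powr (a+b-1))"
      if "P > 0" "Q > 0" "R > 0" "S > 0" "E > 0" for P Q R S E :: real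
    proof (rule ln_eqD)
      show "ln (pi * (R*Q/(2*E)) powr (-b) * (P*S/(2*E)) powr (-a))
       = ln (P powr (-a) * Q powr (-b) * 2 powr (a+b) * E * (pi * R powr (-b) * S powr (-a) * E powr (a+b-1)))"
        using that by (simp add: ln_mult ln_div) (simp add: algebra_simps)
    qed (use that in auto)
    from this[of "1+x" "1-x" "y+1" "y-1" "y-x"] show ?thesis
      using x y by (simp add: p_def p'_def C_def add.commute)
  qed
  have "ennreal C * (ennreal (sin (pi*a)) * ?I1 + ennreal (sin (pi*b)) * ?I2)
      = ennreal C * ennreal (pi * (y+1) powr (-b) * (y-1) powr (-a) * (y-x) powr (a+b-1))"
    using Stieltjes_product[OF a b pp] C unfolding I1 I2 fin
    by (simp add: distrib_left ennreal_mult' mult_ac)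
  then show ?thesis using C by (simp add: ennreal_mult_cancel_left)
qed

text \<open>The degenerate case \<open>x = 1\<close> or \<open>x = -1\<close> of the balayage: one
  of the two integrals is over an empty interval, and in the other the kernel merges with one
  weight, leaving exponents that add up to \<open>-1\<close>. The substitution
  \<open>v = (1-z)/(1+z)\<close> then gives a single Stieltjes integral.\<close>

lemma nn_integral_endpoint:
  fixes \<beta> y :: real
  assumes \<beta>: "0 < \<beta>" "\<beta> < 1" and y: "1 < y"
  shows "(\<integral>\<^sup>+z\<in>{-1<..<1}. ennreal ((1-z) powr (-\<beta>) * (1+z) powr (\<beta>-1) / (y-z)) \<partial>lborel)
    = ennreal (pi / sin (pi*\<beta>) * (y-1) powr (-\<beta>) * (y+1) powr (\<beta>-1))" (is "?I = _")
proof -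
  define c where "c = (y-1)/(y+1)"
  have c: "c > 0" using y by (simp add: c_def)
  have alg: "(2 / B\<^sup>2) * ((A/B) powr (-\<beta>) / (2*F/(B*G))) = G * (A powr (-\<beta>) * B powr (\<beta>-1) / F)"
    if "A > 0" "B > 0" "F > 0" "G > 0" for A B F G :: real
  proof (rule ln_eqD)
    show "ln ((2 / B\<^sup>2) * ((A/B) powr (-\<beta>) / (2*F/(B*G)))) = ln (G * (A powr (-\<beta>) * B powr (\<beta>-1) / F))"
      using that by (simp add: ln_mult ln_div ln_realpow) (simp add: algebra_simps)
  qed (use that in auto)
  have "ennreal (pi / sin (pi*\<beta>) * c powr (-\<beta>)) = (\<integral>\<^sup>+v\<in>{0<..}. ennreal (v powr (-\<beta>) / (v+c)) \<partial>lborel)"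
    by (rule nn_integral_Stieltjes_powr[OF \<beta> c, symmetric])
  also have "\<dots> = (\<integral>\<^sup>+z\<in>{-1<..<1}. ennreal (\<bar>- (2 / (1+z)\<^sup>2)\<bar> * (((1-z)/(1+z)) powr (-\<beta>) / ((1-z)/(1+z)+c))) \<partial>lborel)"
  proof (rule nn_integral_lborel_substitution_inverse[where k = "\<lambda>v. (1-v)/(1+v)"])
    fix z :: real assume z: "z \<in> {-1<..<1}"
    show "((\<lambda>z. (1-z)/(1+z)) has_real_derivative - (2 / (1+z)\<^sup>2)) (at z)"
      using z by (auto intro!: derivative_eq_intros simp: divide_simps power2_eq_square)
    show "(1-(1-z)/(1+z))/(1+(1-z)/(1+z)) = z" using z by (simp add: divide_simps)
    show "(1-z)/(1+z) \<in> {0<..}" using z by auto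
  next
    fix v :: real assume "v \<in> {0<..}"
    then show "(1-v)/(1+v) \<in> {-1<..<1}" "(1-(1-v)/(1+v))/(1+(1-v)/(1+v)) = v" by (auto simp: divide_simps)
  qed (use c in auto)
  also have "\<dots> = ennreal (y+1) * ?I"
  proof (rule set_nn_integral_cong_cmult)
    fix z :: real assume z: "z \<in> {-1<..<1}"
    have e: "(1-z)/(1+z)+c = 2*(y-z)/((1+z)*(y+1))"
      using z y unfolding c_def by (simp add: divide_simps) (simp add: algebra_simps)
    show "ennreal (\<bar>- (2 / (1+z)\<^sup>2)\<bar> * (((1-z)/(1+z)) powr (-\<beta>) / ((1-z)/(1+z)+c)))
       = ennreal (y+1) * ennreal ((1-z) powr (-\<beta>) * (1+z) powr (\<beta>-1) / (y-z))"
      unfolding e using alg[of "1-z" "1+z" "y-z" "y+1"] z y by (subst ennreal_mult'[symmetric]) auto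
  qed auto
  finally have *: "ennreal (pi / sin (pi*\<beta>) * c powr (-\<beta>)) = ennreal (y+1) * ?I" .
  have "pi / sin (pi*\<beta>) * c powr (-\<beta>) = (y+1) * (pi / sin (pi*\<beta>) * (y-1) powr (-\<beta>) * (y+1) powr (\<beta>-1))"
  proof (rule ln_eqD)
    show "ln (pi / sin (pi*\<beta>) * c powr (-\<beta>)) = ln ((y+1) * (pi / sin (pi*\<beta>) * (y-1) powr (-\<beta>) * (y+1) powr (\<beta>-1)))"
      using y sin_pi_pos[OF \<beta>] unfolding c_def by (simp add: ln_mult ln_div) (simp add: algebra_simps)
  qed (use y c sin_pi_pos[OF \<beta>] in auto)
  then have "ennreal (pi / sin (pi*\<beta>) * c powr (-\<beta>)) = ennreal (y+1) * ennreal (pi / sin (pi*\<beta>) * (y-1) powr (-\<beta>) * (y+1) powr (\<beta>-1))"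
    by (simp only:) (rule ennreal_mult', use y in simp)
  then have "ennreal (y+1) * ?I = ennreal (y+1) * ennreal (pi / sin (pi*\<beta>) * (y-1) powr (-\<beta>) * (y+1) powr (\<beta>-1))"
    by (simp only: *)
  then show ?thesis using y by (simp add: ennreal_mult_cancel_left)
qed

text \<open>The endpoints are included because the entrance law is shown to be carried by the closed
  interval only.\<close>

lemma hit_kernel_potential_inside:
  fixes a b x y :: real
  assumes a: "0 < a" and b: "0 < b" and ab: "a + b < 1" and x: "-1 \<le> x" "x \<le> 1" and y: "1 < y"
  shows "(\<integral>\<^sup>+z\<in>{-1<..<1}. ennreal (hit_kernel a b y z) * ennreal (riesz_kernel a b (z-x)) \<partial>lborel) = ennreal (riesz_kernel a b (y-x))"
proof -
  have a': "a < 1" and b': "b < 1" using a b ab by auto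
  have sa: "0 < sin (pi*a)" and sb: "0 < sin (pi*b)" using a b a' b' by (auto intro: sin_pi_pos)
  define G where "G = Gamma (1-a-b) / pi"
  have G: "G > 0" using ab by (auto simp: G_def intro!: divide_pos_pos Gamma_real_pos)
  define K where "K = sin (pi*a) / pi * (y-1) powr a * (y+1) powr b"
  have K: "K > 0" using sa y by (auto simp: K_def)
  let ?W = "\<lambda>z. (1-z) powr (-a) * (1+z) powr (-b) / (y-z)"
  \<comment> \<open>The sign of \<open>z - x\<close> selects the constant in
    \<open>riesz_kernel\<close>, which splits the integral at \<open>x\<close>.\<close>
  have split: "(\<integral>\<^sup>+z\<in>{-1<..<1}. ennreal (hit_kernel a b y z) * ennreal (riesz_kernel a b (z-x)) \<partial>lborel)
      = ennreal (K * G) * (ennreal (sin (pi*a)) * (\<integral>\<^sup>+z\<in>{x<..<1}. ennreal (?W z * (z-x) powr (a+b-1)) \<partial>lborel)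
       + ennreal (sin (pi*b)) * (\<integral>\<^sup>+z\<in>{-1<..<x}. ennreal (?W z * (x-z) powr (a+b-1)) \<partial>lborel))" (is "?L = _")
  proof -
    have "?L = (\<integral>\<^sup>+z. ennreal (K * G * sin (pi*a)) * (ennreal (?W z * (z-x) powr (a+b-1)) * indicator {x<..<1} z)
       + ennreal (K * G * sin (pi*b)) * (ennreal (?W z * (x-z) powr (a+b-1)) * indicator {-1<..<x} z) \<partial>lborel)"
    proof (rule nn_integral_cong_AE)
      have "AE z in lborel. z \<noteq> x" by (rule AE_lborel_singleton)
      then show "AE z in lborel. ennreal (hit_kernel a b y z) * ennreal (riesz_kernel a b (z-x)) * indicator {-1<..<1} z
        = ennreal (K * G * sin (pi*a)) * (ennreal (?W z * (z-x) powr (a+b-1)) * indicator {x<..<1} z)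
       + ennreal (K * G * sin (pi*b)) * (ennreal (?W z * (x-z) powr (a+b-1)) * indicator {-1<..<x} z)"
      proof eventually_elim
        fix z assume "z \<noteq> x"
        consider "z \<le> -1 \<or> z \<ge> 1" | "-1 < z" "z < 1" "z > x" | "-1 < z" "z < 1" "z < x" using \<open>z \<noteq> x\<close> by linarith
        then show "ennreal (hit_kernel a b y z) * ennreal (riesz_kernel a b (z-x)) * indicator {-1<..<1} z
        = ennreal (K * G * sin (pi*a)) * (ennreal (?W z * (z-x) powr (a+b-1)) * indicator {x<..<1} z)
       + ennreal (K * G * sin (pi*b)) * (ennreal (?W z * (x-z) powr (a+b-1)) * indicator {-1<..<x} z)"
        proof cases
          case 1 then show ?thesis using x by (auto simp: indicator_def)
        next
          case 2
          have "hit_kernel a b y z * riesz_kernel a b (z-x) = K * G * sin (pi*a) * (?W z * (z-x) powr (a+b-1))"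
            using 2 by (simp add: hit_kernel_def riesz_kernel_def K_def G_def mult_ac)
          then show ?thesis using 2 K G sa y hit_kernel_nonneg[OF a a' y 2(1,2), of b]
            by (simp add: indicator_def ennreal_mult'[symmetric])
        next
          case 3
          have "hit_kernel a b y z * riesz_kernel a b (z-x) = K * G * sin (pi*b) * (?W z * (x-z) powr (a+b-1))"
            using 3 by (simp add: hit_kernel_def riesz_kernel_def K_def G_def mult_ac)
          then show ?thesis using 3 K G sb y hit_kernel_nonneg[OF a a' y 3(1,2), of b]
            by (simp add: indicator_def ennreal_mult'[symmetric])
        qed
      qed
    qed
    also have "\<dots> = ennreal (K * G * sin (pi*a)) * (\<integral>\<^sup>+z\<in>{x<..<1}. ennreal (?W z * (z-x) powr (a+b-1)) \<partial>lborel)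
       + ennreal (K * G * sin (pi*b)) * (\<integral>\<^sup>+z\<in>{-1<..<x}. ennreal (?W z * (x-z) powr (a+b-1)) \<partial>lborel)"
      by (simp add: nn_integral_add nn_integral_cmult)
    also have "\<dots> = ennreal (K * G) * (ennreal (sin (pi*a)) * (\<integral>\<^sup>+z\<in>{x<..<1}. ennreal (?W z * (z-x) powr (a+b-1)) \<partial>lborel)
       + ennreal (sin (pi*b)) * (\<integral>\<^sup>+z\<in>{-1<..<x}. ennreal (?W z * (x-z) powr (a+b-1)) \<partial>lborel))"
      using K G sa sb by (simp add: distrib_left ennreal_mult' mult.assoc)
    finally show ?thesis .
  qed
  have core: "ennreal (sin (pi*a)) * (\<integral>\<^sup>+z\<in>{x<..<1}. ennreal (?W z * (z-x) powr (a+b-1)) \<partial>lborel)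
       + ennreal (sin (pi*b)) * (\<integral>\<^sup>+z\<in>{-1<..<x}. ennreal (?W z * (x-z) powr (a+b-1)) \<partial>lborel)
       = ennreal (pi * (y+1) powr (-b) * (y-1) powr (-a) * (y-x) powr (a+b-1))"
  proof -
    consider "x = 1" | "x = -1" | "-1 < x" "x < 1" using x by linarith
    then show ?thesis
    proof cases
      case 1
      have "(\<integral>\<^sup>+z\<in>{-1<..<x}. ennreal (?W z * (x-z) powr (a+b-1)) \<partial>lborel)
         = (\<integral>\<^sup>+z\<in>{-1<..<1}. ennreal ((1-z) powr (-(1-b)) * (1+z) powr ((1-b)-1) / (y-z)) \<partial>lborel)"
        unfolding 1
      proof (rule set_nn_integral_cong)
        fix z :: real
        have "(1-z) powr (-(1-b)) = (1-z) powr (-a) * (1-z) powr (a+b-1)" by (simp add: powr_add[symmetric])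
        then show "ennreal (?W z * (1-z) powr (a+b-1)) = ennreal ((1-z) powr (-(1-b)) * (1+z) powr ((1-b)-1) / (y-z))"
          by (simp add: mult_ac)
      qed
      also have "\<dots> = ennreal (pi / sin (pi*(1-b)) * (y-1) powr (-(1-b)) * (y+1) powr ((1-b)-1))"
        by (rule nn_integral_endpoint) (use b b' y in auto)
      also have "sin (pi*(1-b)) = sin (pi*b)" by (simp add: right_diff_distrib)
      finally show ?thesis using 1 sb y by (simp add: ennreal_mult'[symmetric] powr_add[symmetric] mult_ac)
    next
      case 2
      have "(\<integral>\<^sup>+z\<in>{x<..<1}. ennreal (?W z * (z-x) powr (a+b-1)) \<partial>lborel)
         = (\<integral>\<^sup>+z\<in>{-1<..<1}. ennreal ((1-z) powr (-a) * (1+z) powr (a-1) / (y-z)) \<partial>lborel)"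
        unfolding 2 by (intro set_nn_integral_cong) (simp add: powr_add[symmetric] add.commute mult.assoc)
      also have "\<dots> = ennreal (pi / sin (pi*a) * (y-1) powr (-a) * (y+1) powr (a-1))"
        by (rule nn_integral_endpoint) (use a a' y in auto)
      finally show ?thesis using 2 sa y by (simp add: ennreal_mult'[symmetric] powr_add[symmetric] mult_ac)
    next
      case 3 then show ?thesis by (rule balayage_interior[OF a a' b b' _ _ y])
    qed
  qed
  have "K * G * (pi * (y+1) powr (-b) * (y-1) powr (-a) * (y-x) powr (a+b-1)) = riesz_kernel a b (y-x)"
    using x y by (simp add: K_def G_def riesz_kernel_def powr_minus field_simps)
  then show ?thesis unfolding split core using K G by (simp add: ennreal_mult'[symmetric])
qed

section \<open>The swept potential outside the interval\<close>

lemma set_nn_integral_Ioo_Icc: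
  "(\<integral>\<^sup>+w\<in>{p<..<q}. f w \<partial>lborel) = (\<integral>\<^sup>+w\<in>{p..q::real}. f w \<partial>lborel)"
proof (rule nn_integral_cong_AE)
  have "AE t in lborel. t \<noteq> p \<and> t \<noteq> q"
    using AE_lborel_singleton[of p] AE_lborel_singleton[of q] by auto
  then show "AE w in lborel. f w * indicator {p<..<q} w = f w * indicator {p..q} w"
    by eventually_elim (auto simp: indicator_def)
qed

lemma nn_integral_Beta_scaled:
  fixes a b w :: real
  assumes a: "a < 1" and b: "b < 1" and w: "0 < w"
  shows "(\<integral>\<^sup>+v\<in>{0<..}. ennreal (v powr (-b) * (1 + w * v) powr (a+b-2)) \<partial>lborel) = ennreal (Beta (1-b) (1-a) * w powr (b-1))"
proof -
  have "ennreal (Beta (1-b) (1-a)) = (\<integral>\<^sup>+v\<in>{0<..}. ennreal (v powr ((1-b)-1) * (1+v) powr (-((1-b)+(1-a)))) \<partial>lborel)"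
    by (rule nn_integral_Beta_halfline[symmetric]) (use a b in auto)
  also have "\<dots> = (\<integral>\<^sup>+v\<in>{0<..}. ennreal (\<bar>w\<bar> * ((w * v) powr ((1-b)-1) * (1 + w * v) powr (-((1-b)+(1-a))))) \<partial>lborel)"
    by (rule nn_integral_lborel_substitution_inverse[where k = "\<lambda>v. v / w"])
       (use w in \<open>auto intro!: derivative_eq_intros\<close>)
  also have "\<dots> = ennreal (w powr (1-b)) * (\<integral>\<^sup>+v\<in>{0<..}. ennreal (v powr (-b) * (1 + w * v) powr (a+b-2)) \<partial>lborel)"
  proof (rule set_nn_integral_cong_cmult)
    fix v :: real assume v: "v \<in> {0<..}"
    have "w powr (1-b) = w * w powr (-b)" using w by (simp add: powr_diff powr_minus field_simps)
    then show "ennreal (\<bar>w\<bar> * ((w * v) powr ((1-b)-1) * (1 + w * v) powr (-((1-b)+(1-a)))))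
      = ennreal (w powr (1-b)) * ennreal (v powr (-b) * (1 + w * v) powr (a+b-2))"
      using v w by (subst ennreal_mult'[symmetric]) (auto simp: powr_mult algebra_simps)
  qed auto
  finally have "ennreal (w powr (b-1)) * ennreal (Beta (1-b) (1-a))
     = ennreal (w powr (b-1)) * (ennreal (w powr (1-b)) * (\<integral>\<^sup>+v\<in>{0<..}. ennreal (v powr (-b) * (1 + w * v) powr (a+b-2)) \<partial>lborel))" by simp
  moreover have "w powr (b-1) * w powr (1-b) = 1" using w by (simp add: powr_add[symmetric])
  ultimately show ?thesis using w
    by (simp add: mult.assoc[symmetric] ennreal_mult'[symmetric] mult.commute)
qed

text \<open>Integrating out \<open>v\<close> first scales out a Beta function. The power of
  \<open>1 + w * v\<close> is the one that differentiation produces in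
  \<open>Beta_deficit\<close>.\<close>

lemma nn_integral_Beta_incomplete:
  fixes a b c :: real
  assumes a: "a < 1" and b: "b < 1"
  shows "(\<integral>\<^sup>+v\<in>{0<..}. (\<integral>\<^sup>+w\<in>{0<..<c}. ennreal (v powr (-b) * ((1-w) powr (-(a+b)) * (1 + w * v) powr (a+b-2))) \<partial>lborel) \<partial>lborel)
    = ennreal (Beta (1-b) (1-a)) * (\<integral>\<^sup>+w\<in>{0<..<c}. ennreal (w powr (b-1) * (1-w) powr (-(a+b))) \<partial>lborel)"
proof -
  have B: "Beta (1-b) (1-a) > 0" using a b by (auto simp: Beta_def intro!: divide_pos_pos mult_pos_pos Gamma_real_pos)
  show ?thesis
  proof (subst set_nn_integral_swap, goal_cases)
    case 4
    show ?case
    proof (rule set_nn_integral_cong_cmult)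
      fix w assume w: "w \<in> {0<..<c}"
      have "(\<integral>\<^sup>+v\<in>{0<..}. ennreal (v powr (-b) * ((1-w) powr (-(a+b)) * (1 + w * v) powr (a+b-2))) \<partial>lborel)
         = ennreal ((1-w) powr (-(a+b))) * (\<integral>\<^sup>+v\<in>{0<..}. ennreal (v powr (-b) * (1 + w * v) powr (a+b-2)) \<partial>lborel)"
        by (rule set_nn_integral_cong_cmult) (auto simp: ennreal_mult'[symmetric] mult_ac)
      also have "\<dots> = ennreal ((1-w) powr (-(a+b))) * ennreal (Beta (1-b) (1-a) * w powr (b-1))"
        using w nn_integral_Beta_scaled[OF a b, of w] by simp
      finally show "(\<integral>\<^sup>+v\<in>{0<..}. ennreal (v powr (-b) * ((1-w) powr (-(a+b)) * (1 + w * v) powr (a+b-2))) \<partial>lborel)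
         = ennreal (Beta (1-b) (1-a)) * ennreal (w powr (b-1) * (1-w) powr (-(a+b)))"
        using B by (simp add: ennreal_mult'[symmetric] mult_ac)
    qed auto
  qed auto
qed

lemma nn_integral_FTC_Ioo:
  fixes f :: "real \<Rightarrow> real"
  assumes "f \<in> borel_measurable borel"
    "\<And>x. p \<le> x \<Longrightarrow> x \<le> q \<Longrightarrow> (F has_real_derivative f x) (at x)"
    "\<And>x. p \<le> x \<Longrightarrow> x \<le> q \<Longrightarrow> 0 \<le> f x" "p \<le> q"
  shows "(\<integral>\<^sup>+x\<in>{p<..<q}. ennreal (f x) \<partial>lborel) = ennreal (F q - F p)"
  unfolding set_nn_integral_Ioo_Icc by (rule nn_integral_FTC_Icc) (use assms in auto)

text \<open>As \<open>w\<close> runs from \<open>0\<close> to \<open>c\<close>, the factor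
  \<open>((1-w) / (1 + w * v)) powr (1-a-b)\<close> decreases from one. Its drop is the integral of
  its derivative, and integrating over \<open>v\<close> first turns the total drop into an
  incomplete Beta integral. At \<open>c = 0\<close> the first integral would be the full Stieltjes
  integral on the right.\<close>

lemma Beta_deficit:
  fixes a b c :: real
  assumes a: "0 < a" and b: "0 < b" and ab: "a + b < 1" and c: "0 < c" "c < 1"
  shows "(\<integral>\<^sup>+v\<in>{0<..}. ennreal (v powr (-b) / (1+v) * ((1-c) / (1 + c * v)) powr (1-a-b)) \<partial>lborel)
     + ennreal ((1-a-b) * Beta (1-b) (1-a)) * (\<integral>\<^sup>+w\<in>{0<..<c}. ennreal (w powr (b-1) * (1-w) powr (-(a+b))) \<partial>lborel)
     = ennreal (pi / sin (pi*b))"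
proof -
  have a': "a < 1" and b': "b < 1" using a b ab by auto
  let ?In = "\<lambda>v. \<integral>\<^sup>+w\<in>{0<..<c}. ennreal (v powr (-b) * ((1-w) powr (-(a+b)) * (1 + w * v) powr (a+b-2))) \<partial>lborel"
  have inner: "ennreal (1-a-b) * ?In v = ennreal (v powr (-b) / (1+v) * (1 - ((1-c) / (1 + c * v)) powr (1-a-b)))"
    if v: "v > 0" for v
  proof -
    let ?f = "\<lambda>w. (1-a-b) * (1+v) * ((1-w) powr (-(a+b)) * (1 + w * v) powr (a+b-2))"
    have "?In v = ennreal (v powr (-b) / ((1-a-b) * (1+v))) * (\<integral>\<^sup>+w\<in>{0<..<c}. ennreal (?f w) \<partial>lborel)"
      by (rule set_nn_integral_cong_cmult) (use v ab in \<open>auto simp: ennreal_mult'[symmetric]\<close>)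
    also have "(\<integral>\<^sup>+w\<in>{0<..<c}. ennreal (?f w) \<partial>lborel) = ennreal (- (((1-c) / (1 + c * v)) powr (1-a-b)) - - (((1-0) / (1 + 0 * v)) powr (1-a-b)))"
    proof (rule nn_integral_FTC_Ioo)
      fix w assume w: "0 \<le> w" "w \<le> c"
      have w1: "w < 1" "1 + w * v > 0" using w c v by (auto simp: add_pos_nonneg)
      have "((\<lambda>w. (1-w) / (1 + w * v)) has_real_derivative - ((1+v) / (1 + w * v)\<^sup>2)) (at w)"
        using w1 by (auto intro!: derivative_eq_intros simp: divide_simps power2_eq_square) (simp add: algebra_simps)
      then have "((\<lambda>w. - (((1-w) / (1 + w * v)) powr (1-a-b))) has_real_derivative
        - ((1-a-b) * ((1-w) / (1 + w * v)) powr (1-a-b-1) * - ((1+v) / (1 + w * v)\<^sup>2))) (at w)"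
        using w1 by (intro DERIV_minus DERIV_chain2[OF has_real_derivative_powr]) auto
      moreover have "- ((1-a-b) * ((1-w) / (1 + w * v)) powr (1-a-b-1) * - ((1+v) / (1 + w * v)\<^sup>2)) = ?f w"
      proof -
        have "(1-a-b) * (P / Q) powr (1-a-b-1) * ((1+v) / Q\<^sup>2) = (1-a-b) * (1+v) * (P powr (-(a+b)) * Q powr (a+b-2))"
          if "P > 0" "Q > 0" for P Q :: real
        proof (rule ln_eqD)
          show "ln ((1-a-b) * (P / Q) powr (1-a-b-1) * ((1+v) / Q\<^sup>2)) = ln ((1-a-b) * (1+v) * (P powr (-(a+b)) * Q powr (a+b-2)))"
            using that v ab by (simp add: ln_mult ln_div ln_realpow) (simp add: algebra_simps)
        qed (use that v ab in auto)
        from this[of "1-w" "1 + w * v"] show ?thesis using w1 by simp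
      qed
      ultimately show "((\<lambda>w. - (((1-w) / (1 + w * v)) powr (1-a-b))) has_real_derivative ?f w) (at w)" by simp
      show "0 \<le> ?f w" using v ab by simp
    qed (use c in auto)
    finally have "?In v = ennreal (v powr (-b) / ((1-a-b) * (1+v)) * (1 - ((1-c) / (1 + c * v)) powr (1-a-b)))"
      using v ab by (simp add: ennreal_mult'[symmetric])
    then show ?thesis using v ab by (simp add: ennreal_mult'[symmetric])
  qed
  have q1: "((1-c) / (1 + c * v)) powr (1-a-b) \<le> 1" if "v > 0" for v
  proof -
    have "0 < c * v" using that c by simp
    then have "(1-c) / (1 + c * v) \<le> 1" using c by (simp add: divide_simps)
    then show ?thesis using \<open>0 < c * v\<close> c ab by (intro powr_le1) auto
  qed
  have "ennreal ((1-a-b) * Beta (1-b) (1-a)) * (\<integral>\<^sup>+w\<in>{0<..<c}. ennreal (w powr (b-1) * (1-w) powr (-(a+b))) \<partial>lborel)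
     = ennreal (1-a-b) * (\<integral>\<^sup>+v\<in>{0<..}. ?In v \<partial>lborel)"
    unfolding nn_integral_Beta_incomplete[OF a' b'] using ab by (simp add: ennreal_mult' mult.assoc)
  also have "\<dots> = (\<integral>\<^sup>+v\<in>{0<..}. ennreal (v powr (-b) / (1+v) * (1 - ((1-c) / (1 + c * v)) powr (1-a-b))) \<partial>lborel)"
    by (subst set_nn_integral_cmult[symmetric]) (use inner in \<open>auto intro!: set_nn_integral_cong\<close>)
  finally have "(\<integral>\<^sup>+v\<in>{0<..}. ennreal (v powr (-b) / (1+v) * ((1-c) / (1 + c * v)) powr (1-a-b)) \<partial>lborel)
     + ennreal ((1-a-b) * Beta (1-b) (1-a)) * (\<integral>\<^sup>+w\<in>{0<..<c}. ennreal (w powr (b-1) * (1-w) powr (-(a+b))) \<partial>lborel)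
    = (\<integral>\<^sup>+v\<in>{0<..}. (ennreal (v powr (-b) / (1+v) * ((1-c) / (1 + c * v)) powr (1-a-b))
       + ennreal (v powr (-b) / (1+v) * (1 - ((1-c) / (1 + c * v)) powr (1-a-b)))) \<partial>lborel)"
    by (simp add: distrib_right nn_integral_add)
  also have "\<dots> = (\<integral>\<^sup>+v\<in>{0<..}. ennreal (v powr (-b) / (v+1)) \<partial>lborel)"
  proof (rule set_nn_integral_cong)
    fix v :: real assume v: "v \<in> {0<..}"
    define A where "A = v powr (-b) / (1+v)"
    define Q where "Q = ((1-c) / (1 + c * v)) powr (1-a-b)"
    have "0 \<le> A" "0 \<le> Q" "Q \<le> 1" using v q1[of v] by (auto simp: A_def Q_def)
    then have "ennreal (A * Q) + ennreal (A * (1 - Q)) = ennreal (A * Q + A * (1 - Q))"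
      by (intro ennreal_plus[symmetric]) auto
    also have "A * Q + A * (1 - Q) = A" by (simp add: algebra_simps)
    finally have "ennreal (A * Q) + ennreal (A * (1 - Q)) = ennreal (v powr (-b) / (v+1))"
      by (simp add: A_def add.commute)
    then show "ennreal (v powr (-b) / (1+v) * ((1-c) / (1 + c * v)) powr (1-a-b))
       + ennreal (v powr (-b) / (1+v) * (1 - ((1-c) / (1 + c * v)) powr (1-a-b))) = ennreal (v powr (-b) / (v+1))"
      by (simp only: A_def Q_def)
  qed
  also have "\<dots> = ennreal (pi / sin (pi*b))"
    using nn_integral_Stieltjes_powr[OF b b', of 1] by simp
  finally show ?thesis .
qed

text \<open>This increasing Moebius map carries \<open>(-1,1)\<close> onto the half-line and sends
  \<open>y\<close> to \<open>-1\<close>, so that the pole of \<open>hit_kernel\<close> becomes that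
  of \<open>1 / (1 + v)\<close>.\<close>

lemma nn_integral_moebius_up:
  fixes f :: "real \<Rightarrow> real" and y :: real
  assumes y: "1 < y" and f [measurable]: "f \<in> borel_measurable borel" and nn: "\<And>v. 0 < v \<Longrightarrow> 0 \<le> f v"
  shows "(\<integral>\<^sup>+v\<in>{0<..}. ennreal (f v) \<partial>lborel)
    = (\<integral>\<^sup>+z\<in>{-1<..<1}. ennreal (2*(y-1)/((y+1)*(1-z)\<^sup>2) * f ((1+z)*(y-1)/((1-z)*(y+1)))) \<partial>lborel)"
proof -
  have "(\<integral>\<^sup>+v\<in>{0<..}. ennreal (f v) \<partial>lborel)
    = (\<integral>\<^sup>+z\<in>{-1<..<1}. ennreal (\<bar>2*(y-1)/((y+1)*(1-z)\<^sup>2)\<bar> * f ((1+z)*(y-1)/((1-z)*(y+1)))) \<partial>lborel)"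
  proof (rule nn_integral_lborel_substitution_inverse[where k = "\<lambda>v. ((y+1) * v - (y-1)) / ((y+1) * v + (y-1))"])
    fix z :: real assume z: "z \<in> {-1<..<1}"
    show "((\<lambda>z. (1+z)*(y-1)/((1-z)*(y+1))) has_real_derivative (2*(y-1)/((y+1)*(1-z)\<^sup>2))) (at z)"
      using z y by (auto intro!: derivative_eq_intros simp: divide_simps power2_eq_square) (simp add: algebra_simps)?
    show "(1+z)*(y-1)/((1-z)*(y+1)) \<in> {0<..}" using z y by auto
    have "(y+1) * ((1+z)*(y-1)/((1-z)*(y+1))) = (1+z)*(y-1)/(1-z)" using z y by (simp add: divide_simps)
    then show "((y+1) * ((1+z)*(y-1)/((1-z)*(y+1))) - (y-1)) / ((y+1) * ((1+z)*(y-1)/((1-z)*(y+1))) + (y-1)) = z"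
      using z y by (simp add: divide_simps) (simp add: algebra_simps)
  next
    fix v :: real assume v: "v \<in> {0<..}"
    define d where "d = (y+1) * v + (y-1)"
    have d: "d > 0" using v y by (simp add: d_def add_pos_pos)
    have e: "1 - ((y+1) * v - (y-1)) / d = 2*(y-1)/d" "1 + ((y+1) * v - (y-1)) / d = 2*(y+1) * v/d"
      using d by (simp_all add: divide_simps) (simp_all add: d_def algebra_simps)
    have "2*(y-1)/d > 0" "2*(y+1) * v/d > 0" using d y v by auto
    with e show "((y+1) * v - (y-1)) / ((y+1) * v + (y-1)) \<in> {-1<..<1}" by (auto simp: d_def[symmetric])
    show "(1 + ((y+1) * v - (y-1)) / ((y+1) * v + (y-1)))*(y-1)/((1- ((y+1) * v - (y-1)) / ((y+1) * v + (y-1)))*(y+1)) = v"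
      unfolding d_def[symmetric] e using d y by (simp add: divide_simps) (simp add: algebra_simps)
  qed (use nn in auto)
  also have "\<dots> = (\<integral>\<^sup>+z\<in>{-1<..<1}. ennreal (2*(y-1)/((y+1)*(1-z)\<^sup>2) * f ((1+z)*(y-1)/((1-z)*(y+1)))) \<partial>lborel)"
    using y by (intro set_nn_integral_cong) auto
  finally show ?thesis .
qed

text \<open>The reciprocal of the previous map: decreasing, again with \<open>y\<close> sent to
  \<open>-1\<close>. It serves for \<open>y < x\<close>, where the roles of \<open>a\<close> and
  \<open>b\<close> are exchanged.\<close>

lemma nn_integral_moebius_down:
  fixes f :: "real \<Rightarrow> real" and y :: real
  assumes y: "1 < y" and f [measurable]: "f \<in> borel_measurable borel" and nn: "\<And>v. 0 < v \<Longrightarrow> 0 \<le> f v"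
  shows "(\<integral>\<^sup>+v\<in>{0<..}. ennreal (f v) \<partial>lborel)
    = (\<integral>\<^sup>+z\<in>{-1<..<1}. ennreal (2*(y+1)/((y-1)*(1+z)\<^sup>2) * f ((1-z)*(y+1)/((1+z)*(y-1)))) \<partial>lborel)"
proof -
  have "(\<integral>\<^sup>+v\<in>{0<..}. ennreal (f v) \<partial>lborel)
    = (\<integral>\<^sup>+v\<in>{0<..}. ennreal (\<bar>- (1/v\<^sup>2)\<bar> * f (1/v)) \<partial>lborel)"
    by (rule nn_integral_lborel_substitution_inverse[where k = "\<lambda>v. 1/v"])
       (use nn in \<open>auto intro!: derivative_eq_intros simp: power2_eq_square\<close>)
  also have "\<dots> = (\<integral>\<^sup>+z\<in>{-1<..<1}. ennreal (2*(y-1)/((y+1)*(1-z)\<^sup>2) *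
      (\<bar>- (1/((1+z)*(y-1)/((1-z)*(y+1)))\<^sup>2)\<bar> * f (1/((1+z)*(y-1)/((1-z)*(y+1)))))) \<partial>lborel)"
    by (rule nn_integral_moebius_up) (use nn y in auto)
  also have "\<dots> = (\<integral>\<^sup>+z\<in>{-1<..<1}. ennreal (2*(y+1)/((y-1)*(1+z)\<^sup>2) * f ((1-z)*(y+1)/((1+z)*(y-1)))) \<partial>lborel)"
  proof (rule set_nn_integral_cong)
    fix z :: real assume z: "z \<in> {-1<..<1}"
    have "2*(y-1)/((y+1)*(1-z)\<^sup>2) * \<bar>- (1/((1+z)*(y-1)/((1-z)*(y+1)))\<^sup>2)\<bar> = 2*(y+1)/((y-1)*(1+z)\<^sup>2)"
      using z y by (simp add: divide_simps power2_eq_square) (simp add: algebra_simps)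
    note e = this
    have e': "1/((1+z)*(y-1)/((1-z)*(y+1))) = (1-z)*(y+1)/((1+z)*(y-1))" by simp
    show "ennreal (2*(y-1)/((y+1)*(1-z)\<^sup>2) *
      (\<bar>- (1/((1+z)*(y-1)/((1-z)*(y+1)))\<^sup>2)\<bar> * f (1/((1+z)*(y-1)/((1-z)*(y+1)))))) = ennreal (2*(y+1)/((y-1)*(1+z)\<^sup>2) * f ((1-z)*(y+1)/((1+z)*(y-1))))"
      unfolding e' mult.assoc[symmetric] e[unfolded mult.assoc[symmetric]] ..
  qed
  finally show ?thesis .
qed

text \<open>The substitution \<open>w = (t-1)/(t+1)\<close> turns the interval integral of
  \<open>green_density\<close> into a nonnegative incomplete Beta integral.\<close>

lemma LBINT_incomplete_Beta:
  fixes p q T :: real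
  assumes p: "0 < p" and q: "0 < q" and T: "1 < T"
  shows "ennreal (LBINT t=1..ereal T. (t-1) powr (p-1) * (t+1) powr (q-1))
    = ennreal (2 powr (p+q-1)) * (\<integral>\<^sup>+w\<in>{0<..<(T-1)/(T+1)}. ennreal (w powr (p-1) * (1-w) powr (-(p+q))) \<partial>lborel)"
proof -
  define c where "c = (T-1)/(T+1)"
  have c: "0 < c" "c < 1" using T by (auto simp: c_def)
  let ?J = "\<integral>\<^sup>+w\<in>{0<..<c}. ennreal (w powr (p-1) * (1-w) powr (-(p+q))) \<partial>lborel"
  let ?f = "\<lambda>t. (t-1) powr (p-1) * (t+1) powr (q-1)"
  have sub: "(\<integral>\<^sup>+t\<in>{1<..<T}. ennreal (?f t) \<partial>lborel) = ennreal (2 powr (p+q-1)) * ?J"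
  proof -
    have "(\<integral>\<^sup>+t\<in>{1<..<T}. ennreal (?f t) \<partial>lborel)
       = (\<integral>\<^sup>+w\<in>{0<..<c}. ennreal (\<bar>2/(1-w)\<^sup>2\<bar> * ?f ((1+w)/(1-w))) \<partial>lborel)"
    proof (rule nn_integral_lborel_substitution_inverse[where k = "\<lambda>t. (t-1)/(t+1)"])
      fix w assume w: "w \<in> {0<..<c}"
      then have w1: "0 < w" "w < 1" using c by auto
      show "((\<lambda>w. (1+w)/(1-w)) has_real_derivative 2/(1-w)\<^sup>2) (at w)"
        using w1 by (auto intro!: derivative_eq_intros simp: divide_simps power2_eq_square)
      show "((1+w)/(1-w)-1)/((1+w)/(1-w)+1) = w" using w1 by (simp add: divide_simps)
      have "(1+w) * (1-c) < (1+c) * (1-w)" using w by (simp add: algebra_simps)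
      then have "(1+w)/(1-w) < (1+c)/(1-c)" using w1 c by (simp add: divide_simps mult.commute)
      also have "(1+c)/(1-c) = T" using T unfolding c_def by (simp add: divide_simps)
      finally show "(1+w)/(1-w) \<in> {1<..<T}" using w1 by auto
    next
      fix t assume t: "t \<in> {1<..<T}"
      then have "(t-1) * (T+1) < (T-1) * (t+1)" by (simp add: algebra_simps)
      then show "(t-1)/(t+1) \<in> {0<..<c}" using t T unfolding c_def by (auto simp: divide_simps)
      show "(1+(t-1)/(t+1))/(1-(t-1)/(t+1)) = t" using t by (simp add: divide_simps)
    qed auto
    also have "\<dots> = ennreal (2 powr (p+q-1)) * ?J"
    proof (rule set_nn_integral_cong_cmult)
      fix w assume w: "w \<in> {0<..<c}"
      then have w1: "0 < w" "w < 1" using c by auto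
      have e: "(1+w)/(1-w) - 1 = 2*w/(1-w)" "(1+w)/(1-w)+1 = 2/(1-w)" using w1 by (simp_all add: divide_simps)
      have alg: "2/A\<^sup>2 * ((2*w/A) powr (p-1) * (2/A) powr (q-1)) = 2 powr (p+q-1) * (w powr (p-1) * A powr (-(p+q)))"
        if "A > 0" for A :: real
      proof (rule ln_eqD)
        show "ln (2/A\<^sup>2 * ((2*w/A) powr (p-1) * (2/A) powr (q-1))) = ln (2 powr (p+q-1) * (w powr (p-1) * A powr (-(p+q))))"
          using that w1 by (simp add: ln_mult ln_div ln_realpow) (simp add: algebra_simps)
      qed (use that w1 in auto)
      have "\<bar>2/(1-w)\<^sup>2\<bar> = 2/(1-w)\<^sup>2" by simp
      then show "ennreal (\<bar>2/(1-w)\<^sup>2\<bar> * ?f ((1+w)/(1-w))) = ennreal (2 powr (p+q-1)) * ennreal (w powr (p-1) * (1-w) powr (-(p+q)))"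
        unfolding e using alg[of "1-w"] w1 by (simp only: ennreal_mult'[symmetric] powr_ge_zero)
    qed auto
    finally show ?thesis .
  qed
  \<comment> \<open>Finiteness has to be shown separately: a non-integrable function would have
    Bochner integral zero, and the two sides would differ.\<close>
  have "?J \<le> (\<integral>\<^sup>+w\<in>{0..1}. ennreal ((1-c) powr (-(p+q))) * ennreal (w powr (p-1) * (1-w) powr (1-1)) \<partial>lborel)"
  proof (rule nn_integral_mono)
    fix w :: real
    show "ennreal (w powr (p-1) * (1-w) powr (-(p+q))) * indicator {0<..<c} w
      \<le> ennreal ((1-c) powr (-(p+q))) * ennreal (w powr (p-1) * (1-w) powr (1-1)) * indicator {0..1} w"
    proof (cases "w \<in> {0<..<c}")
      case True
      have "(1-w) powr (-(p+q)) \<le> (1-c) powr (-(p+q))" using True c p q by (intro powr_mono2') auto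
      then show ?thesis using True c by (auto simp: ennreal_mult'[symmetric] mult.commute intro!: ennreal_leI mult_left_mono)
    qed auto
  qed
  also have "\<dots> = ennreal ((1-c) powr (-(p+q))) * ennreal (Beta p 1)"
    by (subst set_nn_integral_cmult) (use nn_integral_has_integral_lebesgue'[OF _ has_integral_Beta_real[OF p zero_less_one]] in auto)
  also have "\<dots> < \<infinity>" by (simp add: ennreal_mult'[symmetric])
  finally have fin: "(\<integral>\<^sup>+t\<in>{1<..<T}. ennreal (?f t) \<partial>lborel) < \<infinity>"
    unfolding sub by (simp add: ennreal_mult_less_top)
  have 1: "(LBINT t=1..ereal T. ?f t) = (LBINT t:{1<..<T}. ?f t)"
    using T interval_lebesgue_integral_def[of lborel 1 "ereal T" ?f] by (simp add: one_ereal_def)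
  have 2: "ennreal (LBINT t:{1<..<T}. ?f t) = (\<integral>\<^sup>+t. ennreal (indicator {1<..<T} t *\<^sub>R ?f t) \<partial>lborel)"
    unfolding set_lebesgue_integral_def
  proof (rule nn_integral_eq_integral[symmetric])
    have "(\<integral>\<^sup>+t. ennreal (norm (indicator {1<..<T} t *\<^sub>R ?f t)) \<partial>lborel) = (\<integral>\<^sup>+t\<in>{1<..<T}. ennreal (?f t) \<partial>lborel)"
      by (intro nn_integral_cong) (auto simp: indicator_def)
    then show "integrable lborel (\<lambda>t. indicator {1<..<T} t *\<^sub>R ?f t)"
      using fin by (auto intro!: integrableI_bounded)
  qed auto
  have 3: "(\<integral>\<^sup>+t. ennreal (indicator {1<..<T} t *\<^sub>R ?f t) \<partial>lborel) = (\<integral>\<^sup>+t\<in>{1<..<T}. ennreal (?f t) \<partial>lborel)"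
    by (intro nn_integral_cong) (auto simp: indicator_def)
  show ?thesis unfolding 1 2 3 sub c_def ..
qed

text \<open>The new upper limit is the cross ratio of \<open>x\<close> and \<open>y\<close> with the
  endpoints, the image of the upper limit in \<open>green_density\<close> under
  \<open>t \<mapsto> (t-1)/(t+1)\<close>.\<close>

lemma green_density_upper:
  fixes \<alpha> \<rho> x y :: real
  defines "a \<equiv> \<alpha> * \<rho>" and "b \<equiv> \<alpha> * (1 - \<rho>)"
  assumes a: "0 < a" and b: "0 < b" and x: "1 < x" and y: "x < y"
  shows "ennreal (green_density \<alpha> \<rho> x y) = ennreal (1 / (Gamma a * Gamma b) * (y-x) powr (a+b-1)) *
     (\<integral>\<^sup>+w\<in>{0<..<(x-1)*(y+1)/((x+1)*(y-1))}. ennreal (w powr (b-1) * (1-w) powr (-(a+b))) \<partial>lborel)"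
proof -
  define T where "T = (1 - x*y) / (x - y)"
  have ab: "\<alpha> = a + b" by (simp add: a_def b_def algebra_simps)
  have 0: "0 < (x-1)*(y+1)" using x y by simp
  then have T: "1 < T" using y by (simp add: T_def divide_simps) (simp add: algebra_simps)
  have e: "(T-1)/(T+1) = (x-1)*(y+1)/((x+1)*(y-1))"
  proof -
    have "T - 1 = (x-1)*(y+1)/(y-x)" "T + 1 = (x+1)*(y-1)/(y-x)"
      unfolding T_def using y by (simp_all add: divide_simps) (simp_all add: algebra_simps)
    then show ?thesis using y by simp
  qed
  have G: "Gamma a > 0" "Gamma b > 0" using a b by auto
  have "ennreal (green_density \<alpha> \<rho> x y) = ennreal (1 / (Gamma a * Gamma b) * ((y-x)/2) powr (a+b-1)) * ennreal (LBINT t=1..ereal T. (t-1) powr (b-1) * (t+1) powr (a-1))"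
  proof -
    have "green_density \<alpha> \<rho> x y = 1 / (Gamma a * Gamma b) * ((y-x)/2) powr (a+b-1) * (LBINT t=1..ereal T. (t-1) powr (b-1) * (t+1) powr (a-1))"
      unfolding green_density_def a_def[symmetric] b_def[symmetric] T_def[symmetric] using y by (simp add: ab)
    then show ?thesis using G by (simp only:) (rule ennreal_mult', simp)
  qed
  also have "\<dots> = ennreal (1 / (Gamma a * Gamma b) * ((y-x)/2) powr (a+b-1)) * ennreal (2 powr (b+a-1)) *
     (\<integral>\<^sup>+w\<in>{0<..<(x-1)*(y+1)/((x+1)*(y-1))}. ennreal (w powr (b-1) * (1-w) powr (-(b+a))) \<partial>lborel)"
    unfolding LBINT_incomplete_Beta[OF b a T] e by (simp only: mult.assoc)
  also have "ennreal (1 / (Gamma a * Gamma b) * ((y-x)/2) powr (a+b-1)) * ennreal (2 powr (b+a-1)) = ennreal (1 / (Gamma a * Gamma b) * (y-x) powr (a+b-1))"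
    using y G by (subst ennreal_mult'[symmetric]) (auto simp: powr_divide add.commute)
  finally show ?thesis by (simp add: add.commute)
qed

lemma green_density_lower:
  fixes \<alpha> \<rho> x y :: real
  defines "a \<equiv> \<alpha> * \<rho>" and "b \<equiv> \<alpha> * (1 - \<rho>)"
  assumes a: "0 < a" and b: "0 < b" and y: "1 < y" and x: "y < x"
  shows "ennreal (green_density \<alpha> \<rho> x y) = ennreal (1 / (Gamma a * Gamma b) * (x-y) powr (a+b-1)) *
     (\<integral>\<^sup>+w\<in>{0<..<(x+1)*(y-1)/((x-1)*(y+1))}. ennreal (w powr (a-1) * (1-w) powr (-(a+b))) \<partial>lborel)"
proof -
  define T where "T = (1 - x*y) / (y - x)"
  have ab: "\<alpha> = a + b" by (simp add: a_def b_def algebra_simps)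
  have 0: "0 < (x+1)*(y-1)" using x y by simp
  then have T: "1 < T" using x by (simp add: T_def divide_simps) (simp add: algebra_simps)
  have e: "(T-1)/(T+1) = (x+1)*(y-1)/((x-1)*(y+1))"
  proof -
    have "T - 1 = (x+1)*(y-1)/(x-y)" "T + 1 = (x-1)*(y+1)/(x-y)"
      unfolding T_def using x by (simp_all add: divide_simps) (simp_all add: algebra_simps)
    then show ?thesis using x by simp
  qed
  have G: "Gamma a > 0" "Gamma b > 0" using a b by auto
  have "ennreal (green_density \<alpha> \<rho> x y) = ennreal (1 / (Gamma a * Gamma b) * ((x-y)/2) powr (a+b-1)) * ennreal (LBINT t=1..ereal T. (t-1) powr (a-1) * (t+1) powr (b-1))"
  proof -
    have "green_density \<alpha> \<rho> x y = 1 / (Gamma a * Gamma b) * ((x-y)/2) powr (a+b-1) * (LBINT t=1..ereal T. (t-1) powr (a-1) * (t+1) powr (b-1))"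
      unfolding green_density_def a_def[symmetric] b_def[symmetric] T_def[symmetric] using x by (simp add: ab)
    then show ?thesis using G by (simp only:) (rule ennreal_mult', simp)
  qed
  also have "\<dots> = ennreal (1 / (Gamma a * Gamma b) * ((x-y)/2) powr (a+b-1)) * ennreal (2 powr (a+b-1)) *
     (\<integral>\<^sup>+w\<in>{0<..<(x+1)*(y-1)/((x-1)*(y+1))}. ennreal (w powr (a-1) * (1-w) powr (-(a+b))) \<partial>lborel)"
    unfolding LBINT_incomplete_Beta[OF a b T] e by (simp only: mult.assoc)
  also have "ennreal (1 / (Gamma a * Gamma b) * ((x-y)/2) powr (a+b-1)) * ennreal (2 powr (a+b-1)) = ennreal (1 / (Gamma a * Gamma b) * (x-y) powr (a+b-1))"
    using x G by (subst ennreal_mult'[symmetric]) (auto simp: powr_divide)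
  finally show ?thesis .
qed

text \<open>The left side collects the constants of \<open>hit_kernel\<close>,
  \<open>riesz_kernel\<close> and \<open>Beta_deficit\<close>. Two reflection formulas turn the
  sines into Gamma functions, and \<open>(1-a-b) * Gamma (1-a-b) = Gamma (2-a-b)\<close> cancels the
  denominator of the Beta function.\<close>

lemma green_constant:
  fixes a b :: real
  assumes a: "0 < a" and b: "0 < b" and ab: "a + b < 1"
  shows "sin (pi*a) / pi * (Gamma (1-a-b) / pi) * sin (pi*b) * ((1-a-b) * Beta (1-b) (1-a)) = 1 / (Gamma a * Gamma b)"
proof -
  have a': "a < 1" and b': "b < 1" using a b ab by auto
  have G: "Gamma (1-a) > 0" "Gamma (1-b) > 0" "Gamma a > 0" "Gamma b > 0" "Gamma (2-a-b) > 0"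
    using a b ab by auto
  have "1-a-b \<notin> \<int>\<^sub>\<le>\<^sub>0" using ab by (auto elim!: nonpos_Ints_cases)
  then have "Gamma (1-a-b+1) = (1-a-b) * Gamma (1-a-b)" by (rule Gamma_plus1)
  then have 1: "(1-a-b) * Gamma (1-a-b) = Gamma (2-a-b)" by (simp add: algebra_simps)
  have 2: "Beta (1-b) (1-a) = Gamma (1-b) * Gamma (1-a) / Gamma (2-a-b)" by (simp add: Beta_def algebra_simps)
  note sa = sin_pi_over_pi_eq_Gamma[OF a a'] and sb = sin_pi_over_pi_eq_Gamma[OF b b']
  have "sin (pi*a) / pi * (Gamma (1-a-b) / pi) * sin (pi*b) * ((1-a-b) * Beta (1-b) (1-a))
     = (sin (pi*a) / pi) * (sin (pi*b) / pi) * ((1-a-b) * Gamma (1-a-b)) * Beta (1-b) (1-a)" by simp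
  also have "\<dots> = 1 / (Gamma a * Gamma b)" unfolding 1 2 sa sb using G by simp
  finally show ?thesis .
qed

text \<open>After a Moebius substitution, and up to one common factor, the three terms are those of
  \<open>Beta_deficit\<close>: its first integral is the swept potential, the incomplete Beta
  integral is the Green density, and the right side is the Riesz kernel at
  \<open>y - x\<close>.\<close>

lemma hit_kernel_potential_outside:
  fixes \<alpha> \<rho> x y :: real
  defines "a \<equiv> \<alpha> * \<rho>" and "b \<equiv> \<alpha> * (1 - \<rho>)"
  assumes a: "0 < a" and b: "0 < b" and ab: "a + b < 1" and x: "1 < x" and y: "1 < y" and xy: "x \<noteq> y"
  shows "(\<integral>\<^sup>+z\<in>{-1<..<1}. ennreal (hit_kernel a b y z) * ennreal (riesz_kernel a b (z-x)) \<partial>lborel)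
      + ennreal (green_density \<alpha> \<rho> x y) = ennreal (riesz_kernel a b (y-x))"
proof -
  have a': "a < 1" and b': "b < 1" using a b ab by auto
  have sa: "0 < sin (pi*a)" and sb: "0 < sin (pi*b)" using a b a' b' by (auto intro: sin_pi_pos)
  define G where "G = Gamma (1-a-b) / pi"
  have G: "G > 0" using ab by (auto simp: G_def intro!: divide_pos_pos Gamma_real_pos)
  have B: "Beta (1-b) (1-a) > 0" "(1-a-b) * Beta (1-b) (1-a) > 0"
    using a' b' ab by (auto simp: Beta_def intro!: divide_pos_pos mult_pos_pos Gamma_real_pos)
  let ?L = "\<integral>\<^sup>+z\<in>{-1<..<1}. ennreal (hit_kernel a b y z) * ennreal (riesz_kernel a b (z-x)) \<partial>lborel"
  let ?W = "\<lambda>z. (1+z) powr (-b) * (1-z) powr (-a) * (x-z) powr (a+b-1) / (y-z)"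
  define K where "K = sin (pi*a) / pi * (y-1) powr a * (y+1) powr b * G * sin (pi*b)"
  have K: "K > 0" using sa sb y G by (auto simp: K_def)
  have L: "?L = ennreal K * (\<integral>\<^sup>+z\<in>{-1<..<1}. ennreal (?W z) \<partial>lborel)"
  proof (rule set_nn_integral_cong_cmult)
    fix z :: real assume z: "z \<in> {-1<..<1}"
    have "hit_kernel a b y z * riesz_kernel a b (z-x) = K * ?W z"
      using z x by (simp add: hit_kernel_def riesz_kernel_def K_def G_def mult_ac)
    then show "ennreal (hit_kernel a b y z) * ennreal (riesz_kernel a b (z-x)) = ennreal K * ennreal (?W z)"
      using K z y hit_kernel_nonneg[OF a a' y, of z b] by (simp add: ennreal_mult'[symmetric])
  qed auto
  consider "x < y" | "y < x" using xy by linarith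
  then show ?thesis
  proof cases
    case 1
    \<comment> \<open>The map of \<open>nn_integral_moebius_up\<close> sends \<open>x\<close> to
      \<open>-1/c\<close>, so that \<open>1 + c * v\<close> vanishes at
      \<open>z = x\<close>.\<close>
    define c where "c = (x-1)*(y+1)/((x+1)*(y-1))"
    have c: "0 < c" "c < 1"
    proof -
      have "(x-1)*(y+1) < (x+1)*(y-1)" using 1 by (simp add: algebra_simps)
      then show "c < 1" using x y by (simp add: c_def)
    qed (use x y in \<open>simp add: c_def\<close>)
    define C where "C = (y-x) powr (1-a-b) * (y-1) powr a * (y+1) powr b"
    have C: "C > 0" using 1 y by (simp add: C_def)
    define J where "J = (\<integral>\<^sup>+w\<in>{0<..<c}. ennreal (w powr (b-1) * (1-w) powr (-(a+b))) \<partial>lborel)"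
    define V where "V = (\<integral>\<^sup>+v\<in>{0<..}. ennreal (v powr (-b) / (1+v) * ((1-c) / (1 + c * v)) powr (1-a-b)) \<partial>lborel)"
    have V: "V = ennreal C * (\<integral>\<^sup>+z\<in>{-1<..<1}. ennreal (?W z) \<partial>lborel)"
    proof -
      have "V = (\<integral>\<^sup>+z\<in>{-1<..<1}. ennreal (2*(y-1)/((y+1)*(1-z)\<^sup>2) * (((1+z)*(y-1)/((1-z)*(y+1))) powr (-b) / (1+(1+z)*(y-1)/((1-z)*(y+1)))
           * ((1-c) / (1 + c * ((1+z)*(y-1)/((1-z)*(y+1))))) powr (1-a-b))) \<partial>lborel)"
        unfolding V_def by (rule nn_integral_moebius_up[OF y]) (use c in auto)
      also have "\<dots> = ennreal C * (\<integral>\<^sup>+z\<in>{-1<..<1}. ennreal (?W z) \<partial>lborel)"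
      proof (rule set_nn_integral_cong_cmult)
        fix z :: real assume z: "z \<in> {-1<..<1}"
        have e1: "1+(1+z)*(y-1)/((1-z)*(y+1)) = 2*(y-z)/((1-z)*(y+1))"
          using z y by (simp add: divide_simps) (simp add: algebra_simps)
        have e2: "(1-c) / (1 + c * ((1+z)*(y-1)/((1-z)*(y+1)))) = (y-x)*(1-z)/((y-1)*(x-z))"
        proof -
          have n1: "1 - c = 2*(y-x)/((x+1)*(y-1))" unfolding c_def using x y by (simp add: divide_simps) (simp add: algebra_simps)
          have e3: "c * ((1+z)*(y-1)/((1-z)*(y+1))) = (x-1)*(1+z)/((x+1)*(1-z))"
            unfolding c_def using x y z by (simp add: divide_simps)
          have n2: "1 + c * ((1+z)*(y-1)/((1-z)*(y+1))) = 2*(x-z)/((x+1)*(1-z))"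
            unfolding e3 using x z by (simp add: divide_simps) (simp add: algebra_simps)
          show ?thesis unfolding n1 n2 using x y z by (simp add: divide_simps) (simp add: algebra_simps)
        qed
        have alg: "2*P/(Q*A\<^sup>2) * ((B*P/(A*Q)) powr (-b) / (2*F/(A*Q)) * (E*A/(P*D)) powr (1-a-b))
          = (E powr (1-a-b) * P powr a * Q powr b) * (B powr (-b) * A powr (-a) * D powr (a+b-1) / F)"
          if "A > 0" "B > 0" "D > 0" "E > 0" "F > 0" "P > 0" "Q > 0" for A B D E F P Q :: real
        proof (rule ln_eqD)
          show "ln (2*P/(Q*A\<^sup>2) * ((B*P/(A*Q)) powr (-b) / (2*F/(A*Q)) * (E*A/(P*D)) powr (1-a-b)))
             = ln ((E powr (1-a-b) * P powr a * Q powr b) * (B powr (-b) * A powr (-a) * D powr (a+b-1) / F))"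
            using that by (simp add: ln_mult ln_div ln_realpow) (simp add: algebra_simps)
        qed (use that in auto)
        have "2*(y-1)/((y+1)*(1-z)\<^sup>2) * (((1+z)*(y-1)/((1-z)*(y+1))) powr (-b) / (1+(1+z)*(y-1)/((1-z)*(y+1)))
           * ((1-c) / (1 + c * ((1+z)*(y-1)/((1-z)*(y+1))))) powr (1-a-b)) = C * ?W z"
          unfolding e1 e2 C_def by (rule alg) (use z x y 1 in auto)
        then show "ennreal (2*(y-1)/((y+1)*(1-z)\<^sup>2) * (((1+z)*(y-1)/((1-z)*(y+1))) powr (-b) / (1+(1+z)*(y-1)/((1-z)*(y+1)))
           * ((1-c) / (1 + c * ((1+z)*(y-1)/((1-z)*(y+1))))) powr (1-a-b))) = ennreal C * ennreal (?W z)"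
          using C by (simp only: ennreal_mult'[OF less_imp_le[OF C]])
      qed auto
      finally show ?thesis .
    qed
    \<comment> \<open>The factor common to the swept potential and the Green density.\<close>
    define Mc where "Mc = sin (pi*a) / pi * G * sin (pi*b) * (y-x) powr (a+b-1)"
    have M: "Mc > 0" using sa sb G 1 by (simp add: Mc_def)
    have KM: "K = Mc * C"
      using 1 y by (simp add: K_def Mc_def C_def powr_diff powr_add)
    have L': "?L = ennreal Mc * V" unfolding L V KM using M by (simp add: ennreal_mult' mult.assoc)
    have gr: "ennreal (green_density \<alpha> \<rho> x y) = ennreal Mc * (ennreal ((1-a-b) * Beta (1-b) (1-a)) * J)"
    proof -
      have "ennreal (green_density \<alpha> \<rho> x y) = ennreal (1 / (Gamma a * Gamma b) * (y-x) powr (a+b-1)) * J"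
        unfolding a_def b_def J_def c_def by (rule green_density_upper) (use a b x 1 in \<open>simp_all add: a_def b_def\<close>)
      also have "1 / (Gamma a * Gamma b) * (y-x) powr (a+b-1) = Mc * ((1-a-b) * Beta (1-b) (1-a))"
        unfolding green_constant[OF a b ab, symmetric] Mc_def G_def by simp
      finally show ?thesis using M by (simp add: ennreal_mult' mult.assoc)
    qed
    have "?L + ennreal (green_density \<alpha> \<rho> x y) = ennreal Mc * ennreal (pi / sin (pi*b))"
      unfolding L' gr distrib_left[symmetric] V_def J_def Beta_deficit[OF a b ab c] ..
    also have "\<dots> = ennreal (Mc * (pi / sin (pi*b)))"
      using M by (intro ennreal_mult'[symmetric]) simp
    also have "Mc * (pi / sin (pi*b)) = riesz_kernel a b (y-x)"
      using 1 sb by (simp add: Mc_def riesz_kernel_def G_def)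
    finally show ?thesis .
  next
    case 2
    \<comment> \<open>The cross ratio is inverted against the previous case, so that again
      \<open>c < 1\<close>.\<close>
    define c where "c = (x+1)*(y-1)/((x-1)*(y+1))"
    have c: "0 < c" "c < 1"
    proof -
      have "(x+1)*(y-1) < (x-1)*(y+1)" using 2 by (simp add: algebra_simps)
      then show "c < 1" using x y by (simp add: c_def)
    qed (use x y in \<open>simp add: c_def\<close>)
    define C where "C = (x-y) powr (1-a-b) * (y-1) powr a * (y+1) powr b"
    have C: "C > 0" using 2 y by (simp add: C_def)
    define J where "J = (\<integral>\<^sup>+w\<in>{0<..<c}. ennreal (w powr (a-1) * (1-w) powr (-(a+b))) \<partial>lborel)"
    define V where "V = (\<integral>\<^sup>+v\<in>{0<..}. ennreal (v powr (-a) / (1+v) * ((1-c) / (1 + c * v)) powr (1-a-b)) \<partial>lborel)"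
    have V: "V = ennreal C * (\<integral>\<^sup>+z\<in>{-1<..<1}. ennreal (?W z) \<partial>lborel)"
    proof -
      have "V = (\<integral>\<^sup>+z\<in>{-1<..<1}. ennreal (2*(y+1)/((y-1)*(1+z)\<^sup>2) * (((1-z)*(y+1)/((1+z)*(y-1))) powr (-a) / (1+(1-z)*(y+1)/((1+z)*(y-1)))
           * ((1-c) / (1 + c * ((1-z)*(y+1)/((1+z)*(y-1))))) powr (1-a-b))) \<partial>lborel)"
        unfolding V_def by (rule nn_integral_moebius_down[OF y]) (use c in auto)
      also have "\<dots> = ennreal C * (\<integral>\<^sup>+z\<in>{-1<..<1}. ennreal (?W z) \<partial>lborel)"
      proof (rule set_nn_integral_cong_cmult)
        fix z :: real assume z: "z \<in> {-1<..<1}"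
        have e1: "1+(1-z)*(y+1)/((1+z)*(y-1)) = 2*(y-z)/((1+z)*(y-1))"
          using z y by (simp add: divide_simps) (simp add: algebra_simps)
        have e2: "(1-c) / (1 + c * ((1-z)*(y+1)/((1+z)*(y-1)))) = (x-y)*(1+z)/((y+1)*(x-z))"
        proof -
          have n1: "1 - c = 2*(x-y)/((x-1)*(y+1))" unfolding c_def using x y by (simp add: divide_simps) (simp add: algebra_simps)
          have e3: "c * ((1-z)*(y+1)/((1+z)*(y-1))) = (x+1)*(1-z)/((x-1)*(1+z))"
            unfolding c_def using x y z by (simp add: divide_simps)
          have n2: "1 + c * ((1-z)*(y+1)/((1+z)*(y-1))) = 2*(x-z)/((x-1)*(1+z))"
            unfolding e3 using x z by (simp add: divide_simps) (simp add: algebra_simps)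
          show ?thesis unfolding n1 n2 using x y z by (simp add: divide_simps) (simp add: algebra_simps)
        qed
        have alg: "2*Q/(P*B\<^sup>2) * ((A*Q/(B*P)) powr (-a) / (2*F/(B*P)) * (E*B/(Q*D)) powr (1-a-b))
          = (E powr (1-a-b) * P powr a * Q powr b) * (B powr (-b) * A powr (-a) * D powr (a+b-1) / F)"
          if "A > 0" "B > 0" "D > 0" "E > 0" "F > 0" "P > 0" "Q > 0" for A B D E F P Q :: real
        proof (rule ln_eqD)
          show "ln (2*Q/(P*B\<^sup>2) * ((A*Q/(B*P)) powr (-a) / (2*F/(B*P)) * (E*B/(Q*D)) powr (1-a-b)))
             = ln ((E powr (1-a-b) * P powr a * Q powr b) * (B powr (-b) * A powr (-a) * D powr (a+b-1) / F))"
            using that by (simp add: ln_mult ln_div ln_realpow) (simp add: algebra_simps)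
        qed (use that in auto)
        have "2*(y+1)/((y-1)*(1+z)\<^sup>2) * (((1-z)*(y+1)/((1+z)*(y-1))) powr (-a) / (1+(1-z)*(y+1)/((1+z)*(y-1)))
           * ((1-c) / (1 + c * ((1-z)*(y+1)/((1+z)*(y-1))))) powr (1-a-b)) = C * ?W z"
          unfolding e1 e2 C_def by (rule alg) (use z x y 2 in auto)
        then show "ennreal (2*(y+1)/((y-1)*(1+z)\<^sup>2) * (((1-z)*(y+1)/((1+z)*(y-1))) powr (-a) / (1+(1-z)*(y+1)/((1+z)*(y-1)))
           * ((1-c) / (1 + c * ((1-z)*(y+1)/((1+z)*(y-1))))) powr (1-a-b))) = ennreal C * ennreal (?W z)"
          using C by (simp only: ennreal_mult'[OF less_imp_le[OF C]])
      qed auto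
      finally show ?thesis .
    qed
    define Mc where "Mc = sin (pi*a) / pi * G * sin (pi*b) * (x-y) powr (a+b-1)"
    have M: "Mc > 0" using sa sb G 2 by (simp add: Mc_def)
    have KM: "K = Mc * C"
      using 2 y by (simp add: K_def Mc_def C_def powr_diff powr_add)
    have L': "?L = ennreal Mc * V" unfolding L V KM using M by (simp add: ennreal_mult' mult.assoc)
    have ba: "b + a < 1" "1-b-a = 1-a-b" "b + a = a + b" "Beta (1-a) (1-b) = Beta (1-b) (1-a)"
      using ab by (auto simp: Beta_commute)
    have gr: "ennreal (green_density \<alpha> \<rho> x y) = ennreal Mc * (ennreal ((1-a-b) * Beta (1-b) (1-a)) * J)"
    proof -
      have "ennreal (green_density \<alpha> \<rho> x y) = ennreal (1 / (Gamma a * Gamma b) * (x-y) powr (a+b-1)) * J"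
        unfolding a_def b_def J_def c_def by (rule green_density_lower) (use a b y 2 in \<open>simp_all add: a_def b_def\<close>)
      also have "1 / (Gamma a * Gamma b) * (x-y) powr (a+b-1) = Mc * ((1-a-b) * Beta (1-b) (1-a))"
        unfolding green_constant[OF a b ab, symmetric] Mc_def G_def by simp
      finally show ?thesis using M by (simp add: ennreal_mult' mult.assoc)
    qed
    have "?L + ennreal (green_density \<alpha> \<rho> x y) = ennreal Mc * ennreal (pi / sin (pi*a))"
      unfolding L' gr distrib_left[symmetric] V_def J_def
      using Beta_deficit[OF b a ba(1) c] by (simp only: ba(2-4))
    also have "\<dots> = ennreal (Mc * (pi / sin (pi*a)))"
      using M by (intro ennreal_mult'[symmetric]) simp
    also have "Mc * (pi / sin (pi*a)) = riesz_kernel a b (y-x)"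
      using 2 sa by (simp add: Mc_def riesz_kernel_def G_def)
    finally show ?thesis .
  qed
qed

section \<open>Processes with stationary independent increments and their hitting times\<close>

lemma finite_measure_eq_if_char_eq:
  fixes \<mu> \<nu> :: "real measure"
  assumes "finite_measure \<mu>" "finite_measure \<nu>"
    and sets [measurable_cong]: "sets \<mu> = sets borel" "sets \<nu> = sets borel"
    and char: "\<And>\<theta>. (CLINT x|\<mu>. iexp (\<theta> * x)) = (CLINT x|\<nu>. iexp (\<theta> * x))"
  shows "\<mu> = \<nu>"
proof -
  interpret \<mu>: finite_measure \<mu> by fact
  interpret \<nu>: finite_measure \<nu> by fact
  have sp: "space \<mu> = UNIV" "space \<nu> = UNIV" using sets by (auto dest: sets_eq_imp_space_eq)
  define c where "c = measure \<mu> UNIV"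
  have "measure \<mu> UNIV = measure \<nu> UNIV"
    using char[of 0] sp by (simp flip: of_real_eq_iff)
  then have c: "measure \<mu> UNIV = c" "measure \<nu> UNIV = c" by (simp_all add: c_def)
  show ?thesis
  proof (cases "c = 0")
    case True
    then have "emeasure \<mu> UNIV = 0" "emeasure \<nu> UNIV = 0"
      using c by (simp_all add: \<mu>.emeasure_eq_measure \<nu>.emeasure_eq_measure)
    then have "emeasure \<mu> A = 0" "emeasure \<nu> A = 0" for A
      using emeasure_mono[of A UNIV \<mu>] emeasure_mono[of A UNIV \<nu>] sp sets.top[of \<mu>] sets.top[of \<nu>] by (auto simp: sets)
    then show ?thesis using sets by (intro measure_eqI) auto
  next
    case False
    then have c0: "c > 0" using zero_less_measure_iff[of \<mu> UNIV] c by auto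
    have main: "real_distribution (scale_measure (ennreal (1/c)) N) \<and>
        char (scale_measure (ennreal (1/c)) N) \<theta> = (CLINT x|N. iexp (\<theta> * x)) / c"
      if N: "finite_measure N" "sets N = sets borel" "measure N UNIV = c" for N and \<theta>
    proof
      interpret N: finite_measure N by fact
      have spN: "space N = UNIV" using N by (auto dest: sets_eq_imp_space_eq)
      have "emeasure (scale_measure (ennreal (1/c)) N) (space (scale_measure (ennreal (1/c)) N)) = 1"
        using c0 N by (simp add: spN space_scale_measure N.emeasure_eq_measure ennreal_mult'[symmetric])
      then have "prob_space (scale_measure (ennreal (1/c)) N)" by (rule prob_spaceI)
      then show "real_distribution (scale_measure (ennreal (1/c)) N)"
        unfolding real_distribution_def real_distribution_axioms_def using N by (simp add: spN space_scale_measure)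
      have "char (scale_measure (ennreal (1/c)) N) \<theta> = (CLINT x|density N (\<lambda>_. ennreal (1/c)). iexp (\<theta> * x))"
        unfolding char_def
        by (intro arg_cong2[where f="lebesgue_integral"] measure_eqI) (auto simp: emeasure_density N.emeasure_eq_measure nn_integral_cmult)
      also have "\<dots> = (CLINT x|N. (1/c) *\<^sub>R iexp (\<theta> * x))"
        by (subst integral_density) (use N c0 in \<open>auto simp: measurable_cong_sets[OF N(2) refl]\<close>)
      finally show "char (scale_measure (ennreal (1/c)) N) \<theta> = (CLINT x|N. iexp (\<theta> * x)) / c"
        by (simp add: scaleR_conv_of_real)
    qed
    have "scale_measure (ennreal (1/c)) \<mu> = scale_measure (ennreal (1/c)) \<nu>"
      using main[OF assms(1) sets(1) c(1)] main[OF assms(2) sets(2) c(2)] char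
      by (intro Levy_uniqueness) auto
    then have "ennreal (1/c) * emeasure \<mu> A = ennreal (1/c) * emeasure \<nu> A" for A
      by (metis emeasure_scale_measure)
    then show ?thesis using c0 sets by (intro measure_eqI) (auto simp: ennreal_mult_cancel_left)
  qed
qed

text \<open>The filter to the right of \<open>t\<close> does not see \<open>t\<close> itself; this
  half-open version includes it, since approximating times may equal \<open>t\<close>.\<close>

lemma tendsto_at_right_closed:
  fixes g :: "real \<Rightarrow> 'b :: metric_space"
  assumes "(g \<longlongrightarrow> g t) (at_right t)" "0 < e"
  shows "\<exists>d>0. \<forall>r. t \<le> r \<longrightarrow> r < t + d \<longrightarrow> dist (g r) (g t) < e"
proof -
  from assms have "eventually (\<lambda>r. dist (g r) (g t) < e) (at_right t)" by (rule tendstoD)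
  then obtain b where b: "b > t" "\<And>r. r > t \<Longrightarrow> r < b \<Longrightarrow> dist (g r) (g t) < e"
    by (auto simp: eventually_at_right_field)
  show ?thesis
    by (rule exI[of _ "b - t"]) (use b assms(2) in \<open>auto simp: le_less\<close>)
qed

text \<open>The exponent stays abstract: the strong Markov property is proved once, and the formula
  for the stable exponent enters only with the potential densities.\<close>

locale levy_process = prob_space M for M :: "'a measure" +
  fixes X :: "real \<Rightarrow> 'a \<Rightarrow> real" and \<Psi> :: "real \<Rightarrow> complex"
  assumes rv: "0 \<le> t \<Longrightarrow> X t \<in> borel_measurable M"
    and X_0: "\<omega> \<in> space M \<Longrightarrow> X 0 \<omega> = 0"
    and right_cont: "\<omega> \<in> space M \<Longrightarrow> 0 \<le> t \<Longrightarrow> ((\<lambda>s. X s \<omega>) \<longlongrightarrow> X t \<omega>) (at_right t)"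
    and indep_increments: "0 \<le> ts 0 \<Longrightarrow> (\<And>i. i < n \<Longrightarrow> ts i \<le> ts (Suc i)) \<Longrightarrow>
      indep_vars (\<lambda>_. borel) (\<lambda>i \<omega>. X (ts (Suc i)) \<omega> - X (ts i) \<omega>) {..<n::nat}"
    and char_increment: "0 \<le> s \<Longrightarrow> s \<le> t \<Longrightarrow>
      char (distr M borel (\<lambda>\<omega>. X t \<omega> - X s \<omega>)) \<theta> = exp (- complex_of_real (t - s) * \<Psi> \<theta>)"
begin

text \<open>Nothing is known about \<open>X\<close> at negative times. Writing
  \<open>max 0 t\<close> gives a process that is measurable over all real times, so that it can be
  integrated over \<open>lborel\<close>.\<close>

lemma rv_max [measurable]: "X (max 0 t) \<in> borel_measurable M"
  by (rule rv) simp

text \<open>Right-continuity makes the process a pointwise limit of processes that are constant in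
  time on dyadic intervals.\<close>

lemma borel_measurable_X_joint [measurable]: "(\<lambda>(t, \<omega>). X (max 0 t) \<omega>) \<in> borel_measurable (borel \<Otimes>\<^sub>M M)"
proof (rule borel_measurable_LIMSEQ_real)
  \<comment> \<open>The \<open>+ 1\<close> puts the dyadic time strictly to the right of
    \<open>max 0 t\<close>, as the limit from the right demands.\<close>
  let ?d = "\<lambda>n (t::real). (real_of_int \<lfloor>2^n * max 0 t\<rfloor> + 1) / 2^n"
  show "(\<lambda>n. (case p of (t, \<omega>) \<Rightarrow> X (?d n t) \<omega>)) \<longlonglongrightarrow> (case p of (t, \<omega>) \<Rightarrow> X (max 0 t) \<omega>)"
    if "p \<in> space (borel \<Otimes>\<^sub>M M)" for p
  proof -
    obtain t \<omega> where p: "p = (t, \<omega>)" and w: "\<omega> \<in> space M" using \<open>p \<in> _\<close> by (auto simp: space_pair_measure)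
    have bd: "m < (real_of_int \<lfloor>2^n * m\<rfloor> + 1) / 2^n" "(real_of_int \<lfloor>2^n * m\<rfloor> + 1) / 2^n \<le> m + (1/2)^n" for m :: real and n
    proof -
      have "m * 2^n < real_of_int \<lfloor>2^n * m\<rfloor> + 1" "real_of_int \<lfloor>2^n * m\<rfloor> + 1 \<le> m * 2^n + 1"
        by (simp_all add: mult.commute)
      then show "m < (real_of_int \<lfloor>2^n * m\<rfloor> + 1) / 2^n" "(real_of_int \<lfloor>2^n * m\<rfloor> + 1) / 2^n \<le> m + (1/2)^n"
        by (simp_all add: field_simps)
    qed
    have lim: "(\<lambda>n. ?d n t) \<longlonglongrightarrow> max 0 t"
    proof (rule tendsto_sandwich[where f="\<lambda>_. max 0 t" and h="\<lambda>n. max 0 t + (1/2)^n"])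
      show "\<forall>\<^sub>F n in sequentially. max 0 t \<le> ?d n t"
        by (rule always_eventually, rule allI, rule less_imp_le, rule bd(1))
      show "\<forall>\<^sub>F n in sequentially. ?d n t \<le> max 0 t + (1/2)^n"
        by (rule always_eventually, rule allI, rule bd(2))
      have "(\<lambda>n. max 0 t + (1/2)^n) \<longlonglongrightarrow> max 0 t + 0"
        by (intro tendsto_intros LIMSEQ_power_zero) auto
      then show "(\<lambda>n. max 0 t + (1/2)^n) \<longlonglongrightarrow> max 0 t" by simp
    qed auto
    have gt: "?d n t > max 0 t" for n
      by (rule bd)
    have "filterlim (\<lambda>n. ?d n t) (at_right (max 0 t)) sequentially"
      unfolding filterlim_at
      by (rule conjI[OF _ lim], rule always_eventually) (use gt in \<open>metis greaterThan_iff less_irrefl\<close>)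
    then show ?thesis
      unfolding p using right_cont[OF w, of "max 0 t"] by (auto intro: filterlim_compose)
  qed
  fix n
  have *: "(\<lambda>p. X (max 0 ((real_of_int i + 1) / 2^n)) (snd p)) \<in> borel_measurable (borel \<Otimes>\<^sub>M M)" for i :: int
    by measurable
  have "(\<lambda>p :: real \<times> 'a. X (max 0 ((real_of_int \<lfloor>2^n * max 0 (fst p)\<rfloor> + 1) / 2^n)) (snd p)) \<in> borel_measurable (borel \<Otimes>\<^sub>M M)"
    by (rule measurable_compose_countable[OF *]) measurable
  moreover have "max 0 (?d n t) = ?d n t" for t
  proof -
    have "0 \<le> \<lfloor>2^n * max 0 t\<rfloor>" by simp
    then show ?thesis by simp
  qed
  ultimately show "(\<lambda>p. case p of (t, \<omega>) \<Rightarrow> X (?d n t) \<omega>) \<in> borel_measurable (borel \<Otimes>\<^sub>M M)"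
    by (simp add: case_prod_beta')
qed

lemma borel_measurable_X_compose:
  assumes "g \<in> borel_measurable N" "h \<in> measurable N M" "\<And>p. p \<in> space N \<Longrightarrow> 0 \<le> g p"
  shows "(\<lambda>p. X (g p) (h p)) \<in> borel_measurable N"
proof -
  have "(\<lambda>p. (\<lambda>(t, \<omega>). X (max 0 t) \<omega>) (g p, h p)) \<in> borel_measurable N"
    using assms(1,2) by (intro measurable_compose[OF _ borel_measurable_X_joint] measurable_Pair) auto
  then show ?thesis
    by (rule measurable_cong[THEN iffD1, rotated]) (use assms(3) in \<open>auto simp: max_def\<close>)
qed

section \<open>Hitting times of open sets and their dyadic approximation\<close>

definition hitting_time :: "real set \<Rightarrow> 'a \<Rightarrow> ereal" where
  "hitting_time B \<omega> = Inf (ereal ` {t. 0 < t \<and> X t \<omega> \<in> B})"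

text \<open>The indices start at one because \<open>hitting_time\<close> ignores time zero.\<close>

definition first_hit :: "real set \<Rightarrow> nat \<Rightarrow> nat \<Rightarrow> 'a set" where
  "first_hit B n k = {\<omega> \<in> space M. X (real k / 2^n) \<omega> \<in> B \<and> (\<forall>j\<in>{1..<k}. X (real j / 2^n) \<omega> \<notin> B)}"

lemma hitting_time_nonneg: "0 \<le> hitting_time B \<omega>"
  unfolding hitting_time_def by (auto intro!: Inf_greatest)

lemma hitting_time_le: "0 < t \<Longrightarrow> X t \<omega> \<in> B \<Longrightarrow> hitting_time B \<omega> \<le> ereal t"
  unfolding hitting_time_def by (auto intro!: Inf_lower)

lemma not_in_before_hitting_time: "0 < t \<Longrightarrow> ereal t < hitting_time B \<omega> \<Longrightarrow> X t \<omega> \<notin> B"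
  using hitting_time_le[of t \<omega> B] by (auto simp: not_le)

text \<open>By right-continuity the path stays in the open set for a short time after
  \<open>s\<close>, and that stretch contains a grid point as soon as the mesh is small.\<close>

lemma ex_dyadic_hit:
  assumes B: "open B" and w: "\<omega> \<in> space M" and s: "0 < s" "X s \<omega> \<in> B" and e: "0 < e"
  shows "\<forall>\<^sub>F n in sequentially. \<exists>j\<ge>1. s \<le> real j / 2^n \<and> real j / 2^n < s + e \<and> X (real j / 2^n) \<omega> \<in> B"
proof -
  have "\<exists>r>0. \<forall>z. dist z (X s \<omega>) < r \<longrightarrow> z \<in> B"
    using B[unfolded open_dist] s(2) by (rule bspec)
  then obtain r where r: "0 < r" "\<forall>z. dist z (X s \<omega>) < r \<longrightarrow> z \<in> B"
    by (elim exE conjE)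
  have "\<exists>d>0. \<forall>u. s \<le> u \<longrightarrow> u < s + d \<longrightarrow> dist (X u \<omega>) (X s \<omega>) < r"
    by (rule tendsto_at_right_closed[where g="\<lambda>u. X u \<omega>", OF right_cont[OF w less_imp_le[OF s(1)]] r(1)])
  then obtain d where d: "0 < d" "\<forall>u. s \<le> u \<longrightarrow> u < s + d \<longrightarrow> dist (X u \<omega>) (X s \<omega>) < r"
    by (elim exE conjE)
  have "(\<lambda>n. (1/2)^n :: real) \<longlonglongrightarrow> 0" by (rule LIMSEQ_power_zero) auto
  then have "\<forall>\<^sub>F n in sequentially. (1/2)^n < min d e"
    by (rule order_tendstoD(2)) (use d e in auto)
  then show ?thesis
  proof eventually_elim
    case (elim n)
    \<comment> \<open>The first grid point not before \<open>s\<close>.\<close>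
    define j where "j = nat \<lceil>s * 2^n\<rceil>"
    have pos: "0 < s * 2^n" using s by simp
    then have j: "s * 2^n \<le> real j" "real j < s * 2^n + 1" unfolding j_def by linarith+
    have 1: "j \<ge> 1" using j(1) pos by (cases j) auto
    have 2: "s \<le> real j / 2^n" using j(1) by (simp add: field_simps)
    have "real j / 2^n < (s * 2^n + 1) / 2^n" using j(2) by (intro divide_strict_right_mono) auto
    also have "\<dots> = s + (1/2)^n" by (simp add: field_simps power_one_over)
    finally have 3: "real j / 2^n < s + d" "real j / 2^n < s + e" using elim by auto
    show ?case using 1 2 3 d(2)[rule_format, of "real j / 2^n"] r(2) by blast
  qed
qed

text \<open>For an open set the infimum may be taken over the dyadic hits, of which there are
  countably many.\<close>

lemma borel_measurable_hitting_time:
  assumes B: "open B"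
  shows "hitting_time B \<in> borel_measurable M"
proof -
  have [measurable]: "B \<in> sets borel" using B by simp
  define h where "h = (\<lambda>(i :: nat \<times> nat) \<omega>. if 1 \<le> snd i \<and> X (max 0 (real (snd i) / 2^fst i)) \<omega> \<in> B
    then ereal (real (snd i) / 2^fst i) else \<infinity>)"
  have "hitting_time B \<omega> = (INF i\<in>UNIV. h i \<omega>)" if w: "\<omega> \<in> space M" for \<omega>
  proof (rule antisym)
    show "hitting_time B \<omega> \<le> (INF i\<in>UNIV. h i \<omega>)"
      by (rule INF_greatest) (auto intro!: hitting_time_le simp: h_def)
    show "(INF i\<in>UNIV. h i \<omega>) \<le> hitting_time B \<omega>"
      unfolding hitting_time_def
    proof (rule Inf_greatest, safe)
      fix t assume t: "0 < t" "X t \<omega> \<in> B"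
      show "(INF i\<in>UNIV. h i \<omega>) \<le> ereal t"
      proof (rule ereal_le_epsilon2)
        fix e :: real assume "0 < e"
        from eventually_happens[OF ex_dyadic_hit[OF B w t this]] obtain n j where
          j: "j \<ge> 1" "real j / 2^n < t + e" "X (real j / 2^n) \<omega> \<in> B" by auto
        have "(INF i\<in>UNIV. h i \<omega>) \<le> h (n, j) \<omega>" by (rule INF_lower) simp
        also have "\<dots> \<le> ereal t + ereal e" using j by (simp add: h_def)
        finally show "(INF i\<in>UNIV. h i \<omega>) \<le> ereal t + ereal e" .
      qed
    qed
  qed
  then have "hitting_time B \<in> borel_measurable M \<longleftrightarrow> (\<lambda>\<omega>. INF i\<in>UNIV. h i \<omega>) \<in> borel_measurable M"
    by (rule measurable_cong)
  moreover have "h i \<in> borel_measurable M" for i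
    unfolding h_def by measurable
  then have "(\<lambda>\<omega>. INF i\<in>UNIV. h i \<omega>) \<in> borel_measurable M"
    by (intro borel_measurable_INF) auto
  ultimately show ?thesis by simp
qed

lemma first_hit_sets:
  assumes B: "open B" shows "first_hit B n k \<in> sets M"
proof -
  have [measurable]: "B \<in> sets borel" using B by simp
  have "first_hit B n k = {\<omega> \<in> space M. X (max 0 (real k / 2^n)) \<omega> \<in> B \<and> (\<forall>j\<in>{1..<k}. X (max 0 (real j / 2^n)) \<omega> \<notin> B)}"
    by (auto simp: first_hit_def)
  also have "\<dots> \<in> sets M" by measurable
  finally show ?thesis .
qed

lemma first_hit_unique:
  assumes "\<omega> \<in> first_hit B n k" "\<omega> \<in> first_hit B n k'" "1 \<le> k" "1 \<le> k'"
  shows "k = k'"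
  using assms unfolding first_hit_def by (metis (mono_tags, lifting) atLeastLessThan_iff linorder_neqE_nat mem_Collect_eq)

lemma expectation_iexp_increment:
  assumes "0 \<le> s" "s \<le> t"
  shows "(CLINT \<omega>|M. iexp (\<theta> * (X t \<omega> - X s \<omega>))) = exp (- complex_of_real (t - s) * \<Psi> \<theta>)"
proof -
  have "(\<lambda>\<omega>. X t \<omega> - X s \<omega>) \<in> borel_measurable M" using rv[of t] rv[of s] assms by simp
  then show ?thesis
    using char_increment[OF assms, of \<theta>] by (simp add: char_def integral_distr)
qed

lemma expectation_iexp:
  assumes "0 \<le> t"
  shows "(CLINT \<omega>|M. iexp (\<theta> * X t \<omega>)) = exp (- complex_of_real t * \<Psi> \<theta>)"
proof -
  have "(CLINT \<omega>|M. iexp (\<theta> * X t \<omega>)) = (CLINT \<omega>|M. iexp (\<theta> * (X t \<omega> - X 0 \<omega>)))"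
    by (rule Bochner_Integration.integral_cong) (auto simp: X_0)
  then show ?thesis using expectation_iexp_increment[of 0 t \<theta>] assms by simp
qed

text \<open>The event \<open>first_hit B n k\<close> and the position at \<open>k / 2^n\<close> are
  functions of the first \<open>k\<close> increments on the grid, while the later increment is the
  next member of the same independent family.\<close>

lemma first_hit_markov:
  assumes B: "open B" and k: "1 \<le> k" and s: "0 \<le> s"
  shows "(CLINT \<omega>|M. indicator (first_hit B n k) \<omega> * iexp (\<theta> * X (real k / 2^n + s) \<omega>))
    = (CLINT \<omega>|M. indicator (first_hit B n k) \<omega> * iexp (\<theta> * X (real k / 2^n) \<omega>)) * exp (- complex_of_real s * \<Psi> \<theta>)"
proof -
  have [measurable]: "B \<in> sets borel" using B by simp
  \<comment> \<open>\<open>k\<close> grid steps followed by one step of length \<open>s\<close>: one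
    family, so that independence holds for all its increments at once.\<close>
  define ts where "ts = (\<lambda>i. if i \<le> k then real i / 2^n else real k / 2^n + s)"
  define Y where "Y = (\<lambda>i \<omega>. X (ts (Suc i)) \<omega> - X (ts i) \<omega>)"
  have ind: "indep_vars (\<lambda>_. borel) Y {..<Suc k}"
    unfolding Y_def
  proof (rule indep_increments)
    show "ts i \<le> ts (Suc i)" if "i < Suc k" for i
      using that s by (cases "i = k") (auto simp: ts_def divide_right_mono)
  qed (simp add: ts_def)
  have tele: "(\<Sum>i<j. Y i \<omega>) = X (real j / 2^n) \<omega>" if "j \<le> k" "\<omega> \<in> space M" for j \<omega>
  proof -
    have "(\<Sum>i<j. Y i \<omega>) = X (ts j) \<omega> - X (ts 0) \<omega>"
      unfolding Y_def by (rule sum_lessThan_telescope)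
    then show ?thesis using that by (simp add: ts_def X_0)
  qed
  \<comment> \<open>The path on the grid is recovered from its increments as partial sums, which
    uses \<open>X 0 = 0\<close>.\<close>
  define U where "U = (\<lambda>f :: nat \<Rightarrow> real. if (\<Sum>i<k. f i) \<in> B \<and> (\<forall>j\<in>{1..<k}. (\<Sum>i<j. f i) \<notin> B)
    then iexp (\<theta> * (\<Sum>i<k. f i)) else 0)"
  have sm: "(\<lambda>f :: nat \<Rightarrow> real. \<Sum>i<j. f i) \<in> borel_measurable (Pi\<^sub>M {..<k} (\<lambda>_. borel))" if "j \<le> k" for j
    by (intro borel_measurable_sum measurable_component_singleton) (use that in auto)
  have U [measurable]: "U \<in> borel_measurable (Pi\<^sub>M {..<k} (\<lambda>_. borel))"
  proof -
    have [measurable]: "(\<lambda>f :: nat \<Rightarrow> real. \<Sum>i<k. f i) \<in> borel_measurable (Pi\<^sub>M {..<k} (\<lambda>_. borel))" by (rule sm) simp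
    have "Measurable.pred (Pi\<^sub>M {..<k} (\<lambda>_. borel)) (\<lambda>f :: nat \<Rightarrow> real. \<forall>j\<in>{1..<k}. (\<Sum>i<j. f i) \<notin> B)"
    proof (rule pred_intros_finite(3))
      show "Measurable.pred (Pi\<^sub>M {..<k} (\<lambda>_. borel)) (\<lambda>f :: nat \<Rightarrow> real. (\<Sum>i<j. f i) \<notin> B)" if "j \<in> {1..<k}" for j
      proof -
        have [measurable]: "(\<lambda>f :: nat \<Rightarrow> real. \<Sum>i<j. f i) \<in> borel_measurable (Pi\<^sub>M {..<k} (\<lambda>_. borel))" using that by (intro sm) auto
        show ?thesis by measurable
      qed
    qed simp
    then show ?thesis unfolding U_def by measurable
  qed
  define V where "V = (\<lambda>f :: nat \<Rightarrow> real. iexp (\<theta> * f k))"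
  have V [measurable]: "V \<in> borel_measurable (Pi\<^sub>M {k} (\<lambda>_. borel))"
    unfolding V_def by measurable
  have iv: "indep_var borel (U \<circ> (\<lambda>\<omega>. restrict (\<lambda>i. Y i \<omega>) {..<k})) borel (V \<circ> (\<lambda>\<omega>. restrict (\<lambda>i. Y i \<omega>) {k}))"
    by (rule indep_var_compose[OF indep_var_restrict[OF ind] U V]) auto
  have Ueq: "(U \<circ> (\<lambda>\<omega>. restrict (\<lambda>i. Y i \<omega>) {..<k})) \<omega> = indicator (first_hit B n k) \<omega> * iexp (\<theta> * X (real k / 2^n) \<omega>)"
    if w: "\<omega> \<in> space M" for \<omega>
  proof -
    have r: "(\<Sum>i<j. restrict (\<lambda>i. Y i \<omega>) {..<k} i) = X (real j / 2^n) \<omega>" if "j \<le> k" for j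
      using that tele[OF that w] by (subst sum.cong[OF refl, of _ _ "\<lambda>i. Y i \<omega>"]) auto
    show ?thesis using w r by (auto simp: U_def first_hit_def indicator_def)
  qed
  have Veq: "(V \<circ> (\<lambda>\<omega>. restrict (\<lambda>i. Y i \<omega>) {k})) \<omega> = iexp (\<theta> * (X (real k / 2^n + s) \<omega> - X (real k / 2^n) \<omega>))" for \<omega>
    by (simp add: V_def Y_def ts_def)
  have mU: "U \<circ> (\<lambda>\<omega>. restrict (\<lambda>i. Y i \<omega>) {..<k}) \<in> borel_measurable M"
    and mV: "V \<circ> (\<lambda>\<omega>. restrict (\<lambda>i. Y i \<omega>) {k}) \<in> borel_measurable M"
    using iv by (auto dest: indep_var_rv1 indep_var_rv2)
  have "(CLINT \<omega>|M. indicator (first_hit B n k) \<omega> * iexp (\<theta> * X (real k / 2^n + s) \<omega>))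
     = (CLINT \<omega>|M. (U \<circ> (\<lambda>\<omega>. restrict (\<lambda>i. Y i \<omega>) {..<k})) \<omega> * (V \<circ> (\<lambda>\<omega>. restrict (\<lambda>i. Y i \<omega>) {k})) \<omega>)"
  proof (rule Bochner_Integration.integral_cong[OF refl])
    fix \<omega> assume w: "\<omega> \<in> space M"
    have "iexp (\<theta> * X (real k / 2^n + s) \<omega>) = iexp (\<theta> * X (real k / 2^n) \<omega>) * iexp (\<theta> * (X (real k / 2^n + s) \<omega> - X (real k / 2^n) \<omega>))"
      by (simp add: exp_add[symmetric] algebra_simps)
    then show "indicator (first_hit B n k) \<omega> * iexp (\<theta> * X (real k / 2^n + s) \<omega>)
      = (U \<circ> (\<lambda>\<omega>. restrict (\<lambda>i. Y i \<omega>) {..<k})) \<omega> * (V \<circ> (\<lambda>\<omega>. restrict (\<lambda>i. Y i \<omega>) {k})) \<omega>"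
      unfolding Ueq[OF w] Veq by (simp add: mult.assoc)
  qed
  also have "\<dots> = (CLINT \<omega>|M. (U \<circ> (\<lambda>\<omega>. restrict (\<lambda>i. Y i \<omega>) {..<k})) \<omega>) * (CLINT \<omega>|M. (V \<circ> (\<lambda>\<omega>. restrict (\<lambda>i. Y i \<omega>) {k})) \<omega>)"
  proof (rule indep_var_lebesgue_integral[OF iv])
    show "integrable M (U \<circ> (\<lambda>\<omega>. restrict (\<lambda>i. Y i \<omega>) {..<k}))"
      using mU by (rule integrable_const_bound[rotated, where B=1]) (auto simp: U_def)
    show "integrable M (V \<circ> (\<lambda>\<omega>. restrict (\<lambda>i. Y i \<omega>) {k}))"
      using mV by (rule integrable_const_bound[rotated, where B=1]) (auto simp: V_def)
  qed
  also have "(CLINT \<omega>|M. (V \<circ> (\<lambda>\<omega>. restrict (\<lambda>i. Y i \<omega>) {k})) \<omega>) = exp (- complex_of_real s * \<Psi> \<theta>)"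
    unfolding Veq using expectation_iexp_increment[of "real k / 2^n" "real k / 2^n + s" \<theta>] s by simp
  also have "(CLINT \<omega>|M. (U \<circ> (\<lambda>\<omega>. restrict (\<lambda>i. Y i \<omega>) {..<k})) \<omega>) = (CLINT \<omega>|M. indicator (first_hit B n k) \<omega> * iexp (\<theta> * X (real k / 2^n) \<omega>))"
    by (rule Bochner_Integration.integral_cong[OF refl Ueq])
  finally show ?thesis .
qed

end

section \<open>The strong Markov property\<close>

context levy_process begin

lemma measurable_X_raw [measurable (raw)]:
  assumes "g \<in> borel_measurable N" "h \<in> measurable N M"
  shows "(\<lambda>p. X (max 0 (g p)) (h p)) \<in> borel_measurable N"
  by (rule borel_measurable_X_compose) (use assms in auto)

text \<open>At \<open>q = 0\<close> this is the indicator of hitting at all; paths that never hit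
  carry no weight for any \<open>q\<close>.\<close>

definition hit_weight :: "real \<Rightarrow> real set \<Rightarrow> 'a \<Rightarrow> real" where
  "hit_weight q B \<omega> = (if hitting_time B \<omega> < \<infinity> then exp (- q * real_of_ereal (hitting_time B \<omega>)) else 0)"

text \<open>The hitting time is approximated from above by the dyadic times of mesh \<open>2^(-n)\<close>, at which the
  Markov property only involves independence of increments.\<close>
definition dyadic_approx :: "real \<Rightarrow> real set \<Rightarrow> real \<Rightarrow> nat \<Rightarrow> real \<Rightarrow> 'a \<Rightarrow> complex" where
  "dyadic_approx q B \<theta> n s \<omega> = (\<Sum>k\<in>{1..n*2^n}. complex_of_real (exp (- q * (real k / 2^n))) *
     (indicator (first_hit B n k) \<omega> * iexp (\<theta> * X (real k / 2^n + s) \<omega>)))"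

lemma dyadic_approx_hit:
  assumes "k \<in> {1..n*2^n}" "\<omega> \<in> first_hit B n k"
  shows "dyadic_approx q B \<theta> n s \<omega> = complex_of_real (exp (- q * (real k / 2^n))) * iexp (\<theta> * X (real k / 2^n + s) \<omega>)"
proof -
  have "dyadic_approx q B \<theta> n s \<omega> = (\<Sum>k'\<in>{1..n*2^n}. if k' = k then
      complex_of_real (exp (- q * (real k / 2^n))) * iexp (\<theta> * X (real k / 2^n + s) \<omega>) else 0)"
    unfolding dyadic_approx_def
  proof (rule sum.cong[OF refl])
    fix k' assume "k' \<in> {1..n*2^n}"
    then show "complex_of_real (exp (- q * (real k' / 2^n))) *
     (indicator (first_hit B n k') \<omega> * iexp (\<theta> * X (real k' / 2^n + s) \<omega>)) = (if k' = k then
      complex_of_real (exp (- q * (real k / 2^n))) * iexp (\<theta> * X (real k / 2^n + s) \<omega>) else 0)"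
      using first_hit_unique[of \<omega> B n k k'] assms by (cases "\<omega> \<in> first_hit B n k'") auto
  qed
  also have "\<dots> = complex_of_real (exp (- q * (real k / 2^n))) * iexp (\<theta> * X (real k / 2^n + s) \<omega>)"
    using assms(1) by (subst sum.delta) auto
  finally show ?thesis .
qed

lemma dyadic_approx_no_hit:
  assumes "\<And>k. k \<in> {1..n*2^n} \<Longrightarrow> \<omega> \<notin> first_hit B n k"
  shows "dyadic_approx q B \<theta> n s \<omega> = 0"
  unfolding dyadic_approx_def using assms by (intro sum.neutral) auto

lemma norm_dyadic_approx:
  assumes "0 \<le> q" shows "norm (dyadic_approx q B \<theta> n s \<omega>) \<le> 1"
proof (cases "\<exists>k\<in>{1..n*2^n}. \<omega> \<in> first_hit B n k")
  case True
  then obtain k where "k \<in> {1..n*2^n}" "\<omega> \<in> first_hit B n k" by blast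
  then show ?thesis using assms by (simp add: dyadic_approx_hit norm_mult)
next
  case False
  then show ?thesis by (subst dyadic_approx_no_hit) auto
qed

lemma borel_measurable_first_hit_iexp:
  assumes B: "open B" and s: "0 \<le> s"
  shows "(\<lambda>\<omega>. indicator (first_hit B n k) \<omega> * iexp (\<theta> * X (real k / 2^n + s) \<omega>)) \<in> borel_measurable M"
proof -
  have [measurable]: "first_hit B n k \<in> sets M" by (rule first_hit_sets[OF B])
  have [measurable]: "X (real k / 2^n + s) \<in> borel_measurable M" using s by (intro rv) auto
  show ?thesis by measurable
qed

lemma integrable_first_hit_iexp:
  assumes B: "open B" and s: "0 \<le> s"
  shows "integrable M (\<lambda>\<omega>. indicator (first_hit B n k) \<omega> * iexp (\<theta> * X (real k / 2^n + s) \<omega>))"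
  by (rule integrable_const_bound[where B=1])
     (use borel_measurable_first_hit_iexp[OF B s] in \<open>auto simp: norm_mult indicator_def\<close>)

lemma borel_measurable_dyadic_approx:
  assumes B: "open B" and s: "0 \<le> s"
  shows "dyadic_approx q B \<theta> n s \<in> borel_measurable M"
  unfolding dyadic_approx_def
  by (intro borel_measurable_sum borel_measurable_times borel_measurable_first_hit_iexp[OF B s] borel_measurable_const)

lemma expectation_dyadic_approx:
  assumes B: "open B" and s: "0 \<le> s"
  shows "(CLINT \<omega>|M. dyadic_approx q B \<theta> n s \<omega>) = (CLINT \<omega>|M. dyadic_approx q B \<theta> n 0 \<omega>) * exp (- complex_of_real s * \<Psi> \<theta>)"
proof -
  have "(CLINT \<omega>|M. dyadic_approx q B \<theta> n u \<omega>) = (\<Sum>k\<in>{1..n*2^n}. complex_of_real (exp (- q * (real k / 2^n))) *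
     (CLINT \<omega>|M. indicator (first_hit B n k) \<omega> * iexp (\<theta> * X (real k / 2^n + u) \<omega>)))" if "0 \<le> u" for u
    unfolding dyadic_approx_def
    by (subst Bochner_Integration.integral_sum, intro integrable_mult_right integrable_first_hit_iexp[OF B that])
       (simp only: integral_mult_right_zero)
  from this[OF s] this[of 0] show ?thesis
    using first_hit_markov[OF B _ s] by (simp add: sum_distrib_right mult.assoc)
qed

text \<open>The first grid hit is never earlier than the hitting time, and by
  \<open>ex_dyadic_hit\<close> it converges to it; right-continuity at the hitting time plus
  \<open>s\<close> then gives the limit.\<close>

lemma dyadic_approx_tendsto:
  assumes B: "open B" and s: "0 \<le> s" and w: "\<omega> \<in> space M"
  shows "(\<lambda>n. dyadic_approx q B \<theta> n s \<omega>) \<longlonglongrightarrow>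
    complex_of_real (hit_weight q B \<omega>) * iexp (\<theta> * X (real_of_ereal (hitting_time B \<omega>) + s) \<omega>)"
proof (cases "hitting_time B \<omega> < \<infinity>")
  case False
  have "\<omega> \<notin> first_hit B n k" if "k \<in> {1..n*2^n}" for n k
  proof
    assume "\<omega> \<in> first_hit B n k"
    then have "hitting_time B \<omega> \<le> ereal (real k / 2^n)"
      using that by (intro hitting_time_le) (auto simp: first_hit_def)
    then show False using False by auto
  qed
  then have "dyadic_approx q B \<theta> n s \<omega> = 0" for n by (rule dyadic_approx_no_hit)
  then show ?thesis using False by (simp add: hit_weight_def)
next
  case True
  then obtain t where t: "hitting_time B \<omega> = ereal t" "0 \<le> t"
    using hitting_time_nonneg[of B \<omega>] by (cases "hitting_time B \<omega>") auto
  define g where "g = (\<lambda>r. complex_of_real (exp (- q * r)) * iexp (\<theta> * X (r + s) \<omega>))"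
  have lim: "(g \<longlongrightarrow> g t) (at_right t)"
  proof -
    have "filterlim (\<lambda>r. r + s) (at_right (t + s)) (at_right t)"
      unfolding filterlim_at
    proof
      show "\<forall>\<^sub>F r in at_right t. r + s \<in> {t + s<..} \<and> r + s \<noteq> t + s"
        unfolding eventually_at_filter by (auto intro!: always_eventually)
      show "((\<lambda>r. r + s) \<longlongrightarrow> t + s) (at_right t)" by (intro tendsto_intros)
    qed
    then have "((\<lambda>r. X (r + s) \<omega>) \<longlongrightarrow> X (t + s) \<omega>) (at_right t)"
      using right_cont[OF w, of "t + s"] t s by (auto intro: filterlim_compose)
    then show ?thesis unfolding g_def by (intro tendsto_intros)
  qed
  have "(\<lambda>n. dyadic_approx q B \<theta> n s \<omega>) \<longlonglongrightarrow> g t"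
  proof (rule tendstoI)
    fix e :: real assume "0 < e"
    from tendsto_at_right_closed[where g=g, OF lim this] obtain d where
      d: "0 < d" "\<forall>r. t \<le> r \<longrightarrow> r < t + d \<longrightarrow> dist (g r) (g t) < e" by (elim exE conjE)
    have "hitting_time B \<omega> < ereal (t + d/2)" using t d by simp
    then obtain u where u: "0 < u" "X u \<omega> \<in> B" "u < t + d/2"
      unfolding hitting_time_def by (auto simp: Inf_less_iff)
    have "t \<le> u" using hitting_time_le[OF u(1,2)] t by simp
    \<comment> \<open>The sum in \<open>dyadic_approx\<close> stops at time \<open>n\<close>, so
      only for large \<open>n\<close> does it reach the hit.\<close>
    have "\<forall>\<^sub>F n in sequentially. t + d \<le> real n"
      by (rule eventually_sequentiallyI[of "nat \<lceil>t + d\<rceil>"]) linarith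
    with ex_dyadic_hit[OF B w u(1,2), of "d/2"] d(1) have
      "\<forall>\<^sub>F n in sequentially. (\<exists>j\<ge>1. u \<le> real j / 2^n \<and> real j / 2^n < u + d/2 \<and> X (real j / 2^n) \<omega> \<in> B) \<and> t + d \<le> real n"
      by (auto intro: eventually_conj)
    then show "\<forall>\<^sub>F n in sequentially. dist (dyadic_approx q B \<theta> n s \<omega>) (g t) < e"
    proof eventually_elim
      case (elim n)
      then obtain j where j: "1 \<le> j" "real j / 2^n < u + d/2" "X (real j / 2^n) \<omega> \<in> B" by blast
      define k where "k = (LEAST k. 1 \<le> k \<and> X (real k / 2^n) \<omega> \<in> B)"
      have k: "1 \<le> k" "X (real k / 2^n) \<omega> \<in> B" "k \<le> j"
        using LeastI[of "\<lambda>k. 1 \<le> k \<and> X (real k / 2^n) \<omega> \<in> B" j] Least_le[of "\<lambda>k. 1 \<le> k \<and> X (real k / 2^n) \<omega> \<in> B" j] j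
        unfolding k_def by auto
      have fh: "\<omega> \<in> first_hit B n k"
        using k w not_less_Least[of _ "\<lambda>k. 1 \<le> k \<and> X (real k / 2^n) \<omega> \<in> B"]
        unfolding first_hit_def k_def by auto
      have "real k / 2^n \<le> real j / 2^n" using k by (simp add: divide_right_mono)
      then have less: "real k / 2^n < t + d" using j u by simp
      have ge: "t \<le> real k / 2^n" using hitting_time_le[of "real k / 2^n" \<omega> B] k t by simp
      have "real k / 2^n < real n" using less elim by simp
      then have "real k < real n * 2^n" by (simp add: field_simps)
      then have "real k < real (n * 2^n)" by simp
      then have "k \<in> {1..n*2^n}" using k by (simp only: of_nat_less_iff atLeastAtMost_iff less_imp_le)
      then have "dyadic_approx q B \<theta> n s \<omega> = g (real k / 2^n)"
        using fh by (simp only: dyadic_approx_hit g_def)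
      then show ?case using d(2) ge less by simp
    qed
  qed
  then show ?thesis using t by (simp add: g_def hit_weight_def)
qed

lemma borel_measurable_hit_weight:
  assumes "open B" shows "hit_weight q B \<in> borel_measurable M"
proof -
  note [measurable] = borel_measurable_hitting_time[OF assms]
  show ?thesis unfolding hit_weight_def by measurable
qed

lemma hit_weight_bounds: "0 \<le> q \<Longrightarrow> 0 \<le> hit_weight q B \<omega>" "0 \<le> q \<Longrightarrow> hit_weight q B \<omega> \<le> 1"
  using real_of_ereal_pos[OF hitting_time_nonneg[of B \<omega>]] by (auto simp: hit_weight_def)

lemma borel_measurable_X_hitting_time:
  assumes "open B" "0 \<le> s"
  shows "(\<lambda>\<omega>. X (real_of_ereal (hitting_time B \<omega>) + s) \<omega>) \<in> borel_measurable M"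
proof -
  note [measurable] = borel_measurable_hitting_time[OF assms(1)]
  show ?thesis
    by (rule borel_measurable_X_compose) (use assms real_of_ereal_pos[OF hitting_time_nonneg] in auto)
qed

text \<open>Each dyadic approximation satisfies the identity by \<open>first_hit_markov\<close>, and
  both sides pass to the limit because the approximations are bounded by one.\<close>

lemma strong_markov_iexp:
  assumes B: "open B" and s: "0 \<le> s" and q: "0 \<le> q"
  shows "(CLINT \<omega>|M. complex_of_real (hit_weight q B \<omega>) * iexp (\<theta> * X (real_of_ereal (hitting_time B \<omega>) + s) \<omega>))
   = (CLINT \<omega>|M. complex_of_real (hit_weight q B \<omega>) * iexp (\<theta> * X (real_of_ereal (hitting_time B \<omega>)) \<omega>)) * exp (- complex_of_real s * \<Psi> \<theta>)"
proof -
  have lim: "(\<lambda>n. CLINT \<omega>|M. dyadic_approx q B \<theta> n u \<omega>) \<longlonglongrightarrow>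
     (CLINT \<omega>|M. complex_of_real (hit_weight q B \<omega>) * iexp (\<theta> * X (real_of_ereal (hitting_time B \<omega>) + u) \<omega>))" if u: "0 \<le> u" for u
  proof (rule integral_dominated_convergence[where w="\<lambda>_. 1"])
    note [measurable] = borel_measurable_hit_weight[OF B, of q] borel_measurable_X_hitting_time[OF B u]
    show "(\<lambda>\<omega>. complex_of_real (hit_weight q B \<omega>) * iexp (\<theta> * X (real_of_ereal (hitting_time B \<omega>) + u) \<omega>)) \<in> borel_measurable M"
      by measurable
  qed (use borel_measurable_dyadic_approx[OF B u] dyadic_approx_tendsto[OF B u] norm_dyadic_approx[OF q] in auto)
  have "(\<lambda>n. CLINT \<omega>|M. dyadic_approx q B \<theta> n s \<omega>) \<longlonglongrightarrow>
    (CLINT \<omega>|M. complex_of_real (hit_weight q B \<omega>) * iexp (\<theta> * X (real_of_ereal (hitting_time B \<omega>) + 0) \<omega>)) * exp (- complex_of_real s * \<Psi> \<theta>)"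
    unfolding expectation_dyadic_approx[OF B s] by (intro tendsto_mult_right lim) simp
  from LIMSEQ_unique[OF lim[OF s] this] show ?thesis by simp
qed

text \<open>Discounted law of the position at delay \<open>s\<close> after the hitting time; at
  \<open>s = 0\<close> it is the discounted entrance law.\<close>

definition hit_law :: "real \<Rightarrow> real set \<Rightarrow> real \<Rightarrow> real measure" where
  "hit_law q B s = distr (density M (\<lambda>\<omega>. ennreal (hit_weight q B \<omega>))) borel (\<lambda>\<omega>. X (real_of_ereal (hitting_time B \<omega>) + s) \<omega>)"

lemma sets_hit_law [simp, measurable_cong]: "sets (hit_law q B s) = sets borel"
  by (simp add: hit_law_def)

lemma nn_integral_hit_law:
  assumes B: "open B" and s: "0 \<le> s" and f [measurable]: "f \<in> borel_measurable borel"
  shows "(\<integral>\<^sup>+x. f x \<partial>hit_law q B s) = (\<integral>\<^sup>+\<omega>. ennreal (hit_weight q B \<omega>) * f (X (real_of_ereal (hitting_time B \<omega>) + s) \<omega>) \<partial>M)"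
proof -
  note [measurable] = borel_measurable_hit_weight[OF B, of q] borel_measurable_X_hitting_time[OF B s]
  show ?thesis unfolding hit_law_def by (simp add: nn_integral_distr nn_integral_density)
qed

lemma finite_measure_hit_law:
  assumes B: "open B" and s: "0 \<le> s" and q: "0 \<le> q"
  shows "finite_measure (hit_law q B s)"
proof
  have "emeasure (hit_law q B s) (space (hit_law q B s)) = (\<integral>\<^sup>+x. 1 \<partial>hit_law q B s)" by simp
  also have "\<dots> = (\<integral>\<^sup>+\<omega>. ennreal (hit_weight q B \<omega>) * 1 \<partial>M)"
    by (rule nn_integral_hit_law[OF B s]) simp
  also have "\<dots> \<le> (\<integral>\<^sup>+\<omega>. 1 \<partial>M)"
    by (rule nn_integral_mono) (simp add: hit_weight_bounds[OF q])
  finally show "emeasure (hit_law q B s) (space (hit_law q B s)) \<noteq> \<infinity>" by (auto simp: emeasure_space_1 top_unique)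
qed

lemma char_hit_law:
  assumes B: "open B" and s: "0 \<le> s" and q: "0 \<le> q"
  shows "(CLINT x|hit_law q B s. iexp (\<theta> * x)) =
    (CLINT \<omega>|M. complex_of_real (hit_weight q B \<omega>) * iexp (\<theta> * X (real_of_ereal (hitting_time B \<omega>) + s) \<omega>))"
proof -
  note [measurable] = borel_measurable_hit_weight[OF B, of q] borel_measurable_X_hitting_time[OF B s]
  show ?thesis unfolding hit_law_def
    by (simp add: integral_distr integral_density hit_weight_bounds[OF q] scaleR_conv_of_real)
qed

text \<open>Convolution multiplies characteristic functions, so this is
  \<open>strong_markov_iexp\<close> read through uniqueness. One fixed \<open>s\<close> at a time
  suffices, because potentials are time integrals of one-dimensional laws.\<close>

lemma strong_markov:
  assumes B: "open B" and s: "0 \<le> s" and q: "0 \<le> q"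
  shows "hit_law q B s = convolution (hit_law q B 0) (distr M borel (X s))"
proof (rule finite_measure_eq_if_char_eq)
  have [measurable]: "X s \<in> borel_measurable M" using s by (rule rv)
  interpret H: finite_measure "hit_law q B 0" by (rule finite_measure_hit_law[OF B order.refl q])
  interpret D: prob_space "distr M borel (X s)" by (rule prob_space_distr) simp
  interpret HD: pair_sigma_finite "hit_law q B 0" "distr M borel (X s)" ..
  show "finite_measure (hit_law q B s)" by (rule finite_measure_hit_law[OF B s q])
  show "finite_measure (convolution (hit_law q B 0) (distr M borel (X s)))"
    by (rule convolution_finite) (auto intro: H.finite_measure_axioms D.finite_measure_axioms)
  fix \<theta>
  have "(CLINT x|convolution (hit_law q B 0) (distr M borel (X s)). iexp (\<theta> * x))
     = (CLINT p|hit_law q B 0 \<Otimes>\<^sub>M distr M borel (X s). iexp (\<theta> * (fst p + snd p)))"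
    unfolding convolution_def by (subst integral_distr) (auto simp: case_prod_beta')
  also have "\<dots> = (CLINT p|hit_law q B 0 \<Otimes>\<^sub>M distr M borel (X s). iexp (\<theta> * fst p) * iexp (\<theta> * snd p))"
    by (simp add: distrib_left exp_add)
  also have "\<dots> = (CLINT u|hit_law q B 0. (CLINT v|distr M borel (X s). iexp (\<theta> * u) * iexp (\<theta> * v)))"
  proof (subst HD.integral_fst)
    interpret P: finite_measure "hit_law q B 0 \<Otimes>\<^sub>M distr M borel (X s)"
      by (rule finite_measure_pair_measure) (auto intro: H.finite_measure_axioms D.finite_measure_axioms)
    show "integrable (hit_law q B 0 \<Otimes>\<^sub>M distr M borel (X s)) (\<lambda>(u, v). iexp (\<theta> * u) * iexp (\<theta> * v))"
      by (rule P.integrable_const_bound[where B=1]) (auto simp: norm_mult case_prod_beta')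
  qed (simp add: case_prod_beta')
  also have "\<dots> = (CLINT u|hit_law q B 0. iexp (\<theta> * u)) * (CLINT v|distr M borel (X s). iexp (\<theta> * v))"
    by simp
  also have "(CLINT v|distr M borel (X s). iexp (\<theta> * v)) = exp (- complex_of_real s * \<Psi> \<theta>)"
    using expectation_iexp[OF s, of \<theta>] by (simp add: integral_distr)
  finally have "(CLINT x|convolution (hit_law q B 0) (distr M borel (X s)). iexp (\<theta> * x))
      = (CLINT u|hit_law q B 0. iexp (\<theta> * u)) * exp (- complex_of_real s * \<Psi> \<theta>)" .
  then show "(CLINT x|hit_law q B s. iexp (\<theta> * x)) = (CLINT x|convolution (hit_law q B 0) (distr M borel (X s)). iexp (\<theta> * x))"
    by (simp only: char_hit_law[OF B s q] char_hit_law[OF B order.refl q] strong_markov_iexp[OF B s q] add_0_right)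
qed (simp_all add: convolution_def)

section \<open>Potentials and their decomposition at the hitting time\<close>

definition potential :: "real \<Rightarrow> (real \<Rightarrow> ennreal) \<Rightarrow> real \<Rightarrow> ennreal" where
  "potential q f y = (\<integral>\<^sup>+\<omega>. (\<integral>\<^sup>+t\<in>{0..}. ennreal (exp (- q * t)) * f (y + X (max 0 t) \<omega>) \<partial>lborel) \<partial>M)"

text \<open>The path starts at zero, so a start at \<open>x\<close> is expressed by translating both
  the set and the function.\<close>

definition killed_potential :: "real \<Rightarrow> real set \<Rightarrow> (real \<Rightarrow> ennreal) \<Rightarrow> ennreal" where
  "killed_potential q B f = (\<integral>\<^sup>+\<omega>. (\<integral>\<^sup>+t. indicator {t. 0 \<le> t \<and> ereal t < hitting_time B \<omega>} t * (ennreal (exp (- q * t)) * f (X (max 0 t) \<omega>)) \<partial>lborel) \<partial>M)"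

text \<open>Split the time integral at the hitting time. The later part is shifted by that time, and
  after an exchange of integrals the strong Markov property is applied for each fixed delay
  \<open>r\<close>.\<close>

lemma potential_hit_decomposition:
  assumes B: "open B" and q: "0 \<le> q" and f [measurable]: "f \<in> borel_measurable borel"
  shows "potential q f 0 = killed_potential q B f + (\<integral>\<^sup>+u. potential q f u \<partial>hit_law q B 0)"
proof -
  note [measurable] = borel_measurable_hitting_time[OF B] borel_measurable_hit_weight[OF B, of q]
  interpret MB: pair_sigma_finite M "lborel :: real measure" ..
  interpret H: finite_measure "hit_law q B 0" by (rule finite_measure_hit_law[OF B order.refl q])
  interpret HM: pair_sigma_finite "hit_law q B 0" M ..
  interpret HL: pair_sigma_finite "hit_law q B 0" "lborel :: real measure" ..
  define T where "T = (\<lambda>\<omega>. real_of_ereal (hitting_time B \<omega>))"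
  have T0: "0 \<le> T \<omega>" for \<omega> unfolding T_def by (rule real_of_ereal_pos[OF hitting_time_nonneg])
  have [measurable]: "T \<in> borel_measurable M" unfolding T_def by measurable
  let ?K = "\<lambda>\<omega>. \<integral>\<^sup>+t. indicator {t. 0 \<le> t \<and> ereal t < hitting_time B \<omega>} t * (ennreal (exp (- q * t)) * f (X (max 0 t) \<omega>)) \<partial>lborel"
  let ?R = "\<lambda>\<omega>. \<integral>\<^sup>+r\<in>{0..}. ennreal (exp (- q * r)) * f (X (max 0 (T \<omega> + r)) \<omega>) \<partial>lborel"
  have pathwise: "(\<integral>\<^sup>+t\<in>{0..}. ennreal (exp (- q * t)) * f (0 + X (max 0 t) \<omega>) \<partial>lborel) = ?K \<omega> + ennreal (hit_weight q B \<omega>) * ?R \<omega>"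
    if w: "\<omega> \<in> space M" for \<omega>
  proof -
    have [measurable]: "(\<lambda>t. X (max 0 t) \<omega>) \<in> borel_measurable borel"
      using w by (intro measurable_X_raw) auto
    let ?h = "\<lambda>t. ennreal (exp (- q * t)) * f (X (max 0 t) \<omega>)"
    have "(\<integral>\<^sup>+t\<in>{0..}. ?h t \<partial>lborel) = (\<integral>\<^sup>+t. indicator {t. 0 \<le> t \<and> ereal t < hitting_time B \<omega>} t * ?h t
        + indicator {t. 0 \<le> t \<and> hitting_time B \<omega> \<le> ereal t} t * ?h t \<partial>lborel)"
      by (intro nn_integral_cong) (auto simp: indicator_def)
    also have "\<dots> = ?K \<omega> + (\<integral>\<^sup>+t. indicator {t. 0 \<le> t \<and> hitting_time B \<omega> \<le> ereal t} t * ?h t \<partial>lborel)"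
      by (rule nn_integral_add) measurable
    also have "(\<integral>\<^sup>+t. indicator {t. 0 \<le> t \<and> hitting_time B \<omega> \<le> ereal t} t * ?h t \<partial>lborel) = ennreal (hit_weight q B \<omega>) * ?R \<omega>"
    proof (cases "hitting_time B \<omega> < \<infinity>")
      \<comment> \<open>On paths that never hit, the region of integration is empty and
        \<open>hit_weight\<close> is zero.\<close>
      case False
      then show ?thesis by (simp add: hit_weight_def)
    next
      case True
      then have t: "hitting_time B \<omega> = ereal (T \<omega>)"
        using hitting_time_nonneg[of B \<omega>] unfolding T_def by (cases "hitting_time B \<omega>") auto
      have "(\<integral>\<^sup>+t. indicator {t. 0 \<le> t \<and> hitting_time B \<omega> \<le> ereal t} t * ?h t \<partial>lborel)
         = (\<integral>\<^sup>+t. indicator {T \<omega>..} t * ?h t \<partial>lborel)"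
        using T0[of \<omega>] t by (intro nn_integral_cong) (auto simp: indicator_def)
      also have "\<dots> = (\<integral>\<^sup>+r. indicator {T \<omega>..} (T \<omega> + 1 * r) * ?h (T \<omega> + 1 * r) \<partial>lborel)"
        by (subst nn_integral_real_affine[where c=1 and t="T \<omega>"]) auto
      also have "\<dots> = (\<integral>\<^sup>+r. ennreal (hit_weight q B \<omega>) * (ennreal (exp (- q * r)) * f (X (max 0 (T \<omega> + r)) \<omega>) * indicator {0..} r) \<partial>lborel)"
      proof (rule nn_integral_cong)
        fix r :: real
        have "exp (- q * (T \<omega> + r)) = hit_weight q B \<omega> * exp (- q * r)"
          using True by (simp add: hit_weight_def T_def right_diff_distrib distrib_left exp_add[symmetric])
        then have ex: "ennreal (exp (- q * (T \<omega> + r))) = ennreal (hit_weight q B \<omega>) * ennreal (exp (- q * r))"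
          by (simp only: ennreal_mult'[OF hit_weight_bounds(1)[OF q]])
        show "indicator {T \<omega>..} (T \<omega> + 1 * r) * ?h (T \<omega> + 1 * r)
          = ennreal (hit_weight q B \<omega>) * (ennreal (exp (- q * r)) * f (X (max 0 (T \<omega> + r)) \<omega>) * indicator {0..} r)"
          unfolding mult_1 ex by (cases "0 \<le> r") (simp_all add: mult.assoc)
      qed
      also have "\<dots> = ennreal (hit_weight q B \<omega>) * ?R \<omega>"
        by (rule nn_integral_cmult) measurable
      finally show ?thesis .
    qed
    finally show ?thesis by simp
  qed
  have "potential q f 0 = (\<integral>\<^sup>+\<omega>. ?K \<omega> + ennreal (hit_weight q B \<omega>) * ?R \<omega> \<partial>M)"
    unfolding potential_def using pathwise by (rule nn_integral_cong)
  also have "\<dots> = killed_potential q B f + (\<integral>\<^sup>+\<omega>. ennreal (hit_weight q B \<omega>) * ?R \<omega> \<partial>M)"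
    unfolding killed_potential_def by (rule nn_integral_add) measurable
  also have "(\<integral>\<^sup>+\<omega>. ennreal (hit_weight q B \<omega>) * ?R \<omega> \<partial>M)
     = (\<integral>\<^sup>+\<omega>. (\<integral>\<^sup>+r. ennreal (exp (- q * r)) * indicator {0..} r * (ennreal (hit_weight q B \<omega>) * f (X (max 0 (T \<omega> + r)) \<omega>)) \<partial>lborel) \<partial>M)"
    by (intro nn_integral_cong, subst nn_integral_cmult[symmetric]) (auto intro!: measurable_X_raw nn_integral_cong simp: mult_ac)
  also have "\<dots> = (\<integral>\<^sup>+r. (\<integral>\<^sup>+\<omega>. ennreal (exp (- q * r)) * indicator {0..} r * (ennreal (hit_weight q B \<omega>) * f (X (max 0 (T \<omega> + r)) \<omega>)) \<partial>M) \<partial>lborel)"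
    by (rule MB.Fubini'[symmetric]) measurable
  also have "\<dots> = (\<integral>\<^sup>+r. ennreal (exp (- q * r)) * indicator {0..} r * (\<integral>\<^sup>+u. (\<integral>\<^sup>+\<omega>. f (u + X (max 0 r) \<omega>) \<partial>M) \<partial>hit_law q B 0) \<partial>lborel)"
  proof (rule nn_integral_cong)
    fix r :: real
    show "(\<integral>\<^sup>+\<omega>. ennreal (exp (- q * r)) * indicator {0..} r * (ennreal (hit_weight q B \<omega>) * f (X (max 0 (T \<omega> + r)) \<omega>)) \<partial>M)
      = ennreal (exp (- q * r)) * indicator {0..} r * (\<integral>\<^sup>+u. (\<integral>\<^sup>+\<omega>. f (u + X (max 0 r) \<omega>) \<partial>M) \<partial>hit_law q B 0)"
    proof (cases "0 \<le> r")
      case True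
      have [measurable]: "X r \<in> borel_measurable M" using True by (rule rv)
      interpret D: prob_space "distr M borel (X r)" by (rule prob_space_distr) simp
      have "(\<integral>\<^sup>+\<omega>. ennreal (hit_weight q B \<omega>) * f (X (max 0 (T \<omega> + r)) \<omega>) \<partial>M) = (\<integral>\<^sup>+x. f x \<partial>hit_law q B r)"
        using True T0 by (subst nn_integral_hit_law[OF B True f]) (auto simp: T_def max_def intro!: nn_integral_cong)
      also have "\<dots> = (\<integral>\<^sup>+u. (\<integral>\<^sup>+v. f (u + v) \<partial>distr M borel (X r)) \<partial>hit_law q B 0)"
        unfolding strong_markov[OF B True q]
        by (rule nn_integral_convolution) (auto intro: H.finite_measure_axioms D.finite_measure_axioms)
      also have "\<dots> = (\<integral>\<^sup>+u. (\<integral>\<^sup>+\<omega>. f (u + X (max 0 r) \<omega>) \<partial>M) \<partial>hit_law q B 0)"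
        using True by (simp add: nn_integral_distr max_def)
      finally show ?thesis by (subst nn_integral_cmult) (auto intro!: measurable_X_raw)
    qed simp
  qed
  also have "\<dots> = (\<integral>\<^sup>+r. (\<integral>\<^sup>+u. ennreal (exp (- q * r)) * indicator {0..} r * (\<integral>\<^sup>+\<omega>. f (u + X (max 0 r) \<omega>) \<partial>M) \<partial>hit_law q B 0) \<partial>lborel)"
    by (intro nn_integral_cong nn_integral_cmult[symmetric]) measurable
  also have "\<dots> = (\<integral>\<^sup>+u. (\<integral>\<^sup>+r. ennreal (exp (- q * r)) * indicator {0..} r * (\<integral>\<^sup>+\<omega>. f (u + X (max 0 r) \<omega>) \<partial>M) \<partial>lborel) \<partial>hit_law q B 0)"
    by (rule HL.Fubini') measurable
  also have "\<dots> = (\<integral>\<^sup>+u. (\<integral>\<^sup>+r. (\<integral>\<^sup>+\<omega>. ennreal (exp (- q * r)) * f (u + X (max 0 r) \<omega>) * indicator {0..} r \<partial>M) \<partial>lborel) \<partial>hit_law q B 0)"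
  proof (intro nn_integral_cong)
    fix u r :: real
    have "(\<integral>\<^sup>+\<omega>. ennreal (exp (- q * r)) * f (u + X (max 0 r) \<omega>) * indicator {0..} r \<partial>M)
      = (\<integral>\<^sup>+\<omega>. ennreal (exp (- q * r)) * indicator {0..} r * f (u + X (max 0 r) \<omega>) \<partial>M)" by (simp add: mult_ac)
    also have "\<dots> = ennreal (exp (- q * r)) * indicator {0..} r * (\<integral>\<^sup>+\<omega>. f (u + X (max 0 r) \<omega>) \<partial>M)"
      by (rule nn_integral_cmult) measurable
    finally show "ennreal (exp (- q * r)) * indicator {0..} r * (\<integral>\<^sup>+\<omega>. f (u + X (max 0 r) \<omega>) \<partial>M)
      = (\<integral>\<^sup>+\<omega>. ennreal (exp (- q * r)) * f (u + X (max 0 r) \<omega>) * indicator {0..} r \<partial>M)" by simp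
  qed
  also have "\<dots> = (\<integral>\<^sup>+u. potential q f u \<partial>hit_law q B 0)"
    unfolding potential_def by (intro nn_integral_cong MB.Fubini') measurable
  finally show ?thesis .
qed

text \<open>The hitting time is an infimum of times spent in the set, so by right-continuity there
  are points of the set arbitrarily close to the position at that time.\<close>

lemma emeasure_hit_law_closure:
  assumes B: "open B" and q: "0 \<le> q"
  shows "AE u in hit_law q B 0. u \<in> closure B"
proof -
  note [measurable] = borel_measurable_hit_weight[OF B, of q] borel_measurable_X_hitting_time[OF B order.refl]
    borel_measurable_X_hitting_time[OF B order.refl, unfolded add_0_right]
  have "X (real_of_ereal (hitting_time B \<omega>) + 0) \<omega> \<in> closure B" if w: "\<omega> \<in> space M" and h: "0 < hit_weight q B \<omega>" for \<omega>
  proof -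
    have "hitting_time B \<omega> < \<infinity>" using h by (auto simp: hit_weight_def split: if_splits)
    then obtain t where t: "hitting_time B \<omega> = ereal t" "0 \<le> t"
      using hitting_time_nonneg[of B \<omega>] by (cases "hitting_time B \<omega>") auto
    have "X t \<omega> \<in> closure B"
      unfolding closure_approachable
    proof (intro allI impI)
      fix e :: real assume "0 < e"
      from tendsto_at_right_closed[where g="\<lambda>u. X u \<omega>", OF right_cont[OF w t(2)] this] obtain d where
        d: "0 < d" "\<forall>r. t \<le> r \<longrightarrow> r < t + d \<longrightarrow> dist (X r \<omega>) (X t \<omega>) < e" by (elim exE conjE)
      have "hitting_time B \<omega> < ereal (t + d)" using t d by simp
      then obtain u where u: "0 < u" "X u \<omega> \<in> B" "u < t + d"
        unfolding hitting_time_def by (auto simp: Inf_less_iff)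
      have "t \<le> u" using hitting_time_le[OF u(1,2)] t by simp
      then show "\<exists>y\<in>B. dist y (X t \<omega>) < e" using d(2) u by blast
    qed
    then show ?thesis using t by simp
  qed
  moreover have "closure B \<in> sets borel" by simp
  ultimately show ?thesis
    unfolding hit_law_def by (subst AE_distr_iff) (auto simp: AE_density)
qed

lemma emeasure_hit_law_UNIV:
  assumes B: "open B"
  shows "emeasure (hit_law q B 0) UNIV = (\<integral>\<^sup>+\<omega>. ennreal (hit_weight q B \<omega>) \<partial>M)"
  using nn_integral_hit_law[OF B order.refl, of "\<lambda>_. 1" q] by (simp add: sets_eq_imp_space_eq[OF sets_hit_law])

lemma killed_potential_eq_0:
  assumes "\<And>z. z \<notin> B \<Longrightarrow> f z = 0"
  shows "killed_potential q B f = 0"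
proof -
  have "(\<integral>\<^sup>+t. indicator {t. 0 \<le> t \<and> ereal t < hitting_time B \<omega>} t * (ennreal (exp (- q * t)) * f (X (max 0 t) \<omega>)) \<partial>lborel) = 0" for \<omega>
  proof -
    \<comment> \<open>At time zero the path may lie in the set, since only positive times count for
      \<open>hitting_time\<close>; this single time is negligible.\<close>
    have "AE t in lborel. t \<noteq> (0::real)" by (rule AE_lborel_singleton)
    then have "AE t in lborel. indicator {t. 0 \<le> t \<and> ereal t < hitting_time B \<omega>} t * (ennreal (exp (- q * t)) * f (X (max 0 t) \<omega>)) = 0"
    proof eventually_elim
      case (elim t)
      then show ?case using assms not_in_before_hitting_time[of t B \<omega>] by (auto simp: indicator_def max_def)
    qed
    then have "(\<integral>\<^sup>+t. indicator {t. 0 \<le> t \<and> ereal t < hitting_time B \<omega>} t * (ennreal (exp (- q * t)) * f (X (max 0 t) \<omega>)) \<partial>lborel) = (\<integral>\<^sup>+(t::real). 0 \<partial>lborel)"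
      by (rule nn_integral_cong_AE)
    then show ?thesis by simp
  qed
  then show ?thesis unfolding killed_potential_def by simp
qed

end

section \<open>Densities of potential measures\<close>

lemma (in pair_sigma_finite) Fubini_integral_bounded:
  fixes f :: "'a \<Rightarrow> 'b \<Rightarrow> 'c :: {banach, second_countable_topology}"
  assumes f [measurable]: "case_prod f \<in> borel_measurable (M1 \<Otimes>\<^sub>M M2)"
    and fin: "(\<integral>\<^sup>+x. (\<integral>\<^sup>+y. ennreal (norm (f x y)) \<partial>M2) \<partial>M1) < \<infinity>"
  shows "integrable (M1 \<Otimes>\<^sub>M M2) (case_prod f)"
    and "(\<integral>x. (\<integral>y. f x y \<partial>M2) \<partial>M1) = (\<integral>y. (\<integral>x. f x y \<partial>M1) \<partial>M2)"
    and "(\<integral>p. case_prod f p \<partial>(M1 \<Otimes>\<^sub>M M2)) = (\<integral>x. (\<integral>y. f x y \<partial>M2) \<partial>M1)"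
proof -
  show int: "integrable (M1 \<Otimes>\<^sub>M M2) (case_prod f)"
  proof (rule integrableI_bounded)
    have "(\<integral>\<^sup>+p. ennreal (norm (case_prod f p)) \<partial>(M1 \<Otimes>\<^sub>M M2)) = (\<integral>\<^sup>+x. (\<integral>\<^sup>+y. ennreal (norm (f x y)) \<partial>M2) \<partial>M1)"
      by (subst M2.nn_integral_fst[symmetric]) simp_all
    then show "(\<integral>\<^sup>+p. ennreal (norm (case_prod f p)) \<partial>(M1 \<Otimes>\<^sub>M M2)) < \<infinity>" using fin by simp
  qed simp
  show "(\<integral>x. (\<integral>y. f x y \<partial>M2) \<partial>M1) = (\<integral>y. (\<integral>x. f x y \<partial>M1) \<partial>M2)"
    by (rule Fubini_integral[OF int, symmetric])
  show "(\<integral>p. case_prod f p \<partial>(M1 \<Otimes>\<^sub>M M2)) = (\<integral>x. (\<integral>y. f x y \<partial>M2) \<partial>M1)"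
    by (rule integral_fst[OF int, symmetric])
qed

lemma nn_integral_exp_halfline:
  assumes "0 < (u::real)"
  shows "(\<integral>\<^sup>+s\<in>{0<..}. ennreal (exp (- (u * s))) \<partial>lborel) = ennreal (1 / u)"
proof -
  have "(\<integral>\<^sup>+s\<in>{0<..}. ennreal (exp (- (u * s))) \<partial>lborel) = (\<integral>\<^sup>+s. ennreal (indicator {0<..} s *\<^sub>R exp (- (s * u))) \<partial>lborel)"
    by (intro nn_integral_cong) (auto simp: indicator_def mult.commute)
  also have "\<dots> = ennreal (\<integral>s. indicator {0<..} s *\<^sub>R exp (- (s * u)) \<partial>lborel)"
    using integrable_I0i_exp_mscale[OF assms] by (intro nn_integral_eq_integral) (auto simp: set_integrable_def)
  also have "(\<integral>s. indicator {0<..} s *\<^sub>R exp (- (s * u)) \<partial>lborel) = 1 / u"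
    using LBINT_I0i_exp_mscale[OF assms] by (simp add: interval_lebesgue_integral_0_infty set_lebesgue_integral_def)
  finally show ?thesis .
qed

lemma exp_halfline_complex:
  fixes z :: complex
  assumes z: "0 < Re z"
  shows "integrable lborel (\<lambda>s. indicator {0<..} s *\<^sub>R exp (- (z * complex_of_real s)))"
    and "(\<integral>s. indicator {0<..} s *\<^sub>R exp (- (z * complex_of_real s)) \<partial>lborel) = 1 / z"
proof -
  show int: "integrable lborel (\<lambda>s. indicator {0<..} s *\<^sub>R exp (- (z * complex_of_real s)))"
    using integrable_I0i_exp_mscale[OF z] unfolding set_integrable_def
    by (rule Bochner_Integration.integrable_bound) (auto simp: indicator_def mult.commute)
  have z0: "z \<noteq> 0" using z by auto
  have "(LBINT s=0..\<infinity>. exp (- (z * complex_of_real s))) = 0 - (- 1 / z)"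
  proof (rule interval_integral_FTC_integrable)
    show "((\<lambda>s. - exp (- (z * complex_of_real s)) / z) has_vector_derivative exp (- (z * complex_of_real x))) (at x)" for x
    proof -
      have "((\<lambda>w. - exp (- (z * w)) / z) has_field_derivative exp (- (z * w))) (at w)" for w
        using z0 by (auto intro!: derivative_eq_intros)
      from field_vector_diff_chain_at[OF has_vector_derivative_of_real[OF DERIV_ident] this[of "complex_of_real x"], simplified]
      show ?thesis by (simp add: o_def)
    qed
    show "set_integrable lborel (einterval 0 \<infinity>) (\<lambda>s. exp (- (z * complex_of_real s)))"
      using int by (simp add: set_integrable_def einterval_def zero_ereal_def greaterThan_def)
    have "isCont (\<lambda>s. - exp (- (z * complex_of_real s)) / z) 0" using z0 by (intro continuous_intros) auto
    then have "((\<lambda>s. - exp (- (z * complex_of_real s)) / z) \<longlongrightarrow> - 1 / z) (at_right 0)"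
      by (auto simp: isCont_def intro: tendsto_mono[OF at_le])
    then show "(((\<lambda>s. - exp (- (z * complex_of_real s)) / z) \<circ> real_of_ereal) \<longlongrightarrow> - 1 / z) (at_right 0)"
      by (simp add: zero_ereal_def ereal_tendsto_simps)
    have "((\<lambda>s. exp (- (Re z * s)) / norm z) \<longlongrightarrow> 0 / norm z) at_top"
      using z by (intro tendsto_divide tendsto_const filterlim_compose[OF exp_at_bot]) (auto intro!: filterlim_tendsto_pos_mult_at_top simp: filterlim_uminus_at_bot filterlim_ident)
    then have "((\<lambda>s. - exp (- (z * complex_of_real s)) / z) \<longlongrightarrow> 0) at_top"
      by (intro tendsto_norm_zero_cancel[of "\<lambda>s. - exp (- (z * complex_of_real s)) / z"]) (simp add: norm_divide)
    then show "(((\<lambda>s. - exp (- (z * complex_of_real s)) / z) \<circ> real_of_ereal) \<longlongrightarrow> 0) (at_left \<infinity>)"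
      by (simp add: ereal_tendsto_simps)
  qed (auto intro!: continuous_intros)
  then show "(\<integral>s. indicator {0<..} s *\<^sub>R exp (- (z * complex_of_real s)) \<partial>lborel) = 1 / z"
    by (simp add: interval_lebesgue_integral_0_infty set_lebesgue_integral_def)
qed

definition laplace_kernel :: "(real \<Rightarrow> real) \<Rightarrow> (real \<Rightarrow> real) \<Rightarrow> real \<Rightarrow> ennreal" where
  "laplace_kernel mp mm w = (\<integral>\<^sup>+l\<in>{0<..}. ennreal (exp (- (l * \<bar>w\<bar>)) * (if 0 < w then mp l else mm l)) \<partial>lborel)"

abbreviation gauss :: "real \<Rightarrow> real" where "gauss w \<equiv> exp (- (w\<^sup>2) / 2)"

text \<open>Damping by a Gaussian in space amounts to averaging the frequency over a standard normal
  law. All transforms of damped measures below are computed through this.\<close>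

lemma gauss_eq_integral: "complex_of_real (gauss w) = (CLINT \<theta>|std_normal_distribution. iexp (w * \<theta>))"
  using fun_cong[OF char_std_normal_distribution, of w] by (simp add: char_def)

text \<open>Near the singularity the normal density is at most one and the power is integrable
  because \<open>\<gamma> < 1\<close>; elsewhere the power is at most one. It controls the
  singularity of the reciprocal exponent at frequency zero.\<close>

lemma nn_integral_normal_powr:
  assumes g: "0 \<le> \<gamma>" "\<gamma> < 1"
  shows "(\<integral>\<^sup>+\<theta>. ennreal (\<bar>\<eta> + \<theta>\<bar> powr (-\<gamma>)) \<partial>std_normal_distribution) < \<infinity>"
proof -
  have n1: "std_normal_density \<theta> \<le> 1" for \<theta>
  proof -
    have "1 \<le> sqrt (2 * pi)" using pi_gt3 by (simp add: real_le_rsqrt)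
    then have "1 / sqrt (2 * pi) * exp (- \<theta>\<^sup>2 / 2) \<le> 1 * 1" by (intro mult_mono) auto
    then show ?thesis by (simp add: std_normal_density_def)
  qed
  have b1: "(\<integral>\<^sup>+u\<in>{0..1}. ennreal (u powr (-\<gamma>)) \<partial>lborel) = ennreal (Beta (1-\<gamma>) 1)"
  proof -
    have "(\<integral>\<^sup>+u\<in>{0..1}. ennreal (u powr (1-\<gamma>-1) * (1-u) powr (1-1)) \<partial>lborel) = ennreal (Beta (1-\<gamma>) 1)"
      by (rule nn_integral_has_integral_lebesgue'[OF _ has_integral_Beta_real]) (use g in auto)
    moreover have "(\<integral>\<^sup>+u\<in>{0..1}. ennreal (u powr (-\<gamma>)) \<partial>lborel) = (\<integral>\<^sup>+u\<in>{0..1}. ennreal (u powr (1-\<gamma>-1) * (1-u) powr (1-1)) \<partial>lborel)"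
    proof (rule nn_integral_cong_AE)
      have "AE u in lborel. u \<noteq> (1::real)" by (rule AE_lborel_singleton)
      then show "AE u in lborel. ennreal (u powr (-\<gamma>)) * indicator {0..1} u = ennreal (u powr (1-\<gamma>-1) * (1-u) powr (1-1)) * indicator {0..1} u"
        by eventually_elim auto
    qed
    ultimately show ?thesis by simp
  qed
  have b2: "(\<integral>\<^sup>+u\<in>{-1..0}. ennreal (\<bar>u\<bar> powr (-\<gamma>)) \<partial>lborel) = ennreal (Beta (1-\<gamma>) 1)"
  proof -
    have "(\<integral>\<^sup>+u\<in>{-1..0}. ennreal (\<bar>u\<bar> powr (-\<gamma>)) \<partial>lborel) = (\<integral>\<^sup>+u. ennreal (\<bar>0 + (-1) * u\<bar> powr (-\<gamma>)) * indicator {-1..0} (0 + (-1) * u) \<partial>lborel)"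
      by (subst nn_integral_real_affine[where c="-1" and t=0]) auto
    also have "\<dots> = (\<integral>\<^sup>+u\<in>{0..1}. ennreal (u powr (-\<gamma>)) \<partial>lborel)"
      by (intro nn_integral_cong) (auto simp: indicator_def)
    finally show ?thesis using b1 by simp
  qed
  have "(\<integral>\<^sup>+\<theta>. ennreal (\<bar>\<eta> + \<theta>\<bar> powr (-\<gamma>)) \<partial>std_normal_distribution)
      = (\<integral>\<^sup>+\<theta>. ennreal (std_normal_density \<theta>) * ennreal (\<bar>\<eta> + \<theta>\<bar> powr (-\<gamma>)) \<partial>lborel)"
    by (subst nn_integral_density) auto
  also have "\<dots> \<le> (\<integral>\<^sup>+\<theta>. ennreal (\<bar>\<eta> + \<theta>\<bar> powr (-\<gamma>)) * indicator {-1..1} (\<eta> + \<theta>) + ennreal (std_normal_density \<theta>) \<partial>lborel)"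
  proof (rule nn_integral_mono)
    fix \<theta> :: real
    show "ennreal (std_normal_density \<theta>) * ennreal (\<bar>\<eta> + \<theta>\<bar> powr (-\<gamma>))
        \<le> ennreal (\<bar>\<eta> + \<theta>\<bar> powr (-\<gamma>)) * indicator {-1..1} (\<eta> + \<theta>) + ennreal (std_normal_density \<theta>)"
    proof (cases "\<eta> + \<theta> \<in> {-1..1}")
      case True
      have "std_normal_density \<theta> * \<bar>\<eta> + \<theta>\<bar> powr (-\<gamma>) \<le> 1 * \<bar>\<eta> + \<theta>\<bar> powr (-\<gamma>)"
        using n1 by (intro mult_right_mono) auto
      then have "ennreal (std_normal_density \<theta>) * ennreal (\<bar>\<eta> + \<theta>\<bar> powr (-\<gamma>)) \<le> ennreal (\<bar>\<eta> + \<theta>\<bar> powr (-\<gamma>))"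
        by (simp add: ennreal_mult'[symmetric] ennreal_leI)
      then show ?thesis using True by (simp add: add_increasing2)
    next
      case False
      then have "\<bar>\<eta> + \<theta>\<bar> powr (-\<gamma>) \<le> 1 powr (-\<gamma>)" using g by (intro powr_mono2') auto
      then have "std_normal_density \<theta> * \<bar>\<eta> + \<theta>\<bar> powr (-\<gamma>) \<le> std_normal_density \<theta> * 1" by (intro mult_left_mono) auto
      then show ?thesis using False by (simp add: ennreal_mult'[symmetric] ennreal_leI)
    qed
  qed
  also have "\<dots> = (\<integral>\<^sup>+\<theta>. ennreal (\<bar>\<eta> + 1 * \<theta>\<bar> powr (-\<gamma>)) * indicator {-1..1} (\<eta> + 1 * \<theta>) \<partial>lborel) + (\<integral>\<^sup>+\<theta>. ennreal (std_normal_density \<theta>) \<partial>lborel)"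
    by (subst nn_integral_add) auto
  also have "(\<integral>\<^sup>+\<theta>. ennreal (\<bar>\<eta> + 1 * \<theta>\<bar> powr (-\<gamma>)) * indicator {-1..1} (\<eta> + 1 * \<theta>) \<partial>lborel) = (\<integral>\<^sup>+u\<in>{-1..1}. ennreal (\<bar>u\<bar> powr (-\<gamma>)) \<partial>lborel)"
    by (subst nn_integral_real_affine[where c=1 and t=\<eta> and f="\<lambda>u. ennreal (\<bar>u\<bar> powr (-\<gamma>)) * indicator {-1..1} u"]) auto
  also have "\<dots> \<le> (\<integral>\<^sup>+u. ennreal (\<bar>u\<bar> powr (-\<gamma>)) * indicator {-1..0} u + ennreal (u powr (-\<gamma>)) * indicator {0..1} u \<partial>lborel)"
    by (intro nn_integral_mono) (auto simp: indicator_def)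
  also have "\<dots> = ennreal (Beta (1-\<gamma>) 1) + ennreal (Beta (1-\<gamma>) 1)"
    by (subst nn_integral_add) (auto simp: b1 b2)
  also have "(\<integral>\<^sup>+\<theta>. ennreal (std_normal_density \<theta>) \<partial>lborel) = 1"
    using prob_space.emeasure_space_1[OF prob_space_normal_density[of 1 0]] by (simp add: emeasure_density)
  finally show ?thesis by (auto simp: less_top[symmetric] top_unique)
qed

context levy_process begin

lemma expectation_gauss_iexp:
  assumes s: "0 \<le> s"
  shows "(CLINT \<omega>|M. complex_of_real (gauss (X s \<omega>)) * iexp (\<eta> * X s \<omega>)) = (CLINT \<theta>|std_normal_distribution. exp (- complex_of_real s * \<Psi> (\<eta> + \<theta>)))"
proof -
  have [measurable]: "X s \<in> borel_measurable M" using s by (rule rv)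
  interpret N: real_distribution std_normal_distribution by (rule real_dist_normal_dist)
  interpret MN: pair_prob_space M std_normal_distribution ..
  have "(CLINT \<omega>|M. complex_of_real (gauss (X s \<omega>)) * iexp (\<eta> * X s \<omega>)) = (CLINT \<omega>|M. (CLINT \<theta>|std_normal_distribution. iexp (X s \<omega> * \<theta>) * iexp (\<eta> * X s \<omega>)))"
    unfolding gauss_eq_integral by simp
  also have "\<dots> = (CLINT \<theta>|std_normal_distribution. (CLINT \<omega>|M. iexp (X s \<omega> * \<theta>) * iexp (\<eta> * X s \<omega>)))"
  proof (rule MN.Fubini_integral_bounded(2))
    show "(\<integral>\<^sup>+\<omega>. (\<integral>\<^sup>+\<theta>. ennreal (norm (iexp (X s \<omega> * \<theta>) * iexp (\<eta> * X s \<omega>))) \<partial>std_normal_distribution) \<partial>M) < \<infinity>"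
      using N.emeasure_space_1 by (simp add: norm_mult emeasure_space_1 del: of_real_mult)
  qed measurable
  also have "\<dots> = (CLINT \<theta>|std_normal_distribution. (CLINT \<omega>|M. iexp ((\<eta> + \<theta>) * X s \<omega>)))"
    by (simp add: exp_add[symmetric] algebra_simps)
  also have "\<dots> = (CLINT \<theta>|std_normal_distribution. exp (- complex_of_real s * \<Psi> (\<eta> + \<theta>)))"
    unfolding expectation_iexp[OF s] ..
  finally show ?thesis .
qed

end

lemma AE_std_normal_neq: "AE \<theta> in std_normal_distribution. \<eta> + \<theta> \<noteq> 0"
proof -
  have "AE \<theta> in lborel. \<theta> \<noteq> - \<eta>" by (rule AE_lborel_singleton)
  then show ?thesis by (subst AE_density) (auto elim!: eventually_mono)
qed

text \<open>In the non-integrable case the Bochner integral is zero by convention.\<close>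

lemma norm_integral_le_nn_integral:
  fixes f :: "'a \<Rightarrow> complex"
  shows "ennreal (norm (\<integral>x. f x \<partial>M)) \<le> (\<integral>\<^sup>+x. ennreal (norm (f x)) \<partial>M)"
proof (cases "integrable M f")
  case True then show ?thesis by (rule integral_norm_bound_ennreal)
next
  case False
  then have "(\<integral>x. f x \<partial>M) = 0" by (rule not_integrable_integral_eq)
  then show ?thesis by simp
qed

lemma laplace_kernel_fourier:
  fixes a b l \<xi> :: real
  assumes l: "0 < l"
  shows "integrable lborel (\<lambda>w. complex_of_real (exp (- (l * \<bar>w\<bar>)) * (if 0 < w then a else b)) * iexp (\<xi> * w))"
    and "(CLINT w|lborel. complex_of_real (exp (- (l * \<bar>w\<bar>)) * (if 0 < w then a else b)) * iexp (\<xi> * w))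
      = complex_of_real a / (complex_of_real l - \<i> * \<xi>) + complex_of_real b / (complex_of_real l + \<i> * \<xi>)"
proof -
  let ?P = "\<lambda>w. indicator {0<..} w *\<^sub>R exp (- ((complex_of_real l - \<i> * \<xi>) * complex_of_real w))"
  let ?N = "\<lambda>w. indicator {0<..} w *\<^sub>R exp (- ((complex_of_real l + \<i> * \<xi>) * complex_of_real w))"
  have P: "integrable lborel ?P" "(CLINT w|lborel. ?P w) = 1 / (complex_of_real l - \<i> * \<xi>)"
    using exp_halfline_complex[of "complex_of_real l - \<i> * \<xi>"] l by auto
  have N: "integrable lborel ?N" "(CLINT w|lborel. ?N w) = 1 / (complex_of_real l + \<i> * \<xi>)"
    using exp_halfline_complex[of "complex_of_real l + \<i> * \<xi>"] l by auto
  have N': "integrable lborel (\<lambda>w. ?N (0 + (-1) * w))" "(CLINT w|lborel. ?N (0 + (-1) * w)) = 1 / (complex_of_real l + \<i> * \<xi>)"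
    using lborel_integrable_real_affine[OF N(1), of "-1" 0] lborel_integral_real_affine[of "-1" ?N 0] N(2) by auto
  have AE: "AE w in lborel. complex_of_real a * ?P w + complex_of_real b * ?N (0 + (-1) * w)
     = complex_of_real (exp (- (l * \<bar>w\<bar>)) * (if 0 < w then a else b)) * iexp (\<xi> * w)"
    using AE_lborel_singleton[of "0::real"]
  proof eventually_elim
    case (elim w)
    have "iexp (\<xi> * w) * complex_of_real (exp (- (l * w))) = exp (- ((complex_of_real l - \<i> * \<xi>) * complex_of_real w))"
      "iexp (\<xi> * w) * complex_of_real (exp (l * w)) = exp ((complex_of_real l + \<i> * \<xi>) * complex_of_real w)"
      by (simp_all add: exp_of_real[symmetric] exp_add[symmetric] algebra_simps)
    then show ?case using elim by (cases "0 < w") (auto simp: indicator_def mult_ac)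
  qed
  have int: "integrable lborel (\<lambda>w. complex_of_real a * ?P w + complex_of_real b * ?N (0 + (-1) * w))"
    using P(1) N'(1) by (intro Bochner_Integration.integrable_add integrable_mult_right)
  show "integrable lborel (\<lambda>w. complex_of_real (exp (- (l * \<bar>w\<bar>)) * (if 0 < w then a else b)) * iexp (\<xi> * w))"
    by (rule integrable_cong_AE_imp[OF int _ AE]) measurable
  have "(CLINT w|lborel. complex_of_real (exp (- (l * \<bar>w\<bar>)) * (if 0 < w then a else b)) * iexp (\<xi> * w))
     = (CLINT w|lborel. complex_of_real a * ?P w + complex_of_real b * ?N (0 + (-1) * w))"
  proof (rule integral_cong_AE)
    show "AE w in lborel. complex_of_real (exp (- (l * \<bar>w\<bar>)) * (if 0 < w then a else b)) * iexp (\<xi> * w)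
      = complex_of_real a * ?P w + complex_of_real b * ?N (0 + (-1) * w)"
      using AE by eventually_elim (rule sym)
  qed measurable
  also have "\<dots> = complex_of_real a * (CLINT w|lborel. ?P w) + complex_of_real b * (CLINT w|lborel. ?N (0 + (-1) * w))"
    by (subst Bochner_Integration.integral_add, intro integrable_mult_right P(1), intro integrable_mult_right N'(1))
       (simp only: integral_mult_right_zero)
  finally show "(CLINT w|lborel. complex_of_real (exp (- (l * \<bar>w\<bar>)) * (if 0 < w then a else b)) * iexp (\<xi> * w))
      = complex_of_real a / (complex_of_real l - \<i> * \<xi>) + complex_of_real b / (complex_of_real l + \<i> * \<xi>)"
    unfolding P(2) N'(2) by simp
qed

lemma norm_laplace_fourier_le:
  assumes "0 \<le> a" "0 \<le> b"
  shows "norm (complex_of_real a / (complex_of_real l - \<i> * \<xi>) + complex_of_real b / (complex_of_real l + \<i> * \<xi>))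
    \<le> (a + b) / sqrt (l\<^sup>2 + \<xi>\<^sup>2)"
proof -
  have n: "norm (complex_of_real l - \<i> * complex_of_real \<xi>) = sqrt (l\<^sup>2 + \<xi>\<^sup>2)" "norm (complex_of_real l + \<i> * complex_of_real \<xi>) = sqrt (l\<^sup>2 + \<xi>\<^sup>2)"
    by (simp_all add: cmod_def)
  show ?thesis
    by (rule order_trans[OF norm_triangle_ineq]) (use assms in \<open>simp add: norm_divide n add_divide_distrib\<close>)
qed

text \<open>The bound reads the mass of a nonnegative function off its transform at zero. Without
  the Gaussian the mass is \<open>(a + b) / l\<close>, which may fail to be integrable against the
  mixing densities near zero; the averaged bound is milder for small \<open>l\<close>.\<close>

lemma gauss_laplace_fourier:
  fixes a b l \<eta> :: real
  assumes l: "0 < l" and ab: "0 \<le> a" "0 \<le> b"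
  shows "(CLINT w|lborel. complex_of_real (gauss w * (exp (- (l * \<bar>w\<bar>)) * (if 0 < w then a else b))) * iexp (\<eta> * w))
      = (CLINT \<theta>|std_normal_distribution. complex_of_real a / (complex_of_real l - \<i> * (\<eta> + \<theta>)) + complex_of_real b / (complex_of_real l + \<i> * (\<eta> + \<theta>)))"
    and "(\<integral>\<^sup>+w. ennreal (gauss w * (exp (- (l * \<bar>w\<bar>)) * (if 0 < w then a else b))) \<partial>lborel)
      \<le> (\<integral>\<^sup>+\<theta>. ennreal ((a + b) / sqrt (l\<^sup>2 + \<theta>\<^sup>2)) \<partial>std_normal_distribution)"
proof -
  interpret N: real_distribution std_normal_distribution by (rule real_dist_normal_dist)
  interpret LN: pair_sigma_finite "lborel :: real measure" std_normal_distribution ..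
  let ?e = "\<lambda>w. exp (- (l * \<bar>w\<bar>)) * (if 0 < w then a else b)"
  let ?F = "\<lambda>\<xi>::real. complex_of_real a / (complex_of_real l - \<i> * \<xi>) + complex_of_real b / (complex_of_real l + \<i> * \<xi>)"
  have e0: "0 \<le> ?e w" for w using ab by simp
  have einti: "integrable lborel (\<lambda>w. complex_of_real (?e w))"
    using laplace_kernel_fourier(1)[OF l, of a b 0] by simp
  show main: "(CLINT w|lborel. complex_of_real (gauss w * ?e w) * iexp (\<eta> * w)) = (CLINT \<theta>|std_normal_distribution. ?F (\<eta> + \<theta>))" for \<eta>
  proof -
    have "(CLINT w|lborel. complex_of_real (gauss w * ?e w) * iexp (\<eta> * w))
      = (CLINT w|lborel. (CLINT \<theta>|std_normal_distribution. iexp (w * \<theta>) * (complex_of_real (?e w) * iexp (\<eta> * w))))"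
      unfolding of_real_mult[of "gauss _"] gauss_eq_integral by (simp add: mult.assoc)
    also have "\<dots> = (CLINT \<theta>|std_normal_distribution. (CLINT w|lborel. iexp (w * \<theta>) * (complex_of_real (?e w) * iexp (\<eta> * w))))"
    proof (rule LN.Fubini_integral_bounded(2))
      have "(\<integral>\<^sup>+w. (\<integral>\<^sup>+\<theta>. ennreal (norm (iexp (w * \<theta>) * (complex_of_real (?e w) * iexp (\<eta> * w)))) \<partial>std_normal_distribution) \<partial>lborel)
         = (\<integral>\<^sup>+w. ennreal (norm (complex_of_real (?e w))) \<partial>lborel)"
        using N.emeasure_space_1 by (simp add: norm_mult del: of_real_mult)
      also have "\<dots> < \<infinity>" using einti by (simp add: integrable_iff_bounded)
      finally show "(\<integral>\<^sup>+w. (\<integral>\<^sup>+\<theta>. ennreal (norm (iexp (w * \<theta>) * (complex_of_real (?e w) * iexp (\<eta> * w)))) \<partial>std_normal_distribution) \<partial>lborel) < \<infinity>" .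
    qed measurable
    also have "\<dots> = (CLINT \<theta>|std_normal_distribution. (CLINT w|lborel. complex_of_real (?e w) * iexp ((\<eta> + \<theta>) * w)))"
      by (intro Bochner_Integration.integral_cong refl) (simp add: exp_add algebra_simps)
    also have "\<dots> = (CLINT \<theta>|std_normal_distribution. ?F (\<eta> + \<theta>))"
      unfolding laplace_kernel_fourier(2)[OF l] ..
    finally show ?thesis .
  qed
  have gint: "integrable lborel (\<lambda>w. gauss w * ?e w)"
  proof (rule Bochner_Integration.integrable_bound)
    show "integrable lborel (\<lambda>w. complex_of_real (?e w))" by (rule einti)
    show "AE w in lborel. norm (gauss w * ?e w) \<le> norm (complex_of_real (?e w))"
    proof (rule AE_I2)
      fix w
      have "gauss w * ?e w \<le> 1 * ?e w" by (rule mult_right_mono[OF _ e0]) simp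
      moreover have "0 \<le> gauss w * ?e w" by (rule mult_nonneg_nonneg[OF _ e0]) simp
      ultimately show "norm (gauss w * ?e w) \<le> norm (complex_of_real (?e w))"
        using e0[of w] by (simp only: norm_of_real real_norm_def abs_of_nonneg mult_1)
    qed
  qed measurable
  have "(\<integral>\<^sup>+w. ennreal (gauss w * ?e w) \<partial>lborel) = ennreal (\<integral>w. gauss w * ?e w \<partial>lborel)"
    using gint e0 by (intro nn_integral_eq_integral) auto
  also have "(\<integral>w. gauss w * ?e w \<partial>lborel) = norm (complex_of_real (\<integral>w. gauss w * ?e w \<partial>lborel))"
    using e0 by (simp add: integral_nonneg_AE)
  also have "complex_of_real (\<integral>w. gauss w * ?e w \<partial>lborel) = (CLINT w|lborel. complex_of_real (gauss w * ?e w) * iexp (0 * w))"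
    by (simp only: integral_complex_of_real[symmetric]) simp
  also have "\<dots> = (CLINT \<theta>|std_normal_distribution. ?F (0 + \<theta>))" by (rule main)
  also have "ennreal (norm \<dots>) \<le> (\<integral>\<^sup>+\<theta>. ennreal (norm (?F (0 + \<theta>))) \<partial>std_normal_distribution)"
    by (rule norm_integral_le_nn_integral)
  also have "\<dots> \<le> (\<integral>\<^sup>+\<theta>. ennreal ((a + b) / sqrt (l\<^sup>2 + \<theta>\<^sup>2)) \<partial>std_normal_distribution)"
    using norm_laplace_fourier_le[OF ab] by (intro nn_integral_mono ennreal_leI) simp
  finally show "(\<integral>\<^sup>+w. ennreal (gauss w * ?e w) \<partial>lborel) \<le> (\<integral>\<^sup>+\<theta>. ennreal ((a + b) / sqrt (l\<^sup>2 + \<theta>\<^sup>2)) \<partial>std_normal_distribution)" .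
qed

context levy_process begin

text \<open>The density of the resolvent measure is a mixture of two-sided exponentials. Both sides are damped by a
  Gaussian weight, which makes them finite measures, and compared through their characteristic functions.\<close>
theorem potential_eq_laplace_kernel:
  fixes q K \<gamma> :: real and mp mm :: "real \<Rightarrow> real"
  assumes q: "0 \<le> q" and g: "0 \<le> \<gamma>" "\<gamma> < 1" and K: "0 \<le> K"
    and \<Psi> [measurable]: "\<Psi> \<in> borel_measurable borel"
    and [measurable]: "mp \<in> borel_measurable borel" "mm \<in> borel_measurable borel"
    and m0: "\<And>l. 0 < l \<Longrightarrow> 0 \<le> mp l" "\<And>l. 0 < l \<Longrightarrow> 0 \<le> mm l"
    and bound: "\<And>\<xi>. \<xi> \<noteq> 0 \<Longrightarrow> (\<integral>\<^sup>+l\<in>{0<..}. ennreal ((mp l + mm l) / sqrt (l\<^sup>2 + \<xi>\<^sup>2)) \<partial>lborel) \<le> ennreal (K * \<bar>\<xi>\<bar> powr (-\<gamma>))"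
    and fourier: "\<And>\<xi>. \<xi> \<noteq> 0 \<Longrightarrow> (CLINT l|lborel. indicator {0<..} l *\<^sub>R (complex_of_real (mp l) / (complex_of_real l - \<i> * \<xi>)
        + complex_of_real (mm l) / (complex_of_real l + \<i> * \<xi>))) = 1 / (complex_of_real q + \<Psi> \<xi>)"
    and Re_pos: "\<And>\<xi>. \<xi> \<noteq> 0 \<Longrightarrow> 0 < q + Re (\<Psi> \<xi>)"
    and Re_bound: "\<And>\<xi>. \<xi> \<noteq> 0 \<Longrightarrow> 1 / (q + Re (\<Psi> \<xi>)) \<le> K * \<bar>\<xi>\<bar> powr (-\<gamma>)"
    and f [measurable]: "f \<in> borel_measurable borel"
  shows "potential q f y = (\<integral>\<^sup>+w. f (y + w) * laplace_kernel mp mm w \<partial>lborel)"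
proof -
  let ?S = std_normal_distribution
  interpret N: real_distribution ?S by (rule real_dist_normal_dist)
  interpret LM: pair_sigma_finite "lborel :: real measure" M ..
  interpret LN: pair_sigma_finite "lborel :: real measure" ?S ..
  have normK: "(\<integral>\<^sup>+\<theta>. ennreal (K * \<bar>\<eta> + \<theta>\<bar> powr (-\<gamma>)) \<partial>?S) < \<infinity>" for \<eta>
    using nn_integral_normal_powr[OF g, of \<eta>] K
    by (simp add: ennreal_mult' nn_integral_cmult ennreal_mult_less_top)
  define D1 where "D1 = (\<lambda>s \<omega>. indicator {0<..} s * (exp (- q * s) * gauss (X (max 0 s) \<omega>)))"
  define D2 where "D2 = (\<lambda>l w. indicator {0<..} l * (gauss w * (exp (- (l * \<bar>w\<bar>)) * (if 0 < w then mp l else mm l))))"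
  have [measurable]: "case_prod D1 \<in> borel_measurable (lborel \<Otimes>\<^sub>M M)" unfolding D1_def by measurable
  have [measurable]: "case_prod D2 \<in> borel_measurable (lborel \<Otimes>\<^sub>M lborel)" unfolding D2_def by measurable
  have D1_nn: "0 \<le> D1 s \<omega>" for s \<omega> by (simp add: D1_def)
  have D2_nn: "0 \<le> D2 l w" for l w using m0 by (simp add: D2_def indicator_def)
  \<comment> \<open>The damped resolvent measure and the damped measure with the claimed density,
    both as images of measures on product spaces, so that their transforms become double
    integrals.\<close>
  define \<nu>1 where "\<nu>1 = distr (density (lborel \<Otimes>\<^sub>M M) (\<lambda>(s, \<omega>). ennreal (D1 s \<omega>))) borel (\<lambda>(s, \<omega>). X (max 0 s) \<omega>)"
  define \<nu>2 where "\<nu>2 = distr (density (lborel \<Otimes>\<^sub>M lborel) (\<lambda>(l, w). ennreal (D2 l w))) borel snd"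
  have nn1: "(\<integral>\<^sup>+x. h x \<partial>\<nu>1) = (\<integral>\<^sup>+s. (\<integral>\<^sup>+\<omega>. ennreal (D1 s \<omega>) * h (X (max 0 s) \<omega>) \<partial>M) \<partial>lborel)"
    if [measurable]: "h \<in> borel_measurable borel" for h
    unfolding \<nu>1_def
    by (simp add: nn_integral_distr nn_integral_density case_prod_beta' nn_integral_fst[symmetric])
  have nn2: "(\<integral>\<^sup>+x. h x \<partial>\<nu>2) = (\<integral>\<^sup>+l. (\<integral>\<^sup>+w. ennreal (D2 l w) * h w \<partial>lborel) \<partial>lborel)"
    if [measurable]: "h \<in> borel_measurable borel" for h
    unfolding \<nu>2_def
    by (simp add: nn_integral_distr nn_integral_density case_prod_beta' lborel.nn_integral_fst[symmetric])
  \<comment> \<open>Absolute convergence in time and frequency: the time integral is the reciprocal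
    of \<open>q\<close> plus the real part of the exponent, whose bound is integrable against the
    normal law.\<close>
  have time_fubini: "(\<integral>\<^sup>+s. (\<integral>\<^sup>+\<theta>. ennreal (norm (indicator {0<..} s *\<^sub>R exp (- ((complex_of_real q + \<Psi> (\<eta> + \<theta>)) * complex_of_real s)))) \<partial>?S) \<partial>lborel) < \<infinity>" for \<eta>
  proof -
    have "(\<integral>\<^sup>+s. (\<integral>\<^sup>+\<theta>. ennreal (norm (indicator {0<..} s *\<^sub>R exp (- ((complex_of_real q + \<Psi> (\<eta> + \<theta>)) * complex_of_real s)))) \<partial>?S) \<partial>lborel)
       = (\<integral>\<^sup>+\<theta>. (\<integral>\<^sup>+s. ennreal (norm (indicator {0<..} s *\<^sub>R exp (- ((complex_of_real q + \<Psi> (\<eta> + \<theta>)) * complex_of_real s)))) \<partial>lborel) \<partial>?S)"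
      by (rule LN.Fubini'[symmetric]) measurable
    also have "\<dots> = (\<integral>\<^sup>+\<theta>. (\<integral>\<^sup>+s\<in>{0<..}. ennreal (exp (- ((q + Re (\<Psi> (\<eta> + \<theta>))) * s))) \<partial>lborel) \<partial>?S)"
      by (intro nn_integral_cong) (auto simp: indicator_def)
    also have "\<dots> \<le> (\<integral>\<^sup>+\<theta>. ennreal (K * \<bar>\<eta> + \<theta>\<bar> powr (-\<gamma>)) \<partial>?S)"
      by (rule nn_integral_mono_AE) (use AE_std_normal_neq[of \<eta>] in \<open>eventually_elim, simp add: nn_integral_exp_halfline Re_pos Re_bound ennreal_leI\<close>)
    also have "\<dots> < \<infinity>" by (rule normK)
    finally show ?thesis .
  qed
  have inner1: "(CLINT \<omega>|M. complex_of_real (D1 s \<omega>) * iexp (\<eta> * X (max 0 s) \<omega>))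
      = (CLINT \<theta>|?S. indicator {0<..} s *\<^sub>R exp (- ((complex_of_real q + \<Psi> (\<eta> + \<theta>)) * complex_of_real s)))" for s \<eta>
  proof (cases "0 < s")
    case True
    have "(CLINT \<omega>|M. complex_of_real (D1 s \<omega>) * iexp (\<eta> * X (max 0 s) \<omega>))
       = (CLINT \<omega>|M. complex_of_real (exp (- q * s)) * (complex_of_real (gauss (X s \<omega>)) * iexp (\<eta> * X s \<omega>)))"
      using True by (simp add: D1_def max_def mult.assoc)
    also have "\<dots> = complex_of_real (exp (- q * s)) * (CLINT \<theta>|?S. exp (- complex_of_real s * \<Psi> (\<eta> + \<theta>)))"
      using True expectation_gauss_iexp[of s \<eta>] by (simp only: integral_mult_right_zero)
    also have "\<dots> = (CLINT \<theta>|?S. complex_of_real (exp (- q * s)) * exp (- complex_of_real s * \<Psi> (\<eta> + \<theta>)))"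
      by (simp only: integral_mult_right_zero)
    also have "\<dots> = (CLINT \<theta>|?S. indicator {0<..} s *\<^sub>R exp (- ((complex_of_real q + \<Psi> (\<eta> + \<theta>)) * complex_of_real s)))"
      using True by (intro Bochner_Integration.integral_cong refl) (simp add: exp_of_real[symmetric] exp_add[symmetric] algebra_simps)
    finally show ?thesis .
  qed (simp add: D1_def)
  \<comment> \<open>The density is nonnegative, so its mass is its transform at zero, and finiteness
    follows from absolute convergence of the transform.\<close>
  have fin1: "(\<integral>\<^sup>+s. (\<integral>\<^sup>+\<omega>. ennreal (D1 s \<omega>) \<partial>M) \<partial>lborel) < \<infinity>"
  proof -
    have "(\<integral>\<^sup>+\<omega>. ennreal (D1 s \<omega>) \<partial>M) \<le> (\<integral>\<^sup>+\<theta>. ennreal (norm (indicator {0<..} s *\<^sub>R exp (- ((complex_of_real q + \<Psi> (0 + \<theta>)) * complex_of_real s)))) \<partial>?S)" for s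
    proof -
      let ?G = "\<lambda>\<theta>. indicator {0<..} s *\<^sub>R exp (- ((complex_of_real q + \<Psi> (0 + \<theta>)) * complex_of_real s))"
      have "integrable M (D1 s)"
      proof (rule integrable_const_bound[where B=1])
        show "AE \<omega> in M. norm (D1 s \<omega>) \<le> 1"
          using q by (intro AE_I2) (auto simp: D1_def indicator_def intro!: mult_le_one)
      qed measurable
      then have "(\<integral>\<^sup>+\<omega>. ennreal (D1 s \<omega>) \<partial>M) = ennreal (\<integral>\<omega>. D1 s \<omega> \<partial>M)"
        using D1_nn by (intro nn_integral_eq_integral) auto
      also have "(\<integral>\<omega>. D1 s \<omega> \<partial>M) = norm (complex_of_real (\<integral>\<omega>. D1 s \<omega> \<partial>M))"
        using D1_nn by (simp add: integral_nonneg_AE)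
      also have "complex_of_real (\<integral>\<omega>. D1 s \<omega> \<partial>M) = (CLINT \<omega>|M. complex_of_real (D1 s \<omega>) * iexp (0 * X (max 0 s) \<omega>))"
        by (simp only: integral_complex_of_real[symmetric]) simp
      also have "\<dots> = (CLINT \<theta>|?S. ?G \<theta>)" by (rule inner1)
      also have "ennreal (norm (CLINT \<theta>|?S. ?G \<theta>)) \<le> (\<integral>\<^sup>+\<theta>. ennreal (norm (?G \<theta>)) \<partial>?S)"
        by (rule norm_integral_le_nn_integral)
      finally show ?thesis .
    qed
    then have "(\<integral>\<^sup>+s. (\<integral>\<^sup>+\<omega>. ennreal (D1 s \<omega>) \<partial>M) \<partial>lborel) \<le>
      (\<integral>\<^sup>+s. (\<integral>\<^sup>+\<theta>. ennreal (norm (indicator {0<..} s *\<^sub>R exp (- ((complex_of_real q + \<Psi> (0 + \<theta>)) * complex_of_real s)))) \<partial>?S) \<partial>lborel)"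
      by (rule nn_integral_mono)
    also have "\<dots> < \<infinity>" by (rule time_fubini)
    finally show ?thesis .
  qed
  have space_fubini: "(\<integral>\<^sup>+l. (\<integral>\<^sup>+\<theta>. ennreal (indicator {0<..} l * ((mp l + mm l) / sqrt (l\<^sup>2 + (\<eta> + \<theta>)\<^sup>2))) \<partial>?S) \<partial>lborel) < \<infinity>" for \<eta>
  proof -
    have "(\<integral>\<^sup>+l. (\<integral>\<^sup>+\<theta>. ennreal (indicator {0<..} l * ((mp l + mm l) / sqrt (l\<^sup>2 + (\<eta> + \<theta>)\<^sup>2))) \<partial>?S) \<partial>lborel)
       = (\<integral>\<^sup>+\<theta>. (\<integral>\<^sup>+l. ennreal (indicator {0<..} l * ((mp l + mm l) / sqrt (l\<^sup>2 + (\<eta> + \<theta>)\<^sup>2))) \<partial>lborel) \<partial>?S)"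
      by (rule LN.Fubini'[symmetric]) measurable
    also have "\<dots> = (\<integral>\<^sup>+\<theta>. (\<integral>\<^sup>+l\<in>{0<..}. ennreal ((mp l + mm l) / sqrt (l\<^sup>2 + (\<eta> + \<theta>)\<^sup>2)) \<partial>lborel) \<partial>?S)"
      by (intro nn_integral_cong) (auto simp: indicator_def)
    also have "\<dots> \<le> (\<integral>\<^sup>+\<theta>. ennreal (K * \<bar>\<eta> + \<theta>\<bar> powr (-\<gamma>)) \<partial>?S)"
    proof (rule nn_integral_mono_AE)
      show "AE \<theta> in ?S. (\<integral>\<^sup>+l\<in>{0<..}. ennreal ((mp l + mm l) / sqrt (l\<^sup>2 + (\<eta> + \<theta>)\<^sup>2)) \<partial>lborel) \<le> ennreal (K * \<bar>\<eta> + \<theta>\<bar> powr (-\<gamma>))"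
        using AE_std_normal_neq[of \<eta>] by eventually_elim (rule bound)
    qed
    also have "\<dots> < \<infinity>" by (rule normK)
    finally show ?thesis .
  qed
  have fin2: "(\<integral>\<^sup>+l. (\<integral>\<^sup>+w. ennreal (D2 l w) \<partial>lborel) \<partial>lborel) < \<infinity>"
  proof -
    have "(\<integral>\<^sup>+w. ennreal (D2 l w) \<partial>lborel) \<le> (\<integral>\<^sup>+\<theta>. ennreal (indicator {0<..} l * ((mp l + mm l) / sqrt (l\<^sup>2 + (0 + \<theta>)\<^sup>2))) \<partial>?S)" for l
      using gauss_laplace_fourier(2)[of l "mp l" "mm l"] m0 by (cases "0 < l") (auto simp: D2_def)
    then have "(\<integral>\<^sup>+l. (\<integral>\<^sup>+w. ennreal (D2 l w) \<partial>lborel) \<partial>lborel) \<le> (\<integral>\<^sup>+l. (\<integral>\<^sup>+\<theta>. ennreal (indicator {0<..} l * ((mp l + mm l) / sqrt (l\<^sup>2 + (0 + \<theta>)\<^sup>2))) \<partial>?S) \<partial>lborel)"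
      by (rule nn_integral_mono)
    also have "\<dots> < \<infinity>" by (rule space_fubini)
    finally show ?thesis .
  qed
  have "\<nu>1 = \<nu>2"
  proof (rule finite_measure_eq_if_char_eq)
    show "sets \<nu>1 = sets borel" "sets \<nu>2 = sets borel" by (simp_all add: \<nu>1_def \<nu>2_def)
    show "finite_measure \<nu>1"
    proof
      show "emeasure \<nu>1 (space \<nu>1) \<noteq> \<infinity>"
        using nn1[of "\<lambda>_. 1"] fin1 by (simp add: less_top)
    qed
    show "finite_measure \<nu>2"
    proof
      show "emeasure \<nu>2 (space \<nu>2) \<noteq> \<infinity>"
        using nn2[of "\<lambda>_. 1"] fin2 by (simp add: less_top)
    qed
    fix \<eta>
    have "(CLINT x|\<nu>1. iexp (\<eta> * x)) = (CLINT p|lborel \<Otimes>\<^sub>M M. case_prod (\<lambda>s \<omega>. complex_of_real (D1 s \<omega>) * iexp (\<eta> * X (max 0 s) \<omega>)) p)"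
      unfolding \<nu>1_def using D1_nn
      by (simp add: integral_distr integral_density case_prod_beta' scaleR_conv_of_real)
    also have "\<dots> = (CLINT s|lborel. (CLINT \<omega>|M. complex_of_real (D1 s \<omega>) * iexp (\<eta> * X (max 0 s) \<omega>)))"
    proof (rule LM.Fubini_integral_bounded(3))
      show "(\<integral>\<^sup>+s. (\<integral>\<^sup>+\<omega>. ennreal (norm (complex_of_real (D1 s \<omega>) * iexp (\<eta> * X (max 0 s) \<omega>))) \<partial>M) \<partial>lborel) < \<infinity>"
        using fin1 D1_nn by (simp add: norm_mult)
    qed measurable
    also have "\<dots> = (CLINT s|lborel. (CLINT \<theta>|?S. indicator {0<..} s *\<^sub>R exp (- ((complex_of_real q + \<Psi> (\<eta> + \<theta>)) * complex_of_real s))))"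
      unfolding inner1 ..
    also have "\<dots> = (CLINT \<theta>|?S. (CLINT s|lborel. indicator {0<..} s *\<^sub>R exp (- ((complex_of_real q + \<Psi> (\<eta> + \<theta>)) * complex_of_real s))))"
      by (rule LN.Fubini_integral_bounded(2)[OF _ time_fubini]) measurable
    also have "\<dots> = (CLINT \<theta>|?S. 1 / (complex_of_real q + \<Psi> (\<eta> + \<theta>)))"
    proof (rule integral_cong_AE)
      show "AE \<theta> in ?S. (CLINT s|lborel. indicator {0<..} s *\<^sub>R exp (- ((complex_of_real q + \<Psi> (\<eta> + \<theta>)) * complex_of_real s))) = 1 / (complex_of_real q + \<Psi> (\<eta> + \<theta>))"
        using AE_std_normal_neq[of \<eta>] by eventually_elim (rule exp_halfline_complex(2), simp add: Re_pos)
    qed measurable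
    finally have c1: "(CLINT x|\<nu>1. iexp (\<eta> * x)) = (CLINT \<theta>|?S. 1 / (complex_of_real q + \<Psi> (\<eta> + \<theta>)))" .
    let ?F = "\<lambda>l \<xi>::real. indicator {0<..} l *\<^sub>R (complex_of_real (mp l) / (complex_of_real l - \<i> * \<xi>)
        + complex_of_real (mm l) / (complex_of_real l + \<i> * \<xi>))"
    have "(CLINT x|\<nu>2. iexp (\<eta> * x)) = (CLINT p|lborel \<Otimes>\<^sub>M lborel. case_prod (\<lambda>l w. complex_of_real (D2 l w) * iexp (\<eta> * w)) p)"
      unfolding \<nu>2_def using D2_nn
      by (simp add: integral_distr integral_density case_prod_beta' scaleR_conv_of_real)
    also have "\<dots> = (CLINT l|lborel. (CLINT w|lborel. complex_of_real (D2 l w) * iexp (\<eta> * w)))"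
    proof (rule lborel_pair.Fubini_integral_bounded(3))
      show "(\<integral>\<^sup>+l. (\<integral>\<^sup>+w. ennreal (norm (complex_of_real (D2 l w) * iexp (\<eta> * w))) \<partial>lborel) \<partial>lborel) < \<infinity>"
        using fin2 D2_nn by (simp add: norm_mult)
    qed measurable
    also have "\<dots> = (CLINT l|lborel. (CLINT \<theta>|?S. ?F l (\<eta> + \<theta>)))"
    proof (rule Bochner_Integration.integral_cong[OF refl])
      fix l :: real
      show "(CLINT w|lborel. complex_of_real (D2 l w) * iexp (\<eta> * w)) = (CLINT \<theta>|?S. ?F l (\<eta> + \<theta>))"
        using gauss_laplace_fourier(1)[of l "mp l" "mm l" \<eta>] m0 by (cases "0 < l") (auto simp: D2_def)
    qed
    also have "\<dots> = (CLINT \<theta>|?S. (CLINT l|lborel. ?F l (\<eta> + \<theta>)))"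
    proof (rule LN.Fubini_integral_bounded(2))
      have "(\<integral>\<^sup>+l. (\<integral>\<^sup>+\<theta>. ennreal (norm (?F l (\<eta> + \<theta>))) \<partial>?S) \<partial>lborel)
        \<le> (\<integral>\<^sup>+l. (\<integral>\<^sup>+\<theta>. ennreal (indicator {0<..} l * ((mp l + mm l) / sqrt (l\<^sup>2 + (\<eta> + \<theta>)\<^sup>2))) \<partial>?S) \<partial>lborel)"
      proof (intro nn_integral_mono ennreal_leI)
        fix l \<theta> :: real
        show "norm (?F l (\<eta> + \<theta>)) \<le> indicator {0<..} l * ((mp l + mm l) / sqrt (l\<^sup>2 + (\<eta> + \<theta>)\<^sup>2))"
          using norm_laplace_fourier_le[of "mp l" "mm l" l "\<eta> + \<theta>"] m0[of l] by (cases "0 < l") (simp_all del: of_real_add)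
      qed
      also have "\<dots> < \<infinity>" by (rule space_fubini)
      finally show "(\<integral>\<^sup>+l. (\<integral>\<^sup>+\<theta>. ennreal (norm (?F l (\<eta> + \<theta>))) \<partial>?S) \<partial>lborel) < \<infinity>" .
    qed measurable
    also have "\<dots> = (CLINT \<theta>|?S. 1 / (complex_of_real q + \<Psi> (\<eta> + \<theta>)))"
    proof (rule integral_cong_AE)
      show "AE \<theta> in ?S. (CLINT l|lborel. ?F l (\<eta> + \<theta>)) = 1 / (complex_of_real q + \<Psi> (\<eta> + \<theta>))"
        using AE_std_normal_neq[of \<eta>] by eventually_elim (rule fourier)
    qed measurable
    finally show "(CLINT x|\<nu>1. iexp (\<eta> * x)) = (CLINT x|\<nu>2. iexp (\<eta> * x))" using c1 by simp
  qed
  \<comment> \<open>Dividing the test function by the Gaussian undoes the damping; equality of the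
    damped measures then gives the identity for every nonnegative \<open>f\<close>, finite or
    not.\<close>
  define h where "h = (\<lambda>w. f (y + w) * ennreal (1 / gauss w))"
  have [measurable]: "h \<in> borel_measurable borel" unfolding h_def by measurable
  have gg: "ennreal (gauss w) * ennreal (1 / gauss w) = 1" for w by (simp add: ennreal_mult'[symmetric])
  have "potential q f y = (\<integral>\<^sup>+s. (\<integral>\<^sup>+\<omega>. ennreal (exp (- q * s)) * f (y + X (max 0 s) \<omega>) * indicator {0..} s \<partial>M) \<partial>lborel)"
    unfolding potential_def by (rule LM.Fubini') measurable
  also have "\<dots> = (\<integral>\<^sup>+s. (\<integral>\<^sup>+\<omega>. ennreal (D1 s \<omega>) * h (X (max 0 s) \<omega>) \<partial>M) \<partial>lborel)"
  proof (rule nn_integral_cong_AE)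
    have "AE s in lborel. s \<noteq> (0::real)" by (rule AE_lborel_singleton)
    then show "AE s in lborel. (\<integral>\<^sup>+\<omega>. ennreal (exp (- q * s)) * f (y + X (max 0 s) \<omega>) * indicator {0..} s \<partial>M) = (\<integral>\<^sup>+\<omega>. ennreal (D1 s \<omega>) * h (X (max 0 s) \<omega>) \<partial>M)"
    proof eventually_elim
      case (elim s)
      have "ennreal (exp (- q * s)) * f (y + v) = ennreal (exp (- q * s) * gauss v) * h v" for v
      proof -
        have "ennreal (exp (- q * s) * gauss v) * h v = ennreal (exp (- q * s)) * f (y + v) * (ennreal (gauss v) * ennreal (1 / gauss v))"
          by (simp add: h_def ennreal_mult' mult_ac)
        then show ?thesis by (simp only: gg mult_1_right)
      qed
      then show ?case using elim by (intro nn_integral_cong) (simp add: D1_def indicator_def)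
    qed
  qed
  also have "\<dots> = (\<integral>\<^sup>+l. (\<integral>\<^sup>+w. ennreal (D2 l w) * h w \<partial>lborel) \<partial>lborel)"
    using nn1[of h] nn2[of h] \<open>\<nu>1 = \<nu>2\<close> by simp
  also have "\<dots> = (\<integral>\<^sup>+w. (\<integral>\<^sup>+l. ennreal (D2 l w) * h w \<partial>lborel) \<partial>lborel)"
    by (rule lborel_pair.Fubini'[symmetric]) measurable
  also have "\<dots> = (\<integral>\<^sup>+w. f (y + w) * laplace_kernel mp mm w \<partial>lborel)"
  proof (rule nn_integral_cong)
    fix w :: real
    have "ennreal (D2 l w) * h w = f (y + w) * (ennreal (exp (- (l * \<bar>w\<bar>)) * (if 0 < w then mp l else mm l)) * indicator {0<..} l)" for l
    proof (cases "0 < l")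
      case True
      have "D2 l w = gauss w * (exp (- (l * \<bar>w\<bar>)) * (if 0 < w then mp l else mm l))"
        using True by (simp add: D2_def)
      then have "ennreal (D2 l w) = ennreal (gauss w) * ennreal (exp (- (l * \<bar>w\<bar>)) * (if 0 < w then mp l else mm l))"
        by (simp only: ennreal_mult'[OF exp_ge_zero])
      then have "ennreal (D2 l w) * h w = f (y + w) * ennreal (exp (- (l * \<bar>w\<bar>)) * (if 0 < w then mp l else mm l)) * (ennreal (gauss w) * ennreal (1 / gauss w))"
        by (simp only: h_def mult_ac)
      then show ?thesis using True by (simp only: gg) simp
    qed (simp add: D2_def)
    then have "(\<integral>\<^sup>+l. ennreal (D2 l w) * h w \<partial>lborel) = (\<integral>\<^sup>+l. f (y + w) * (ennreal (exp (- (l * \<bar>w\<bar>)) * (if 0 < w then mp l else mm l)) * indicator {0<..} l) \<partial>lborel)" by simp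
    also have "\<dots> = f (y + w) * laplace_kernel mp mm w"
      unfolding laplace_kernel_def by (rule nn_integral_cmult) measurable
    finally show "(\<integral>\<^sup>+l. ennreal (D2 l w) * h w \<partial>lborel) = f (y + w) * laplace_kernel mp mm w" .
  qed
  finally show ?thesis .
qed

end

section \<open>The characteristic exponent\<close>

lemma ennreal_mult_eqD:
  assumes "0 < c" "ennreal c * x = ennreal (c * v)" shows "x = ennreal v"
  using assms by (simp add: ennreal_mult' ennreal_mult_cancel_left)

text \<open>The substitution \<open>v = s^2\<close> leads to the Stieltjes integral with exponent
  \<open>1 - \<beta>/2\<close> at the point \<open>\<xi>^2\<close>.\<close>

lemma nn_integral_powr_square:
  fixes \<beta> \<xi> :: real
  assumes b: "0 < \<beta>" "\<beta> < 2" and x: "\<xi> \<noteq> 0"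
  shows "(\<integral>\<^sup>+s\<in>{0<..}. ennreal (s powr (\<beta>-1) / (s\<^sup>2 + \<xi>\<^sup>2)) \<partial>lborel) = ennreal (\<bar>\<xi>\<bar> powr (\<beta>-2) * (pi / (2 * sin (pi*\<beta>/2))))"
proof -
  define a where "a = 1 - \<beta>/2"
  have a: "0 < a" "a < 1" using b by (auto simp: a_def)
  have sa: "sin (pi*a) = sin (pi*\<beta>/2)"
    using sin_pi_minus[of "pi*\<beta>/2"] by (simp add: a_def right_diff_distrib)
  have "ennreal (pi / sin (pi*a) * (\<xi>\<^sup>2) powr (-a)) = (\<integral>\<^sup>+v\<in>{0<..}. ennreal (v powr (-a) / (v + \<xi>\<^sup>2)) \<partial>lborel)"
    by (rule nn_integral_Stieltjes_powr[symmetric]) (use a x in auto)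
  also have "\<dots> = (\<integral>\<^sup>+s\<in>{0<..}. ennreal (\<bar>2 * s\<bar> * ((s\<^sup>2) powr (-a) / (s\<^sup>2 + \<xi>\<^sup>2))) \<partial>lborel)"
    by (rule nn_integral_lborel_substitution_inverse[where k = sqrt]) (auto intro!: derivative_eq_intros)
  also have "\<dots> = ennreal 2 * (\<integral>\<^sup>+s\<in>{0<..}. ennreal (s powr (\<beta>-1) / (s\<^sup>2 + \<xi>\<^sup>2)) \<partial>lborel)"
  proof (rule set_nn_integral_cong_cmult)
    fix s :: real assume "s \<in> {0<..}"
    then have s: "0 < s" by simp
    have "s * (s\<^sup>2) powr (-a) = s powr (\<beta>-1)"
    proof (rule ln_eqD)
      show "ln (s * (s\<^sup>2) powr (-a)) = ln (s powr (\<beta>-1))"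
        using s by (simp add: ln_mult ln_realpow a_def) (simp add: algebra_simps)
    qed (use s in auto)
    then have "\<bar>2 * s\<bar> * ((s\<^sup>2) powr (-a) / (s\<^sup>2 + \<xi>\<^sup>2)) = 2 * (s powr (\<beta>-1) / (s\<^sup>2 + \<xi>\<^sup>2))"
      using s by simp
    then show "ennreal (\<bar>2 * s\<bar> * ((s\<^sup>2) powr (-a) / (s\<^sup>2 + \<xi>\<^sup>2))) = ennreal 2 * ennreal (s powr (\<beta>-1) / (s\<^sup>2 + \<xi>\<^sup>2))"
      by (simp only: ennreal_mult'[of 2])
  qed auto
  finally have "ennreal 2 * (\<integral>\<^sup>+s\<in>{0<..}. ennreal (s powr (\<beta>-1) / (s\<^sup>2 + \<xi>\<^sup>2)) \<partial>lborel) = ennreal (pi / sin (pi*a) * (\<xi>\<^sup>2) powr (-a))" ..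
  also have "(\<xi>\<^sup>2) powr (-a) = \<bar>\<xi>\<bar> powr (\<beta>-2)"
  proof (rule ln_eqD)
    have "\<xi>\<^sup>2 = \<bar>\<xi>\<bar>\<^sup>2" by simp
    then show "ln ((\<xi>\<^sup>2) powr (-a)) = ln (\<bar>\<xi>\<bar> powr (\<beta>-2))"
      using x by (simp only: ln_powr ln_realpow zero_less_abs_iff a_def) (simp add: ln_realpow algebra_simps)
  qed (use x in auto)
  also have "ennreal (pi / sin (pi*a) * \<bar>\<xi>\<bar> powr (\<beta>-2)) = ennreal 2 * ennreal (\<bar>\<xi>\<bar> powr (\<beta>-2) * (pi / (2 * sin (pi*\<beta>/2))))"
    unfolding sa by (subst ennreal_mult'[symmetric]) (auto simp: mult_ac)
  finally show ?thesis by (simp add: ennreal_mult_cancel_left)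
qed

lemma nn_integral_Gamma_scaled:
  fixes \<beta> x :: real
  assumes b: "0 < \<beta>" and x: "0 < x"
  shows "(\<integral>\<^sup>+s\<in>{0<..}. ennreal (s powr (\<beta>-1) * exp (- (s * x))) \<partial>lborel) = ennreal (Gamma \<beta> * x powr (-\<beta>))"
proof -
  have "ennreal (Gamma \<beta>) = (\<integral>\<^sup>+t\<in>{0<..}. ennreal (t powr (\<beta>-1) * exp (- t)) \<partial>lborel)"
  proof -
    have "ennreal (Gamma \<beta>) = (\<integral>\<^sup>+t. ennreal (indicator {0..} t * t powr (\<beta>-1) / exp t) \<partial>lborel)"
      by (rule Gamma_conv_nn_integral_real[OF b])
    also have "\<dots> = (\<integral>\<^sup>+t\<in>{0<..}. ennreal (t powr (\<beta>-1) * exp (- t)) \<partial>lborel)"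
      by (intro nn_integral_cong) (auto simp: indicator_def exp_minus divide_inverse)
    finally show ?thesis .
  qed
  also have "\<dots> = (\<integral>\<^sup>+s\<in>{0<..}. ennreal (\<bar>x\<bar> * ((s * x) powr (\<beta>-1) * exp (- (s * x)))) \<partial>lborel)"
    by (rule nn_integral_lborel_substitution_inverse[where k = "\<lambda>t. t / x"]) (use x in \<open>auto intro!: derivative_eq_intros\<close>)
  also have "\<dots> = ennreal (x powr \<beta>) * (\<integral>\<^sup>+s\<in>{0<..}. ennreal (s powr (\<beta>-1) * exp (- (s * x))) \<partial>lborel)"
  proof (rule set_nn_integral_cong_cmult)
    fix s :: real assume "s \<in> {0<..}"
    then have "\<bar>x\<bar> * ((s * x) powr (\<beta>-1) * exp (- (s * x))) = x powr \<beta> * (s powr (\<beta>-1) * exp (- (s * x)))"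
      using x by (simp add: powr_mult powr_diff)
    then show "ennreal (\<bar>x\<bar> * ((s * x) powr (\<beta>-1) * exp (- (s * x)))) = ennreal (x powr \<beta>) * ennreal (s powr (\<beta>-1) * exp (- (s * x)))"
      by (simp only: ennreal_mult'[OF powr_ge_zero])
  qed auto
  finally have "ennreal (x powr (-\<beta>)) * ennreal (Gamma \<beta>) = ennreal (x powr (-\<beta>)) * (ennreal (x powr \<beta>) * (\<integral>\<^sup>+s\<in>{0<..}. ennreal (s powr (\<beta>-1) * exp (- (s * x))) \<partial>lborel))"
    by simp
  moreover have "x powr (-\<beta>) * x powr \<beta> = 1" using x by (simp add: powr_add[symmetric])
  moreover have "0 \<le> Gamma \<beta>" using b by (simp add: less_imp_le)
  ultimately show ?thesis by (simp add: mult.assoc[symmetric] ennreal_mult'[symmetric] mult.commute)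
qed

lemma nn_integral_one_minus_cos_exp:
  fixes s \<xi> :: real
  assumes s: "0 < s"
  shows "(\<integral>\<^sup>+x\<in>{0<..}. ennreal ((1 - cos (\<xi> * x)) * exp (- (s * x))) \<partial>lborel) = ennreal (\<xi>\<^sup>2 / (s * (s\<^sup>2 + \<xi>\<^sup>2)))"
    and "integrable lborel (\<lambda>x. indicator {0<..} x * (sin (\<xi> * x) * exp (- (s * x))))"
    and "(\<integral>x. indicator {0<..} x * (sin (\<xi> * x) * exp (- (s * x))) \<partial>lborel) = \<xi> / (s\<^sup>2 + \<xi>\<^sup>2)"
proof -
  let ?z = "complex_of_real s - \<i> * complex_of_real \<xi>"
  have e: "exp (- (?z * complex_of_real x)) = complex_of_real (exp (- (s * x))) * (complex_of_real (cos (\<xi> * x)) + \<i> * complex_of_real (sin (\<xi> * x)))" for x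
  proof -
    have "- (?z * complex_of_real x) = complex_of_real (- (s * x)) + \<i> * complex_of_real (\<xi> * x)" by (simp add: algebra_simps)
    then show ?thesis by (simp only: exp_add exp_of_real cis_conv_exp[symmetric]) (simp add: cis.ctr complex_eq_iff)
  qed
  have z: "0 < Re ?z" using s by simp
  note E = exp_halfline_complex[OF z]
  have inv: "1 / ?z = complex_of_real (s / (s\<^sup>2 + \<xi>\<^sup>2)) + \<i> * complex_of_real (\<xi> / (s\<^sup>2 + \<xi>\<^sup>2))"
    by (simp add: complex_eq_iff Re_divide Im_divide power2_eq_square)
  note E1 = E(1)[unfolded e] and E2 = E(2)[unfolded e inv]
  have R: "integrable lborel (\<lambda>x. indicator {0<..} x * (exp (- (s * x)) * cos (\<xi> * x)))"
     "(\<integral>x. indicator {0<..} x * (exp (- (s * x)) * cos (\<xi> * x)) \<partial>lborel) = s / (s\<^sup>2 + \<xi>\<^sup>2)"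
    using integrable_Re[OF E1] integral_Re[OF E1] unfolding E2 by simp_all
  have I: "integrable lborel (\<lambda>x. indicator {0<..} x * (exp (- (s * x)) * sin (\<xi> * x)))"
     "(\<integral>x. indicator {0<..} x * (exp (- (s * x)) * sin (\<xi> * x)) \<partial>lborel) = \<xi> / (s\<^sup>2 + \<xi>\<^sup>2)"
    using integrable_Im[OF E1] integral_Im[OF E1] unfolding E2 by simp_all
  show "integrable lborel (\<lambda>x. indicator {0<..} x * (sin (\<xi> * x) * exp (- (s * x))))"
    "(\<integral>x. indicator {0<..} x * (sin (\<xi> * x) * exp (- (s * x))) \<partial>lborel) = \<xi> / (s\<^sup>2 + \<xi>\<^sup>2)"
    using I by (simp_all add: mult_ac)
  have O: "integrable lborel (\<lambda>x. indicator {0<..} x * exp (- (s * x)))" "(\<integral>x. indicator {0<..} x * exp (- (s * x)) \<partial>lborel) = 1 / s"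
    using integrable_I0i_exp_mscale[OF s] LBINT_I0i_exp_mscale[OF s]
    by (simp_all add: interval_lebesgue_integral_0_infty set_lebesgue_integral_def set_integrable_def mult.commute)
  have "(\<integral>\<^sup>+x\<in>{0<..}. ennreal ((1 - cos (\<xi> * x)) * exp (- (s * x))) \<partial>lborel)
     = (\<integral>\<^sup>+x. ennreal (indicator {0<..} x * exp (- (s * x)) - indicator {0<..} x * (exp (- (s * x)) * cos (\<xi> * x))) \<partial>lborel)"
    by (intro nn_integral_cong) (auto simp: indicator_def algebra_simps)
  also have "\<dots> = ennreal (\<integral>x. indicator {0<..} x * exp (- (s * x)) - indicator {0<..} x * (exp (- (s * x)) * cos (\<xi> * x)) \<partial>lborel)"
    using O(1) R(1) by (intro nn_integral_eq_integral Bochner_Integration.integrable_diff) (auto simp: indicator_def mult_left_le)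
  also have "(\<integral>x. indicator {0<..} x * exp (- (s * x)) - indicator {0<..} x * (exp (- (s * x)) * cos (\<xi> * x)) \<partial>lborel) = 1 / s - s / (s\<^sup>2 + \<xi>\<^sup>2)"
    using O R by simp
  also have "1 / s - s / (s\<^sup>2 + \<xi>\<^sup>2) = \<xi>\<^sup>2 / (s * (s\<^sup>2 + \<xi>\<^sup>2))"
  proof -
    have "s\<^sup>2 + \<xi>\<^sup>2 > 0" using s by (simp add: add_pos_nonneg)
    then show ?thesis using s by (simp add: divide_simps power2_eq_square)
  qed
  finally show "(\<integral>\<^sup>+x\<in>{0<..}. ennreal ((1 - cos (\<xi> * x)) * exp (- (s * x))) \<partial>lborel) = ennreal (\<xi>\<^sup>2 / (s * (s\<^sup>2 + \<xi>\<^sup>2)))" .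
qed

text \<open>The power is a Gamma mixture of exponentials; after exchanging the integrals, the
  Laplace transform of \<open>1 - cos\<close> leaves the integral of
  \<open>nn_integral_powr_square\<close>.\<close>

lemma nn_integral_one_minus_cos_powr:
  fixes \<alpha> \<xi> :: real
  assumes a: "0 < \<alpha>" "\<alpha> < 2" and x: "\<xi> \<noteq> 0"
  shows "(\<integral>\<^sup>+x\<in>{0<..}. ennreal ((1 - cos (\<xi> * x)) * x powr (-(\<alpha>+1))) \<partial>lborel)
    = ennreal (\<bar>\<xi>\<bar> powr \<alpha> * (pi / (2 * Gamma (\<alpha>+1) * sin (pi*\<alpha>/2))))"
proof -
  have G: "Gamma (\<alpha>+1) > 0" using a by auto
  have "ennreal (Gamma (\<alpha>+1)) * (\<integral>\<^sup>+x\<in>{0<..}. ennreal ((1 - cos (\<xi> * x)) * x powr (-(\<alpha>+1))) \<partial>lborel)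
    = (\<integral>\<^sup>+x\<in>{0<..}. (\<integral>\<^sup>+s\<in>{0<..}. ennreal ((1 - cos (\<xi> * x)) * (s powr \<alpha> * exp (- (s * x)))) \<partial>lborel) \<partial>lborel)"
  proof (subst set_nn_integral_cmult[symmetric], goal_cases)
    case 3
    show ?case
    proof (rule set_nn_integral_cong)
      fix x :: real assume "x \<in> {0<..}"
      then have x: "0 < x" by simp
      have "(\<integral>\<^sup>+s\<in>{0<..}. ennreal ((1 - cos (\<xi> * x)) * (s powr \<alpha> * exp (- (s * x)))) \<partial>lborel)
        = ennreal (1 - cos (\<xi> * x)) * (\<integral>\<^sup>+s\<in>{0<..}. ennreal (s powr (\<alpha>+1-1) * exp (- (s * x))) \<partial>lborel)"
        by (rule set_nn_integral_cong_cmult) (auto simp: ennreal_mult'[symmetric])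
      also have "\<dots> = ennreal (1 - cos (\<xi> * x)) * ennreal (Gamma (\<alpha>+1) * x powr (-(\<alpha>+1)))"
        using a x by (subst nn_integral_Gamma_scaled) auto
      finally show "ennreal (Gamma (\<alpha>+1)) * ennreal ((1 - cos (\<xi> * x)) * x powr (-(\<alpha>+1)))
        = (\<integral>\<^sup>+s\<in>{0<..}. ennreal ((1 - cos (\<xi> * x)) * (s powr \<alpha> * exp (- (s * x)))) \<partial>lborel)"
        using G by (simp add: ennreal_mult'[symmetric] mult_ac)
    qed
  qed auto
  also have "\<dots> = (\<integral>\<^sup>+s\<in>{0<..}. (\<integral>\<^sup>+x\<in>{0<..}. ennreal ((1 - cos (\<xi> * x)) * (s powr \<alpha> * exp (- (s * x)))) \<partial>lborel) \<partial>lborel)"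
    by (rule set_nn_integral_swap) auto
  also have "\<dots> = ennreal (\<xi>\<^sup>2) * (\<integral>\<^sup>+s\<in>{0<..}. ennreal (s powr (\<alpha>-1) / (s\<^sup>2 + \<xi>\<^sup>2)) \<partial>lborel)"
  proof (rule set_nn_integral_cong_cmult)
    fix s :: real assume "s \<in> {0<..}"
    then have s: "0 < s" by simp
    have "(\<integral>\<^sup>+x\<in>{0<..}. ennreal ((1 - cos (\<xi> * x)) * (s powr \<alpha> * exp (- (s * x)))) \<partial>lborel)
      = ennreal (s powr \<alpha>) * (\<integral>\<^sup>+x\<in>{0<..}. ennreal ((1 - cos (\<xi> * x)) * exp (- (s * x))) \<partial>lborel)"
      by (rule set_nn_integral_cong_cmult) (auto simp: ennreal_mult'[symmetric] mult_ac)
    also have "\<dots> = ennreal (s powr \<alpha> * (\<xi>\<^sup>2 / (s * (s\<^sup>2 + \<xi>\<^sup>2))))"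
      unfolding nn_integral_one_minus_cos_exp(1)[OF s] by (simp only: ennreal_mult'[OF powr_ge_zero])
    also have "s powr \<alpha> * (\<xi>\<^sup>2 / (s * (s\<^sup>2 + \<xi>\<^sup>2))) = \<xi>\<^sup>2 * (s powr (\<alpha>-1) / (s\<^sup>2 + \<xi>\<^sup>2))"
      using s by (simp add: powr_diff)
    finally show "(\<integral>\<^sup>+x\<in>{0<..}. ennreal ((1 - cos (\<xi> * x)) * (s powr \<alpha> * exp (- (s * x)))) \<partial>lborel)
      = ennreal (\<xi>\<^sup>2) * ennreal (s powr (\<alpha>-1) / (s\<^sup>2 + \<xi>\<^sup>2))"
      by (simp only: ennreal_mult'[OF zero_le_power2])
  qed auto
  also have "\<dots> = ennreal (\<xi>\<^sup>2 * (\<bar>\<xi>\<bar> powr (\<alpha>-2) * (pi / (2 * sin (pi*\<alpha>/2)))))"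
    unfolding nn_integral_powr_square[OF a x] by (simp only: ennreal_mult'[OF zero_le_power2])
  also have "\<xi>\<^sup>2 * (\<bar>\<xi>\<bar> powr (\<alpha>-2) * (pi / (2 * sin (pi*\<alpha>/2)))) = Gamma (\<alpha>+1) * (\<bar>\<xi>\<bar> powr \<alpha> * (pi / (2 * Gamma (\<alpha>+1) * sin (pi*\<alpha>/2))))"
  proof -
    have "\<xi>\<^sup>2 * \<bar>\<xi>\<bar> powr (\<alpha>-2) = \<bar>\<xi>\<bar> powr \<alpha>" using x by (simp add: powr_diff powr_realpow)
    then show ?thesis using G by (simp add: mult.assoc[symmetric])
  qed
  finally show ?thesis by (rule ennreal_mult_eqD[OF G])
qed

text \<open>A bound of this rational form makes the integrand of \<open>integral_sin_powr\<close>
  comparable to a Stieltjes integrand.\<close>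

lemma abs_sin_le_fraction:
  fixes u :: real
  assumes "0 \<le> u" shows "\<bar>sin u\<bar> \<le> 2 * u / (1 + u)"
proof (cases "u \<le> 1")
  case True
  have "\<bar>sin u\<bar> \<le> u" using abs_sin_x_le_abs_x[of u] assms by simp
  also have "u * u \<le> u" using True assms by (simp add: mult_left_le)
  then have "u \<le> 2 * u / (1 + u)" using assms by (simp add: field_simps)
  finally show ?thesis .
next
  case False
  have "\<bar>sin u\<bar> \<le> 1" by simp
  also have "1 \<le> 2 * u / (1 + u)" using False by (simp add: field_simps)
  finally show ?thesis .
qed

text \<open>The same mixture of exponentials as for the cosine. The integrand changes sign, so the
  exchange needs absolute convergence, which near zero requires \<open>\<alpha> < 1\<close>.\<close>

lemma integral_sin_powr:
  fixes \<alpha> \<xi> :: real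
  assumes a: "0 < \<alpha>" "\<alpha> < 1" and x: "\<xi> \<noteq> 0"
  shows "integrable lborel (\<lambda>x. indicator {0<..} x * (sin (\<xi> * x) * x powr (-(\<alpha>+1))))"
    and "(\<integral>x. indicator {0<..} x * (sin (\<xi> * x) * x powr (-(\<alpha>+1))) \<partial>lborel)
      = sgn \<xi> * \<bar>\<xi>\<bar> powr \<alpha> * (pi / (2 * Gamma (\<alpha>+1) * cos (pi*\<alpha>/2)))"
proof -
  have G: "Gamma (\<alpha>+1) > 0" using a by auto
  have cp: "0 < cos (pi*\<alpha>/2)" using a by (intro cos_gt_zero) auto
  have sc: "sin (pi*(\<alpha>+1)/2) = cos (pi*\<alpha>/2)"
  proof -
    have "pi*(\<alpha>+1)/2 = pi*\<alpha>/2 + pi/2" by (simp add: distrib_left add_divide_distrib)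
    then show ?thesis by (simp only: sin_add cos_pi_half sin_pi_half)
  qed
  let ?f = "\<lambda>x s. complex_of_real (indicator {0<..} x * (indicator {0<..} s * (sin (\<xi> * x) * (s powr \<alpha> * exp (- (s * x))))))"
  have inner: "(\<integral>\<^sup>+s\<in>{0<..}. ennreal (s powr \<alpha> * exp (- (s * x))) \<partial>lborel) = ennreal (Gamma (\<alpha>+1) * x powr (-(\<alpha>+1)))" if "0 < x" for x
    using nn_integral_Gamma_scaled[of "\<alpha>+1" x] a that by simp
  have fin0: "(\<integral>\<^sup>+x. ennreal (norm (indicator {0<..} x * (sin (\<xi> * x) * x powr (-(\<alpha>+1))))) \<partial>lborel) < \<infinity>"
  proof -
    have "(\<integral>\<^sup>+x. ennreal (norm (indicator {0<..} x * (sin (\<xi> * x) * x powr (-(\<alpha>+1))))) \<partial>lborel)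
       \<le> (\<integral>\<^sup>+x\<in>{0<..}. ennreal 2 * ennreal (x powr (-\<alpha>) / (x + 1/\<bar>\<xi>\<bar>)) \<partial>lborel)"
    proof (rule nn_integral_mono)
      fix y :: real
      show "ennreal (norm (indicator {0<..} y * (sin (\<xi> * y) * y powr (-(\<alpha>+1))))) \<le> ennreal 2 * ennreal (y powr (-\<alpha>) / (y + 1/\<bar>\<xi>\<bar>)) * indicator {0<..} y"
      proof (cases "0 < y")
        case True
        have "\<bar>sin (\<xi> * y)\<bar> = \<bar>sin (\<bar>\<xi>\<bar> * y)\<bar>" by (cases "0 \<le> \<xi>") auto
        also have "\<dots> \<le> 2 * (\<bar>\<xi>\<bar> * y) / (1 + \<bar>\<xi>\<bar> * y)" using True by (intro abs_sin_le_fraction) auto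
        finally have "\<bar>sin (\<xi> * y)\<bar> * y powr (-(\<alpha>+1)) \<le> 2 * (\<bar>\<xi>\<bar> * y) / (1 + \<bar>\<xi>\<bar> * y) * y powr (-(\<alpha>+1))"
          by (intro mult_right_mono) auto
        also have "\<dots> = 2 * (y powr (-\<alpha>) / (y + 1/\<bar>\<xi>\<bar>))"
        proof -
          have p: "y * y powr (-(\<alpha>+1)) = y powr (-\<alpha>)" using True by (simp add: powr_diff powr_minus field_simps powr_add)
          have d: "\<bar>\<xi>\<bar> / (1 + \<bar>\<xi>\<bar> * y) = 1 / (y + 1/\<bar>\<xi>\<bar>)" using True x by (simp add: divide_simps) (simp add: ac_simps)
          have "2 * (\<bar>\<xi>\<bar> * y) / (1 + \<bar>\<xi>\<bar> * y) * y powr (-(\<alpha>+1)) = 2 * ((y * y powr (-(\<alpha>+1))) * (\<bar>\<xi>\<bar> / (1 + \<bar>\<xi>\<bar> * y)))" by simp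
          also have "\<dots> = 2 * (y powr (-\<alpha>) / (y + 1/\<bar>\<xi>\<bar>))" unfolding p d by simp
          finally show ?thesis .
        qed
        finally show ?thesis using True by (simp add: ennreal_mult'[symmetric] abs_mult ennreal_leI del: ennreal_numeral)
      qed simp
    qed
    also have "\<dots> = ennreal 2 * ennreal (pi / sin (pi*\<alpha>) * (1/\<bar>\<xi>\<bar>) powr (-\<alpha>))"
      using nn_integral_Stieltjes_powr[OF a, of "1/\<bar>\<xi>\<bar>"] x by (subst set_nn_integral_cmult) auto
    also have "\<dots> < \<infinity>" by (simp add: ennreal_mult_less_top del: ennreal_numeral)
    finally show ?thesis .
  qed
  then show int: "integrable lborel (\<lambda>x. indicator {0<..} x * (sin (\<xi> * x) * x powr (-(\<alpha>+1))))"
    by (intro integrableI_bounded) auto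
  have fin: "(\<integral>\<^sup>+x. (\<integral>\<^sup>+s. ennreal (norm (?f x s)) \<partial>lborel) \<partial>lborel) < \<infinity>"
  proof -
    have "(\<integral>\<^sup>+s. ennreal (norm (?f x s)) \<partial>lborel) = ennreal (Gamma (\<alpha>+1)) * ennreal (norm (indicator {0<..} x * (sin (\<xi> * x) * x powr (-(\<alpha>+1)))))" for x
    proof (cases "0 < x")
      case True
      have "(\<integral>\<^sup>+s. ennreal (norm (?f x s)) \<partial>lborel) = (\<integral>\<^sup>+s\<in>{0<..}. ennreal \<bar>sin (\<xi> * x)\<bar> * ennreal (s powr \<alpha> * exp (- (s * x))) \<partial>lborel)"
        using True by (intro nn_integral_cong) (auto simp: indicator_def abs_mult norm_mult ennreal_mult'[symmetric])
      also have "\<dots> = ennreal \<bar>sin (\<xi> * x)\<bar> * ennreal (Gamma (\<alpha>+1) * x powr (-(\<alpha>+1)))"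
        by (subst set_nn_integral_cmult) (auto simp: inner[OF True, unfolded minus_add_distrib] inner[OF True])
      finally show ?thesis using True G by (simp add: ennreal_mult'[symmetric] abs_mult mult_ac)
    qed simp
    then show ?thesis using fin0 by (simp add: nn_integral_cmult ennreal_mult_less_top)
  qed
  have "complex_of_real (Gamma (\<alpha>+1) * (\<integral>x. indicator {0<..} x * (sin (\<xi> * x) * x powr (-(\<alpha>+1))) \<partial>lborel))
     = (CLINT x|lborel. (CLINT s|lborel. ?f x s))"
  proof -
    have "(CLINT s|lborel. ?f x s) = complex_of_real (Gamma (\<alpha>+1) * (indicator {0<..} x * (sin (\<xi> * x) * x powr (-(\<alpha>+1)))))" for x
    proof (cases "0 < x")
      case True
      have "(\<integral>s. indicator {0<..} s * (s powr \<alpha> * exp (- (s * x))) \<partial>lborel) = Gamma (\<alpha>+1) * x powr (-(\<alpha>+1))"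
      proof (rule integral_eq_nn_integral[THEN trans])
        have "(\<integral>\<^sup>+s. ennreal (indicator {0<..} s * (s powr \<alpha> * exp (- (s * x)))) \<partial>lborel) = ennreal (Gamma (\<alpha>+1) * x powr (-(\<alpha>+1)))"
          unfolding inner[OF True, symmetric] by (intro nn_integral_cong) (auto simp: indicator_def)
        then show "enn2real (\<integral>\<^sup>+s. ennreal (indicator {0<..} s * (s powr \<alpha> * exp (- (s * x)))) \<partial>lborel) = Gamma (\<alpha>+1) * x powr (-(\<alpha>+1))"
          using G by simp
      qed auto
      moreover have "(CLINT s|lborel. ?f x s) = complex_of_real (sin (\<xi> * x) * (\<integral>s. indicator {0<..} s * (s powr \<alpha> * exp (- (s * x))) \<partial>lborel))"
        using True by (simp only: integral_complex_of_real integral_mult_right_zero[symmetric]) (simp add: mult_ac)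
      ultimately show ?thesis using True by (simp add: mult_ac)
    qed simp
    then show ?thesis by (simp only: integral_complex_of_real integral_mult_right_zero)
  qed
  also have "\<dots> = (CLINT s|lborel. (CLINT x|lborel. ?f x s))"
    by (rule lborel_pair.Fubini_integral_bounded(2)[OF _ fin]) measurable
  also have "\<dots> = complex_of_real (\<integral>s. indicator {0<..} s * (\<xi> * (s powr (\<alpha>+1-1) / (s\<^sup>2 + \<xi>\<^sup>2))) \<partial>lborel)"
  proof -
    have "(CLINT x|lborel. ?f x s) = complex_of_real (indicator {0<..} s * (\<xi> * (s powr (\<alpha>+1-1) / (s\<^sup>2 + \<xi>\<^sup>2))))" for s
    proof (cases "0 < s")
      case True
      have "(CLINT x|lborel. ?f x s) = complex_of_real (s powr \<alpha> * (\<integral>x. indicator {0<..} x * (sin (\<xi> * x) * exp (- (s * x))) \<partial>lborel))"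
        using True by (simp only: integral_complex_of_real integral_mult_right_zero[symmetric]) (simp add: mult_ac)
      then show ?thesis unfolding nn_integral_one_minus_cos_exp(3)[OF True] using True by simp
    qed simp
    then show ?thesis by (simp only: integral_complex_of_real)
  qed
  also have "(\<integral>s. indicator {0<..} s * (\<xi> * (s powr (\<alpha>+1-1) / (s\<^sup>2 + \<xi>\<^sup>2))) \<partial>lborel)
     = \<xi> * (\<bar>\<xi>\<bar> powr (\<alpha>+1-2) * (pi / (2 * sin (pi*(\<alpha>+1)/2))))"
  proof -
    have "(\<integral>s. indicator {0<..} s * (s powr (\<alpha>+1-1) / (s\<^sup>2 + \<xi>\<^sup>2)) \<partial>lborel) = \<bar>\<xi>\<bar> powr (\<alpha>+1-2) * (pi / (2 * sin (pi*(\<alpha>+1)/2)))"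
    proof (rule integral_eq_nn_integral[THEN trans])
      have "(\<integral>\<^sup>+s. ennreal (indicator {0<..} s * (s powr (\<alpha>+1-1) / (s\<^sup>2 + \<xi>\<^sup>2))) \<partial>lborel) = ennreal (\<bar>\<xi>\<bar> powr (\<alpha>+1-2) * (pi / (2 * sin (pi*(\<alpha>+1)/2))))"
        using a by (subst nn_integral_powr_square[OF _ _ x, symmetric]) (auto intro!: nn_integral_cong simp: indicator_def)
      then show "enn2real (\<integral>\<^sup>+s. ennreal (indicator {0<..} s * (s powr (\<alpha>+1-1) / (s\<^sup>2 + \<xi>\<^sup>2))) \<partial>lborel) = \<bar>\<xi>\<bar> powr (\<alpha>+1-2) * (pi / (2 * sin (pi*(\<alpha>+1)/2)))"
        unfolding sc using cp by simp
    qed auto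
    moreover have "(\<integral>s. indicator {0<..} s * (\<xi> * (s powr (\<alpha>+1-1) / (s\<^sup>2 + \<xi>\<^sup>2))) \<partial>lborel)
       = \<xi> * (\<integral>s. indicator {0<..} s * (s powr (\<alpha>+1-1) / (s\<^sup>2 + \<xi>\<^sup>2)) \<partial>lborel)"
      by (subst integral_mult_right_zero[symmetric]) (simp only: mult.left_commute)
    ultimately show ?thesis by (simp only:)
  qed
  finally have 1: "Gamma (\<alpha>+1) * (\<integral>x. indicator {0<..} x * (sin (\<xi> * x) * x powr (-(\<alpha>+1))) \<partial>lborel)
     = \<xi> * (\<bar>\<xi>\<bar> powr (\<alpha>+1-2) * (pi / (2 * cos (pi*\<alpha>/2))))"
    unfolding sc of_real_eq_iff .
  have p: "\<bar>\<xi>\<bar> powr (\<alpha>+1-2) = \<bar>\<xi>\<bar> powr \<alpha> / \<bar>\<xi>\<bar>" using x by (simp add: powr_diff)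
  have "\<xi> * (\<bar>\<xi>\<bar> powr (\<alpha>+1-2) * (pi / (2 * cos (pi*\<alpha>/2)))) = Gamma (\<alpha>+1) * (sgn \<xi> * \<bar>\<xi>\<bar> powr \<alpha> * (pi / (2 * Gamma (\<alpha>+1) * cos (pi*\<alpha>/2))))"
    unfolding p using x G by (cases "0 < \<xi>") auto
  with 1 have "Gamma (\<alpha>+1) * (\<integral>x. indicator {0<..} x * (sin (\<xi> * x) * x powr (-(\<alpha>+1))) \<partial>lborel)
     = Gamma (\<alpha>+1) * (sgn \<xi> * \<bar>\<xi>\<bar> powr \<alpha> * (pi / (2 * Gamma (\<alpha>+1) * cos (pi*\<alpha>/2))))"
    by (rule trans)
  then show "(\<integral>x. indicator {0<..} x * (sin (\<xi> * x) * x powr (-(\<alpha>+1))) \<partial>lborel)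
      = sgn \<xi> * \<bar>\<xi>\<bar> powr \<alpha> * (pi / (2 * Gamma (\<alpha>+1) * cos (pi*\<alpha>/2)))"
    using G by (simp only: mult_cancel_left) auto
qed

lemma c_plus_eq:
  assumes "0 < \<alpha>" "0 < \<alpha> * \<rho>" "\<alpha> * \<rho> < 1"
  shows "c_plus \<alpha> \<rho> = Gamma (\<alpha>+1) * (sin (pi * (\<alpha> * \<rho>)) / pi)"
  unfolding c_plus_def sin_pi_over_pi_eq_Gamma[OF assms(2,3)] by simp

lemma c_minus_eq:
  assumes "0 < \<alpha>" "0 < \<alpha> * (1-\<rho>)" "\<alpha> * (1-\<rho>) < 1"
  shows "c_minus \<alpha> \<rho> = Gamma (\<alpha>+1) * (sin (pi * (\<alpha> * (1-\<rho>))) / pi)"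
  unfolding c_minus_def sin_pi_over_pi_eq_Gamma[OF assms(2,3)] by simp

lemma borel_measurable_levy_density [measurable]: "levy_density \<alpha> \<rho> \<in> borel_measurable borel"
  unfolding levy_density_def by measurable

lemma integrable_powr_tail:
  fixes \<alpha> \<epsilon> :: real
  assumes a: "0 < \<alpha>" and e: "0 < \<epsilon>"
  shows "integrable lborel (\<lambda>x. indicator {\<epsilon><..} x * x powr (-(\<alpha>+1)))"
proof (rule integrableI_bounded)
  have "(\<integral>\<^sup>+x. ennreal (norm (indicator {\<epsilon><..} x * x powr (-(\<alpha>+1)))) \<partial>lborel) \<le> (\<integral>\<^sup>+x. ennreal (x powr (-(\<alpha>+1))) * indicator {\<epsilon>..} x \<partial>lborel)"
    by (intro nn_integral_mono) (auto simp: indicator_def)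
  also have "\<dots> = ennreal (0 - (- (\<epsilon> powr (-\<alpha>) / \<alpha>)))"
  proof (rule nn_integral_FTC_atLeast)
    fix x assume "\<epsilon> \<le> x"
    then have x: "0 < x" using e by simp
    have "((\<lambda>x. - (x powr (-\<alpha>) / \<alpha>)) has_real_derivative - ((-\<alpha>) * x powr (-\<alpha>-1) / \<alpha>)) (at x)"
      using x a by (intro DERIV_minus DERIV_cdivide has_real_derivative_powr) auto
    moreover have "- ((-\<alpha>) * x powr (-\<alpha>-1) / \<alpha>) = x powr (-(\<alpha>+1))" using a by simp
    ultimately show "((\<lambda>x. - (x powr (-\<alpha>) / \<alpha>)) has_real_derivative x powr (-(\<alpha>+1))) (at x)" by simp
  next
    have "((\<lambda>x. - (x powr (-\<alpha>) / \<alpha>)) \<longlongrightarrow> - (0 / \<alpha>)) at_top"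
      using a by (intro tendsto_minus tendsto_divide tendsto_const tendsto_neg_powr filterlim_ident) auto
    then show "((\<lambda>x. - (x powr (-\<alpha>) / \<alpha>)) \<longlongrightarrow> 0) at_top" by simp
  qed auto
  also have "\<dots> < \<infinity>" by simp
  finally show "(\<integral>\<^sup>+x. ennreal (norm (indicator {\<epsilon><..} x * x powr (-(\<alpha>+1)))) \<partial>lborel) < \<infinity>" .
qed measurable

text \<open>Reflecting the negative half-line turns the truncated integral into one over the
  positive half-line, with real part \<open>(P + Q) * (1 - cos)\<close> and imaginary part
  \<open>- (P - Q) * sin\<close> against the power. The normalisation makes \<open>P\<close> and
  \<open>Q\<close> proportional to \<open>sin (pi*a)\<close> and \<open>sin (pi*b)\<close>, so
  sum-to-product formulas yield the angle \<open>pi*(a-b)/2\<close>.\<close>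

lemma char_exponent_eq:
  fixes \<alpha> \<rho> \<xi> :: real
  defines "a \<equiv> \<alpha> * \<rho>" and "b \<equiv> \<alpha> * (1 - \<rho>)"
  assumes adm: "admissible \<alpha> \<rho>" and \<alpha>1: "\<alpha> \<le> 1"
  shows "char_exponent \<alpha> \<rho> \<xi> = complex_of_real (\<bar>\<xi>\<bar> powr \<alpha>) *
    (complex_of_real (cos (pi*(a-b)/2)) - \<i> * complex_of_real (sgn \<xi> * sin (pi*(a-b)/2)))"
proof (cases "\<xi> = 0")
  case True
  then show ?thesis by (simp add: char_exponent_def tendsto_Lim)
next
  case False
  have \<alpha>: "0 < \<alpha>" and ab0: "0 < a" "0 < b" and ab: "a + b = \<alpha>"
    using adm \<alpha>1 by (auto simp: admissible_def a_def b_def algebra_simps)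
  have a1: "a < 1" and b1: "b < 1" using ab ab0 \<alpha>1 by auto
  define P where "P = c_plus \<alpha> \<rho>"
  define Q where "Q = c_minus \<alpha> \<rho>"
  have G: "0 < Gamma (\<alpha>+1)" using \<alpha> by simp
  have Peq: "P = Gamma (\<alpha>+1) * (sin (pi*a) / pi)"
    unfolding P_def a_def by (rule c_plus_eq) (use \<alpha> ab0 a1 in \<open>simp_all only: a_def\<close>)
  have Qeq: "Q = Gamma (\<alpha>+1) * (sin (pi*b) / pi)"
    unfolding Q_def b_def by (rule c_minus_eq) (use \<alpha> ab0 b1 in \<open>simp_all only: b_def\<close>)
  have PQ: "0 \<le> P" "0 \<le> Q"
    unfolding Peq Qeq using G sin_pi_pos[OF ab0(1) a1] sin_pi_pos[OF ab0(2) b1] by auto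
  define g1 where "g1 = (\<lambda>x. indicator {0<..} x * ((1 - cos (\<xi> * x)) * x powr (-(\<alpha>+1))))"
  define g2 where "g2 = (\<lambda>x. (P - Q) * (indicator {0<..} x * (sin (\<xi> * x) * x powr (-(\<alpha>+1)))))"
  define Gx where "Gx = (\<lambda>x. complex_of_real ((P + Q) * g1 x) - \<i> * complex_of_real (g2 x))"
  have nn1: "(\<integral>\<^sup>+x. ennreal (g1 x) \<partial>lborel) = ennreal (\<bar>\<xi>\<bar> powr \<alpha> * (pi / (2 * Gamma (\<alpha>+1) * sin (pi*\<alpha>/2))))"
    using \<alpha> \<alpha>1 False by (subst nn_integral_one_minus_cos_powr[symmetric]) (auto simp: g1_def indicator_def intro!: nn_integral_cong)
  have g1_nn: "0 \<le> g1 x" for x by (simp add: g1_def)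
  have [measurable]: "g1 \<in> borel_measurable borel" "g2 \<in> borel_measurable borel" unfolding g1_def g2_def by measurable
  have sp: "0 < sin (pi*\<alpha>/2)" using \<alpha> \<alpha>1 by (intro sin_gt_zero) auto
  have g1: "integrable lborel g1" "(\<integral>x. g1 x \<partial>lborel) = \<bar>\<xi>\<bar> powr \<alpha> * (pi / (2 * Gamma (\<alpha>+1) * sin (pi*\<alpha>/2)))"
  proof -
    show "integrable lborel g1" using nn1 g1_nn by (intro integrableI_nonneg) auto
    show "(\<integral>x. g1 x \<partial>lborel) = \<bar>\<xi>\<bar> powr \<alpha> * (pi / (2 * Gamma (\<alpha>+1) * sin (pi*\<alpha>/2)))"
      using g1_nn G sp by (subst integral_eq_nn_integral) (auto simp: nn1)
  qed
  have g2: "integrable lborel g2" "(\<integral>x. g2 x \<partial>lborel) = sgn \<xi> * \<bar>\<xi>\<bar> powr \<alpha> * sin (pi*(a-b)/2)"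
  proof -
    have "integrable lborel g2 \<and> (\<integral>x. g2 x \<partial>lborel) = sgn \<xi> * \<bar>\<xi>\<bar> powr \<alpha> * sin (pi*(a-b)/2)"
    proof (cases "\<alpha> = 1")
      \<comment> \<open>For exponent one the process is symmetric: \<open>P = Q\<close>, and the
        sine part, which would not converge absolutely, is multiplied by zero.\<close>
      case True
      then have "\<rho> = 1/2" using adm by (auto simp: admissible_def)
      then have "a = b" by (simp add: a_def b_def)
      then show ?thesis by (simp add: g2_def Peq Qeq)
    next
      case False
      then have a': "\<alpha> < 1" using \<alpha>1 by simp
      have cp: "0 < cos (pi*\<alpha>/2)" using \<alpha> a' by (intro cos_gt_zero) auto
      note S = integral_sin_powr[OF \<alpha> a' \<open>\<xi> \<noteq> 0\<close>]
      have "(\<integral>x. g2 x \<partial>lborel) = (P - Q) * (sgn \<xi> * \<bar>\<xi>\<bar> powr \<alpha> * (pi / (2 * Gamma (\<alpha>+1) * cos (pi*\<alpha>/2))))"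
        unfolding g2_def integral_mult_right_zero S(2) ..
      also have "P - Q = Gamma (\<alpha>+1) / pi * (2 * sin (pi*(a-b)/2) * cos (pi*\<alpha>/2))"
      proof -
        have "sin (pi*a) - sin (pi*b) = 2 * sin ((pi*a - pi*b)/2) * cos ((pi*a + pi*b)/2)" by (rule sin_diff_sin)
        also have "(pi*a - pi*b)/2 = pi*(a-b)/2" by (simp add: right_diff_distrib)
        also have "(pi*a + pi*b)/2 = pi*\<alpha>/2" by (simp add: ab[symmetric] distrib_left)
        finally have s: "sin (pi*a) - sin (pi*b) = 2 * sin (pi*(a-b)/2) * cos (pi*\<alpha>/2)" .
        have "P - Q = Gamma (\<alpha>+1) / pi * (sin (pi*a) - sin (pi*b))" unfolding Peq Qeq by (simp add: algebra_simps)
        then show ?thesis unfolding s .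
      qed
      finally have "(\<integral>x. g2 x \<partial>lborel) = sgn \<xi> * \<bar>\<xi>\<bar> powr \<alpha> * sin (pi*(a-b)/2)" using G cp by (simp add: field_simps)
      moreover have "integrable lborel g2" unfolding g2_def using S(1) by (rule integrable_mult_right)
      ultimately show ?thesis by blast
    qed
    then show "integrable lborel g2" "(\<integral>x. g2 x \<partial>lborel) = sgn \<xi> * \<bar>\<xi>\<bar> powr \<alpha> * sin (pi*(a-b)/2)" by auto
  qed
  have Gint: "integrable lborel Gx"
    unfolding Gx_def by (intro Bochner_Integration.integrable_diff integrable_mult_right integrable_of_real g1 g2)
  have Gval: "(CLINT x|lborel. Gx x) = complex_of_real (\<bar>\<xi>\<bar> powr \<alpha>) *
    (complex_of_real (cos (pi*(a-b)/2)) - \<i> * complex_of_real (sgn \<xi> * sin (pi*(a-b)/2)))"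
  proof -
    have "(CLINT x|lborel. Gx x) = (CLINT x|lborel. complex_of_real ((P + Q) * g1 x)) - (CLINT x|lborel. \<i> * complex_of_real (g2 x))"
      unfolding Gx_def by (intro Bochner_Integration.integral_diff integrable_mult_right integrable_of_real g1 g2)
    also have "\<dots> = complex_of_real ((P + Q) * (\<integral>x. g1 x \<partial>lborel)) - \<i> * complex_of_real (\<integral>x. g2 x \<partial>lborel)"
      by (simp only: integral_mult_right_zero integral_complex_of_real)
    also have "(P + Q) * (\<integral>x. g1 x \<partial>lborel) = \<bar>\<xi>\<bar> powr \<alpha> * cos (pi*(a-b)/2)"
    proof -
      have "sin (pi*a) + sin (pi*b) = 2 * sin ((pi*a + pi*b)/2) * cos ((pi*a - pi*b)/2)" by (rule sin_plus_sin)
      also have "(pi*a - pi*b)/2 = pi*(a-b)/2" by (simp add: right_diff_distrib)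
      also have "(pi*a + pi*b)/2 = pi*\<alpha>/2" by (simp add: ab[symmetric] distrib_left)
      finally have s: "sin (pi*a) + sin (pi*b) = 2 * sin (pi*\<alpha>/2) * cos (pi*(a-b)/2)" .
      have e: "P + Q = Gamma (\<alpha>+1) / pi * (sin (pi*a) + sin (pi*b))" unfolding Peq Qeq by (simp add: algebra_simps)
      show ?thesis unfolding e s g1(2) using G sp by simp
    qed
    finally show ?thesis unfolding g2(2) by (simp add: algebra_simps)
  qed
  let ?f = "\<lambda>\<epsilon> x. indicator {x. \<epsilon> < \<bar>x\<bar>} x * complex_of_real (levy_density \<alpha> \<rho> x) * (1 - iexp (\<xi> * x))"
  \<comment> \<open>The truncation is symmetric, so the reflection is exact for every
    \<open>\<epsilon>\<close>.\<close>
  have cut: "(CLINT x|lborel. ?f \<epsilon> x) = (CLINT x|lborel. indicator {\<epsilon><..} x *\<^sub>R Gx x)" if e: "0 < \<epsilon>" for \<epsilon> :: real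
  proof -
    have [measurable]: "{x :: real. \<epsilon> < \<bar>x\<bar>} \<in> sets borel" by measurable
    have [measurable]: "?f \<epsilon> \<in> borel_measurable borel" by measurable
    have int: "integrable lborel (?f \<epsilon>)"
    proof (rule Bochner_Integration.integrable_bound)
      let ?t = "\<lambda>x. indicator {\<epsilon><..} x * x powr (-(\<alpha>+1))"
      show "integrable lborel (\<lambda>x. 2 * (P + Q) * (?t x + ?t (0 + (-1) * x)))"
        using integrable_powr_tail[OF \<alpha> e]
        by (intro integrable_mult_right Bochner_Integration.integrable_add lborel_integrable_real_affine) auto
      show "AE x in lborel. norm (?f \<epsilon> x) \<le> norm (2 * (P + Q) * (?t x + ?t (0 + (-1) * x)))"
      proof (rule AE_I2)
        fix x :: real
        have i2: "norm (1 - iexp (\<xi> * x)) \<le> 2"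
          by (rule order_trans[OF norm_triangle_ineq4]) simp
        show "norm (?f \<epsilon> x) \<le> norm (2 * (P + Q) * (?t x + ?t (0 + (-1) * x)))"
        proof (cases "\<epsilon> < \<bar>x\<bar>")
          case True
          have L: "\<bar>levy_density \<alpha> \<rho> x\<bar> \<le> (P + Q) * \<bar>x\<bar> powr (-(\<alpha>+1))"
            using PQ True e by (auto simp: levy_density_def P_def[symmetric] Q_def[symmetric] abs_mult intro!: mult_right_mono)
          have "norm (?f \<epsilon> x) = \<bar>levy_density \<alpha> \<rho> x\<bar> * norm (1 - iexp (\<xi> * x))" using True by (simp add: norm_mult)
          also have "\<dots> \<le> ((P + Q) * \<bar>x\<bar> powr (-(\<alpha>+1))) * 2"
            using L i2 PQ by (intro mult_mono) auto
          also have "\<dots> = norm (2 * (P + Q) * (?t x + ?t (0 + (-1) * x)))"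
            using True e PQ by (cases "0 < x") (auto simp: indicator_def abs_mult)
          finally show ?thesis .
        qed simp
      qed
    qed measurable
    let ?p = "\<lambda>x. indicator {0<..} x *\<^sub>R ?f \<epsilon> x" and ?n = "\<lambda>x. indicator {..<0} x *\<^sub>R ?f \<epsilon> x"
    have pint: "integrable lborel ?p" and nint: "integrable lborel ?n"
      using int by (auto intro!: integrable_mult_indicator)
    have "(CLINT x|lborel. ?f \<epsilon> x) = (CLINT x|lborel. ?p x + ?n x)"
      using e by (intro Bochner_Integration.integral_cong refl) (auto simp: indicator_def)
    also have "\<dots> = (CLINT x|lborel. ?p x) + (CLINT x|lborel. ?n x)"
      by (rule Bochner_Integration.integral_add[OF pint nint])
    also have "(CLINT x|lborel. ?n x) = (CLINT x|lborel. ?n (0 + (-1) * x))"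
      by (subst lborel_integral_real_affine[where c="-1" and t=0]) auto
    also have "(CLINT x|lborel. ?p x) + (CLINT x|lborel. ?n (0 + (-1) * x)) = (CLINT x|lborel. ?p x + ?n (0 + (-1) * x))"
      by (rule Bochner_Integration.integral_add[symmetric, OF pint]) (rule lborel_integrable_real_affine[OF nint], simp)
    also have "\<dots> = (CLINT x|lborel. indicator {\<epsilon><..} x *\<^sub>R Gx x)"
    proof (intro Bochner_Integration.integral_cong refl)
      fix x :: real
      have ie: "iexp (\<xi> * x) = complex_of_real (cos (\<xi> * x)) + \<i> * complex_of_real (sin (\<xi> * x))"
        "iexp (\<xi> * (-x)) = complex_of_real (cos (\<xi> * x)) - \<i> * complex_of_real (sin (\<xi> * x))"
        by (simp_all only: cis_conv_exp[symmetric]) (simp_all add: complex_eq_iff)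
      show "?p x + ?n (0 + (-1) * x) = indicator {\<epsilon><..} x *\<^sub>R Gx x"
      proof (cases "\<epsilon> < x")
        case True
        then have x: "0 < x" "\<epsilon> < \<bar>x\<bar>" using e by auto
        have "?p x + ?n (0 + (-1) * x) = complex_of_real (P * x powr (-(\<alpha>+1))) * (1 - iexp (\<xi> * x)) + complex_of_real (Q * x powr (-(\<alpha>+1))) * (1 - iexp (\<xi> * (-x)))"
          using x True e by (simp add: levy_density_def P_def Q_def)
        also have "\<dots> = Gx x"
          unfolding ie using x by (simp add: Gx_def g1_def g2_def algebra_simps)
        finally show ?thesis using True by simp
      next
        case False
        then show ?thesis using e by (auto simp: indicator_def)
      qed
    qed
    finally show ?thesis .
  qed
  have "((\<lambda>\<epsilon>. CLINT x|lborel. ?f \<epsilon> x) \<longlongrightarrow> (CLINT x|lborel. Gx x)) (at_right 0)"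
  \<comment> \<open>Along sequences dominated convergence applies, with the norm of
    \<open>Gx\<close> dominating every truncation.\<close>
  proof (rule tendsto_at_right_sequentially[of 0 1])
    fix S :: "nat \<Rightarrow> real" assume S: "\<And>n. 0 < S n" "S \<longlonglongrightarrow> 0"
    have "(\<lambda>n. CLINT x|lborel. indicator {S n<..} x *\<^sub>R Gx x) \<longlonglongrightarrow> (CLINT x|lborel. Gx x)"
    proof (rule integral_dominated_convergence[where w="\<lambda>x. norm (Gx x)"])
      show "AE x in lborel. (\<lambda>n. indicator {S n<..} x *\<^sub>R Gx x) \<longlonglongrightarrow> Gx x"
      proof (rule AE_I2)
        fix x :: real
        show "(\<lambda>n. indicator {S n<..} x *\<^sub>R Gx x) \<longlonglongrightarrow> Gx x"
        proof (cases "0 < x")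
          case True
          have "\<forall>\<^sub>F n in sequentially. S n < x" using S(2) True by (rule order_tendstoD)
          then have "\<forall>\<^sub>F n in sequentially. indicator {S n<..} x *\<^sub>R Gx x = Gx x"
            by eventually_elim simp
          then show ?thesis by (rule tendsto_eventually)
        next
          case False
          then have "Gx x = 0" by (simp add: Gx_def g1_def g2_def)
          then show ?thesis by simp
        qed
      qed
    qed (use Gint in \<open>auto simp: indicator_def intro!: integrable_norm\<close>)
    then show "(\<lambda>n. CLINT x|lborel. ?f (S n) x) \<longlonglongrightarrow> (CLINT x|lborel. Gx x)"
      unfolding cut[OF S(1)] .
  qed simp
  then have "char_exponent \<alpha> \<rho> \<xi> = (CLINT x|lborel. Gx x)"
    unfolding char_exponent_def by (intro tendsto_Lim) auto
  then show ?thesis unfolding Gval .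
qed

section \<open>Occupation densities for exponents below one\<close>

lemma levy_process_if_stable:
  assumes "stable_levy_process M X \<alpha> \<rho>"
  shows "levy_process M X (char_exponent \<alpha> \<rho>)"
proof -
  interpret prob_space M using assms by (simp add: stable_levy_process_def)
  show ?thesis
    by unfold_locales (use assms in \<open>auto simp: stable_levy_process_def continuous_within\<close>)
qed

text \<open>Brings the norm bound for the transform of an exponential into the form of a Stieltjes
  integrand.\<close>

lemma inverse_sqrt_sum_squares_le:
  fixes l \<xi> :: real
  assumes "0 < l" "\<xi> \<noteq> 0"
  shows "1 / sqrt (l\<^sup>2 + \<xi>\<^sup>2) \<le> 2 / (l + \<bar>\<xi>\<bar>)"
proof -
  have s: "2 * l * \<bar>\<xi>\<bar> \<le> l\<^sup>2 + \<xi>\<^sup>2" using sum_squares_bound[of l "\<bar>\<xi>\<bar>"] by simp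
  have "(l + \<bar>\<xi>\<bar>)\<^sup>2 = l\<^sup>2 + \<xi>\<^sup>2 + 2 * l * \<bar>\<xi>\<bar>" by (simp add: power2_sum)
  also have "\<dots> \<le> 4 * (l\<^sup>2 + \<xi>\<^sup>2)"
  proof -
    have "q + p \<le> 4 * q" if "p \<le> q" "0 \<le> q" for p q :: real using that by simp
    from this[OF s] show ?thesis by simp
  qed
  also have "\<dots> = (2 * sqrt (l\<^sup>2 + \<xi>\<^sup>2))\<^sup>2" by (simp add: power_mult_distrib)
  finally have "(l + \<bar>\<xi>\<bar>)\<^sup>2 \<le> (2 * sqrt (l\<^sup>2 + \<xi>\<^sup>2))\<^sup>2" .
  then have "l + \<bar>\<xi>\<bar> \<le> 2 * sqrt (l\<^sup>2 + \<xi>\<^sup>2)" by (rule power2_le_imp_le) simp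
  moreover have "0 < sqrt (l\<^sup>2 + \<xi>\<^sup>2)" using assms by (simp add: add_pos_nonneg)
  ultimately show ?thesis using assms by (simp add: field_simps)
qed

text \<open>The constants of the real and imaginary parts in the transform of the potential density;
  sum-to-product formulas make them the cosine and sine of the angle of the exponent.\<close>

lemma stable_fourier_constants:
  fixes a b :: real
  assumes a: "0 < a" and b: "0 < b" and ab: "a + b < 1"
  shows "(sin (pi*a) + sin (pi*b)) / pi * (pi / (2 * sin (pi*(2-(a+b))/2))) = cos (pi*(a-b)/2)"
    and "(sin (pi*a) - sin (pi*b)) / pi * (pi / (2 * sin (pi*(1-(a+b))/2))) = sin (pi*(a-b)/2)"
    and "0 < cos (pi*(a-b)/2)"
proof -
  have sp: "0 < sin (pi*(a+b)/2)" using a b ab by (intro sin_gt_zero) auto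
  have cp: "0 < cos (pi*(a+b)/2)" using a b ab by (intro cos_gt_zero) auto
  have e1: "sin (pi*(2-(a+b))/2) = sin (pi*(a+b)/2)"
  proof -
    have "pi*(2-(a+b))/2 = pi - pi*(a+b)/2" by (simp add: field_simps)
    then show ?thesis by (simp only: sin_pi_minus)
  qed
  have e2: "sin (pi*(1-(a+b))/2) = cos (pi*(a+b)/2)"
  proof -
    have "pi*(1-(a+b))/2 = pi/2 - pi*(a+b)/2" by (simp add: field_simps)
    then show ?thesis by (simp only: sin_diff sin_pi_half cos_pi_half mult_1 mult_zero_left diff_zero)
  qed
  have p: "sin (pi*a) + sin (pi*b) = 2 * sin (pi*(a+b)/2) * cos (pi*(a-b)/2)"
    using sin_plus_sin[of "pi*a" "pi*b"] by (simp only: distrib_left right_diff_distrib)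
  have m: "sin (pi*a) - sin (pi*b) = 2 * sin (pi*(a-b)/2) * cos (pi*(a+b)/2)"
    using sin_diff_sin[of "pi*a" "pi*b"] by (simp only: distrib_left right_diff_distrib)
  show "(sin (pi*a) + sin (pi*b)) / pi * (pi / (2 * sin (pi*(2-(a+b))/2))) = cos (pi*(a-b)/2)"
    unfolding e1 p using sp by simp
  show "(sin (pi*a) - sin (pi*b)) / pi * (pi / (2 * sin (pi*(1-(a+b))/2))) = sin (pi*(a-b)/2)"
    unfolding e2 m using cp by simp
  have ab': "- 1 < a - b" "a - b < 1" using a b ab by auto
  have "pi * (-1) < pi * (a-b)" "pi * (a-b) < pi * 1"
    by (rule mult_strict_left_mono[OF ab'(1) pi_gt_zero], rule mult_strict_left_mono[OF ab'(2) pi_gt_zero])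
  then have "- (pi/2) < pi*(a-b)/2" "pi*(a-b)/2 < pi/2" by simp_all
  then show "0 < cos (pi*(a-b)/2)" by (rule cos_gt_zero_pi)
qed

lemma integral_powr_square:
  fixes \<beta> \<xi> :: real
  assumes b: "0 < \<beta>" "\<beta> < 2" and x: "\<xi> \<noteq> 0"
  shows "integrable lborel (\<lambda>s. indicator {0<..} s * (s powr (\<beta>-1) / (s\<^sup>2 + \<xi>\<^sup>2)))"
    and "(\<integral>s. indicator {0<..} s * (s powr (\<beta>-1) / (s\<^sup>2 + \<xi>\<^sup>2)) \<partial>lborel) = \<bar>\<xi>\<bar> powr (\<beta>-2) * (pi / (2 * sin (pi*\<beta>/2)))"
proof -
  have sp: "0 < sin (pi*\<beta>/2)" using b by (intro sin_gt_zero) auto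
  have nn: "(\<integral>\<^sup>+s. ennreal (indicator {0<..} s * (s powr (\<beta>-1) / (s\<^sup>2 + \<xi>\<^sup>2))) \<partial>lborel) = ennreal (\<bar>\<xi>\<bar> powr (\<beta>-2) * (pi / (2 * sin (pi*\<beta>/2))))"
    unfolding nn_integral_powr_square[OF b x, symmetric] by (intro nn_integral_cong) (auto simp: indicator_def)
  then show "integrable lborel (\<lambda>s. indicator {0<..} s * (s powr (\<beta>-1) / (s\<^sup>2 + \<xi>\<^sup>2)))"
    by (intro integrableI_nonneg) auto
  show "(\<integral>s. indicator {0<..} s * (s powr (\<beta>-1) / (s\<^sup>2 + \<xi>\<^sup>2)) \<partial>lborel) = \<bar>\<xi>\<bar> powr (\<beta>-2) * (pi / (2 * sin (pi*\<beta>/2)))"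
  proof -
    have "(\<integral>s. indicator {0<..} s * (s powr (\<beta>-1) / (s\<^sup>2 + \<xi>\<^sup>2)) \<partial>lborel) = enn2real (\<integral>\<^sup>+s. ennreal (indicator {0<..} s * (s powr (\<beta>-1) / (s\<^sup>2 + \<xi>\<^sup>2))) \<partial>lborel)"
      by (rule integral_eq_nn_integral) auto
    then show ?thesis unfolding nn using sp by simp
  qed
qed

lemma laplace_kernel_riesz:
  fixes a b w :: real
  assumes a: "0 < a" and b: "0 < b" and ab: "a + b < 1" and w: "w \<noteq> 0"
  shows "laplace_kernel (\<lambda>l. sin (pi*a) / pi * l powr (-(a+b))) (\<lambda>l. sin (pi*b) / pi * l powr (-(a+b))) w = ennreal (riesz_kernel a b w)"
proof -
  define c where "c = (if 0 < w then sin (pi*a) else sin (pi*b)) / pi"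
  have c: "0 \<le> c" using sin_pi_pos[of a] sin_pi_pos[of b] a b ab by (auto simp: c_def)
  have "laplace_kernel (\<lambda>l. sin (pi*a) / pi * l powr (-(a+b))) (\<lambda>l. sin (pi*b) / pi * l powr (-(a+b))) w
     = ennreal c * (\<integral>\<^sup>+l\<in>{0<..}. ennreal (l powr (1-(a+b)-1) * exp (- (l * \<bar>w\<bar>))) \<partial>lborel)"
    unfolding laplace_kernel_def
  proof (rule set_nn_integral_cong_cmult)
    fix l :: real
    have "exp (- (l * \<bar>w\<bar>)) * (if 0 < w then sin (pi*a) / pi * l powr (-(a+b)) else sin (pi*b) / pi * l powr (-(a+b)))
      = c * (l powr (1-(a+b)-1) * exp (- (l * \<bar>w\<bar>)))" by (simp add: c_def)
    then show "ennreal (exp (- (l * \<bar>w\<bar>)) * (if 0 < w then sin (pi*a) / pi * l powr (-(a+b)) else sin (pi*b) / pi * l powr (-(a+b))))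
      = ennreal c * ennreal (l powr (1-(a+b)-1) * exp (- (l * \<bar>w\<bar>)))"
      by (simp only: ennreal_mult'[OF c])
  qed auto
  also have "\<dots> = ennreal c * ennreal (Gamma (1-(a+b)) * \<bar>w\<bar> powr (-(1-(a+b))))"
    using ab w by (subst nn_integral_Gamma_scaled) auto
  also have "\<dots> = ennreal (riesz_kernel a b w)"
    using c by (simp add: ennreal_mult'[symmetric] riesz_kernel_def c_def diff_diff_eq mult_ac)
  finally show ?thesis .
qed

text \<open>The mixing densities are \<open>sin (pi*a) / pi * l powr (-\<alpha>)\<close> and its
  counterpart for \<open>b\<close>: their transform is the reciprocal of the exponent, and by a
  Gamma integral the resulting mixture of exponentials is the Riesz kernel.\<close>

lemma stable_potential:
  fixes \<alpha> \<rho> y :: real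
  defines "a \<equiv> \<alpha> * \<rho>" and "b \<equiv> \<alpha> * (1 - \<rho>)"
  assumes lp: "levy_process M X (char_exponent \<alpha> \<rho>)" and adm: "admissible \<alpha> \<rho>" and \<alpha>1: "\<alpha> < 1"
    and f [measurable]: "f \<in> borel_measurable borel"
  shows "levy_process.potential M X 0 f y = (\<integral>\<^sup>+w. f (y + w) * ennreal (riesz_kernel a b w) \<partial>lborel)"
proof -
  interpret levy_process M X "char_exponent \<alpha> \<rho>" by fact
  have a: "0 < a" and b: "0 < b" and ab: "a + b = \<alpha>"
    using adm \<alpha>1 by (auto simp: admissible_def a_def b_def algebra_simps)
  have ab1: "a + b < 1" using ab \<alpha>1 by simp
  have \<alpha>0: "0 < \<alpha>" using a b ab by simp
  note FC = stable_fourier_constants[OF a b ab1]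
  define \<delta> where "\<delta> = pi*(a-b)/2"
  have psi: "char_exponent \<alpha> \<rho> \<xi> = complex_of_real (\<bar>\<xi>\<bar> powr \<alpha>) * (complex_of_real (cos \<delta>) - \<i> * complex_of_real (sgn \<xi> * sin \<delta>))" for \<xi>
    unfolding \<delta>_def a_def b_def by (rule char_exponent_eq[OF adm]) (use \<alpha>1 in simp)
  have s0: "0 < sin (pi*a)" "0 < sin (pi*b)" using a b ab1 by (auto intro!: sin_pi_pos)
  \<comment> \<open>The sum of the constants of the two required bounds, so that one
    \<open>K\<close> serves both.\<close>
  define K where "K = 2 * (sin (pi*a) / pi + sin (pi*b) / pi) * (pi / sin (pi*\<alpha>)) + 1 / cos \<delta>"
  have s\<alpha>: "0 < sin (pi*\<alpha>)" using \<alpha>0 \<alpha>1 by (intro sin_pi_pos)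
  have cd: "0 < cos \<delta>" unfolding \<delta>_def by (rule FC(3))
  have K12: "0 \<le> 2 * (sin (pi*a) / pi + sin (pi*b) / pi) * (pi / sin (pi*\<alpha>))" "0 \<le> 1 / cos \<delta>"
    using s0 s\<alpha> cd by auto
  have "potential 0 f y = (\<integral>\<^sup>+w. f (y + w) * laplace_kernel (\<lambda>l. sin (pi*a) / pi * l powr (-(a+b))) (\<lambda>l. sin (pi*b) / pi * l powr (-(a+b))) w \<partial>lborel)"
  proof (rule potential_eq_laplace_kernel[where K=K and \<gamma>=\<alpha>])
    show "char_exponent \<alpha> \<rho> \<in> borel_measurable borel"
      unfolding psi[abs_def] by measurable
    show "0 \<le> K" using K12 by (simp add: K_def)
  next
    fix \<xi> :: real assume x: "\<xi> \<noteq> 0"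
    let ?m = "\<lambda>l::real. sin (pi*a) / pi * l powr (-(a+b)) + sin (pi*b) / pi * l powr (-(a+b))"
    have "(\<integral>\<^sup>+l\<in>{0<..}. ennreal (?m l / sqrt (l\<^sup>2 + \<xi>\<^sup>2)) \<partial>lborel)
      \<le> (\<integral>\<^sup>+l\<in>{0<..}. ennreal (2 * (sin (pi*a) / pi + sin (pi*b) / pi)) * ennreal (l powr (-\<alpha>) / (l + \<bar>\<xi>\<bar>)) \<partial>lborel)"
    proof (rule nn_integral_mono)
      fix l :: real
      have key: "?m l / sqrt (l\<^sup>2 + \<xi>\<^sup>2) \<le> 2 * (sin (pi*a) / pi + sin (pi*b) / pi) * (l powr (-\<alpha>) / (l + \<bar>\<xi>\<bar>))" if l: "0 < l"
      proof -
        have "?m l * (1 / sqrt (l\<^sup>2 + \<xi>\<^sup>2)) \<le> ?m l * (2 / (l + \<bar>\<xi>\<bar>))"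
          using inverse_sqrt_sum_squares_le[OF l x] s0 by (intro mult_left_mono) auto
        moreover have e: "?m l = (sin (pi*a) / pi + sin (pi*b) / pi) * l powr (-\<alpha>)" by (simp add: ab distrib_right)
        moreover obtain S where S: "S = sin (pi*a) / pi + sin (pi*b) / pi" by simp
        ultimately show ?thesis unfolding e S[symmetric] by (simp add: mult_ac)
      qed
      have C: "0 \<le> 2 * (sin (pi*a) / pi + sin (pi*b) / pi)" using s0 by simp
      show "ennreal (?m l / sqrt (l\<^sup>2 + \<xi>\<^sup>2)) * indicator {0<..} l \<le> ennreal (2 * (sin (pi*a) / pi + sin (pi*b) / pi)) * ennreal (l powr (-\<alpha>) / (l + \<bar>\<xi>\<bar>)) * indicator {0<..} l"
      proof (cases "0 < l")
        case True
        then show ?thesis using ennreal_leI[OF key[OF True]] by (simp only: ennreal_mult'[OF C]) (rule mult_right_mono, simp_all)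
      qed simp
    qed
    also have "\<dots> = ennreal (2 * (sin (pi*a) / pi + sin (pi*b) / pi)) * ennreal (pi / sin (pi*\<alpha>) * \<bar>\<xi>\<bar> powr (-\<alpha>))"
      using x by (subst set_nn_integral_cmult) (auto simp: nn_integral_Stieltjes_powr[OF \<alpha>0 \<alpha>1])
    also have "\<dots> = ennreal (2 * (sin (pi*a) / pi + sin (pi*b) / pi) * (pi / sin (pi*\<alpha>)) * \<bar>\<xi>\<bar> powr (-\<alpha>))"
      using s0 by (subst ennreal_mult'[symmetric]) (auto simp: mult.assoc)
    also have "\<dots> \<le> ennreal (K * \<bar>\<xi>\<bar> powr (-\<alpha>))"
      using K12 by (intro ennreal_leI mult_right_mono) (auto simp: K_def)
    finally show "(\<integral>\<^sup>+l\<in>{0<..}. ennreal (?m l / sqrt (l\<^sup>2 + \<xi>\<^sup>2)) \<partial>lborel) \<le> ennreal (K * \<bar>\<xi>\<bar> powr (-\<alpha>))" .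
    \<comment> \<open>\<open>?u\<close> and \<open>?v\<close> are the real and imaginary parts of
      the integrand of the transform.\<close>
    let ?u = "\<lambda>l. (sin (pi*a) + sin (pi*b)) / pi * (indicator {0<..} l * (l powr ((2-\<alpha>)-1) / (l\<^sup>2 + \<xi>\<^sup>2)))"
    let ?v = "\<lambda>l. \<xi> * ((sin (pi*a) - sin (pi*b)) / pi) * (indicator {0<..} l * (l powr ((1-\<alpha>)-1) / (l\<^sup>2 + \<xi>\<^sup>2)))"
    have Q1: "integrable lborel ?u" "(\<integral>l. ?u l \<partial>lborel) = \<bar>\<xi>\<bar> powr (-\<alpha>) * cos \<delta>"
    proof -
      note I = integral_powr_square[of "2-\<alpha>" \<xi>]
      show "integrable lborel ?u" using I(1) \<alpha>0 \<alpha>1 x by (intro integrable_mult_right) auto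
      have "(\<integral>l. ?u l \<partial>lborel) = (sin (pi*a) + sin (pi*b)) / pi * (\<bar>\<xi>\<bar> powr (2-\<alpha>-2) * (pi / (2 * sin (pi*(2-\<alpha>)/2))))"
        unfolding integral_mult_right_zero using I(2) \<alpha>0 \<alpha>1 x by simp
      also have "\<dots> = \<bar>\<xi>\<bar> powr (-\<alpha>) * ((sin (pi*a) + sin (pi*b)) / pi * (pi / (2 * sin (pi*(2-(a+b))/2))))"
        unfolding ab by simp
      finally show "(\<integral>l. ?u l \<partial>lborel) = \<bar>\<xi>\<bar> powr (-\<alpha>) * cos \<delta>" unfolding FC(1) \<delta>_def .
    qed
    have Q2: "integrable lborel ?v" "(\<integral>l. ?v l \<partial>lborel) = \<bar>\<xi>\<bar> powr (-\<alpha>) * (sgn \<xi> * sin \<delta>)"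
    proof -
      note I = integral_powr_square[of "1-\<alpha>" \<xi>]
      show "integrable lborel ?v" using I(1) \<alpha>0 \<alpha>1 x by (intro integrable_mult_right) auto
      have "(\<integral>l. ?v l \<partial>lborel) = \<xi> * ((sin (pi*a) - sin (pi*b)) / pi) * (\<bar>\<xi>\<bar> powr (1-\<alpha>-2) * (pi / (2 * sin (pi*(1-\<alpha>)/2))))"
        unfolding integral_mult_right_zero using I(2) \<alpha>0 \<alpha>1 x by simp
      also have "\<dots> = (\<xi> * \<bar>\<xi>\<bar> powr (1-\<alpha>-2)) * ((sin (pi*a) - sin (pi*b)) / pi * (pi / (2 * sin (pi*(1-(a+b))/2))))"
        unfolding ab by simp
      also have "\<xi> * \<bar>\<xi>\<bar> powr (1-\<alpha>-2) = \<bar>\<xi>\<bar> powr (-\<alpha>) * sgn \<xi>"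
      proof -
        have "1-\<alpha>-2 = -\<alpha> - 1" by simp
        then have p: "\<bar>\<xi>\<bar> powr (1-\<alpha>-2) = \<bar>\<xi>\<bar> powr (-\<alpha>) / \<bar>\<xi>\<bar>" using x by (simp only: powr_diff) simp
        show ?thesis unfolding p using x by (cases "0 < \<xi>") auto
      qed
      finally show "(\<integral>l. ?v l \<partial>lborel) = \<bar>\<xi>\<bar> powr (-\<alpha>) * (sgn \<xi> * sin \<delta>)" unfolding FC(2) \<delta>_def by (simp only: mult.assoc)
    qed
    have "(CLINT l|lborel. indicator {0<..} l *\<^sub>R (complex_of_real (sin (pi*a) / pi * l powr (-(a+b))) / (complex_of_real l - \<i> * \<xi>)
        + complex_of_real (sin (pi*b) / pi * l powr (-(a+b))) / (complex_of_real l + \<i> * \<xi>)))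
       = (CLINT l|lborel. complex_of_real (?u l) + \<i> * complex_of_real (?v l))"
    proof (intro Bochner_Integration.integral_cong refl)
      fix l :: real
      show "indicator {0<..} l *\<^sub>R (complex_of_real (sin (pi*a) / pi * l powr (-(a+b))) / (complex_of_real l - \<i> * \<xi>)
        + complex_of_real (sin (pi*b) / pi * l powr (-(a+b))) / (complex_of_real l + \<i> * \<xi>)) = complex_of_real (?u l) + \<i> * complex_of_real (?v l)"
      proof (cases "0 < l")
        case True
        define d where "d = l\<^sup>2 + \<xi>\<^sup>2"
        have d: "d > 0" using True by (simp add: d_def add_pos_nonneg)
        have i1: "1 / (complex_of_real l - \<i> * \<xi>) = complex_of_real (l / d) + \<i> * complex_of_real (\<xi> / d)"
          "1 / (complex_of_real l + \<i> * \<xi>) = complex_of_real (l / d) - \<i> * complex_of_real (\<xi> / d)"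
          by (simp_all add: d_def complex_eq_iff Re_divide Im_divide power2_eq_square)
        have p: "l powr (2-\<alpha>-1) = l powr (-(a+b)) * l" using True unfolding ab by (simp add: powr_diff powr_minus field_simps flip: powr_add)
        have p': "l powr (1-\<alpha>-1) = l powr (-(a+b))" unfolding ab by simp
        have "complex_of_real A / (complex_of_real l - \<i> * \<xi>) + complex_of_real B / (complex_of_real l + \<i> * \<xi>)
          = complex_of_real ((A + B) * (l / d)) + \<i> * complex_of_real ((A - B) * (\<xi> / d))" for A B
        proof -
          have "complex_of_real A / (complex_of_real l - \<i> * \<xi>) + complex_of_real B / (complex_of_real l + \<i> * \<xi>)
            = complex_of_real A * (1 / (complex_of_real l - \<i> * \<xi>)) + complex_of_real B * (1 / (complex_of_real l + \<i> * \<xi>))" by simp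
          also have "\<dots> = complex_of_real ((A + B) * (l / d)) + \<i> * complex_of_real ((A - B) * (\<xi> / d))"
            unfolding i1 by (simp add: algebra_simps add_divide_distrib diff_divide_distrib)
          finally show ?thesis .
        qed
        note f1 = this[of "sin (pi*a) / pi * l powr (-(a+b))" "sin (pi*b) / pi * l powr (-(a+b))"]
        have f2: "(sin (pi*a) / pi * l powr (-(a+b)) + sin (pi*b) / pi * l powr (-(a+b))) * (l / d) = ?u l"
          using True unfolding p by (simp add: d_def algebra_simps add_divide_distrib)
        have f3: "(sin (pi*a) / pi * l powr (-(a+b)) - sin (pi*b) / pi * l powr (-(a+b))) * (\<xi> / d) = ?v l"
          using True unfolding p' by (simp add: d_def algebra_simps diff_divide_distrib)
        have f4: "indicator {0<..} l *\<^sub>R Z = Z" for Z :: complex using True by simp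
        show ?thesis unfolding f4 by (simp only: f1 f2 f3)
      qed simp
    qed
    also have "\<dots> = (CLINT l|lborel. complex_of_real (?u l)) + (CLINT l|lborel. \<i> * complex_of_real (?v l))"
      by (intro Bochner_Integration.integral_add integrable_mult_right[of \<i>] integrable_of_real Q1 Q2)
    also have "\<dots> = complex_of_real (\<integral>l. ?u l \<partial>lborel) + \<i> * complex_of_real (\<integral>l. ?v l \<partial>lborel)"
      by (simp only: integral_mult_right_zero integral_complex_of_real)
    also have "\<dots> = complex_of_real (\<bar>\<xi>\<bar> powr (-\<alpha>)) * (complex_of_real (cos \<delta>) + \<i> * complex_of_real (sgn \<xi> * sin \<delta>))"
      unfolding Q1(2) Q2(2) by (simp add: algebra_simps)
    also have "\<dots> = 1 / (complex_of_real 0 + char_exponent \<alpha> \<rho> \<xi>)"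
    proof -
      have s1: "sgn \<xi> * sgn \<xi> = 1" using x by (simp add: sgn_if)
      have "(complex_of_real (cos \<delta>) + \<i> * complex_of_real (sgn \<xi> * sin \<delta>)) * (complex_of_real (cos \<delta>) - \<i> * complex_of_real (sgn \<xi> * sin \<delta>))
         = complex_of_real ((cos \<delta>)\<^sup>2 + (sgn \<xi> * sgn \<xi>) * (sin \<delta>)\<^sup>2)"
        by (simp add: complex_eq_iff power2_eq_square algebra_simps)
      also have "\<dots> = 1" unfolding s1 by simp
      finally have "complex_of_real (\<bar>\<xi>\<bar> powr (-\<alpha>)) * (complex_of_real (cos \<delta>) + \<i> * complex_of_real (sgn \<xi> * sin \<delta>)) * char_exponent \<alpha> \<rho> \<xi>
         = complex_of_real (\<bar>\<xi>\<bar> powr (-\<alpha>) * \<bar>\<xi>\<bar> powr \<alpha>)"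
        unfolding psi by (simp add: mult_ac)
      also have "\<bar>\<xi>\<bar> powr (-\<alpha>) * \<bar>\<xi>\<bar> powr \<alpha> = 1" using x by (simp add: powr_add[symmetric])
      finally have e: "complex_of_real (\<bar>\<xi>\<bar> powr (-\<alpha>)) * (complex_of_real (cos \<delta>) + \<i> * complex_of_real (sgn \<xi> * sin \<delta>)) * char_exponent \<alpha> \<rho> \<xi> = 1" by simp
      then have "char_exponent \<alpha> \<rho> \<xi> \<noteq> 0" by auto
      with e show ?thesis by (simp add: eq_divide_eq)
    qed
    finally show "(CLINT l|lborel. indicator {0<..} l *\<^sub>R (complex_of_real (sin (pi*a) / pi * l powr (-(a+b))) / (complex_of_real l - \<i> * \<xi>)
        + complex_of_real (sin (pi*b) / pi * l powr (-(a+b))) / (complex_of_real l + \<i> * \<xi>))) = 1 / (complex_of_real 0 + char_exponent \<alpha> \<rho> \<xi>)" .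
    have Re: "Re (char_exponent \<alpha> \<rho> \<xi>) = \<bar>\<xi>\<bar> powr \<alpha> * cos \<delta>" unfolding psi by simp
    show "0 < 0 + Re (char_exponent \<alpha> \<rho> \<xi>)" unfolding Re using x cd by simp
    have "1 / (0 + Re (char_exponent \<alpha> \<rho> \<xi>)) = 1 / cos \<delta> * \<bar>\<xi>\<bar> powr (-\<alpha>)"
      unfolding Re by (simp add: powr_minus field_simps)
    also have "\<dots> \<le> K * \<bar>\<xi>\<bar> powr (-\<alpha>)"
      using K12 by (intro mult_right_mono) (auto simp: K_def)
    finally show "1 / (0 + Re (char_exponent \<alpha> \<rho> \<xi>)) \<le> K * \<bar>\<xi>\<bar> powr (-\<alpha>)" .
  qed (use s0 \<alpha>0 \<alpha>1 in auto)
  also have "\<dots> = (\<integral>\<^sup>+w. f (y + w) * ennreal (riesz_kernel a b w) \<partial>lborel)"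
  proof (rule nn_integral_cong_AE)
    have "AE w in lborel. w \<noteq> (0::real)" by (rule AE_lborel_singleton)
    then show "AE w in lborel. f (y + w) * laplace_kernel (\<lambda>l. sin (pi*a) / pi * l powr (-(a+b))) (\<lambda>l. sin (pi*b) / pi * l powr (-(a+b))) w = f (y + w) * ennreal (riesz_kernel a b w)"
    proof eventually_elim
      case (elim w)
      show ?case by (rule arg_cong[OF laplace_kernel_riesz[OF a b ab1 elim]])
    qed
  qed
  finally show ?thesis .
qed

section \<open>Exhaustion by bounded sets, measurability and finiteness\<close>

lemma (in levy_process) killed_potential_LIMSEQ:
  assumes B: "open B" and f [measurable]: "\<And>n. f n \<in> borel_measurable borel" and inc: "incseq f"
    and lim: "\<And>z. (\<lambda>n. f n z) \<longlonglongrightarrow> g z" and g [measurable]: "g \<in> borel_measurable borel"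
  shows "(\<lambda>n. killed_potential q B (f n)) \<longlonglongrightarrow> killed_potential q B g"
proof -
  note [measurable] = borel_measurable_hitting_time[OF B]
  let ?F = "\<lambda>h (\<omega>, t). indicator {t. 0 \<le> t \<and> ereal t < hitting_time B \<omega>} t * (ennreal (exp (- q * t)) * h (X (max 0 t) \<omega>))"
  have [measurable]: "?F h \<in> borel_measurable (M \<Otimes>\<^sub>M lborel)" if [measurable]: "h \<in> borel_measurable borel" for h
    unfolding indicator_def mem_Collect_eq by measurable
  have eq: "killed_potential q B h = (\<integral>\<^sup>+p. ?F h p \<partial>(M \<Otimes>\<^sub>M lborel))" if "h \<in> borel_measurable borel" for h
    unfolding killed_potential_def using that by (subst lborel.nn_integral_fst[symmetric]) auto
  have le: "f m z \<le> f n z" if "m \<le> n" for m n z using inc that by (auto simp: incseq_def le_fun_def)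
  show ?thesis
    unfolding eq[OF f] eq[OF g]
  proof (rule nn_integral_LIMSEQ)
    show "incseq (\<lambda>n. ?F (f n))"
      using le by (auto simp: incseq_def le_fun_def intro!: mult_left_mono)
    show "(\<lambda>n. ?F (f n) p) \<longlonglongrightarrow> ?F g p" for p
      by (cases p) (auto intro!: ennreal_tendsto_cmult lim simp: indicator_def)
  qed measurable
qed

lemma (in levy_process) expectation_occupation:
  "(\<integral>\<^sup>+\<omega>. occupation X x A \<omega> \<partial>M) = killed_potential 0 {-1-x<..<1-x} (\<lambda>z. indicator A (x + z))"
proof -
  have "entrance_time X x \<omega> = hitting_time {-1-x<..<1-x} \<omega>" for \<omega>
    unfolding entrance_time_def hitting_time_def by (intro arg_cong[where f=Inf] image_cong) auto
  then show ?thesis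
    unfolding occupation_def killed_potential_def
    by (intro nn_integral_cong) (auto simp: indicator_def max_def)
qed

text \<open>\<open>A\<close> is exhausted by sets that are bounded and at positive distance from
  \<open>1\<close>. Boundedness makes the potentials to be cancelled finite, and the distance bounds
  the hitting kernels uniformly in the Cauchy case.\<close>

lemma (in levy_process) expectation_occupation_exhaust:
  assumes A: "A \<in> sets borel" "A \<subseteq> {1<..}" and g [measurable]: "g \<in> borel_measurable borel"
    and eq: "\<And>n. (\<integral>\<^sup>+\<omega>. occupation X x (A \<inter> {1 + 1/real (Suc n)..real n}) \<omega> \<partial>M) = (\<integral>\<^sup>+y\<in>A \<inter> {1 + 1/real (Suc n)..real n}. g y \<partial>lborel)"
  shows "(\<integral>\<^sup>+\<omega>. occupation X x A \<omega> \<partial>M) = (\<integral>\<^sup>+y\<in>A. g y \<partial>lborel)"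
proof -
  note [measurable] = A(1)
  let ?A = "\<lambda>n. A \<inter> {1 + 1/real (Suc n)..real n}"
  have inc: "?A m \<subseteq> ?A n" if "m \<le> n" for m n
  proof -
    have "1 / real (Suc n) \<le> 1 / real (Suc m)" using that by (intro frac_le) auto
    then show ?thesis using that by auto
  qed
  have ev: "\<forall>\<^sub>F n in sequentially. indicator (?A n) z = (indicator A z :: ennreal)" for z
  proof (cases "z \<in> A")
    case True
    then have z: "1 < z" using A by auto
    obtain n0 where n0: "1 / real (Suc n0) < z - 1" using z nat_approx_posE[of "z - 1"] by auto
    have "z \<in> ?A n" if n: "n \<ge> max n0 (nat \<lceil>z\<rceil>)" for n
    proof -
      have "1 / real (Suc n) \<le> 1 / real (Suc n0)" using n by (intro frac_le) auto
      moreover have "z \<le> real n" using n by linarith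
      ultimately show ?thesis using True n0 by auto
    qed
    then show ?thesis using True by (intro eventually_sequentiallyI[of "max n0 (nat \<lceil>z\<rceil>)"]) (auto simp: indicator_def)
  qed (auto simp: indicator_def)
  have 1: "(\<lambda>n. killed_potential 0 {-1-x<..<1-x} (\<lambda>z. indicator (?A n) (x + z))) \<longlonglongrightarrow> killed_potential 0 {-1-x<..<1-x} (\<lambda>z. indicator A (x + z))"
  proof (rule killed_potential_LIMSEQ)
    show "incseq (\<lambda>n z. indicator (?A n) (x + z) :: ennreal)"
      using inc by (auto simp: incseq_def le_fun_def indicator_def dest!: inc)
    show "(\<lambda>n. indicator (?A n) (x + z) :: ennreal) \<longlonglongrightarrow> indicator A (x + z)" for z
      by (rule tendsto_eventually[OF ev])
  qed auto
  have 2: "(\<lambda>n. \<integral>\<^sup>+y\<in>?A n. g y \<partial>lborel) \<longlonglongrightarrow> (\<integral>\<^sup>+y\<in>A. g y \<partial>lborel)"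
  proof (rule nn_integral_LIMSEQ)
    show "incseq (\<lambda>n y. g y * indicator (?A n) y)"
      using inc by (auto simp: incseq_def le_fun_def indicator_def dest!: inc)
    show "(\<lambda>n. g y * indicator (?A n) y) \<longlonglongrightarrow> g y * indicator A y" for y
      by (rule tendsto_eventually) (use ev[of y] in \<open>eventually_elim, simp\<close>)
  qed measurable
  show ?thesis
    using LIMSEQ_unique[OF 1] 2 eq unfolding expectation_occupation by simp
qed

lemma borel_measurable_green_density:
  fixes \<alpha> \<rho> x :: real
  assumes a: "0 < \<alpha> * \<rho>" and b: "0 < \<alpha> * (1 - \<rho>)" and x: "1 < x"
  shows "(\<lambda>y. ennreal (green_density \<alpha> \<rho> x y) * indicator {1<..} y) \<in> borel_measurable borel"
proof -
  define a' where "a' = \<alpha> * \<rho>"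
  define b' where "b' = \<alpha> * (1 - \<rho>)"
  \<comment> \<open>The upper limit is moved into the integrand, so that measurability in it is that
    of a parameter integral.\<close>
  define J where "J = (\<lambda>p c. \<integral>\<^sup>+w. (if 0 < w \<and> w < c then ennreal (w powr (p-1) * (1-w) powr (-(a'+b'))) else 0) \<partial>lborel)"
  have [measurable]: "J p \<in> borel_measurable borel" for p unfolding J_def by measurable
  have J: "J p c = (\<integral>\<^sup>+w\<in>{0<..<c}. ennreal (w powr (p-1) * (1-w) powr (-(a'+b'))) \<partial>lborel)" for p c
    unfolding J_def by (intro nn_integral_cong) (auto simp: indicator_def)
  have "(\<lambda>y. ennreal (green_density \<alpha> \<rho> x y) * indicator {1<..} y) = (\<lambda>y. if y \<le> 1 then 0 else if y = x then ennreal (green_density \<alpha> \<rho> x x)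
    else if x < y then ennreal (1 / (Gamma a' * Gamma b') * (y-x) powr (a'+b'-1)) * J b' ((x-1)*(y+1)/((x+1)*(y-1)))
    else ennreal (1 / (Gamma a' * Gamma b') * (x-y) powr (a'+b'-1)) * J a' ((x+1)*(y-1)/((x-1)*(y+1))))"
    using green_density_upper[OF a b x] green_density_lower[OF a b]
    by (auto simp: fun_eq_iff J a'_def[symmetric] b'_def[symmetric] indicator_def)
  also have "\<dots> \<in> borel_measurable borel" by measurable
  finally show ?thesis .
qed

lemma set_nn_integral_riesz_kernel_finite:
  fixes a b x N :: real
  assumes a: "0 < a" and b: "0 < b" and ab: "a + b < 1"
  shows "(\<integral>\<^sup>+y\<in>{-N..N}. ennreal (riesz_kernel a b (y - x)) \<partial>lborel) < \<infinity>"
proof -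
  define c where "c = Gamma (1-a-b) / pi"
  define R where "R = \<bar>N\<bar> + \<bar>x\<bar> + 1"
  have R: "R > 0" by (simp add: R_def add_nonneg_pos)
  have c: "c > 0" using ab by (auto simp: c_def)
  let ?p = "\<lambda>w::real. ennreal (w powr (a+b-1)) * indicator {0..R} w"
  have p: "(\<integral>\<^sup>+w. ?p w \<partial>lborel) < \<infinity>"
  proof -
    have "(\<lambda>w. w powr (a+b-1)) integrable_on {0..R}" using integrable_on_powr_from_0[of "a+b-1" R] a b R by simp
    then have "((\<lambda>w. w powr (a+b-1)) has_integral integral {0..R} (\<lambda>w. w powr (a+b-1))) {0..R}" by (rule integrable_integral)
    from nn_integral_has_integral_lebesgue'[OF _ this] show ?thesis by simp
  qed
  have "(\<integral>\<^sup>+y\<in>{-N..N}. ennreal (riesz_kernel a b (y - x)) \<partial>lborel) \<le> (\<integral>\<^sup>+y. ennreal c * (?p (-x + 1 * y) + ?p (x + (-1) * y)) \<partial>lborel)"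
  proof (rule nn_integral_mono)
    fix y :: real
    show "ennreal (riesz_kernel a b (y - x)) * indicator {-N..N} y \<le> ennreal c * (?p (-x + 1 * y) + ?p (x + (-1) * y))"
    proof (cases "y \<in> {-N..N}")
      case True
      have "riesz_kernel a b (y - x) \<le> c * \<bar>y - x\<bar> powr (a+b-1)"
      proof -
        have "(if 0 < y - x then sin (pi*a) else sin (pi*b)) * \<bar>y - x\<bar> powr (a+b-1) \<le> 1 * \<bar>y - x\<bar> powr (a+b-1)"
          by (intro mult_right_mono) auto
        then have "c * ((if 0 < y - x then sin (pi*a) else sin (pi*b)) * \<bar>y - x\<bar> powr (a+b-1)) \<le> c * (1 * \<bar>y - x\<bar> powr (a+b-1))"
          using c by (intro mult_left_mono) auto
        then show ?thesis by (simp add: riesz_kernel_def c_def mult.assoc)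
      qed
      then have "ennreal (riesz_kernel a b (y - x)) \<le> ennreal c * ennreal (\<bar>y - x\<bar> powr (a+b-1))"
        using c by (simp add: ennreal_mult'[symmetric] ennreal_leI)
      also have "ennreal (\<bar>y - x\<bar> powr (a+b-1)) \<le> ?p (-x + 1 * y) + ?p (x + (-1) * y)"
        using True by (cases "x \<le> y") (auto simp: indicator_def R_def)
      finally show ?thesis using True by (simp add: mult_left_mono)
    qed simp
  qed
  also have "\<dots> = ennreal c * ((\<integral>\<^sup>+y. ?p (-x + 1 * y) \<partial>lborel) + (\<integral>\<^sup>+y. ?p (x + (-1) * y) \<partial>lborel))"
    by (subst nn_integral_cmult) (auto simp: nn_integral_add)
  also have "(\<integral>\<^sup>+y. ?p (-x + 1 * y) \<partial>lborel) = (\<integral>\<^sup>+w. ?p w \<partial>lborel)"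
    by (subst nn_integral_real_affine[where c=1 and t="-x" and f="?p"]) auto
  also have "(\<integral>\<^sup>+y. ?p (x + (-1) * y) \<partial>lborel) = (\<integral>\<^sup>+w. ?p w \<partial>lborel)"
    by (subst nn_integral_real_affine[where c="-1" and t=x and f="?p"]) auto
  also have "ennreal c * ((\<integral>\<^sup>+w. ?p w \<partial>lborel) + (\<integral>\<^sup>+w. ?p w \<partial>lborel)) < \<infinity>"
    using p by (simp add: ennreal_mult_less_top)
  finally show ?thesis .
qed

lemma occupation_density_subcritical:
  fixes M :: "'a measure" and X :: "real \<Rightarrow> 'a \<Rightarrow> real" and \<alpha> \<rho> x N :: real and A :: "real set"
  assumes adm: "admissible \<alpha> \<rho>" and \<alpha>1: "\<alpha> < 1" and st: "stable_levy_process M X \<alpha> \<rho>" and x: "1 < x"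
    and A [measurable]: "A \<in> sets borel" and AN: "A \<subseteq> {1<..N}"
  shows "(\<integral>\<^sup>+\<omega>. occupation X x A \<omega> \<partial>M) = (\<integral>\<^sup>+y\<in>A. ennreal (green_density \<alpha> \<rho> x y) \<partial>lborel)"
proof -
  interpret levy_process M X "char_exponent \<alpha> \<rho>" using st by (rule levy_process_if_stable)
  define a where "a = \<alpha> * \<rho>"
  define b where "b = \<alpha> * (1 - \<rho>)"
  have a: "0 < a" and b: "0 < b" and ab: "a + b < 1"
    using adm \<alpha>1 by (auto simp: admissible_def a_def b_def algebra_simps)
  define B where "B = {-1-x<..<1-x}"
  have B: "open B" by (simp add: B_def)
  have clB: "closure B = {-1-x..1-x}" by (simp add: B_def)
  define U where "U = (\<lambda>z. \<integral>\<^sup>+y\<in>A. ennreal (riesz_kernel a b (y - z)) \<partial>lborel)"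
  define \<phi> where "\<phi> = (\<lambda>z. (\<integral>\<^sup>+y\<in>A. ennreal (hit_kernel a b y z) \<partial>lborel) * indicator {-1<..<1} z)"
  have [measurable]: "\<phi> \<in> borel_measurable borel" unfolding \<phi>_def by measurable
  have pot: "potential 0 f u = (\<integral>\<^sup>+w. f (u + w) * ennreal (riesz_kernel a b w) \<partial>lborel)" if "f \<in> borel_measurable borel" for f u
    unfolding a_def b_def by (rule stable_potential[OF levy_process_axioms adm \<alpha>1 that])
  have shift: "(\<integral>\<^sup>+w. h (x + (u + w)) * ennreal (riesz_kernel a b w) \<partial>lborel) = (\<integral>\<^sup>+z. h z * ennreal (riesz_kernel a b (z - (x + u))) \<partial>lborel)"
    if [measurable]: "h \<in> borel_measurable borel" for h and u
    by (subst nn_integral_real_affine[where c=1 and t="x + u" and f="\<lambda>z. h z * ennreal (riesz_kernel a b (z - (x + u)))"]) (auto simp: add_ac)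
  have p1: "potential 0 (\<lambda>z. indicator A (x + z)) u = U (x + u)" for u
    using shift[of "indicator A" u] by (simp add: pot U_def mult.commute)
  have p2: "potential 0 (\<lambda>z. \<phi> (x + z)) u = (\<integral>\<^sup>+y\<in>A. (\<integral>\<^sup>+z\<in>{-1<..<1}. ennreal (hit_kernel a b y z) * ennreal (riesz_kernel a b (z - (x + u))) \<partial>lborel) \<partial>lborel)" for u
  proof -
    have "potential 0 (\<lambda>z. \<phi> (x + z)) u = (\<integral>\<^sup>+z. \<phi> z * ennreal (riesz_kernel a b (z - (x + u))) \<partial>lborel)"
      using shift[of \<phi> u] by (simp add: pot)
    also have "\<dots> = (\<integral>\<^sup>+z\<in>{-1<..<1}. (\<integral>\<^sup>+y\<in>A. ennreal (hit_kernel a b y z) * ennreal (riesz_kernel a b (z - (x + u))) \<partial>lborel) \<partial>lborel)"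
    proof (rule nn_integral_cong)
      fix z :: real
      have "(\<integral>\<^sup>+y\<in>A. ennreal (hit_kernel a b y z) * ennreal (riesz_kernel a b (z - (x + u))) \<partial>lborel)
        = (\<integral>\<^sup>+y. ennreal (hit_kernel a b y z) * indicator A y * ennreal (riesz_kernel a b (z - (x + u))) \<partial>lborel)" by (simp add: mult_ac)
      also have "\<dots> = (\<integral>\<^sup>+y\<in>A. ennreal (hit_kernel a b y z) \<partial>lborel) * ennreal (riesz_kernel a b (z - (x + u)))"
        by (rule nn_integral_multc) measurable
      finally show "\<phi> z * ennreal (riesz_kernel a b (z - (x + u))) = (\<integral>\<^sup>+y\<in>A. ennreal (hit_kernel a b y z) * ennreal (riesz_kernel a b (z - (x + u))) \<partial>lborel) * indicator {-1<..<1} z"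
        by (simp add: \<phi>_def mult_ac)
    qed
    also have "\<dots> = (\<integral>\<^sup>+y\<in>A. (\<integral>\<^sup>+z\<in>{-1<..<1}. ennreal (hit_kernel a b y z) * ennreal (riesz_kernel a b (z - (x + u))) \<partial>lborel) \<partial>lborel)"
      by (rule set_nn_integral_swap) auto
    finally show ?thesis .
  qed
  have inside: "potential 0 (\<lambda>z. \<phi> (x + z)) u = U (x + u)" if u: "u \<in> closure B" for u
    unfolding p2 U_def
  proof (rule set_nn_integral_cong)
    fix y assume "y \<in> A"
    then have "1 < y" using AN by auto
    then show "(\<integral>\<^sup>+z\<in>{-1<..<1}. ennreal (hit_kernel a b y z) * ennreal (riesz_kernel a b (z - (x + u))) \<partial>lborel) = ennreal (riesz_kernel a b (y - (x + u)))"
      using u unfolding clB by (intro hit_kernel_potential_inside[OF a b ab]) auto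
  qed
  have outside: "U x = potential 0 (\<lambda>z. \<phi> (x + z)) 0 + (\<integral>\<^sup>+y\<in>A. ennreal (green_density \<alpha> \<rho> x y) \<partial>lborel)"
  proof -
    have gm [measurable]: "(\<lambda>y. ennreal (green_density \<alpha> \<rho> x y) * indicator A y) \<in> borel_measurable lborel"
    proof -
      have "(\<lambda>y. ennreal (green_density \<alpha> \<rho> x y) * indicator A y) = (\<lambda>y. (ennreal (green_density \<alpha> \<rho> x y) * indicator {1<..} y) * indicator A y)"
        using AN by (auto simp: fun_eq_iff indicator_def)
      also have "\<dots> \<in> borel_measurable lborel"
        using borel_measurable_green_density[of \<alpha> \<rho> x] a b x by (auto simp: a_def b_def intro!: borel_measurable_times)
      finally show ?thesis .
    qed
    let ?I = "\<lambda>y. \<integral>\<^sup>+z\<in>{-1<..<1}. ennreal (hit_kernel a b y z) * ennreal (riesz_kernel a b (z - x)) \<partial>lborel"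
    have "U x = (\<integral>\<^sup>+y. ?I y * indicator A y + ennreal (green_density \<alpha> \<rho> x y) * indicator A y \<partial>lborel)"
      unfolding U_def
    proof (rule nn_integral_cong_AE)
      \<comment> \<open>The identity outside the interval excludes \<open>y = x\<close>, a null
        set.\<close>
      have "AE y in lborel. y \<noteq> x" by (rule AE_lborel_singleton)
      then show "AE y in lborel. ennreal (riesz_kernel a b (y - x)) * indicator A y = ?I y * indicator A y + ennreal (green_density \<alpha> \<rho> x y) * indicator A y"
      proof eventually_elim
        case (elim y)
        show ?case
        proof (cases "y \<in> A")
          case True
          then have "1 < y" using AN by auto
          then have "?I y + ennreal (green_density \<alpha> \<rho> x y) = ennreal (riesz_kernel a b (y - x))"
            using hit_kernel_potential_outside[of \<alpha> \<rho> x y] a b ab x elim unfolding a_def b_def by auto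
          then show ?thesis using True by simp
        qed simp
      qed
    qed
    also have "\<dots> = (\<integral>\<^sup>+y\<in>A. ?I y \<partial>lborel) + (\<integral>\<^sup>+y\<in>A. ennreal (green_density \<alpha> \<rho> x y) \<partial>lborel)"
      by (rule nn_integral_add) measurable
    finally show ?thesis unfolding p2[of 0] by simp
  qed
  \<comment> \<open>Boundedness of \<open>A\<close> enters here: the entrance term below is at most
    \<open>U x\<close> and has to be finite to be cancelled.\<close>
  have fin: "U x < \<infinity>"
  proof -
    have "U x \<le> (\<integral>\<^sup>+y\<in>{-\<bar>N\<bar>..\<bar>N\<bar>}. ennreal (riesz_kernel a b (y - x)) \<partial>lborel)"
      unfolding U_def using AN by (intro nn_integral_mono mult_left_mono) (auto simp: indicator_def)
    then show ?thesis using set_nn_integral_riesz_kernel_finite[OF a b ab, of x "\<bar>N\<bar>"] by (rule le_less_trans)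
  qed
  \<comment> \<open>The entrance term, the same for the indicator of \<open>A\<close> and for
    \<open>\<phi>\<close>.\<close>
  let ?W = "\<integral>\<^sup>+u. U (x + u) \<partial>hit_law 0 B 0"
  have d1: "U x = killed_potential 0 B (\<lambda>z. indicator A (x + z)) + ?W"
    using potential_hit_decomposition[OF B order.refl, of "\<lambda>z. indicator A (x + z)"] unfolding p1 by simp
  have "potential 0 (\<lambda>z. \<phi> (x + z)) 0 = killed_potential 0 B (\<lambda>z. \<phi> (x + z)) + (\<integral>\<^sup>+u. potential 0 (\<lambda>z. \<phi> (x + z)) u \<partial>hit_law 0 B 0)"
    by (rule potential_hit_decomposition[OF B order.refl]) measurable
  also have "killed_potential 0 B (\<lambda>z. \<phi> (x + z)) = 0"
    by (rule killed_potential_eq_0) (auto simp: \<phi>_def B_def)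
  also have "(\<integral>\<^sup>+u. potential 0 (\<lambda>z. \<phi> (x + z)) u \<partial>hit_law 0 B 0) = ?W"
  proof (rule nn_integral_cong_AE)
    show "AE u in hit_law 0 B 0. potential 0 (\<lambda>z. \<phi> (x + z)) u = U (x + u)"
      using emeasure_hit_law_closure[OF B order.refl] by eventually_elim (rule inside)
  qed
  finally have d2: "potential 0 (\<lambda>z. \<phi> (x + z)) 0 = ?W" by simp
  have "?W \<noteq> \<infinity>" using fin d1 by (auto simp: less_top[symmetric])
  have cancel: "K = G" if "K + W = W + G" "W \<noteq> \<infinity>" for K G W :: ennreal
    using that by (metis add.commute ennreal_add_left_cancel)
  have "killed_potential 0 B (\<lambda>z. indicator A (x + z)) = (\<integral>\<^sup>+y\<in>A. ennreal (green_density \<alpha> \<rho> x y) \<partial>lborel)"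
    by (rule cancel[OF _ \<open>?W \<noteq> \<infinity>\<close>]) (rule trans[OF d1[symmetric] outside[unfolded d2]])
  then show ?thesis unfolding expectation_occupation B_def .
qed

section \<open>Logarithmic balayage\<close>

text \<open>Chosen to dominate \<open>ln\<close> together with its difference quotients \<open>(1 - r powr (-e)) / e\<close>, and mild
  enough to be integrable against the arcsine weight \<open>(1 - z^2) powr (-1/2)\<close>.\<close>
abbreviation log_majorant :: "real \<Rightarrow> real" where
  "log_majorant r \<equiv> 8 * r powr (-1/4) + r"

text \<open>Both halves come from \<open>exp u \<ge> 1 + u\<close>. For \<open>r < 1\<close> the
  quotient is at most \<open>r powr (-e)\<close> times \<open>- ln r\<close>; these are bounded by
  \<open>r powr (-1/8)\<close> and \<open>8 * r powr (-1/8)\<close>, which explains the constants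
  \<open>8\<close>, \<open>-1/4\<close> and \<open>e \<le> 1/8\<close>.\<close>

lemma neg_powr_quotient:
  fixes r e :: real
  assumes r: "0 < r" and e: "0 < e" "e \<le> 1/8"
  shows "\<bar>(r powr (-e) - 1) / e\<bar> \<le> log_majorant r"
proof (cases "1 \<le> r")
  case True
  then have l: "0 \<le> ln r" by simp
  have p: "r powr (-e) = exp (- (e * ln r))" using r by (simp add: powr_def)
  have "1 - e * ln r \<le> r powr (-e)" unfolding p using exp_ge_add_one_self[of "- (e * ln r)"] by simp
  moreover have "r powr (-e) \<le> 1" unfolding p using l e by simp
  ultimately have "\<bar>r powr (-e) - 1\<bar> \<le> e * ln r" by simp
  then have "\<bar>(r powr (-e) - 1) / e\<bar> \<le> ln r" using e by (simp add: field_simps abs_divide)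
  also have "\<dots> \<le> r" using ln_less_self[OF r] by simp
  finally show ?thesis using r by (simp add: add_increasing)
next
  case False
  then have r1: "r < 1" by simp
  have "1 + e * ln r \<le> r powr e" using exp_ge_add_one_self[of "e * ln r"] r by (simp add: powr_def)
  then have 1: "1 - r powr e \<le> e * (- ln r)" by simp
  have "- ln r = 8 * ln (r powr (-1/8))" using r by (simp add: ln_powr)
  also have "ln (r powr (-1/8)) \<le> r powr (-1/8)" using ln_less_self[of "r powr (-1/8)"] r by simp
  finally have 2: "- ln r \<le> 8 * r powr (-1/8)" by simp
  have "r powr (-e) - 1 = r powr (-e) * (1 - r powr e)" using r by (simp add: right_diff_distrib powr_add[symmetric])
  also have "\<dots> \<le> r powr (-e) * (e * (8 * r powr (-1/8)))"
    using 1 2 e by (intro mult_left_mono order_trans[OF 1]) auto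
  also have "\<dots> \<le> r powr (-1/8) * (e * (8 * r powr (-1/8)))"
    using e r r1 by (intro mult_right_mono powr_mono') auto
  also have "\<dots> = e * (8 * r powr (-1/4))" using r by (simp add: powr_add[symmetric])
  finally have "(r powr (-e) - 1) / e \<le> 8 * r powr (-1/4)" using e by (simp add: field_simps)
  moreover have "1 \<le> r powr (-e)" using r r1 e ge_one_powr_ge_zero[of "1/r" e] by (simp add: powr_minus powr_divide field_simps)
  ultimately show ?thesis using e r by simp
qed

lemma abs_ln_le_powr:
  fixes r :: real
  assumes r: "0 < r"
  shows "\<bar>ln r\<bar> \<le> log_majorant r"
proof (cases "1 \<le> r")
  case True
  then have "\<bar>ln r\<bar> \<le> r" using ln_less_self[OF r] ln_ge_zero[OF True] by linarith
  then show ?thesis using r by (simp add: add_increasing)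
next
  case False
  have "- ln r = 4 * ln (r powr (-1/4))" using r by (simp add: ln_powr)
  also have "ln (r powr (-1/4)) \<le> r powr (-1/4)" using ln_less_self[of "r powr (-1/4)"] r by simp
  finally have "- ln r \<le> 8 * r powr (-1/4)" by (simp add: order_trans)
  then show ?thesis using r False by simp
qed

lemma neg_powr_quotient_tendsto:
  fixes r :: real
  assumes r: "0 < r" and e: "\<And>n. 0 < e n" "e \<longlonglongrightarrow> 0"
  shows "(\<lambda>n. (r powr (- e n) - 1) / e n) \<longlonglongrightarrow> - ln r"
proof -
  have "((\<lambda>t. r powr (-t)) has_real_derivative (- ln r)) (at 0)"
    using r by (auto intro!: derivative_eq_intros)
  then have "((\<lambda>h. (r powr (-(0 + h)) - r powr (-0)) / h) \<longlongrightarrow> - ln r) (at 0)" by (simp only: DERIV_def)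
  then have "((\<lambda>h. (r powr (-h) - 1) / h) \<longlongrightarrow> - ln r) (at 0)" using r by simp
  moreover have "filterlim e (at 0) sequentially"
    using e(1) by (intro filterlim_atI e(2)) (auto intro!: always_eventually simp: less_imp_neq[THEN not_sym])
  ultimately show ?thesis by (rule filterlim_compose)
qed

lemma set_nn_integral_abs_powr_bounded:
  fixes p R N :: real
  assumes p: "-1 < p" "p < 0"
  shows "\<exists>K\<ge>0. \<forall>s\<in>{-R..R}. (\<integral>\<^sup>+z\<in>{-N..N}. ennreal (\<bar>z - s\<bar> powr p) \<partial>lborel) \<le> ennreal K"
proof -
  \<comment> \<open>With both parameters equal to \<open>(p+1)/2\<close> the Riesz kernel is a
    positive multiple of \<open>\<bar>w\<bar> powr p\<close>, so finiteness is already known;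
    uniformity in \<open>s\<close> comes from enlarging the interval to radius
    \<open>N + R\<close>.\<close>
  define c where "c = (p + 1) / 2"
  have c: "0 < c" "c + c < 1" "c + c - 1 = p" using p by (auto simp: c_def)
  define k where "k = Gamma (1-c-c) / pi * sin (pi*c)"
  have k: "0 < k" using c by (auto simp: k_def sin_pi_pos)
  have rk: "riesz_kernel c c w = k * \<bar>w\<bar> powr p" for w unfolding riesz_kernel_def c(3) by (simp add: k_def)
  define J where "J = (\<integral>\<^sup>+w\<in>{-(N+R)..N+R}. ennreal (\<bar>w\<bar> powr p) \<partial>lborel)"
  have "ennreal k * J = (\<integral>\<^sup>+w\<in>{-(N+R)..N+R}. ennreal (riesz_kernel c c (w - 0)) \<partial>lborel)"
    unfolding J_def by (subst set_nn_integral_cmult[symmetric]) (use k in \<open>auto simp: rk ennreal_mult'\<close>)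
  also have "\<dots> < \<infinity>" by (rule set_nn_integral_riesz_kernel_finite[OF c(1,1,2)])
  finally have J: "J < \<infinity>" using k by (auto simp: ennreal_mult_less_top)
  have "(\<integral>\<^sup>+z\<in>{-N..N}. ennreal (\<bar>z - s\<bar> powr p) \<partial>lborel) \<le> J" if s: "s \<in> {-R..R}" for s
  proof -
    have "(\<integral>\<^sup>+z\<in>{-N..N}. ennreal (\<bar>z - s\<bar> powr p) \<partial>lborel)
       \<le> (\<integral>\<^sup>+z. ennreal (\<bar>-s + 1 * z\<bar> powr p) * indicator {-(N+R)..N+R} (-s + 1 * z) \<partial>lborel)"
      using s by (intro nn_integral_mono) (auto simp: indicator_def)
    also have "\<dots> = J"
      unfolding J_def by (subst nn_integral_real_affine[where c=1 and t="-s" and f="\<lambda>w. ennreal (\<bar>w\<bar> powr p) * indicator {-(N+R)..N+R} w"]) auto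
    finally show ?thesis .
  qed
  moreover have "J = ennreal (enn2real J)" using J by simp
  ultimately show ?thesis by (intro exI[of _ "enn2real J"]) auto
qed

lemma log_weight_bounded_interval:
  fixes R N :: real
  assumes R: "0 \<le> R" and N: "0 \<le> N"
  shows "\<exists>K\<ge>0. \<forall>s\<in>{-R..R}. (\<integral>\<^sup>+z\<in>{-N..N}. ennreal (log_majorant \<bar>z - s\<bar>) \<partial>lborel) \<le> ennreal K"
proof -
  obtain K where K: "0 \<le> K" "\<And>s. s \<in> {-R..R} \<Longrightarrow> (\<integral>\<^sup>+z\<in>{-N..N}. ennreal (\<bar>z - s\<bar> powr (-1/4)) \<partial>lborel) \<le> ennreal K"
    using set_nn_integral_abs_powr_bounded[of "-1/4" R N] by auto
  have "(\<integral>\<^sup>+z\<in>{-N..N}. ennreal (log_majorant \<bar>z - s\<bar>) \<partial>lborel) \<le> ennreal (8 * K + (N + R) * (2 * N))"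
    if s: "s \<in> {-R..R}" for s
  proof -
    have "(\<integral>\<^sup>+z\<in>{-N..N}. ennreal (log_majorant \<bar>z - s\<bar>) \<partial>lborel)
      \<le> (\<integral>\<^sup>+z. ennreal 8 * (ennreal (\<bar>z - s\<bar> powr (-1/4)) * indicator {-N..N} z) + ennreal (N + R) * indicator {-N..N} z \<partial>lborel)"
      using s by (intro nn_integral_mono) (auto simp: indicator_def ennreal_mult'[symmetric] ennreal_plus[symmetric] ennreal_leI simp del: ennreal_plus ennreal_numeral)
    also have "\<dots> = ennreal 8 * (\<integral>\<^sup>+z\<in>{-N..N}. ennreal (\<bar>z - s\<bar> powr (-1/4)) \<partial>lborel) + ennreal (N + R) * ennreal (2 * N)"
      using N by (subst nn_integral_add) (auto simp: nn_integral_cmult nn_integral_cmult_indicator simp del: ennreal_plus ennreal_numeral)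
    also have "\<dots> \<le> ennreal 8 * ennreal K + ennreal (N + R) * ennreal (2 * N)"
      using K(2)[OF s] by (intro add_right_mono mult_left_mono) auto
    also have "\<dots> = ennreal (8 * K + (N + R) * (2 * N))"
      using K(1) R N by (simp add: ennreal_mult'[symmetric] ennreal_plus[symmetric] del: ennreal_plus ennreal_numeral)
    finally show ?thesis .
  qed
  then show ?thesis using K(1) R N by (intro exI[of _ "8 * K + (N + R) * (2 * N)"]) auto
qed

text \<open>Replace the larger base by the smaller one. The exponents add up to \<open>-3/4\<close>,
  above \<open>-1\<close>, so singularities of the arcsine weight and of \<open>log_majorant\<close>
  may collide and stay integrable.\<close>

lemma powr_product_le_sum:
  fixes A t :: real
  assumes A: "0 < A" and t: "0 < t"
  shows "A powr (-1/2) * t powr (-1/4) \<le> A powr (-3/4) + t powr (-3/4)"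
proof (cases "A \<le> t")
  case True
  have "A powr (-1/2) * t powr (-1/4) \<le> A powr (-1/2) * A powr (-1/4)"
    using True A by (intro mult_left_mono powr_mono2') auto
  also have "\<dots> = A powr (-3/4)" using A by (simp add: powr_add[symmetric])
  finally show ?thesis by (simp add: add_increasing2)
next
  case False
  have "A powr (-1/2) * t powr (-1/4) \<le> t powr (-1/2) * t powr (-1/4)"
    using False t by (intro mult_right_mono powr_mono2') auto
  also have "\<dots> = t powr (-3/4)" using t by (simp add: powr_add[symmetric])
  finally show ?thesis by (simp add: add_increasing)
qed

text \<open>The product is dominated by a sum of singularities of order \<open>3/4\<close> at
  \<open>-1\<close>, \<open>1\<close> and \<open>s\<close>. Uniformity in \<open>s\<close> includes
  the endpoints, where two of them coincide.\<close>

lemma log_weight_bounded_arcsine: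
  fixes R :: real
  assumes R: "0 \<le> R"
  shows "\<exists>K\<ge>0. \<forall>s\<in>{-R..R}. (\<integral>\<^sup>+z\<in>{-1<..<1}. ennreal ((1-z\<^sup>2) powr (-1/2) * log_majorant \<bar>z - s\<bar>) \<partial>lborel) \<le> ennreal K"
proof -
  \<comment> \<open>At least one, so that the points \<open>-1\<close> and \<open>1\<close> are
    covered by the same constant \<open>K\<close>.\<close>
  define R' where "R' = max R 1"
  obtain K where K: "0 \<le> K" "\<And>s. s \<in> {-R'..R'} \<Longrightarrow> (\<integral>\<^sup>+z\<in>{-1..1}. ennreal (\<bar>z - s\<bar> powr (-3/4)) \<partial>lborel) \<le> ennreal K"
    using set_nn_integral_abs_powr_bounded[of "-3/4" R' 1] by auto
  have pw: "(1-z\<^sup>2) powr (-1/2) * log_majorant \<bar>z - s\<bar>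
     \<le> (9 + R) * \<bar>z - 1\<bar> powr (-3/4) + ((9 + R) * \<bar>z - (-1)\<bar> powr (-3/4) + 8 * \<bar>z - s\<bar> powr (-3/4))"
    if s: "s \<in> {-R..R}" and z: "-1 < z" "z < 1" for z s
  proof -
    define A where "A = 1 - z\<^sup>2"
    have A: "0 < A" "A \<le> 1" using z by (auto simp: A_def abs_square_less_1 power_less_one_iff abs_if)
    have AF: "A = (1 - z) * (1 + z)" by (simp add: A_def power2_eq_square algebra_simps)
    have A34: "A powr (-3/4) \<le> \<bar>z - 1\<bar> powr (-3/4) + \<bar>z - (-1)\<bar> powr (-3/4)"
    proof (cases "0 \<le> z")
      case True
      have "1 - z \<le> A" unfolding AF using z True mult_right_mono[of z 1 z] by (simp add: algebra_simps)
      then have "A powr (-3/4) \<le> (1-z) powr (-3/4)" using z by (intro powr_mono2') auto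
      then show ?thesis using z by (simp add: abs_if add_increasing2)
    next
      case False
      have "1 + z \<le> A" unfolding AF using z False mult_nonneg_nonpos[of "1+z" z] by (simp add: algebra_simps)
      then have "A powr (-3/4) \<le> (1+z) powr (-3/4)" using z by (intro powr_mono2') auto
      then show ?thesis using z by (simp add: abs_if add_increasing add.commute)
    qed
    have A12: "A powr (-1/2) \<le> A powr (-3/4)" using A by (intro powr_mono') auto
    have main: "A powr (-1/2) * log_majorant \<bar>z - s\<bar> \<le> (9 + R) * A powr (-3/4) + 8 * \<bar>z - s\<bar> powr (-3/4)"
    proof (cases "z = s")
      case True then show ?thesis using R A by simp
    next
      case False
      have "A powr (-1/2) * \<bar>z - s\<bar> powr (-1/4) \<le> A powr (-3/4) + \<bar>z - s\<bar> powr (-3/4)"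
        using False A by (intro powr_product_le_sum) auto
      moreover have "A powr (-1/2) * \<bar>z - s\<bar> \<le> A powr (-3/4) * (1 + R)"
        using s z A12 by (intro mult_mono) auto
      ultimately show ?thesis by (simp add: algebra_simps)
    qed
    also have "(9 + R) * A powr (-3/4) \<le> (9 + R) * (\<bar>z - 1\<bar> powr (-3/4) + \<bar>z - (-1)\<bar> powr (-3/4))"
      using A34 R by (intro mult_left_mono) auto
    finally show ?thesis unfolding A_def by (simp add: distrib_left)
  qed
  have e3: "ennreal (A * p + (A * q + C * r)) = ennreal A * ennreal p + (ennreal A * ennreal q + ennreal C * ennreal r)"
    if "0 \<le> A" "0 \<le> C" "0 \<le> p" "0 \<le> q" "0 \<le> r" for A C p q r :: real
    using that by (simp add: ennreal_mult')
  have e4: "(\<integral>\<^sup>+z. A * f z + (A * g z + C * h z) \<partial>lborel) = A * (\<integral>\<^sup>+z. f z \<partial>lborel) + (A * (\<integral>\<^sup>+z. g z \<partial>lborel) + C * (\<integral>\<^sup>+z. h z \<partial>lborel))"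
    if "f \<in> borel_measurable lborel" "g \<in> borel_measurable lborel" "h \<in> borel_measurable lborel" for A C and f g h :: "real \<Rightarrow> ennreal"
    using that by (simp add: nn_integral_add nn_integral_cmult)
  have "(\<integral>\<^sup>+z\<in>{-1<..<1}. ennreal ((1-z\<^sup>2) powr (-1/2) * log_majorant \<bar>z - s\<bar>) \<partial>lborel) \<le> ennreal ((9 + R) * K + ((9 + R) * K + 8 * K))"
    if s: "s \<in> {-R..R}" for s
  proof -
    let ?I = "\<lambda>s z. ennreal (\<bar>z - s\<bar> powr (-3/4)) * indicator {-1..1} z"
    have "(\<integral>\<^sup>+z\<in>{-1<..<1}. ennreal ((1-z\<^sup>2) powr (-1/2) * log_majorant \<bar>z - s\<bar>) \<partial>lborel)
      \<le> (\<integral>\<^sup>+z. ennreal (9 + R) * ?I 1 z + (ennreal (9 + R) * ?I (-1) z + ennreal 8 * ?I s z) \<partial>lborel)"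
    proof (rule nn_integral_mono)
      fix z :: real
      show "ennreal ((1-z\<^sup>2) powr (-1/2) * log_majorant \<bar>z - s\<bar>) * indicator {-1<..<1} z
        \<le> ennreal (9 + R) * ?I 1 z + (ennreal (9 + R) * ?I (-1) z + ennreal 8 * ?I s z)"
      proof (cases "z \<in> {-1<..<1}")
        case True
        have i: "indicator {-1<..<1} z = (1::ennreal)" "indicator {-1..1} z = (1::ennreal)" using True by auto
        have "ennreal ((9 + R) * \<bar>z - 1\<bar> powr (-3/4) + ((9 + R) * \<bar>z - (-1)\<bar> powr (-3/4) + 8 * \<bar>z - s\<bar> powr (-3/4)))
          = ennreal (9 + R) * ?I 1 z + (ennreal (9 + R) * ?I (-1) z + ennreal 8 * ?I s z)"
          unfolding i mult_1_right by (rule e3) (use R in auto)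
        then show ?thesis using ennreal_leI[OF pw[OF s, of z]] True by simp
      qed simp
    qed
    also have "\<dots> = ennreal (9 + R) * (\<integral>\<^sup>+z. ?I 1 z \<partial>lborel) + (ennreal (9 + R) * (\<integral>\<^sup>+z. ?I (-1) z \<partial>lborel) + ennreal 8 * (\<integral>\<^sup>+z. ?I s z \<partial>lborel))"
      by (rule e4) measurable
    also have "\<dots> \<le> ennreal (9 + R) * ennreal K + (ennreal (9 + R) * ennreal K + ennreal 8 * ennreal K)"
      using s by (intro add_mono mult_left_mono K(2)) (auto simp: R'_def)
    also have "\<dots> = ennreal ((9 + R) * K + ((9 + R) * K + 8 * K))"
      by (rule e3[symmetric]) (use K(1) R in auto)
    finally show ?thesis .
  qed
  then show ?thesis using K(1) R by (intro exI[of _ "(9 + R) * K + ((9 + R) * K + 8 * K)"]) auto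
qed

text \<open>The bound is uniform in \<open>a \<le> 1/2\<close> and serves to dominate the limit in
  which \<open>a\<close> tends to \<open>1/2\<close>.\<close>

lemma hit_kernel_le_arcsine:
  fixes a y z :: real
  assumes a: "0 < a" "a \<le> 1/2" and y: "1 < y" and z: "-1 < z" "z < 1"
  shows "hit_kernel a a y z \<le> (y+1)/(y-1) * (1-z\<^sup>2) powr (-1/2)"
proof -
  have A: "0 < 1 - z\<^sup>2" "1 - z\<^sup>2 \<le> 1" using z by (auto simp: abs_square_less_1 power_less_one_iff abs_if)
  have AF: "1 - z\<^sup>2 = (1 - z) * (1 + z)" by (simp add: power2_eq_square algebra_simps)
  have "(y-1) powr a * (y+1) powr a \<le> (y+1) powr a * (y+1) powr a" using y a by (intro mult_right_mono powr_mono2) auto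
  also have "\<dots> = (y+1) powr (a+a)" by (rule powr_add[symmetric])
  also have "\<dots> \<le> (y+1) powr 1" using y a by (intro powr_mono) auto
  finally have 1: "(y-1) powr a * (y+1) powr a \<le> y+1" using y by simp
  have "(1-z) powr (-a) * (1+z) powr (-a) = (1-z\<^sup>2) powr (-a)" unfolding AF using z by (simp add: powr_mult)
  also have "\<dots> \<le> (1-z\<^sup>2) powr (-1/2)" using A a by (intro powr_mono') auto
  finally have 2: "(1-z) powr (-a) * (1+z) powr (-a) \<le> (1-z\<^sup>2) powr (-1/2)" .
  have "sin (pi*a) \<le> pi" using sin_le_one[of "pi*a"] pi_gt3 by linarith
  then have s: "0 \<le> sin (pi*a) / pi" "sin (pi*a) / pi \<le> 1"
    using sin_pi_pos[of a] a by (auto simp: field_simps)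
  have "hit_kernel a a y z = (sin (pi*a) / pi) * ((y-1) powr a * (y+1) powr a) * ((1-z) powr (-a) * (1+z) powr (-a)) * (1 / (y-z))"
    by (simp add: hit_kernel_def)
  also have "\<dots> \<le> 1 * (y+1) * (1-z\<^sup>2) powr (-1/2) * (1 / (y-1))"
    using 1 2 s y z by (intro mult_mono) (auto simp: frac_le)
  finally show ?thesis by simp
qed

text \<open>Up to sign, the logarithmic potential of the unit mass at \<open>y\<close> swept onto
  the interval.\<close>

definition hit_log :: "real \<Rightarrow> real \<Rightarrow> real" where
  "hit_log y s = (\<integral>z. indicator {-1<..<1} z * (hit_kernel (1/2) (1/2) y z * ln \<bar>z - s\<bar>) \<partial>lborel)"

text \<open>No mass is lost in the critical case, in accordance with almost sure entrance; this
  gives \<open>hit_mixture A\<close> the same mass as \<open>A\<close>.\<close>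

lemma nn_integral_hit_kernel_half:
  assumes y: "1 < y"
  shows "(\<integral>\<^sup>+z\<in>{-1<..<1}. ennreal (hit_kernel (1/2) (1/2) y z) \<partial>lborel) = 1"
proof -
  define c where "c = 1 / pi * (y-1) powr (1/2) * (y+1) powr (1/2)"
  have c: "0 < c" using y by (simp add: c_def)
  have "(\<integral>\<^sup>+z\<in>{-1<..<1}. ennreal (hit_kernel (1/2) (1/2) y z) \<partial>lborel)
    = ennreal c * (\<integral>\<^sup>+z\<in>{-1<..<1}. ennreal ((1-z) powr (-(1/2)) * (1+z) powr (1/2-1) / (y-z)) \<partial>lborel)"
    by (rule set_nn_integral_cong_cmult) (use c in \<open>simp_all add: hit_kernel_def c_def ennreal_mult'[symmetric]\<close>)
  also have "\<dots> = ennreal (c * (pi / sin (pi*(1/2)) * (y-1) powr (-(1/2)) * (y+1) powr (1/2-1)))"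
    using c by (subst nn_integral_endpoint) (use y in \<open>simp_all add: ennreal_mult'\<close>)
  also have "c * (pi / sin (pi*(1/2)) * (y-1) powr (-(1/2)) * (y+1) powr (1/2-1)) = 1"
    using y by (simp add: c_def powr_minus field_simps)
  finally show ?thesis by simp
qed

text \<open>One domination for logarithms, their difference quotients and constants. The majorant is
  part of the conclusion and the same for all \<open>a \<le> 1/2\<close>, as dominated convergence
  in \<open>a\<close> requires.\<close>

lemma integrable_hit_kernel_dominated:
  fixes a y s :: real and g :: "real \<Rightarrow> real"
  assumes a: "0 < a" "a \<le> 1/2" and y: "1 < y" and g [measurable]: "g \<in> borel_measurable borel"
    and bound: "\<And>z. z \<noteq> s \<Longrightarrow> \<bar>g z\<bar> \<le> log_majorant \<bar>z - s\<bar>"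
  shows "integrable lborel (\<lambda>z. indicator {-1<..<1} z * (hit_kernel a a y z * g z))"
    and "AE z in lborel. \<bar>indicator {-1<..<1} z * (hit_kernel a a y z * g z)\<bar>
      \<le> indicator {-1<..<1} z * ((y+1)/(y-1) * ((1-z\<^sup>2) powr (-1/2) * log_majorant \<bar>z - s\<bar>))"
    and "integrable lborel (\<lambda>z. indicator {-1<..<1} z * ((y+1)/(y-1) * ((1-z\<^sup>2) powr (-1/2) * log_majorant \<bar>z - s\<bar>)))"
proof -
  let ?D = "\<lambda>z. (1-z\<^sup>2) powr (-1/2) * log_majorant \<bar>z - s\<bar>"
  have "integrable lborel (\<lambda>z. indicator {-1<..<1} z * ?D z)"
  proof (rule integrableI_nonneg)
    obtain K where K: "\<forall>s\<in>{-\<bar>s\<bar>..\<bar>s\<bar>}. (\<integral>\<^sup>+z\<in>{-1<..<1}. ennreal ((1-z\<^sup>2) powr (-1/2) * log_majorant \<bar>z - s\<bar>) \<partial>lborel) \<le> ennreal K"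
      using log_weight_bounded_arcsine[of "\<bar>s\<bar>"] by auto
    have "(\<integral>\<^sup>+z. ennreal (indicator {-1<..<1} z * ?D z) \<partial>lborel) = (\<integral>\<^sup>+z\<in>{-1<..<1}. ennreal (?D z) \<partial>lborel)"
      by (intro nn_integral_cong) (simp add: indicator_def)
    also have "\<dots> \<le> ennreal K" by (rule bspec[OF K]) auto
    finally show "(\<integral>\<^sup>+z. ennreal (indicator {-1<..<1} z * ?D z) \<partial>lborel) < \<infinity>" by (rule le_less_trans) simp
  qed (auto simp: indicator_def)
  then have "integrable lborel (\<lambda>z. (y+1)/(y-1) * (indicator {-1<..<1} z * ?D z))" by (rule integrable_mult_right)
  then show D: "integrable lborel (\<lambda>z. indicator {-1<..<1} z * ((y+1)/(y-1) * ?D z))" by (simp only: mult.left_commute)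
  have "AE z in lborel. z \<noteq> s" by (rule AE_lborel_singleton)
  then show le: "AE z in lborel. \<bar>indicator {-1<..<1} z * (hit_kernel a a y z * g z)\<bar> \<le> indicator {-1<..<1} z * ((y+1)/(y-1) * ?D z)"
  proof eventually_elim
    case (elim z)
    show ?case
    proof (cases "z \<in> {-1<..<1}")
      case True
      then have z: "-1 < z" "z < 1" by auto
      have h: "0 \<le> hit_kernel a a y z" by (rule hit_kernel_nonneg) (use a y z in auto)
      have "hit_kernel a a y z * \<bar>g z\<bar> \<le> ((y+1)/(y-1) * (1-z\<^sup>2) powr (-1/2)) * log_majorant \<bar>z - s\<bar>"
        by (intro mult_mono hit_kernel_le_arcsine[OF a y z] bound[OF elim]) (use y in auto)
      then show ?thesis using True h by (simp add: abs_mult mult.assoc)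
    qed simp
  qed
  show "integrable lborel (\<lambda>z. indicator {-1<..<1} z * (hit_kernel a a y z * g z))"
  proof (rule Bochner_Integration.integrable_bound[OF D])
    show "AE z in lborel. norm (indicator {-1<..<1} z * (hit_kernel a a y z * g z)) \<le> norm (indicator {-1<..<1} z * ((y+1)/(y-1) * ?D z))"
      using le by eventually_elim (simp only: real_norm_def abs_ge_self order_trans)
  qed measurable
qed

text \<open>Treats the constant function like a logarithm with base point \<open>2\<close>. The base
  point is excluded because \<open>log_majorant\<close> evaluates to zero there.\<close>

lemma one_le_log_majorant:
  fixes z :: real
  assumes "z \<noteq> 2"
  shows "\<bar>1::real\<bar> \<le> log_majorant \<bar>z - 2\<bar>"
proof (cases "1 \<le> \<bar>z - 2\<bar>")
  case False
  have "1 = \<bar>z - 2\<bar> powr 0" using assms by simp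
  also have "\<dots> \<le> \<bar>z - 2\<bar> powr (-1/4)" using False assms by (intro powr_mono') auto
  finally show ?thesis by simp
qed (simp add: add_increasing)

lemma integrable_hit_kernel:
  fixes a y :: real
  assumes a: "0 < a" "a \<le> 1/2" and y: "1 < y"
  shows "integrable lborel (\<lambda>z. indicator {-1<..<1} z * hit_kernel a a y z)"
proof -
  have "integrable lborel (\<lambda>z. indicator {-1<..<1} z * (hit_kernel a a y z * 1))"
    by (rule integrable_hit_kernel_dominated(1)[OF a y, where s = 2]) (simp, rule one_le_log_majorant)
  then show ?thesis by simp
qed

text \<open>For \<open>\<rho> = 1/2\<close> the two branches have the same form, and the cross ratio
  \<open>c\<close> does not depend on \<open>\<alpha>\<close>; this is what the passage to the limit
  needs.\<close>

lemma green_density_symmetric: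
  fixes x y :: real
  assumes x: "1 < x" and y: "1 < y" and xy: "x \<noteq> y"
  obtains c where "0 < c" "c < 1"
    "\<And>\<alpha>. 0 < \<alpha> \<Longrightarrow> ennreal (green_density \<alpha> (1/2) x y) = ennreal (1 / (Gamma (\<alpha>/2) * Gamma (\<alpha>/2)) * \<bar>y-x\<bar> powr (\<alpha>-1)) *
       (\<integral>\<^sup>+w\<in>{0<..<c}. ennreal (w powr (\<alpha>/2-1) * (1-w) powr (-\<alpha>)) \<partial>lborel)"
proof (cases "x < y")
  case True
  let ?c = "(x-1)*(y+1)/((x+1)*(y-1))"
  have "(x-1)*(y+1) < (x+1)*(y-1)" using True by (simp add: algebra_simps)
  then have "0 < ?c" "?c < 1" using x y by (auto simp: divide_less_eq)
  then show ?thesis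
  proof (rule that)
    fix \<alpha> :: real assume "0 < \<alpha>"
    then show "ennreal (green_density \<alpha> (1/2) x y) = ennreal (1 / (Gamma (\<alpha>/2) * Gamma (\<alpha>/2)) * \<bar>y-x\<bar> powr (\<alpha>-1)) *
       (\<integral>\<^sup>+w\<in>{0<..<?c}. ennreal (w powr (\<alpha>/2-1) * (1-w) powr (-\<alpha>)) \<partial>lborel)"
      using green_density_upper[of \<alpha> "1/2" x y] True x by simp
  qed
next
  case False
  then have yx: "y < x" using xy by simp
  let ?c = "(x+1)*(y-1)/((x-1)*(y+1))"
  have "(x+1)*(y-1) < (x-1)*(y+1)" using yx by (simp add: algebra_simps)
  then have "0 < ?c" "?c < 1" using x y by (auto simp: divide_less_eq)
  then show ?thesis
  proof (rule that)
    fix \<alpha> :: real assume "0 < \<alpha>"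
    then show "ennreal (green_density \<alpha> (1/2) x y) = ennreal (1 / (Gamma (\<alpha>/2) * Gamma (\<alpha>/2)) * \<bar>y-x\<bar> powr (\<alpha>-1)) *
       (\<integral>\<^sup>+w\<in>{0<..<?c}. ennreal (w powr (\<alpha>/2-1) * (1-w) powr (-\<alpha>)) \<partial>lborel)"
      using green_density_lower[of \<alpha> "1/2" y x] yx y by simp
  qed
qed

text \<open>Since \<open>c < 1\<close> is fixed, the integrands keep away from the singularity at
  \<open>1\<close>, and at zero the exponents \<open>(1 - e n)/2 - 1\<close> stay above
  \<open>-3/4\<close>.\<close>

lemma green_density_tendsto_critical:
  fixes x y :: real
  assumes x: "1 < x" and y: "1 < y" and xy: "x \<noteq> y"
    and e: "\<And>n. 0 < e n" "\<And>n. e n \<le> 1/8" "e \<longlonglongrightarrow> 0"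
  shows "(\<lambda>n. ennreal (green_density (1 - e n) (1/2) x y)) \<longlonglongrightarrow> ennreal (green_density 1 (1/2) x y)"
proof -
  obtain c where c: "0 < c" "c < 1" and G: "\<And>\<alpha>. 0 < \<alpha> \<Longrightarrow> ennreal (green_density \<alpha> (1/2) x y) =
      ennreal (1 / (Gamma (\<alpha>/2) * Gamma (\<alpha>/2)) * \<bar>y-x\<bar> powr (\<alpha>-1)) *
       (\<integral>\<^sup>+w\<in>{0<..<c}. ennreal (w powr (\<alpha>/2-1) * (1-w) powr (-\<alpha>)) \<partial>lborel)"
    by (rule green_density_symmetric[OF x y xy]) (rule that)
  have e1: "0 < 1 - e n" for n using e(2)[of n] by simp
  have t: "(\<lambda>n. 1 - e n) \<longlonglongrightarrow> 1" using tendsto_diff[OF tendsto_const e(3), of 1] by simp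
  have A: "(\<lambda>n. 1 / (Gamma ((1 - e n)/2) * Gamma ((1 - e n)/2)) * \<bar>y-x\<bar> powr ((1 - e n)-1))
     \<longlonglongrightarrow> 1 / (Gamma (1/2) * Gamma (1/2)) * \<bar>y-x\<bar> powr (1-1)"
    using xy Gamma_real_pos[of "1/2"] by (intro tendsto_intros t) (auto elim!: nonpos_Ints_cases simp del: Gamma_real_pos)
  have dom: "(\<integral>\<^sup>+w\<in>{0<..<c}. ennreal (1 / (1-c) * w powr (-3/4)) \<partial>lborel) < \<infinity>"
  proof -
    have "(\<integral>\<^sup>+w\<in>{0<..<c}. ennreal (1 / (1-c) * w powr (-3/4)) \<partial>lborel) = ennreal (1/(1-c)) * (\<integral>\<^sup>+w\<in>{0<..<c}. ennreal (w powr (-3/4)) \<partial>lborel)"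
    proof (rule set_nn_integral_cong_cmult)
      show "ennreal (1 / (1-c) * w powr (-3/4)) = ennreal (1 / (1-c)) * ennreal (w powr (-3/4))" for w
        by (rule ennreal_mult') (use c in simp)
    qed auto
    also have "\<dots> \<le> ennreal (1/(1-c)) * (\<integral>\<^sup>+w\<in>{-1..1}. ennreal (\<bar>w - 0\<bar> powr (-3/4)) \<partial>lborel)"
      using c by (intro mult_left_mono nn_integral_mono) (auto simp: indicator_def)
    also have "\<dots> < \<infinity>"
    proof -
      obtain K where "(\<integral>\<^sup>+w\<in>{-1..1}. ennreal (\<bar>w - 0\<bar> powr (-3/4)) \<partial>lborel) \<le> ennreal K"
        using set_nn_integral_abs_powr_bounded[of "-3/4" 0 1] by auto
      then have "(\<integral>\<^sup>+w\<in>{-1..1}. ennreal (\<bar>w - 0\<bar> powr (-3/4)) \<partial>lborel) < \<infinity>" by (rule le_less_trans) simp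
      then show ?thesis by (simp add: ennreal_mult_less_top)
    qed
    finally show ?thesis .
  qed
  have B: "(\<lambda>n. \<integral>\<^sup>+w\<in>{0<..<c}. ennreal (w powr ((1 - e n)/2-1) * (1-w) powr (-(1 - e n))) \<partial>lborel)
     \<longlonglongrightarrow> (\<integral>\<^sup>+w\<in>{0<..<c}. ennreal (w powr (1/2-1) * (1-w) powr (-1)) \<partial>lborel)"
  proof (rule nn_integral_dominated_convergence[OF _ _ _ _ dom])
    fix n
    show "AE w in lborel. ennreal (w powr ((1 - e n)/2-1) * (1-w) powr (-(1 - e n))) * indicator {0<..<c} w \<le> ennreal (1 / (1-c) * w powr (-3/4)) * indicator {0<..<c} w"
    proof (intro AE_I2)
      fix w :: real
      show "ennreal (w powr ((1 - e n)/2-1) * (1-w) powr (-(1 - e n))) * indicator {0<..<c} w \<le> ennreal (1 / (1-c) * w powr (-3/4)) * indicator {0<..<c} w"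
      proof (cases "w \<in> {0<..<c}")
        case True
        have 1: "w powr ((1 - e n)/2-1) \<le> w powr (-3/4)"
          using True c e(2)[of n] by (intro powr_mono') (auto simp: field_simps)
        have "(1-w) powr (-(1 - e n)) \<le> (1-w) powr (-1)"
          using True c e(1)[of n] by (intro powr_mono') auto
        also have "\<dots> \<le> 1 / (1-c)" using True c by (simp add: powr_minus field_simps)
        finally have 2: "(1-w) powr (-(1 - e n)) \<le> 1 / (1-c)" .
        have "w powr ((1 - e n)/2-1) * (1-w) powr (-(1 - e n)) \<le> w powr (-3/4) * (1 / (1-c))"
          by (intro mult_mono 1 2) auto
        then show ?thesis using True by (simp add: mult.commute ennreal_leI)
      qed simp
    qed
  next
    show "AE w in lborel. (\<lambda>n. ennreal (w powr ((1 - e n)/2-1) * (1-w) powr (-(1 - e n))) * indicator {0<..<c} w) \<longlonglongrightarrow> ennreal (w powr (1/2-1) * (1-w) powr (-1)) * indicator {0<..<c} w"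
    proof (intro AE_I2)
      fix w :: real
      show "(\<lambda>n. ennreal (w powr ((1 - e n)/2-1) * (1-w) powr (-(1 - e n))) * indicator {0<..<c} w) \<longlonglongrightarrow> ennreal (w powr (1/2-1) * (1-w) powr (-1)) * indicator {0<..<c} w"
      proof (cases "w \<in> {0<..<c}")
        case True
        then have "(\<lambda>n. ennreal (w powr ((1 - e n)/2-1) * (1-w) powr (-(1 - e n)))) \<longlonglongrightarrow> ennreal (w powr (1/2-1) * (1-w) powr (-1))"
          using c by (intro tendsto_ennrealI tendsto_intros t) auto
        then show ?thesis using True by simp
      qed simp
    qed
  qed measurable
  have fin: "(\<integral>\<^sup>+w\<in>{0<..<c}. ennreal (w powr (1/2-1) * (1-w) powr (-1)) \<partial>lborel) \<noteq> \<infinity>"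
  proof -
    have "(\<integral>\<^sup>+w\<in>{0<..<c}. ennreal (w powr (1/2-1) * (1-w) powr (-1)) \<partial>lborel) \<le> (\<integral>\<^sup>+w\<in>{0<..<c}. ennreal (1 / (1-c) * w powr (-3/4)) \<partial>lborel)"
    proof (intro nn_integral_mono)
      fix w :: real
      show "ennreal (w powr (1/2-1) * (1-w) powr (-1)) * indicator {0<..<c} w \<le> ennreal (1 / (1-c) * w powr (-3/4)) * indicator {0<..<c} w"
      proof (cases "w \<in> {0<..<c}")
        case True
        have "w powr (1/2-1) * (1-w) powr (-1) \<le> w powr (-3/4) * (1 / (1-c))"
          using True c by (intro mult_mono powr_mono') (auto simp: powr_minus field_simps)
        then show ?thesis using True by (simp add: mult.commute ennreal_leI)
      qed simp
    qed
    then show ?thesis using dom by auto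
  qed
  show ?thesis
    unfolding G[OF e1] G[OF zero_less_one] using A B fin
    by (intro tendsto_mult_ennreal tendsto_ennrealI) auto
qed

text \<open>The logarithmic balayage identities are the limits, as the exponent \<open>1 - e\<close> tends to one, of the balayage
  identities for \<open>riesz_kernel\<close>, since \<open>(1 - r powr (-e)) / e\<close> tends to \<open>ln r\<close>. Since \<open>s\<close> does not
  occur in the sequence, it drops out of the limit as well.\<close>
lemma hit_log_tendsto:
  fixes y s \<gamma>0 :: real and e \<gamma> :: "nat \<Rightarrow> real"
  assumes y: "1 < y" and s: "s \<noteq> y"
    and e: "\<And>n. 0 < e n" "\<And>n. e n \<le> 1/8" "e \<longlonglongrightarrow> 0"
    and \<gamma>: "\<And>n. 0 \<le> \<gamma> n" "\<gamma> \<longlonglongrightarrow> \<gamma>0"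
    and pot: "\<And>n. (\<integral>\<^sup>+z\<in>{-1<..<1}. ennreal (hit_kernel ((1 - e n)/2) ((1 - e n)/2) y z) * ennreal (riesz_kernel ((1 - e n)/2) ((1 - e n)/2) (z-s)) \<partial>lborel)
      + ennreal (\<gamma> n) = ennreal (riesz_kernel ((1 - e n)/2) ((1 - e n)/2) (y-s))"
  shows "(\<lambda>n. ((\<integral>z. indicator {-1<..<1} z * hit_kernel ((1 - e n)/2) ((1 - e n)/2) y z \<partial>lborel) - 1) / e n)
     \<longlonglongrightarrow> hit_log y s - ln \<bar>y - s\<bar> - pi * \<gamma>0"
proof -
  define a where "a = (\<lambda>n. (1 - e n)/2)"
  have an: "(1 - e n)/2 = a n" for n by (simp add: a_def)
  \<comment> \<open>The constant of the Riesz kernel. It diverges like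
    \<open>1 / (pi * e n)\<close>, which \<open>ek\<close> below makes precise.\<close>
  define k where "k = (\<lambda>n. Gamma (e n) / pi * sin (pi * a n))"
  have a: "0 < a n" "a n \<le> 1/2" "a n < 1" for n using e(1,2)[of n] by (auto simp: a_def)
  have k: "0 < k n" for n using e(1)[of n] sin_pi_pos[OF a(1,3)[of n]] by (auto simp: k_def)
  have rk: "riesz_kernel (a n) (a n) w = k n * \<bar>w\<bar> powr (- e n)" for n w
  proof -
    have E: "1 - a n - a n = e n" "a n + a n - 1 = - e n" by (simp_all add: a_def field_simps)
    show ?thesis unfolding riesz_kernel_def E by (simp add: k_def)
  qed
  \<comment> \<open>Subtracting one before dividing by \<open>e n\<close> removes the divergence;
    what is subtracted integrates to the mass \<open>m n\<close>.\<close>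
  define g where "g = (\<lambda>n z. (\<bar>z - s\<bar> powr (- e n) - 1) / e n)"
  define m where "m = (\<lambda>n. \<integral>z. indicator {-1<..<1} z * hit_kernel (a n) (a n) y z \<partial>lborel)"
  have gm [measurable]: "g n \<in> borel_measurable borel" for n unfolding g_def by measurable
  have gb: "\<bar>g n z\<bar> \<le> log_majorant \<bar>z - s\<bar>" if "z \<noteq> s" for n z
    unfolding g_def using that by (intro neg_powr_quotient e) auto
  note I = integrable_hit_kernel_dominated[OF a(1,2) y gm gb]
  have I1: "integrable lborel (\<lambda>z. indicator {-1<..<1} z * (hit_kernel (a n) (a n) y z * g n z))" for n
    by (rule I(1))
  note m_int = integrable_hit_kernel[OF a(1,2) y]
  have F: "(\<lambda>n. \<integral>z. indicator {-1<..<1} z * (hit_kernel (a n) (a n) y z * g n z) \<partial>lborel)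
    \<longlonglongrightarrow> (\<integral>z. indicator {-1<..<1} z * (hit_kernel (1/2) (1/2) y z * (- ln \<bar>z - s\<bar>)) \<partial>lborel)"
  proof (rule integral_dominated_convergence[OF _ _ I(3)])
    have "AE z in lborel. z \<noteq> s" by (rule AE_lborel_singleton)
    then show "AE z in lborel. (\<lambda>n. indicator {-1<..<1} z * (hit_kernel (a n) (a n) y z * g n z)) \<longlonglongrightarrow> indicator {-1<..<1} z * (hit_kernel (1/2) (1/2) y z * (- ln \<bar>z - s\<bar>))"
    proof eventually_elim
      case (elim z)
      show ?case
      proof (cases "z \<in> {-1<..<1}")
        case True
        have t: "a \<longlonglongrightarrow> 1/2" unfolding a_def using tendsto_divide[OF tendsto_diff[OF tendsto_const[of 1] e(3)] tendsto_const[of 2]] by simp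
        have "(\<lambda>n. hit_kernel (a n) (a n) y z) \<longlonglongrightarrow> hit_kernel (1/2) (1/2) y z"
          unfolding hit_kernel_def using True y by (intro tendsto_intros t) auto
        moreover have "(\<lambda>n. g n z) \<longlonglongrightarrow> - ln \<bar>z - s\<bar>"
          unfolding g_def using elim by (intro neg_powr_quotient_tendsto e) auto
        ultimately show ?thesis by (intro tendsto_mult tendsto_const)
      qed simp
    qed
    show "AE z in lborel. norm (indicator {-1<..<1} z * (hit_kernel (a n) (a n) y z * g n z))
      \<le> indicator {-1<..<1} z * ((y+1)/(y-1) * ((1-z\<^sup>2) powr (-1/2) * log_majorant \<bar>z - s\<bar>))" for n
      unfolding real_norm_def by (rule I(2))
  qed measurable
  have F0: "(\<integral>z. indicator {-1<..<1} z * (hit_kernel (1/2) (1/2) y z * (- ln \<bar>z - s\<bar>)) \<partial>lborel) = - hit_log y s"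
    unfolding hit_log_def by (simp flip: integral_minus)
  \<comment> \<open>The hypothesis \<open>pot\<close>, divided by \<open>e n * k n\<close> and
    solved for the integral with \<open>g\<close>.\<close>
  have Fn: "(\<integral>z. indicator {-1<..<1} z * (hit_kernel (a n) (a n) y z * g n z) \<partial>lborel)
     = (\<bar>y - s\<bar> powr (- e n) - 1) / e n - (m n - 1) / e n - \<gamma> n / (e n * k n)" for n
  proof -
    let ?H = "\<lambda>z. indicator {-1<..<1} z * (hit_kernel (a n) (a n) y z * \<bar>z - s\<bar> powr (- e n))"
    have H0: "0 \<le> ?H z" for z using hit_kernel_nonneg[OF a(1,3) y, of z n] by (auto simp: indicator_def)
    have Hg: "?H z = e n * (indicator {-1<..<1} z * (hit_kernel (a n) (a n) y z * g n z)) + indicator {-1<..<1} z * hit_kernel (a n) (a n) y z" for z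
      using e(1)[of n] by (simp add: g_def field_simps)
    have Hi: "integrable lborel ?H"
      unfolding Hg by (intro Bochner_Integration.integrable_add integrable_mult_right I1 m_int)
    have "(\<integral>\<^sup>+z\<in>{-1<..<1}. ennreal (hit_kernel (a n) (a n) y z) * ennreal (riesz_kernel (a n) (a n) (z-s)) \<partial>lborel)
      = (\<integral>\<^sup>+z. ennreal (k n) * ennreal (?H z) \<partial>lborel)"
    proof (rule nn_integral_cong)
      fix z :: real
      show "ennreal (hit_kernel (a n) (a n) y z) * ennreal (riesz_kernel (a n) (a n) (z-s)) * indicator {-1<..<1} z = ennreal (k n) * ennreal (?H z)"
        using hit_kernel_nonneg[OF a(1,3) y, of z n] less_imp_le[OF k[of n]]
        by (auto simp: indicator_def rk ennreal_mult mult_ac)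
    qed
    also have "\<dots> = ennreal (k n) * ennreal (\<integral>z. ?H z \<partial>lborel)"
      by (subst nn_integral_cmult) (simp_all add: nn_integral_eq_integral[OF Hi] H0)
    also have "\<dots> = ennreal (k n * (\<integral>z. ?H z \<partial>lborel))" by (rule ennreal_mult'[symmetric]) (use k[of n] in simp)
    finally have "ennreal (k n * (\<integral>z. ?H z \<partial>lborel)) + ennreal (\<gamma> n) = ennreal (k n * \<bar>y - s\<bar> powr (- e n))"
      using pot[of n] unfolding an rk by simp
    moreover have "0 \<le> k n * (\<integral>z. ?H z \<partial>lborel)" using k[of n] H0 by (intro mult_nonneg_nonneg integral_nonneg) auto
    ultimately have "k n * (\<integral>z. ?H z \<partial>lborel) + \<gamma> n = k n * \<bar>y - s\<bar> powr (- e n)"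
      using \<gamma>(1)[of n] k[of n] by (simp add: ennreal_plus[symmetric] del: ennreal_plus)
    then have HI: "(\<integral>z. ?H z \<partial>lborel) = \<bar>y - s\<bar> powr (- e n) - \<gamma> n / k n"
      using k[of n] by (simp add: field_simps)
    have "(\<integral>z. ?H z \<partial>lborel) = e n * (\<integral>z. indicator {-1<..<1} z * (hit_kernel (a n) (a n) y z * g n z) \<partial>lborel) + m n"
      unfolding Hg m_def by (subst Bochner_Integration.integral_add[OF integrable_mult_right[OF I1] m_int]) (simp only: integral_mult_right_zero)
    then show ?thesis using HI e(1)[of n] k[of n] by (simp add: field_simps)
  qed
  \<comment> \<open>By \<open>e * Gamma e = Gamma (e + 1)\<close>. This limit is the origin of the
    factor \<open>pi\<close> in front of \<open>\<gamma>0\<close>.\<close>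
  have ek: "(\<lambda>n. e n * k n) \<longlonglongrightarrow> 1 / pi"
  proof -
    have "e n * k n = Gamma (e n + 1) / pi * sin (pi * a n)" for n
    proof -
      have "e n \<notin> \<int>\<^sub>\<le>\<^sub>0" using e(1)[of n] by (auto elim!: nonpos_Ints_cases)
      then show ?thesis by (simp add: k_def Gamma_plus1)
    qed
    moreover have "(\<lambda>n. Gamma (e n + 1) / pi * sin (pi * ((1 - e n)/2))) \<longlonglongrightarrow> Gamma (0 + 1) / pi * sin (pi * ((1 - 0)/2))"
      by (intro tendsto_intros e(3)) (auto elim!: nonpos_Ints_cases)
    ultimately show ?thesis by (simp add: a_def)
  qed
  have "(\<lambda>n. (\<bar>y - s\<bar> powr (- e n) - 1) / e n - \<gamma> n / (e n * k n) - (\<integral>z. indicator {-1<..<1} z * (hit_kernel (a n) (a n) y z * g n z) \<partial>lborel))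
    \<longlonglongrightarrow> - ln \<bar>y - s\<bar> - \<gamma>0 / (1 / pi) - (- hit_log y s)"
    by (intro tendsto_diff tendsto_divide neg_powr_quotient_tendsto e(1,3) \<gamma>(2) ek F[unfolded F0]) (use s in auto)
  moreover have "(\<bar>y - s\<bar> powr (- e n) - 1) / e n - \<gamma> n / (e n * k n) - (\<integral>z. indicator {-1<..<1} z * (hit_kernel (a n) (a n) y z * g n z) \<partial>lborel)
    = (m n - 1) / e n" for n unfolding Fn by simp
  ultimately have "(\<lambda>n. (m n - 1) / e n) \<longlonglongrightarrow> hit_log y s - ln \<bar>y - s\<bar> - pi * \<gamma>0" by (simp add: algebra_simps)
  then show ?thesis unfolding an m_def .
qed

lemma hit_log_inside_tendsto:
  fixes y s :: real and e :: "nat \<Rightarrow> real"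
  assumes y: "1 < y" and s: "\<bar>s\<bar> \<le> 1" and e: "\<And>n. 0 < e n" "\<And>n. e n \<le> 1/8" "e \<longlonglongrightarrow> 0"
  shows "(\<lambda>n. ((\<integral>z. indicator {-1<..<1} z * hit_kernel ((1 - e n)/2) ((1 - e n)/2) y z \<partial>lborel) - 1) / e n)
     \<longlonglongrightarrow> hit_log y s - ln (y - s)"
proof -
  have "(\<lambda>n. ((\<integral>z. indicator {-1<..<1} z * hit_kernel ((1 - e n)/2) ((1 - e n)/2) y z \<partial>lborel) - 1) / e n)
     \<longlonglongrightarrow> hit_log y s - ln \<bar>y - s\<bar> - pi * 0"
  proof (rule hit_log_tendsto[OF y _ e, where \<gamma> = "\<lambda>_. 0"])
    fix n
    show "(\<integral>\<^sup>+z\<in>{-1<..<1}. ennreal (hit_kernel ((1 - e n)/2) ((1 - e n)/2) y z) * ennreal (riesz_kernel ((1 - e n)/2) ((1 - e n)/2) (z-s)) \<partial>lborel)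
      + ennreal 0 = ennreal (riesz_kernel ((1 - e n)/2) ((1 - e n)/2) (y-s))"
      using e(1,2)[of n] s y by (subst hit_kernel_potential_inside) auto
  qed (use s y in auto)
  then show ?thesis using s y by simp
qed

lemma hit_log_inside:
  assumes "1 < y" "\<bar>s\<bar> \<le> 1"
  shows "hit_log y s - ln (y - s) = hit_log y 1 - ln (y - 1)"
proof -
  \<comment> \<open>A concrete null sequence within the bound \<open>1/8\<close> of
    \<open>neg_powr_quotient\<close>.\<close>
  define e where "e = (\<lambda>n. 1 / (real n + 8))"
  have e: "0 < e n" "e n \<le> 1/8" for n by (auto simp: e_def field_simps)
  have e0: "e \<longlonglongrightarrow> 0" unfolding e_def by real_asymp
  show ?thesis
    by (rule LIMSEQ_unique[OF hit_log_inside_tendsto[OF assms e e0] hit_log_inside_tendsto[OF assms(1) _ e e0]]) simp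
qed

text \<open>At \<open>x\<close> the limit contains the Green density in addition, with factor
  \<open>pi\<close>; uniqueness of the limit of the common sequence of masses compares it with the
  value at \<open>1\<close>.\<close>

lemma hit_log_outside:
  assumes x: "1 < x" and y: "1 < y" and xy: "x \<noteq> y"
  shows "hit_log y x - ln \<bar>y - x\<bar> = hit_log y 1 - ln (y - 1) + pi * enn2real (ennreal (green_density 1 (1/2) x y))"
proof -
  define e where "e = (\<lambda>n. 1 / (real n + 8))"
  have e: "0 < e n" "e n \<le> 1/8" for n by (auto simp: e_def field_simps)
  have e0: "e \<longlonglongrightarrow> 0" unfolding e_def by real_asymp
  \<comment> \<open>Passing through \<open>ennreal\<close> yields a nonnegative real number without
    a separate sign argument for the interval integral.\<close>
  define \<gamma> where "\<gamma> = (\<lambda>n. enn2real (ennreal (green_density (1 - e n) (1/2) x y)))"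
  have "\<gamma> \<longlonglongrightarrow> enn2real (ennreal (green_density 1 (1/2) x y))"
    unfolding \<gamma>_def
  proof (rule tendsto_enn2real)
    show "(\<lambda>n. ennreal (green_density (1 - e n) (1/2) x y)) \<longlonglongrightarrow> ennreal (enn2real (ennreal (green_density 1 (1/2) x y)))"
      using green_density_tendsto_critical[OF x y xy e e0] by simp
  qed simp
  then have "(\<lambda>n. ((\<integral>z. indicator {-1<..<1} z * hit_kernel ((1 - e n)/2) ((1 - e n)/2) y z \<partial>lborel) - 1) / e n)
     \<longlonglongrightarrow> hit_log y x - ln \<bar>y - x\<bar> - pi * enn2real (ennreal (green_density 1 (1/2) x y))"
  proof (rule hit_log_tendsto[OF y xy e e0, rotated])
    fix n
    show "0 \<le> \<gamma> n" by (simp add: \<gamma>_def)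
    have E: "(1 - e n) * (1/2) = (1 - e n)/2" "(1 - e n) * (1 - 1/2) = (1 - e n)/2" by auto
    have "(\<integral>\<^sup>+z\<in>{-1<..<1}. ennreal (hit_kernel ((1 - e n)/2) ((1 - e n)/2) y z) * ennreal (riesz_kernel ((1 - e n)/2) ((1 - e n)/2) (z-x)) \<partial>lborel)
      + ennreal (green_density (1 - e n) (1/2) x y) = ennreal (riesz_kernel ((1 - e n)/2) ((1 - e n)/2) (y-x))"
      using hit_kernel_potential_outside[of "1 - e n" "1/2" x y, unfolded E] e[of n] x y xy by simp
    moreover have "ennreal (\<gamma> n) = ennreal (green_density (1 - e n) (1/2) x y)" by (simp add: \<gamma>_def)
    ultimately show "(\<integral>\<^sup>+z\<in>{-1<..<1}. ennreal (hit_kernel ((1 - e n)/2) ((1 - e n)/2) y z) * ennreal (riesz_kernel ((1 - e n)/2) ((1 - e n)/2) (z-x)) \<partial>lborel)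
      + ennreal (\<gamma> n) = ennreal (riesz_kernel ((1 - e n)/2) ((1 - e n)/2) (y-x))" by (simp only:)
  qed
  from LIMSEQ_unique[OF this hit_log_inside_tendsto[OF y _ e e0, of 1]] show ?thesis by simp
qed

section \<open>Resolvents of the symmetric Cauchy process\<close>

text \<open>Density of the \<open>q\<close>-resolvent of the Cauchy process, found from the
  inversion integral of \<open>1 / (q + \<bar>\<xi>\<bar>)\<close> by turning the path of
  integration onto the imaginary axis.\<close>

definition cauchy_resolvent :: "real \<Rightarrow> real \<Rightarrow> real" where
  "cauchy_resolvent q w = (\<integral>l. indicator {0<..} l * (exp (- (l * \<bar>w\<bar>)) * (l / (pi * (l\<^sup>2 + q\<^sup>2)))) \<partial>lborel)"

lemma borel_measurable_cauchy_resolvent [measurable]: "cauchy_resolvent q \<in> borel_measurable borel"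
  unfolding cauchy_resolvent_def by measurable

lemma cauchy_resolvent_nonneg: "0 \<le> cauchy_resolvent q w"
  unfolding cauchy_resolvent_def by (intro Bochner_Integration.integral_nonneg) (auto simp: indicator_def)

lemma integrable_cauchy_resolvent:
  fixes q w :: real
  assumes q: "0 < q" and w: "w \<noteq> 0"
  shows "integrable lborel (\<lambda>l. indicator {0<..} l * (exp (- (l * \<bar>w\<bar>)) * (l / (pi * (l\<^sup>2 + q\<^sup>2)))))"
proof (rule integrableI_nonneg)
  have "(\<integral>\<^sup>+l. ennreal (indicator {0<..} l * (exp (- (l * \<bar>w\<bar>)) * (l / (pi * (l\<^sup>2 + q\<^sup>2))))) \<partial>lborel)
    \<le> (\<integral>\<^sup>+l. ennreal (1 / (pi * q)) * (ennreal (exp (- (\<bar>w\<bar> * l))) * indicator {0<..} l) \<partial>lborel)"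
  proof (rule nn_integral_mono)
    fix l :: real
    show "ennreal (indicator {0<..} l * (exp (- (l * \<bar>w\<bar>)) * (l / (pi * (l\<^sup>2 + q\<^sup>2))))) \<le> ennreal (1 / (pi * q)) * (ennreal (exp (- (\<bar>w\<bar> * l))) * indicator {0<..} l)"
    proof (cases "0 < l")
      case True
      have "2 * l * q \<le> l\<^sup>2 + q\<^sup>2" by (rule sum_squares_bound)
      then have "l * q \<le> l\<^sup>2 + q\<^sup>2" using True q mult_pos_pos[OF True q] by linarith
      then have "l / (l\<^sup>2 + q\<^sup>2) \<le> 1 / q" using True q by (simp add: field_simps add_pos_pos)
      then have "l / (l\<^sup>2 + q\<^sup>2) / pi \<le> 1 / q / pi" by (rule divide_right_mono) simp
      then have "l / (pi * (l\<^sup>2 + q\<^sup>2)) \<le> 1 / (pi * q)" by (simp only: divide_divide_eq_left mult.commute[of pi])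
      then have "exp (- (l * \<bar>w\<bar>)) * (l / (pi * (l\<^sup>2 + q\<^sup>2))) \<le> exp (- (l * \<bar>w\<bar>)) * (1 / (pi * q))"
        by (rule mult_left_mono) simp
      also have "\<dots> = 1 / (pi * q) * exp (- (\<bar>w\<bar> * l))" by (simp add: mult.commute)
      finally have "ennreal (exp (- (l * \<bar>w\<bar>)) * (l / (pi * (l\<^sup>2 + q\<^sup>2)))) \<le> ennreal (1 / (pi * q) * exp (- (\<bar>w\<bar> * l)))" by (rule ennreal_leI)
      also have "\<dots> = ennreal (1 / (pi * q)) * ennreal (exp (- (\<bar>w\<bar> * l)))" by (rule ennreal_mult') (use q in simp)
      finally show ?thesis using True by simp
    qed simp
  qed
  also have "\<dots> = ennreal (1 / (pi * q)) * ennreal (1 / \<bar>w\<bar>)"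
    using w by (subst nn_integral_cmult) (auto simp: nn_integral_exp_halfline)
  also have "\<dots> < \<infinity>" by (simp add: ennreal_mult_less_top)
  finally show "(\<integral>\<^sup>+l. ennreal (indicator {0<..} l * (exp (- (l * \<bar>w\<bar>)) * (l / (pi * (l\<^sup>2 + q\<^sup>2))))) \<partial>lborel) < \<infinity>" .
qed (auto simp: indicator_def)

lemma laplace_kernel_cauchy:
  assumes q: "0 < q" and w: "w \<noteq> 0"
  shows "laplace_kernel (\<lambda>l. l / (pi * (l\<^sup>2 + q\<^sup>2))) (\<lambda>l. l / (pi * (l\<^sup>2 + q\<^sup>2))) w = ennreal (cauchy_resolvent q w)"
proof -
  have "laplace_kernel (\<lambda>l. l / (pi * (l\<^sup>2 + q\<^sup>2))) (\<lambda>l. l / (pi * (l\<^sup>2 + q\<^sup>2))) w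
    = (\<integral>\<^sup>+l. ennreal (indicator {0<..} l * (exp (- (l * \<bar>w\<bar>)) * (l / (pi * (l\<^sup>2 + q\<^sup>2))))) \<partial>lborel)"
    unfolding laplace_kernel_def by (intro nn_integral_cong) (simp add: indicator_def)
  also have "\<dots> = ennreal (cauchy_resolvent q w)"
    unfolding cauchy_resolvent_def
    by (rule nn_integral_eq_integral[OF integrable_cauchy_resolvent[OF assms]]) (auto simp: indicator_def)
  finally show ?thesis .
qed

text \<open>Partial fractions if \<open>p \<noteq> q\<close>; the case \<open>p = q\<close> has an
  explicit antiderivative with \<open>arctan\<close>. With \<open>p = \<bar>\<xi>\<bar>\<close> the
  value produces \<open>1 / (q + \<bar>\<xi>\<bar>)\<close>.\<close>

lemma integral_square_product:
  fixes p q :: real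
  assumes p: "0 < p" and q: "0 < q"
  shows "integrable lborel (\<lambda>l. indicator {0<..} l * (l\<^sup>2 / ((l\<^sup>2 + q\<^sup>2) * (l\<^sup>2 + p\<^sup>2))))"
    and "(\<integral>l. indicator {0<..} l * (l\<^sup>2 / ((l\<^sup>2 + q\<^sup>2) * (l\<^sup>2 + p\<^sup>2))) \<partial>lborel) = pi / (2 * (q + p))"
proof -
  let ?h = "\<lambda>l. indicator {0<..} l * (l\<^sup>2 / ((l\<^sup>2 + q\<^sup>2) * (l\<^sup>2 + p\<^sup>2)))"
  have "integrable lborel ?h \<and> (\<integral>l. ?h l \<partial>lborel) = pi / (2 * (q + p))"
  proof (cases "p = q")
    case False
    let ?k = "\<lambda>p l. indicator {0<..} l * (l powr (1-1) / (l\<^sup>2 + p\<^sup>2))"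
    have I: "integrable lborel (?k r)" "(\<integral>l. ?k r l \<partial>lborel) = pi / (2 * r)" if "0 < r" for r :: real
      using integral_powr_square[of 1 r] that by (simp_all add: powr_minus field_simps)
    have d: "p\<^sup>2 - q\<^sup>2 = (p - q) * (q + p)" by (simp add: power2_eq_square algebra_simps)
    have d0: "p\<^sup>2 - q\<^sup>2 \<noteq> 0" unfolding d using False p q by simp
    have h: "?h l = 1 / (p\<^sup>2 - q\<^sup>2) * (p\<^sup>2 * ?k p l - q\<^sup>2 * ?k q l)" for l
    proof (cases "0 < l")
      case True
      then have "l\<^sup>2 + q\<^sup>2 \<noteq> 0" "l\<^sup>2 + p\<^sup>2 \<noteq> 0" by (auto simp: add_pos_nonneg less_imp_neq[THEN not_sym])
      then have "l\<^sup>2 / ((l\<^sup>2 + q\<^sup>2) * (l\<^sup>2 + p\<^sup>2)) = 1 / (p\<^sup>2 - q\<^sup>2) * (p\<^sup>2 * (1 / (l\<^sup>2 + p\<^sup>2)) - q\<^sup>2 * (1 / (l\<^sup>2 + q\<^sup>2)))"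
        using d0 by (simp add: divide_simps) (simp add: algebra_simps)
      then show ?thesis using True by simp
    qed simp
    have i: "integrable lborel (\<lambda>l. p\<^sup>2 * ?k p l)" "integrable lborel (\<lambda>l. q\<^sup>2 * ?k q l)"
      by (intro integrable_mult_right I(1) p q)+
    have "(\<integral>l. ?h l \<partial>lborel) = 1 / (p\<^sup>2 - q\<^sup>2) * (p\<^sup>2 * (pi / (2 * p)) - q\<^sup>2 * (pi / (2 * q)))"
      unfolding h integral_mult_right_zero Bochner_Integration.integral_diff[OF i] I(2)[OF p] I(2)[OF q] ..
    also have "\<dots> = 1 / ((p - q) * (q + p)) * ((p - q) * (pi / 2))" 
    proof -
      have "p\<^sup>2 * (pi / (2 * p)) = p * (pi / 2)" "q\<^sup>2 * (pi / (2 * q)) = q * (pi / 2)" using p q by (simp_all add: power2_eq_square)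
      then show ?thesis unfolding d by (simp only: left_diff_distrib)
    qed
    also have "\<dots> = pi / (2 * (q + p))" using False by simp
    finally have "(\<integral>l. ?h l \<partial>lborel) = pi / (2 * (q + p))" .
    moreover have "integrable lborel ?h"
      unfolding h by (intro integrable_mult_right Bochner_Integration.integrable_diff i)
    ultimately show ?thesis by blast
  next
    case True
    let ?F = "\<lambda>l. arctan (l / q) / (2 * q) - l / (2 * (l\<^sup>2 + q\<^sup>2))"
    have "(\<integral>\<^sup>+l. ennreal (?h l) \<partial>lborel) = (\<integral>\<^sup>+l. ennreal (l\<^sup>2 / (l\<^sup>2 + q\<^sup>2)\<^sup>2) * indicator {0..} l \<partial>lborel)"
      unfolding True by (intro nn_integral_cong) (auto simp: indicator_def power2_eq_square)
    also have "\<dots> = ennreal (pi / (4 * q) - ?F 0)"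
    proof (rule nn_integral_FTC_atLeast)
      fix l :: real assume "0 \<le> l"
      have D: "l\<^sup>2 + q\<^sup>2 \<noteq> 0" using q by (simp add: add_nonneg_pos less_imp_neq[THEN not_sym])
      have "((\<lambda>l. arctan (l / q)) has_real_derivative inverse (1 + (l / q)\<^sup>2) * (1 / q)) (at l)"
        using q by (auto intro!: derivative_eq_intros)
      from DERIV_cdivide[OF this, of "2 * q"] have "((\<lambda>l. arctan (l / q) / (2 * q)) has_real_derivative 1 / (1 + (l / q)\<^sup>2) * (1 / q) / (2 * q)) (at l)"
        by (simp only: inverse_eq_divide)
      moreover have "((\<lambda>l. 2 * (l\<^sup>2 + q\<^sup>2)) has_real_derivative 2 * (2 * l)) (at l)"
        by (auto intro!: derivative_eq_intros)
      from DERIV_quotient[OF DERIV_ident this] have "((\<lambda>l. l / (2 * (l\<^sup>2 + q\<^sup>2))) has_real_derivative (1 * (2 * (l\<^sup>2 + q\<^sup>2)) - 2 * (2 * l) * l) / (2 * (l\<^sup>2 + q\<^sup>2)) ^ Suc (Suc 0)) (at l)"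
        using D by simp
      ultimately have "(?F has_real_derivative (1 / (1 + (l / q)\<^sup>2) * (1 / q) / (2 * q) - (1 * (2 * (l\<^sup>2 + q\<^sup>2)) - 2 * (2 * l) * l) / (2 * (l\<^sup>2 + q\<^sup>2)) ^ Suc (Suc 0))) (at l)"
        by (rule DERIV_diff)
      also have "1 / (1 + (l / q)\<^sup>2) * (1 / q) / (2 * q) - (1 * (2 * (l\<^sup>2 + q\<^sup>2)) - 2 * (2 * l) * l) / (2 * (l\<^sup>2 + q\<^sup>2)) ^ Suc (Suc 0) = l\<^sup>2 / (l\<^sup>2 + q\<^sup>2)\<^sup>2"
      proof -
        define A where "A = l\<^sup>2 + q\<^sup>2"
        have A: "A > 0" "l\<^sup>2 = A - q\<^sup>2" using q by (auto simp: A_def add_nonneg_pos)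
        have 1: "1 / (1 + (l / q)\<^sup>2) * (1 / q) / (2 * q) = 1 / (2 * A)"
        proof -
          have e: "1 + (l / q)\<^sup>2 = A / q\<^sup>2" using q by (simp add: A_def power_divide add_divide_distrib)
          show ?thesis unfolding e using q by (simp add: power2_eq_square)
        qed
        have 2: "1 * (2 * A) - 2 * (2 * l) * l = 4 * q\<^sup>2 - 2 * A" using A(2) by (simp add: power2_eq_square)
        show ?thesis unfolding A_def[symmetric] 1 2 unfolding A(2) using A(1) by (simp add: power2_eq_square field_simps)
      qed
      finally show "(?F has_real_derivative l\<^sup>2 / (l\<^sup>2 + q\<^sup>2)\<^sup>2) (at l)" .
    next
      have "((\<lambda>l. arctan (l / q)) \<longlongrightarrow> pi / 2) at_top" using q by real_asymp
      moreover have "((\<lambda>l. l / (2 * (l\<^sup>2 + q\<^sup>2))) \<longlongrightarrow> 0) at_top" using q by real_asymp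
      ultimately have "(?F \<longlongrightarrow> pi / 2 / (2 * q) - 0) at_top"
        using q by (intro tendsto_diff tendsto_divide tendsto_const) auto
      then show "(?F \<longlongrightarrow> pi / (4 * q)) at_top" by simp
    qed auto
    finally have nn: "(\<integral>\<^sup>+l. ennreal (?h l) \<partial>lborel) = ennreal (pi / (4 * q))" by simp
    have h0: "0 \<le> ?h l" for l by (auto simp: indicator_def)
    have i: "integrable lborel ?h" using nn h0 by (intro integrableI_nonneg) auto
    moreover have "(\<integral>l. ?h l \<partial>lborel) = pi / (4 * q)"
      using nn_integral_eq_integral[OF i] h0 nn q by (simp add: integral_nonneg)
    ultimately show ?thesis using True by simp
  qed
  then show "integrable lborel ?h" "(\<integral>l. ?h l \<partial>lborel) = pi / (2 * (q + p))" by auto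
qed

text \<open>For \<open>q > 0\<close> the reciprocal of \<open>q\<close> plus the exponent is
  bounded, so \<open>potential_eq_laplace_kernel\<close> applies with power
  \<open>\<gamma> = 0\<close>.\<close>

lemma (in levy_process) cauchy_potential:
  assumes \<Psi>: "\<And>\<xi>. \<Psi> \<xi> = complex_of_real \<bar>\<xi>\<bar>" and q: "0 < q" and f [measurable]: "f \<in> borel_measurable borel"
  shows "potential q f y = (\<integral>\<^sup>+z. f z * ennreal (cauchy_resolvent q (z - y)) \<partial>lborel)"
proof -
  let ?m = "\<lambda>l::real. l / (pi * (l\<^sup>2 + q\<^sup>2))"
  have "potential q f y = (\<integral>\<^sup>+w. f (y + w) * laplace_kernel ?m ?m w \<partial>lborel)"
  proof (rule potential_eq_laplace_kernel[where K="1/q" and \<gamma>=0])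
    show "\<Psi> \<in> borel_measurable borel" unfolding \<Psi>[abs_def] by measurable
  next
    fix \<xi> :: real assume x: "\<xi> \<noteq> 0"
    have o2: "(1::real) < 2" and q0: "q \<noteq> 0" using q by auto
    have "(\<integral>\<^sup>+l\<in>{0<..}. ennreal ((?m l + ?m l) / sqrt (l\<^sup>2 + \<xi>\<^sup>2)) \<partial>lborel)
      \<le> (\<integral>\<^sup>+l\<in>{0<..}. ennreal (2/pi) * ennreal (l powr (1-1) / (l\<^sup>2 + q\<^sup>2)) \<partial>lborel)"
    proof (rule nn_integral_mono)
      fix l :: real
      show "ennreal ((?m l + ?m l) / sqrt (l\<^sup>2 + \<xi>\<^sup>2)) * indicator {0<..} l \<le> ennreal (2/pi) * ennreal (l powr (1-1) / (l\<^sup>2 + q\<^sup>2)) * indicator {0<..} l"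
      proof (cases "0 < l")
        case True
        have s: "0 < sqrt (l\<^sup>2 + \<xi>\<^sup>2)" using True by (simp add: add_pos_nonneg)
        have "l \<le> sqrt (l\<^sup>2 + \<xi>\<^sup>2)" using True by (intro real_le_rsqrt) simp
        then have 1: "l / sqrt (l\<^sup>2 + \<xi>\<^sup>2) \<le> 1" using s by simp
        have "(?m l + ?m l) / sqrt (l\<^sup>2 + \<xi>\<^sup>2) = (2/pi) * (1 / (l\<^sup>2 + q\<^sup>2)) * (l / sqrt (l\<^sup>2 + \<xi>\<^sup>2))" by simp
        also have "\<dots> \<le> (2/pi) * (1 / (l\<^sup>2 + q\<^sup>2)) * 1" using 1 by (intro mult_left_mono) auto
        finally have "ennreal ((?m l + ?m l) / sqrt (l\<^sup>2 + \<xi>\<^sup>2)) \<le> ennreal ((2/pi) * (1 / (l\<^sup>2 + q\<^sup>2)))" by (intro ennreal_leI) simp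
        also have "\<dots> = ennreal (2/pi) * ennreal (1 / (l\<^sup>2 + q\<^sup>2))" by (rule ennreal_mult') simp
        finally show ?thesis using True by simp
      qed simp
    qed
    also have "\<dots> = ennreal (2/pi) * ennreal (\<bar>q\<bar> powr (1-2) * (pi / (2 * sin (pi*1/2))))"
      unfolding nn_integral_powr_square[OF zero_less_one o2 q0, symmetric]
      by (rule set_nn_integral_cmult) auto
    also have "\<dots> = ennreal ((2/pi) * (\<bar>q\<bar> powr (1-2) * (pi / (2 * sin (pi*1/2)))))" by (rule ennreal_mult'[symmetric]) simp
    also have "(2/pi) * (\<bar>q\<bar> powr (1-2) * (pi / (2 * sin (pi*1/2)))) = 1 / q * \<bar>\<xi>\<bar> powr (-0)" using q x by (simp add: powr_minus field_simps)
    finally show "(\<integral>\<^sup>+l\<in>{0<..}. ennreal ((?m l + ?m l) / sqrt (l\<^sup>2 + \<xi>\<^sup>2)) \<partial>lborel) \<le> ennreal (1 / q * \<bar>\<xi>\<bar> powr (-0))" by simp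
    show "0 < q + Re (\<Psi> \<xi>)" unfolding \<Psi> using q by simp
    show "1 / (q + Re (\<Psi> \<xi>)) \<le> 1 / q * \<bar>\<xi>\<bar> powr (-0)" unfolding \<Psi> using q x by (simp add: frac_le)
    let ?h = "\<lambda>l. indicator {0<..} l * (l\<^sup>2 / ((l\<^sup>2 + q\<^sup>2) * (l\<^sup>2 + \<bar>\<xi>\<bar>\<^sup>2)))"
    have "(CLINT l|lborel. indicator {0<..} l *\<^sub>R (complex_of_real (?m l) / (complex_of_real l - \<i> * \<xi>) + complex_of_real (?m l) / (complex_of_real l + \<i> * \<xi>)))
      = (CLINT l|lborel. complex_of_real (2/pi * ?h l))"
    proof (intro Bochner_Integration.integral_cong refl)
      fix l :: real
      show "indicator {0<..} l *\<^sub>R (complex_of_real (?m l) / (complex_of_real l - \<i> * \<xi>) + complex_of_real (?m l) / (complex_of_real l + \<i> * \<xi>)) = complex_of_real (2/pi * ?h l)"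
      proof (cases "0 < l")
        case True
        define d where "d = l\<^sup>2 + \<bar>\<xi>\<bar>\<^sup>2"
        define k where "k = ?m l"
        have i1: "1 / (complex_of_real l - \<i> * \<xi>) = complex_of_real (l / d) + \<i> * complex_of_real (\<xi> / d)"
          "1 / (complex_of_real l + \<i> * \<xi>) = complex_of_real (l / d) - \<i> * complex_of_real (\<xi> / d)"
          by (simp_all add: d_def complex_eq_iff Re_divide Im_divide power2_eq_square)
        have "complex_of_real k / (complex_of_real l - \<i> * \<xi>) + complex_of_real k / (complex_of_real l + \<i> * \<xi>)
          = complex_of_real k * (1 / (complex_of_real l - \<i> * \<xi>)) + complex_of_real k * (1 / (complex_of_real l + \<i> * \<xi>))" by simp
        also have "\<dots> = complex_of_real (2 * k * (l / d))" unfolding i1 by (simp add: algebra_simps)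
        also have "2 * k * (l / d) = 2/pi * ?h l" using True unfolding k_def d_def by (simp add: power2_eq_square)
        finally show ?thesis using True unfolding k_def by simp
      qed simp
    qed
    also have "\<dots> = complex_of_real (2/pi * (\<integral>l. ?h l \<partial>lborel))"
      by (simp only: integral_complex_of_real integral_mult_right_zero)
    also have "(\<integral>l. ?h l \<partial>lborel) = pi / (2 * (q + \<bar>\<xi>\<bar>))"
      using x q by (intro integral_square_product(2)) auto
    also have "2/pi * (pi / (2 * (q + \<bar>\<xi>\<bar>))) = 1 / (q + \<bar>\<xi>\<bar>)" using q by (simp add: field_simps)
    also have "complex_of_real (1 / (q + \<bar>\<xi>\<bar>)) = 1 / (complex_of_real q + \<Psi> \<xi>)" unfolding \<Psi> by simp
    finally show "(CLINT l|lborel. indicator {0<..} l *\<^sub>R (complex_of_real (?m l) / (complex_of_real l - \<i> * \<xi>) + complex_of_real (?m l) / (complex_of_real l + \<i> * \<xi>)))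
      = 1 / (complex_of_real q + \<Psi> \<xi>)" .
  qed (use q in auto)
  also have "\<dots> = (\<integral>\<^sup>+w. f (y + 1 * w) * ennreal (cauchy_resolvent q (y + 1 * w - y)) \<partial>lborel)"
  proof (rule nn_integral_cong_AE)
    have "AE w in lborel. w \<noteq> (0::real)" by (rule AE_lborel_singleton)
    then show "AE w in lborel. f (y + w) * laplace_kernel ?m ?m w = f (y + 1 * w) * ennreal (cauchy_resolvent q (y + 1 * w - y))"
      by eventually_elim (simp add: laplace_kernel_cauchy[OF q])
  qed
  also have "\<dots> = (\<integral>\<^sup>+z. f z * ennreal (cauchy_resolvent q (z - y)) \<partial>lborel)"
    by (subst nn_integral_real_affine[where c=1 and t=y and f="\<lambda>z. f z * ennreal (cauchy_resolvent q (z - y))"]) auto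
  finally show ?thesis .
qed

section \<open>Frullani integrals and the logarithmic limit of resolvent differences\<close>

lemma nn_integral_frullani:
  fixes s t :: real
  assumes s: "0 < s" and st: "s \<le> t"
  shows "(\<integral>\<^sup>+l\<in>{0<..}. ennreal ((exp (- (l * s)) - exp (- (l * t))) / l) \<partial>lborel) = ennreal (ln t - ln s)"
proof -
  \<comment> \<open>The quotient is the integral of \<open>exp (- (l * v))\<close> over
    \<open>v\<close> between \<open>s\<close> and \<open>t\<close>; exchanging the integrals leaves
    that of \<open>1 / v\<close>.\<close>
  have inner: "(\<integral>\<^sup>+v\<in>{s<..<t}. ennreal (exp (- (l * v))) \<partial>lborel) = ennreal ((exp (- (l * s)) - exp (- (l * t))) / l)" if l: "0 < l" for l :: real
  proof -
    have "(\<integral>\<^sup>+v\<in>{s<..<t}. ennreal (exp (- (l * v))) \<partial>lborel) = ennreal ((- (exp (- (l * t)) / l)) - (- (exp (- (l * s)) / l)))"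
      by (rule nn_integral_FTC_Ioo) (use l st in \<open>auto intro!: derivative_eq_intros\<close>)
    then show ?thesis by (simp add: diff_divide_distrib)
  qed
  have "(\<integral>\<^sup>+l\<in>{0<..}. ennreal ((exp (- (l * s)) - exp (- (l * t))) / l) \<partial>lborel)
    = (\<integral>\<^sup>+l\<in>{0<..}. (\<integral>\<^sup>+v\<in>{s<..<t}. ennreal (exp (- (l * v))) \<partial>lborel) \<partial>lborel)"
    by (rule set_nn_integral_cong) (simp add: inner)
  also have "\<dots> = (\<integral>\<^sup>+v\<in>{s<..<t}. (\<integral>\<^sup>+l\<in>{0<..}. ennreal (exp (- (l * v))) \<partial>lborel) \<partial>lborel)"
    by (rule set_nn_integral_swap) auto
  also have "\<dots> = (\<integral>\<^sup>+v\<in>{s<..<t}. ennreal (1 / v) \<partial>lborel)"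
  proof (rule set_nn_integral_cong)
    fix v assume "v \<in> {s<..<t}"
    then have "0 < v" using s by simp
    from nn_integral_exp_halfline[OF this]
    show "(\<integral>\<^sup>+l\<in>{0<..}. ennreal (exp (- (l * v))) \<partial>lborel) = ennreal (1 / v)" by (simp only: mult.commute[of v])
  qed
  also have "\<dots> = ennreal (ln t - ln s)"
    by (rule nn_integral_FTC_Ioo) (use s st in \<open>auto intro!: derivative_eq_intros\<close>)
  finally show ?thesis .
qed

text \<open>The integrand has constant sign, that of \<open>- ln \<bar>w\<bar>\<close>, so the
  integral of its modulus is known as well.\<close>

lemma integral_frullani:
  fixes w :: real
  assumes w: "w \<noteq> 0"
  defines "h \<equiv> \<lambda>l. indicator {0<..} l * ((exp (- (l * \<bar>w\<bar>)) - exp (- l)) / l)"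
  shows "integrable lborel h" "(\<integral>l. h l \<partial>lborel) = - ln \<bar>w\<bar>" "(\<integral>l. \<bar>h l\<bar> \<partial>lborel) = \<bar>ln \<bar>w\<bar>\<bar>"
proof -
  have pos: "integrable lborel (\<lambda>l. indicator {0<..} l * ((exp (- (l * s)) - exp (- (l * t))) / l))"
    "(\<integral>l. indicator {0<..} l * ((exp (- (l * s)) - exp (- (l * t))) / l) \<partial>lborel) = ln t - ln s"
    "\<And>l. 0 \<le> indicator {0<..} l * ((exp (- (l * s)) - exp (- (l * t))) / l)"
    if st: "0 < s" "s \<le> t" for s t :: real
  proof -
    let ?g = "\<lambda>l. indicator {0<..} l * ((exp (- (l * s)) - exp (- (l * t))) / l)"
    show g0: "0 \<le> ?g l" for l using st by (auto simp: indicator_def intro!: divide_nonneg_pos)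
    have nn: "(\<integral>\<^sup>+l. ennreal (?g l) \<partial>lborel) = ennreal (ln t - ln s)"
      unfolding nn_integral_frullani[OF st, symmetric] by (intro nn_integral_cong) (simp add: indicator_def)
    show i: "integrable lborel ?g" using nn g0 by (intro integrableI_nonneg) auto
    show "(\<integral>l. ?g l \<partial>lborel) = ln t - ln s"
      using nn_integral_eq_integral[OF i] g0 nn st by (simp add: Bochner_Integration.integral_nonneg)
  qed
  show "integrable lborel h" "(\<integral>l. h l \<partial>lborel) = - ln \<bar>w\<bar>" "(\<integral>l. \<bar>h l\<bar> \<partial>lborel) = \<bar>ln \<bar>w\<bar>\<bar>"
  proof -
    have "integrable lborel h \<and> (\<integral>l. h l \<partial>lborel) = - ln \<bar>w\<bar> \<and> (\<integral>l. \<bar>h l\<bar> \<partial>lborel) = \<bar>ln \<bar>w\<bar>\<bar>"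
    proof (cases "\<bar>w\<bar> \<le> 1")
      case True
      define g where "g = (\<lambda>l. indicator {0<..} l * ((exp (- (l * \<bar>w\<bar>)) - exp (- (l * 1))) / l))"
      have l: "ln \<bar>w\<bar> \<le> 0" using True w by simp
      have h: "h = g" by (simp add: h_def g_def)
      have "integrable lborel g" "(\<integral>l. g l \<partial>lborel) = ln 1 - ln \<bar>w\<bar>" "\<And>l. 0 \<le> g l"
        unfolding g_def by (rule pos[OF _ True], use w in simp)+
      then show ?thesis unfolding h using l by simp
    next
      case False
      define g where "g = (\<lambda>l. indicator {0<..} l * ((exp (- (l * 1)) - exp (- (l * \<bar>w\<bar>))) / l))"
      have l: "0 \<le> ln \<bar>w\<bar>" using False by simp
      have h: "h = (\<lambda>l. - g l)" by (auto simp: h_def g_def fun_eq_iff diff_divide_distrib right_diff_distrib)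
      have "integrable lborel g" "(\<integral>l. g l \<partial>lborel) = ln \<bar>w\<bar> - ln 1" "\<And>l. 0 \<le> g l"
        unfolding g_def by (rule pos[OF zero_less_one], use False in simp)+
      then show ?thesis unfolding h using l by simp
    qed
    then show "integrable lborel h" "(\<integral>l. h l \<partial>lborel) = - ln \<bar>w\<bar>" "(\<integral>l. \<bar>h l\<bar> \<partial>lborel) = \<bar>ln \<bar>w\<bar>\<bar>" by auto
  qed
qed

text \<open>The difference is a Frullani integral damped by \<open>l^2 / (l^2 + q^2)\<close>, a
  factor at most one that tends to one with vanishing \<open>q\<close>: this gives both the bound
  and the limit below.\<close>

lemma cauchy_resolvent_difference:
  fixes q w :: real
  assumes q: "0 < q" and w: "w \<noteq> 0"
  defines "h \<equiv> \<lambda>l. indicator {0<..} l * ((exp (- (l * \<bar>w\<bar>)) - exp (- l)) / l)"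
  shows "cauchy_resolvent q w - cauchy_resolvent q 1 = (\<integral>l. 1 / pi * (l\<^sup>2 / (l\<^sup>2 + q\<^sup>2)) * h l \<partial>lborel)"
proof -
  have "cauchy_resolvent q w - cauchy_resolvent q 1 = (\<integral>l. indicator {0<..} l * (exp (- (l * \<bar>w\<bar>)) * (l / (pi * (l\<^sup>2 + q\<^sup>2))))
      - indicator {0<..} l * (exp (- (l * \<bar>1\<bar>)) * (l / (pi * (l\<^sup>2 + q\<^sup>2)))) \<partial>lborel)"
    unfolding cauchy_resolvent_def
    by (rule Bochner_Integration.integral_diff[symmetric]) (intro integrable_cauchy_resolvent q w one_neq_zero)+
  also have "\<dots> = (\<integral>l. 1 / pi * (l\<^sup>2 / (l\<^sup>2 + q\<^sup>2)) * h l \<partial>lborel)"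
  proof (intro Bochner_Integration.integral_cong refl)
    fix l :: real
    show "indicator {0<..} l * (exp (- (l * \<bar>w\<bar>)) * (l / (pi * (l\<^sup>2 + q\<^sup>2)))) - indicator {0<..} l * (exp (- (l * \<bar>1\<bar>)) * (l / (pi * (l\<^sup>2 + q\<^sup>2))))
      = 1 / pi * (l\<^sup>2 / (l\<^sup>2 + q\<^sup>2)) * h l"
    proof (cases "0 < l")
      case True
      define d where "d = pi * (l\<^sup>2 + q\<^sup>2)"
      define E where "E = exp (- (l * \<bar>w\<bar>))"
      define F where "F = exp (- l)"
      have e: "(l\<^sup>2 / d) * ((E - F) / l) = (E - F) * (l / d)" using True by (simp add: power2_eq_square)
      have "E * (l / d) - F * (l / d) = (l\<^sup>2 / d) * ((E - F) / l)" unfolding e by (rule left_diff_distrib[symmetric])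
      then show ?thesis using True by (simp add: h_def d_def E_def F_def)
    qed (simp add: h_def)
  qed
  finally show ?thesis .
qed

lemma cauchy_resolvent_difference_le:
  fixes q w :: real
  assumes q: "0 < q" and w: "w \<noteq> 0"
  shows "\<bar>cauchy_resolvent q w - cauchy_resolvent q 1\<bar> \<le> \<bar>ln \<bar>w\<bar>\<bar> / pi"
proof -
  let ?h = "\<lambda>l. indicator {0<..} l * ((exp (- (l * \<bar>w\<bar>)) - exp (- l)) / l)"
  have "norm (\<integral>l. 1 / pi * (l\<^sup>2 / (l\<^sup>2 + q\<^sup>2)) * ?h l \<partial>lborel) \<le> (\<integral>l. 1 / pi * \<bar>?h l\<bar> \<partial>lborel)"
  proof (rule Bochner_Integration.integral_norm_bound_integral)
    have b: "norm (1 / pi * (l\<^sup>2 / (l\<^sup>2 + q\<^sup>2)) * ?h l) \<le> 1 / pi * \<bar>?h l\<bar>" for l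
    proof -
      have "l\<^sup>2 / (l\<^sup>2 + q\<^sup>2) \<le> 1" using q by (simp add: divide_le_eq_1 add_nonneg_pos)
      then have "1 / pi * (l\<^sup>2 / (l\<^sup>2 + q\<^sup>2)) \<le> 1 / pi * 1" by (intro mult_left_mono) auto
      then have "1 / pi * (l\<^sup>2 / (l\<^sup>2 + q\<^sup>2)) * \<bar>?h l\<bar> \<le> 1 / pi * 1 * \<bar>?h l\<bar>" by (rule mult_right_mono) simp
      then show ?thesis unfolding real_norm_def abs_mult[of _ "?h l"] by simp
    qed
    then show "norm (1 / pi * (l\<^sup>2 / (l\<^sup>2 + q\<^sup>2)) * ?h l) \<le> 1 / pi * \<bar>?h l\<bar>" for l .
    show i: "integrable lborel (\<lambda>l. 1 / pi * \<bar>?h l\<bar>)"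
      by (intro integrable_mult_right integrable_abs integral_frullani(1) w)
    show "integrable lborel (\<lambda>l. 1 / pi * (l\<^sup>2 / (l\<^sup>2 + q\<^sup>2)) * ?h l)"
    proof (rule Bochner_Integration.integrable_bound[OF i])
      show "AE l in lborel. norm (1 / pi * (l\<^sup>2 / (l\<^sup>2 + q\<^sup>2)) * ?h l) \<le> norm (1 / pi * \<bar>?h l\<bar>)"
        by (rule AE_I2, rule order_trans[OF b]) simp
    qed measurable
  qed
  also have "\<dots> = \<bar>ln \<bar>w\<bar>\<bar> / pi" unfolding integral_mult_right_zero integral_frullani(3)[OF w] by simp
  finally show ?thesis unfolding cauchy_resolvent_difference[OF q w] real_norm_def .
qed

lemma cauchy_resolvent_difference_tendsto:
  fixes w :: real and q :: "nat \<Rightarrow> real"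
  assumes q: "\<And>n. 0 < q n" "q \<longlonglongrightarrow> 0" and w: "w \<noteq> 0"
  shows "(\<lambda>n. cauchy_resolvent (q n) w - cauchy_resolvent (q n) 1) \<longlonglongrightarrow> - ln \<bar>w\<bar> / pi"
proof -
  let ?h = "\<lambda>l. indicator {0<..} l * ((exp (- (l * \<bar>w\<bar>)) - exp (- l)) / l)"
  have "(\<lambda>n. \<integral>l. 1 / pi * (l\<^sup>2 / (l\<^sup>2 + (q n)\<^sup>2)) * ?h l \<partial>lborel) \<longlonglongrightarrow> (\<integral>l. 1 / pi * ?h l \<partial>lborel)"
  proof (rule integral_dominated_convergence[where w = "\<lambda>l. 1 / pi * \<bar>?h l\<bar>"])
    show "integrable lborel (\<lambda>l. 1 / pi * \<bar>?h l\<bar>)"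
      by (intro integrable_mult_right integrable_abs integral_frullani(1) w)
    show "AE l in lborel. norm (1 / pi * (l\<^sup>2 / (l\<^sup>2 + (q n)\<^sup>2)) * ?h l) \<le> 1 / pi * \<bar>?h l\<bar>" for n
    proof (rule AE_I2)
      fix l :: real
      have "l\<^sup>2 / (l\<^sup>2 + (q n)\<^sup>2) \<le> 1" using q(1)[of n] by (simp add: divide_le_eq_1 add_nonneg_pos)
      then have "1 / pi * (l\<^sup>2 / (l\<^sup>2 + (q n)\<^sup>2)) \<le> 1 / pi * 1" by (intro mult_left_mono) auto
      then have "1 / pi * (l\<^sup>2 / (l\<^sup>2 + (q n)\<^sup>2)) * \<bar>?h l\<bar> \<le> 1 / pi * 1 * \<bar>?h l\<bar>" by (rule mult_right_mono) simp
      then show "norm (1 / pi * (l\<^sup>2 / (l\<^sup>2 + (q n)\<^sup>2)) * ?h l) \<le> 1 / pi * \<bar>?h l\<bar>"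
        unfolding real_norm_def abs_mult[of _ "?h l"] by simp
    qed
    show "AE l in lborel. (\<lambda>n. 1 / pi * (l\<^sup>2 / (l\<^sup>2 + (q n)\<^sup>2)) * ?h l) \<longlonglongrightarrow> 1 / pi * ?h l"
    proof (rule AE_I2)
      fix l :: real
      show "(\<lambda>n. 1 / pi * (l\<^sup>2 / (l\<^sup>2 + (q n)\<^sup>2)) * ?h l) \<longlonglongrightarrow> 1 / pi * ?h l"
      proof (cases "0 < l")
        case True
        have "(\<lambda>n. 1 / pi * (l\<^sup>2 / (l\<^sup>2 + (q n)\<^sup>2)) * ?h l) \<longlonglongrightarrow> 1 / pi * (l\<^sup>2 / (l\<^sup>2 + 0\<^sup>2)) * ?h l"
          using True by (intro tendsto_intros q(2)) auto
        then show ?thesis using True by simp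
      qed simp
    qed
  qed measurable
  moreover have "(\<integral>l. 1 / pi * ?h l \<partial>lborel) = - ln \<bar>w\<bar> / pi"
    unfolding integral_mult_right_zero integral_frullani(2)[OF w] by simp
  ultimately show ?thesis unfolding cauchy_resolvent_difference[OF q(1) w] by simp
qed

text \<open>For \<open>l\<close> between \<open>q\<close> and \<open>1\<close> the integrand is at
  least a constant times \<open>1 / l\<close>, whose integral is \<open>- ln q\<close>.\<close>

lemma cauchy_resolvent_ge:
  fixes q :: real
  assumes q: "0 < q" "q < 1"
  shows "- ln q * (exp (-1) / (2 * pi)) \<le> cauchy_resolvent q 1"
proof -
  let ?c = "exp (-1) / (2 * pi) :: real"
  have "ennreal (?c * (ln 1 - ln q)) = ennreal ?c * ennreal (ln 1 - ln q)" by (rule ennreal_mult') simp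
  also have "ennreal (ln 1 - ln q) = (\<integral>\<^sup>+l\<in>{q<..<1}. ennreal (1 / l) \<partial>lborel)"
    by (rule nn_integral_FTC_Ioo[symmetric]) (use q in \<open>auto intro!: derivative_eq_intros\<close>)
  also have "ennreal ?c * (\<integral>\<^sup>+l\<in>{q<..<1}. ennreal (1 / l) \<partial>lborel) = (\<integral>\<^sup>+l\<in>{q<..<1}. ennreal ?c * ennreal (1 / l) \<partial>lborel)"
    by (rule set_nn_integral_cmult[symmetric]) auto
  also have "\<dots> \<le> (\<integral>\<^sup>+l. ennreal (indicator {0<..} l * (exp (- (l * \<bar>1\<bar>)) * (l / (pi * (l\<^sup>2 + q\<^sup>2))))) \<partial>lborel)"
  proof (rule nn_integral_mono)
    fix l :: real
    show "ennreal ?c * ennreal (1 / l) * indicator {q<..<1} l \<le> ennreal (indicator {0<..} l * (exp (- (l * \<bar>1\<bar>)) * (l / (pi * (l\<^sup>2 + q\<^sup>2)))))"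
    proof (cases "l \<in> {q<..<1}")
      case True
      then have l: "0 < l" "q < l" "l < 1" using q by auto
      have "q\<^sup>2 \<le> l\<^sup>2" using l q by (intro power_mono) auto
      then have "1 / (2 * pi * l) \<le> l / (pi * (l\<^sup>2 + q\<^sup>2))"
      proof -
        assume "q\<^sup>2 \<le> l\<^sup>2"
        have "l / (pi * (2 * l\<^sup>2)) \<le> l / (pi * (l\<^sup>2 + q\<^sup>2))"
          using \<open>q\<^sup>2 \<le> l\<^sup>2\<close> l q by (intro divide_left_mono mult_left_mono mult_pos_pos) (auto simp: add_pos_pos)
        also have "l / (pi * (2 * l\<^sup>2)) = 1 / (2 * pi * l)" using l by (simp add: power2_eq_square)
        finally show ?thesis .
      qed
      then have "exp (-1) * (1 / (2 * pi * l)) \<le> exp (- (l * \<bar>1\<bar>)) * (l / (pi * (l\<^sup>2 + q\<^sup>2)))"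
        using l by (intro mult_mono) auto
      then have "?c * (1 / l) \<le> exp (- (l * \<bar>1\<bar>)) * (l / (pi * (l\<^sup>2 + q\<^sup>2)))" by simp
      from ennreal_leI[OF this] have "ennreal ?c * ennreal (1 / l) \<le> ennreal (exp (- (l * \<bar>1\<bar>)) * (l / (pi * (l\<^sup>2 + q\<^sup>2))))"
        by (subst (asm) ennreal_mult') auto
      then show ?thesis using True l by simp
    qed simp
  qed
  also have "\<dots> = ennreal (cauchy_resolvent q 1)"
    unfolding cauchy_resolvent_def
    by (rule nn_integral_eq_integral[OF integrable_cauchy_resolvent[OF q(1)]]) (auto simp: indicator_def)
  finally have "ennreal (?c * (ln 1 - ln q)) \<le> ennreal (cauchy_resolvent q 1)" .
  then have "?c * (ln 1 - ln q) \<le> cauchy_resolvent q 1"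
    by (simp only: ennreal_le_iff[OF cauchy_resolvent_nonneg])
  then show ?thesis by (simp add: mult.commute)
qed

text \<open>This divergence expresses recurrence; it forces the limit of the masses in
  \<open>hit_law_mass_tendsto_1\<close>.\<close>

lemma cauchy_resolvent_at_top:
  fixes q :: "nat \<Rightarrow> real"
  assumes q: "\<And>n. 0 < q n" "q \<longlonglongrightarrow> 0"
  shows "filterlim (\<lambda>n. cauchy_resolvent (q n) 1) at_top sequentially"
proof (rule filterlim_at_top_mono)
  have "filterlim q (at_right 0) sequentially"
    unfolding filterlim_at using q(2) by (auto intro!: always_eventually simp: q(1) less_imp_neq[THEN not_sym, OF q(1)])
  then have "filterlim (\<lambda>n. ln (q n)) at_bot sequentially" by (rule filterlim_compose[OF ln_at_0])
  then have "filterlim (\<lambda>n. - ln (q n)) at_top sequentially" by (simp add: filterlim_uminus_at_top)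
  then show "filterlim (\<lambda>n. - ln (q n) * (exp (-1) / (2 * pi))) at_top sequentially"
    by (intro filterlim_at_top_mult_tendsto_pos[OF tendsto_const]) auto
  have "\<forall>\<^sub>F n in sequentially. q n < 1" using order_tendstoD(2)[OF q(2), of 1] by simp
  then show "\<forall>\<^sub>F n in sequentially. - ln (q n) * (exp (-1) / (2 * pi)) \<le> cauchy_resolvent (q n) 1"
    by eventually_elim (rule cauchy_resolvent_ge[OF q(1)])
qed

text \<open>The resolvent density diverges as \<open>q\<close> tends to zero, but its deviation from the value at one converges to a
  logarithm.\<close>
definition resolvent_deviation :: "real \<Rightarrow> (real \<Rightarrow> real) \<Rightarrow> real \<Rightarrow> real" where
  "resolvent_deviation q f s = (\<integral>z. f z * (cauchy_resolvent q (z - s) - cauchy_resolvent q 1) \<partial>lborel)"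

lemma borel_measurable_resolvent_deviation [measurable]:
  assumes [measurable]: "f \<in> borel_measurable borel"
  shows "resolvent_deviation q f \<in> borel_measurable borel"
  unfolding resolvent_deviation_def by measurable

text \<open>The resolvent differences are bounded by
  \<open>\<bar>ln \<bar>z - s\<bar>\<bar> / pi\<close> uniformly in \<open>q\<close>, so one
  logarithmic integral dominates all three claims.\<close>

lemma resolvent_deviation:
  fixes f :: "real \<Rightarrow> real" and K s :: real
  assumes f [measurable]: "f \<in> borel_measurable borel" and f0: "\<And>z. 0 \<le> f z"
    and K: "0 \<le> K" "(\<integral>\<^sup>+z. ennreal (f z * \<bar>ln \<bar>z - s\<bar>\<bar>) \<partial>lborel) \<le> ennreal K"
  shows "0 < q \<Longrightarrow> integrable lborel (\<lambda>z. f z * (cauchy_resolvent q (z - s) - cauchy_resolvent q 1))"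
    and "0 < q \<Longrightarrow> \<bar>resolvent_deviation q f s\<bar> \<le> K / pi"
    and "(\<And>n. 0 < p n) \<Longrightarrow> p \<longlonglongrightarrow> 0 \<Longrightarrow> (\<lambda>n. resolvent_deviation (p n) f s) \<longlonglongrightarrow> - (\<integral>z. f z * ln \<bar>z - s\<bar> \<partial>lborel) / pi"
proof -
  let ?F = "\<lambda>z. f z * \<bar>ln \<bar>z - s\<bar>\<bar>"
  have F: "integrable lborel ?F"
    using f0 by (intro integrableI_nonneg) (auto intro: le_less_trans[OF K(2)])
  have F': "integrable lborel (\<lambda>z. 1 / pi * ?F z)" using F by (rule integrable_mult_right)
  have FK: "(\<integral>z. ?F z \<partial>lborel) \<le> K"
    using K nn_integral_eq_integral[OF F] f0 by simp
  have b: "AE z in lborel. norm (f z * (cauchy_resolvent q (z - s) - cauchy_resolvent q 1)) \<le> 1 / pi * ?F z" if q: "0 < q" for q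
  proof -
    have "AE z in lborel. z \<noteq> s" by (rule AE_lborel_singleton)
    then show ?thesis
    proof eventually_elim
      case (elim z)
      have "\<bar>cauchy_resolvent q (z - s) - cauchy_resolvent q 1\<bar> \<le> \<bar>ln \<bar>z - s\<bar>\<bar> / pi"
        using elim by (intro cauchy_resolvent_difference_le q) simp
      from mult_left_mono[OF this f0[of z]] show ?case using f0[of z] by (simp add: abs_mult)
    qed
  qed
  show i: "integrable lborel (\<lambda>z. f z * (cauchy_resolvent q (z - s) - cauchy_resolvent q 1))" if q: "0 < q" for q
  proof (rule Bochner_Integration.integrable_bound[OF F'])
    show "AE z in lborel. norm (f z * (cauchy_resolvent q (z - s) - cauchy_resolvent q 1)) \<le> norm (1 / pi * ?F z)"
      using b[OF q] by eventually_elim (rule order_trans, assumption, simp only: real_norm_def abs_ge_self)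
  qed measurable
  show "\<bar>resolvent_deviation q f s\<bar> \<le> K / pi" if q: "0 < q" for q
  proof -
    have "norm (resolvent_deviation q f s) \<le> (\<integral>z. norm (f z * (cauchy_resolvent q (z - s) - cauchy_resolvent q 1)) \<partial>lborel)"
      unfolding resolvent_deviation_def by (rule integral_norm_bound)
    also have "\<dots> \<le> (\<integral>z. 1 / pi * ?F z \<partial>lborel)"
      by (rule integral_mono_AE[OF integrable_norm[OF i[OF q]] F' b[OF q]])
    also have "\<dots> = 1 / pi * (\<integral>z. ?F z \<partial>lborel)" by (rule integral_mult_right_zero)
    also have "\<dots> \<le> 1 / pi * K" by (rule mult_left_mono[OF FK]) simp
    finally show ?thesis by simp
  qed
  show "(\<lambda>n. resolvent_deviation (p n) f s) \<longlonglongrightarrow> - (\<integral>z. f z * ln \<bar>z - s\<bar> \<partial>lborel) / pi" if p: "\<And>n. 0 < p n" "p \<longlonglongrightarrow> 0"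
  proof -
    have "(\<lambda>n. \<integral>z. f z * (cauchy_resolvent (p n) (z - s) - cauchy_resolvent (p n) 1) \<partial>lborel) \<longlonglongrightarrow> (\<integral>z. (-1/pi) * (f z * ln \<bar>z - s\<bar>) \<partial>lborel)"
    proof (rule integral_dominated_convergence[OF _ _ F'])
      have "AE z in lborel. z \<noteq> s" by (rule AE_lborel_singleton)
      then show "AE z in lborel. (\<lambda>n. f z * (cauchy_resolvent (p n) (z - s) - cauchy_resolvent (p n) 1)) \<longlonglongrightarrow> (-1/pi) * (f z * ln \<bar>z - s\<bar>)"
      proof eventually_elim
        case (elim z)
        have "(\<lambda>n. f z * (cauchy_resolvent (p n) (z - s) - cauchy_resolvent (p n) 1)) \<longlonglongrightarrow> f z * (- ln \<bar>z - s\<bar> / pi)"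
          using elim by (intro tendsto_mult tendsto_const cauchy_resolvent_difference_tendsto p) simp
        then show ?case by simp
      qed
    qed (use b[OF p(1)] in simp_all)
    then show ?thesis unfolding resolvent_deviation_def integral_mult_right_zero by simp
  qed
qed

section \<open>Real-valued resolvent potentials and limits as \<open>q\<close> decreases to
  zero\<close>

context levy_process
begin

text \<open>Isolates the part that diverges as \<open>q\<close> tends to zero; it depends on
  \<open>f\<close> only through the total mass.\<close>

lemma cauchy_potential_deviation:
  fixes f :: "real \<Rightarrow> real" and K s q :: real
  assumes \<Psi>: "\<And>\<xi>. \<Psi> \<xi> = complex_of_real \<bar>\<xi>\<bar>" and q: "0 < q"
    and f [measurable]: "f \<in> borel_measurable borel" and f0: "\<And>z. 0 \<le> f z" and fi: "integrable lborel f"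
    and K: "0 \<le> K" "(\<integral>\<^sup>+z. ennreal (f z * \<bar>ln \<bar>z - s\<bar>\<bar>) \<partial>lborel) \<le> ennreal K"
  shows "potential q (\<lambda>z. ennreal (f z)) s = ennreal (integral\<^sup>L lborel f * cauchy_resolvent q 1 + resolvent_deviation q f s)"
    and "0 \<le> integral\<^sup>L lborel f * cauchy_resolvent q 1 + resolvent_deviation q f s"
proof -
  note D = resolvent_deviation(1)[OF f f0 K q]
  have e: "f z * cauchy_resolvent q (z - s) = f z * cauchy_resolvent q 1 + f z * (cauchy_resolvent q (z - s) - cauchy_resolvent q 1)" for z
    by (simp add: algebra_simps)
  have i: "integrable lborel (\<lambda>z. f z * cauchy_resolvent q (z - s))"
    unfolding e by (intro Bochner_Integration.integrable_add D integrable_mult_left fi)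
  have v: "(\<integral>z. f z * cauchy_resolvent q (z - s) \<partial>lborel) = integral\<^sup>L lborel f * cauchy_resolvent q 1 + resolvent_deviation q f s"
    unfolding e resolvent_deviation_def
    by (subst Bochner_Integration.integral_add[OF integrable_mult_left[OF fi] D]) (simp only: integral_mult_left_zero)
  have nn: "0 \<le> f z * cauchy_resolvent q (z - s)" for z using f0 cauchy_resolvent_nonneg by simp
  show "0 \<le> integral\<^sup>L lborel f * cauchy_resolvent q 1 + resolvent_deviation q f s"
    unfolding v[symmetric] by (rule Bochner_Integration.integral_nonneg[OF nn])
  have "potential q (\<lambda>z. ennreal (f z)) s = (\<integral>\<^sup>+z. ennreal (f z) * ennreal (cauchy_resolvent q (z - s)) \<partial>lborel)"
    by (rule cauchy_potential[OF \<Psi> q]) measurable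
  also have "\<dots> = (\<integral>\<^sup>+z. ennreal (f z * cauchy_resolvent q (z - s)) \<partial>lborel)"
    by (intro nn_integral_cong ennreal_mult'[symmetric] f0)
  also have "\<dots> = ennreal (\<integral>z. f z * cauchy_resolvent q (z - s) \<partial>lborel)"
    by (rule nn_integral_eq_integral[OF i]) (simp add: nn)
  finally show "potential q (\<lambda>z. ennreal (f z)) s = ennreal (integral\<^sup>L lborel f * cauchy_resolvent q 1 + resolvent_deviation q f s)"
    unfolding v .
qed

lemma potential_shift: "potential q (\<lambda>z. f (x + z)) u = potential q f (x + u)"
  by (simp add: potential_def add.assoc)

text \<open>A real-valued form of \<open>potential_hit_decomposition\<close>, so that decompositions
  of different functions can be subtracted. \<open>S\<close> contains the possible entrance
  positions and carries the bound that makes the entrance term integrable.\<close>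

lemma hit_decomposition_real:
  fixes x c q :: real and V :: "real \<Rightarrow> real"
  assumes B: "open B" and q: "0 \<le> q" and f [measurable]: "f \<in> borel_measurable borel" and V [measurable]: "V \<in> borel_measurable borel"
    and S: "\<And>u. u \<in> closure B \<Longrightarrow> x + u \<in> S" and bound: "\<And>s. s \<in> S \<Longrightarrow> \<bar>V s\<bar> \<le> c"
    and pot: "\<And>s. s \<in> insert x S \<Longrightarrow> potential q f s = ennreal (V s)" and V0: "\<And>s. s \<in> insert x S \<Longrightarrow> 0 \<le> V s"
  shows "integrable (hit_law q B 0) (\<lambda>u. V (x + u))"
    and "killed_potential q B (\<lambda>z. f (x + z)) = ennreal (V x - (\<integral>u. V (x + u) \<partial>hit_law q B 0))"
    and "(\<integral>u. V (x + u) \<partial>hit_law q B 0) \<le> V x"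
proof -
  interpret H: finite_measure "hit_law q B 0" by (rule finite_measure_hit_law[OF B order.refl q])
  note cl = emeasure_hit_law_closure[OF B q]
  show i: "integrable (hit_law q B 0) (\<lambda>u. V (x + u))"
  proof (rule H.integrable_const_bound[where B=c])
    show "AE u in hit_law q B 0. norm (V (x + u)) \<le> c"
      using cl by eventually_elim (simp add: bound S)
  qed measurable
  have ae: "AE u in hit_law q B 0. 0 \<le> V (x + u)" using cl by eventually_elim (simp add: V0 S)
  have "(\<integral>\<^sup>+u. potential q (\<lambda>z. f (x + z)) u \<partial>hit_law q B 0) = (\<integral>\<^sup>+u. ennreal (V (x + u)) \<partial>hit_law q B 0)"
  proof (rule nn_integral_cong_AE)
    show "AE u in hit_law q B 0. potential q (\<lambda>z. f (x + z)) u = ennreal (V (x + u))"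
      unfolding potential_shift using cl by eventually_elim (simp add: pot S)
  qed
  also have "\<dots> = ennreal (\<integral>u. V (x + u) \<partial>hit_law q B 0)"
    by (rule nn_integral_eq_integral[OF i ae])
  finally have e: "ennreal (V x) = killed_potential q B (\<lambda>z. f (x + z)) + ennreal (\<integral>u. V (x + u) \<partial>hit_law q B 0)"
    using potential_hit_decomposition[OF B q, of "\<lambda>z. f (x + z)"] pot[of x] by (simp add: potential_shift)
  have I0: "0 \<le> (\<integral>u. V (x + u) \<partial>hit_law q B 0)" by (rule integral_nonneg_AE[OF ae])
  have Vx: "0 \<le> V x" using V0[of x] by simp
  define k where "k = killed_potential q B (\<lambda>z. f (x + z))"
  have "k \<noteq> \<infinity>" using e unfolding k_def[symmetric] by auto
  then obtain r where r: "0 \<le> r" "k = ennreal r" by (cases k) auto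
  have "V x = r + (\<integral>u. V (x + u) \<partial>hit_law q B 0)"
    using e unfolding k_def[symmetric] r(2) using r(1) I0 Vx by (simp add: ennreal_plus[symmetric] del: ennreal_plus)
  then show "killed_potential q B (\<lambda>z. f (x + z)) = ennreal (V x - (\<integral>u. V (x + u) \<partial>hit_law q B 0))"
    "(\<integral>u. V (x + u) \<partial>hit_law q B 0) \<le> V x"
    using r unfolding k_def[symmetric] by auto
qed

lemma space_hit_law [simp]: "space (hit_law q B s) = UNIV"
  using sets_eq_imp_space_eq[OF sets_hit_law] by simp

lemma measure_hit_law_le_1:
  assumes B: "open B" and q: "0 \<le> q"
  shows "measure (hit_law q B 0) UNIV \<le> 1"
proof -
  interpret H: finite_measure "hit_law q B 0" by (rule finite_measure_hit_law[OF B order.refl q])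
  have "ennreal (measure (hit_law q B 0) UNIV) = (\<integral>\<^sup>+\<omega>. ennreal (hit_weight q B \<omega>) \<partial>M)"
    unfolding H.emeasure_eq_measure[symmetric] by (rule emeasure_hit_law_UNIV[OF B])
  also have "\<dots> \<le> (\<integral>\<^sup>+\<omega>. 1 \<partial>M)" by (intro nn_integral_mono) (simp add: hit_weight_bounds[OF q])
  also have "\<dots> = 1" by (simp add: emeasure_space_1)
  finally show ?thesis by simp
qed

text \<open>Discounting only removes mass. Errors under the varying laws for \<open>q > 0\<close>
  are thereby bounded by errors under the fixed law for \<open>q = 0\<close>.\<close>

lemma nn_integral_hit_law_antimono:
  assumes B: "open B" and q: "0 \<le> q" and f [measurable]: "f \<in> borel_measurable borel"
  shows "(\<integral>\<^sup>+u. f u \<partial>hit_law q B 0) \<le> (\<integral>\<^sup>+u. f u \<partial>hit_law 0 B 0)"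
proof -
  have "hit_weight q B \<omega> \<le> hit_weight 0 B \<omega>" for \<omega>
    using q real_of_ereal_pos[OF hitting_time_nonneg[of B \<omega>]] by (simp add: hit_weight_def)
  then show ?thesis
    unfolding nn_integral_hit_law[OF B order.refl f] by (intro nn_integral_mono mult_right_mono ennreal_leI) auto
qed

text \<open>Monotone convergence, as the discount factors increase when \<open>q\<close>
  decreases.\<close>

lemma killed_potential_tendsto_0:
  fixes q :: "nat \<Rightarrow> real"
  assumes B: "open B" and f [measurable]: "f \<in> borel_measurable borel" and q: "decseq q" "q \<longlonglongrightarrow> 0"
  shows "(\<lambda>n. killed_potential (q n) B f) \<longlonglongrightarrow> killed_potential 0 B f"
proof -
  note [measurable] = borel_measurable_hitting_time[OF B]
  let ?F = "\<lambda>q (\<omega>, t). indicator {t. 0 \<le> t \<and> ereal t < hitting_time B \<omega>} t * (ennreal (exp (- q * t)) * f (X (max 0 t) \<omega>))"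
  have [measurable]: "?F q \<in> borel_measurable (M \<Otimes>\<^sub>M lborel)" for q :: real
    unfolding indicator_def mem_Collect_eq by measurable
  have eq: "killed_potential q B f = (\<integral>\<^sup>+p. ?F q p \<partial>(M \<Otimes>\<^sub>M lborel))" for q
    unfolding killed_potential_def by (subst lborel.nn_integral_fst[symmetric]) auto
  show ?thesis
    unfolding eq
  proof (rule nn_integral_LIMSEQ)
    show "incseq (\<lambda>n. ?F (q n))"
    proof (rule incseq_SucI, rule le_funI, clarify)
      fix n \<omega> and t :: real
      show "indicator {t. 0 \<le> t \<and> ereal t < hitting_time B \<omega>} t * (ennreal (exp (- q n * t)) * f (X (max 0 t) \<omega>))
        \<le> indicator {t. 0 \<le> t \<and> ereal t < hitting_time B \<omega>} t * (ennreal (exp (- q (Suc n) * t)) * f (X (max 0 t) \<omega>))"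
      proof (cases "0 \<le> t")
        case True
        have "q (Suc n) \<le> q n" using q(1) by (simp add: decseq_Suc_iff)
        then have "exp (- q n * t) \<le> exp (- q (Suc n) * t)" using True by (simp add: mult_right_mono)
        then show ?thesis by (intro mult_left_mono mult_right_mono ennreal_leI) auto
      qed simp
    qed
    show "(\<lambda>n. ?F (q n) p) \<longlonglongrightarrow> ?F 0 p" for p
    proof (cases p)
      case (Pair \<omega> t)
      have l: "(\<lambda>n. ennreal (exp (- q n * t))) \<longlonglongrightarrow> ennreal (exp (- 0 * t))" by (intro tendsto_intros q(2))
      show ?thesis unfolding Pair prod.case
        by (intro ennreal_tendsto_cmult tendsto_mult_ennreal[OF l tendsto_const]) (auto simp: indicator_def)
    qed
  qed measurable
qed

end

section \<open>Occupation densities of the symmetric Cauchy process\<close>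

context levy_process
begin

text \<open>The indicator of \<open>(-1,1)\<close> has no killed potential, so its potential at
  \<open>x\<close>, which is \<open>2 * C n\<close> up to a bounded term, equals the integral of its
  potential over the hitting law. There it is again \<open>2 * C n\<close> up to a bounded term, and
  as \<open>C n\<close> diverges, the mass of the hitting law must tend to one.\<close>

lemma hit_law_mass_tendsto_1:
  fixes x :: real and q :: "nat \<Rightarrow> real"
  assumes \<Psi>: "\<And>\<xi>. \<Psi> \<xi> = complex_of_real \<bar>\<xi>\<bar>" and q: "\<And>n. 0 < q n" "q \<longlonglongrightarrow> 0"
  shows "(\<lambda>n. measure (hit_law (q n) {-1-x<..<1-x} 0) UNIV) \<longlonglongrightarrow> 1"
proof -
  define B where "B = {-1-x<..<1-x}"
  have B: "open B" and clB: "closure B = {-1-x..1-x}" by (simp_all add: B_def)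
  define R where "R = max 1 \<bar>x\<bar>"
  let ?f = "indicator {-1<..<1} :: real \<Rightarrow> real"
  have "0 \<le> R" by (simp add: R_def)
  from log_weight_bounded_interval[OF this zero_le_one]
  obtain K where K: "0 \<le> K" "\<forall>s\<in>{-R..R}. (\<integral>\<^sup>+z\<in>{-1..1}. ennreal (log_majorant \<bar>z - s\<bar>) \<partial>lborel) \<le> ennreal K"
    by (elim exE conjE) (rule that)
  have fK: "(\<integral>\<^sup>+z. ennreal (?f z * \<bar>ln \<bar>z - s\<bar>\<bar>) \<partial>lborel) \<le> ennreal K" if s: "s \<in> insert x {-1..1}" for s
  proof -
    have "(\<integral>\<^sup>+z. ennreal (?f z * \<bar>ln \<bar>z - s\<bar>\<bar>) \<partial>lborel) \<le> (\<integral>\<^sup>+z\<in>{-1..1}. ennreal (log_majorant \<bar>z - s\<bar>) \<partial>lborel)"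
    proof (rule nn_integral_mono_AE)
      have "AE z in lborel. z \<noteq> s" by (rule AE_lborel_singleton)
      then show "AE z in lborel. ennreal (?f z * \<bar>ln \<bar>z - s\<bar>\<bar>) \<le> ennreal (log_majorant \<bar>z - s\<bar>) * indicator {-1..1} z"
      proof eventually_elim
        case (elim z)
        then show ?case using abs_ln_le_powr[of "\<bar>z - s\<bar>"] by (auto simp: indicator_def intro: ennreal_leI simp del: ennreal_plus)
      qed
    qed
    also have "\<dots> \<le> ennreal K" by (rule bspec[OF K(2)]) (use s in \<open>auto simp: R_def\<close>)
    finally show ?thesis .
  qed
  define p where "p = (\<lambda>n. measure (hit_law (q n) B 0) UNIV)"
  define C where "C = (\<lambda>n. cauchy_resolvent (q n) 1)"
  define E where "E = (\<lambda>n. resolvent_deviation (q n) ?f)"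
  have fi: "integrable lborel ?f" and f2: "integral\<^sup>L lborel ?f = 2" by simp_all
  have b: "\<bar>E n s\<bar> \<le> K / pi" if "s \<in> insert x {-1..1}" for n s
    unfolding E_def by (rule resolvent_deviation(2)[OF _ _ K(1) fK[OF that] q(1)]) auto
  note P = cauchy_potential_deviation[OF \<Psi> q(1) _ _ fi K(1) fK, unfolded f2]
  have key: "C n * (1 - p n) \<le> K / pi" and p1: "p n \<le> 1" for n
  proof -
    interpret H: finite_measure "hit_law (q n) B 0" by (rule finite_measure_hit_law[OF B order.refl less_imp_le[OF q(1)]])
    have C0: "0 \<le> C n" by (simp add: C_def cauchy_resolvent_nonneg)
    let ?V = "\<lambda>s. 2 * C n + E n s"
    have bV: "\<bar>?V s\<bar> \<le> 2 * C n + K / pi" if "s \<in> {-1..1}" for s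
      using b[of s n] that C0 abs_triangle_ineq[of "2 * C n" "E n s"] by auto
    have V: "?V \<in> borel_measurable borel" unfolding E_def by measurable
    have S: "x + u \<in> {-1..1}" if "u \<in> closure B" for u using that by (auto simp: clB)
    have fm: "(\<lambda>z. ennreal (?f z)) \<in> borel_measurable borel" by measurable
    have pot: "potential (q n) (\<lambda>z. ennreal (?f z)) s = ennreal (?V s)" if "s \<in> insert x {-1..1}" for s
      unfolding C_def E_def by (rule P(1)[OF _ _ that]; simp)
    have V0: "0 \<le> ?V s" if "s \<in> insert x {-1..1}" for s
      unfolding C_def E_def by (rule P(2)[OF _ _ that]; simp)
    note HD = hit_decomposition_real[OF B less_imp_le[OF q(1)] fm V S bV pot V0]
    have D: "integrable (hit_law (q n) B 0) (\<lambda>u. ?V (x + u))"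
      "killed_potential (q n) B (\<lambda>z. ennreal (?f (x + z))) = ennreal (?V x - (\<integral>u. ?V (x + u) \<partial>hit_law (q n) B 0))"
      "(\<integral>u. ?V (x + u) \<partial>hit_law (q n) B 0) \<le> ?V x"
      by (rule HD; assumption)+
    have "killed_potential (q n) B (\<lambda>z. ennreal (?f (x + z))) = 0"
      by (rule killed_potential_eq_0) (auto simp: B_def indicator_def)
    with D(2,3) have e: "?V x = (\<integral>u. ?V (x + u) \<partial>hit_law (q n) B 0)" by (simp add: ennreal_eq_0_iff)
    have "(\<integral>u. ?V (x + u) \<partial>hit_law (q n) B 0) \<le> (\<integral>u. 2 * C n + K / pi \<partial>hit_law (q n) B 0)"
    proof (rule integral_mono_AE[OF D(1)])
      show "AE u in hit_law (q n) B 0. ?V (x + u) \<le> 2 * C n + K / pi"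
        using emeasure_hit_law_closure[OF B less_imp_le[OF q(1)]] unfolding clB
      proof eventually_elim
        case (elim u)
        then show ?case using b[of "x + u" n] by auto
      qed
    qed simp
    also have "\<dots> = p n * (2 * C n + K / pi)" by (simp add: p_def)
    \<comment> \<open>Since \<open>?V x\<close> is at least \<open>2 * C n - K / pi\<close> and
      \<open>p n \<le> 1\<close>, this gives the bound on \<open>C n * (1 - p n)\<close>.\<close>
    finally have "?V x \<le> p n * (2 * C n + K / pi)" unfolding e .
    moreover show p1: "p n \<le> 1" unfolding p_def by (rule measure_hit_law_le_1[OF B less_imp_le[OF q(1)]])
    moreover have "p n * (K / pi) \<le> 1 * (K / pi)" using p1 K(1) by (intro mult_right_mono) auto
    moreover have "- (K / pi) \<le> E n x" using b[of x n] by auto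
    ultimately show "C n * (1 - p n) \<le> K / pi" by (simp add: algebra_simps)
  qed
  have Ct: "filterlim C at_top sequentially" unfolding C_def by (rule cauchy_resolvent_at_top[OF q])
  have l: "(\<lambda>n. 1 - K / pi / C n) \<longlonglongrightarrow> 1"
    using tendsto_diff[OF tendsto_const tendsto_divide_0[OF tendsto_const filterlim_at_top_imp_at_infinity[OF Ct]], of 1 "K / pi"] by simp
  have "p \<longlonglongrightarrow> 1"
  proof (rule tendsto_sandwich[OF _ _ l tendsto_const])
    have "\<forall>\<^sub>F n in sequentially. 0 < C n" using Ct by (simp add: filterlim_at_top_dense)
    then show "\<forall>\<^sub>F n in sequentially. 1 - K / pi / C n \<le> p n"
    proof eventually_elim
      case (elim n)
      then have "1 - p n \<le> K / pi / C n" using key[of n] by (simp only: pos_le_divide_eq mult.commute[of _ "C n"])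
      then show ?case by simp
    qed
    show "\<forall>\<^sub>F n in sequentially. p n \<le> 1" using p1 by simp
  qed
  then show ?thesis unfolding p_def B_def .
qed

text \<open>Equal masses make the diverging terms of the two \<open>q\<close>-potentials cancel. As
  \<open>f2\<close> vanishes outside the interval, its killed potential is zero, so the killed
  potential of \<open>f1\<close> is the difference \<open>\<Delta>\<close> at \<open>x\<close> minus
  its integral over the hitting law. On the closed interval \<open>\<Delta>\<close> tends to the
  constant \<open>- c / pi\<close>, and the mass of the hitting law tends to one.\<close>

lemma cauchy_killed_potential:
  fixes x c K :: real and f1 f2 :: "real \<Rightarrow> real"
  defines "L \<equiv> \<lambda>f s. \<integral>z. f z * ln \<bar>z - s\<bar> \<partial>lborel"
  assumes \<Psi>: "\<And>\<xi>. \<Psi> \<xi> = complex_of_real \<bar>\<xi>\<bar>"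
    and f [measurable]: "f1 \<in> borel_measurable borel" "f2 \<in> borel_measurable borel" and f0: "\<And>z. 0 \<le> f1 z" "\<And>z. 0 \<le> f2 z"
    and fi: "integrable lborel f1" "integrable lborel f2" and mass: "integral\<^sup>L lborel f1 = integral\<^sup>L lborel f2"
    and K: "0 \<le> K" "\<And>s. s \<in> insert x {-1..1} \<Longrightarrow> (\<integral>\<^sup>+z. ennreal (f1 z * \<bar>ln \<bar>z - s\<bar>\<bar>) \<partial>lborel) \<le> ennreal K"
      "\<And>s. s \<in> insert x {-1..1} \<Longrightarrow> (\<integral>\<^sup>+z. ennreal (f2 z * \<bar>ln \<bar>z - s\<bar>\<bar>) \<partial>lborel) \<le> ennreal K"
    and supp: "\<And>z. z \<notin> {-1<..<1} \<Longrightarrow> f2 z = 0"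
    and const: "\<And>s. s \<in> {-1..1} \<Longrightarrow> L f1 s - L f2 s = c"
  shows "killed_potential 0 {-1-x<..<1-x} (\<lambda>z. ennreal (f1 (x + z))) = ennreal ((c - (L f1 x - L f2 x)) / pi)"
proof -
  define B where "B = {-1-x<..<1-x}"
  have B: "open B" and clB: "closure B = {-1-x..1-x}" by (simp_all add: B_def)
  define q where "q = (\<lambda>n. 1 / real (Suc n))"
  have q: "0 < q n" for n by (simp add: q_def)
  have q0: "q \<longlonglongrightarrow> 0" unfolding q_def using LIMSEQ_Suc[OF lim_1_over_n] by simp
  have qd: "decseq q" unfolding q_def by (rule decseq_SucI) (simp add: frac_le)
  define C where "C = (\<lambda>n. cauchy_resolvent (q n) 1)"
  define m where "m = integral\<^sup>L lborel f1"
  have m0: "0 \<le> m" unfolding m_def by (rule Bochner_Integration.integral_nonneg[OF f0(1)])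
  define \<Delta> where "\<Delta> = (\<lambda>n s. resolvent_deviation (q n) f1 s - resolvent_deviation (q n) f2 s)"
  have [measurable]: "\<Delta> n \<in> borel_measurable borel" for n unfolding \<Delta>_def by measurable
  have b1: "\<bar>resolvent_deviation (q n) f1 s\<bar> \<le> K / pi" if "s \<in> insert x {-1..1}" for n s
    by (rule resolvent_deviation(2)[OF f(1) f0(1) K(1) K(2)[OF that] q])
  have b2: "\<bar>resolvent_deviation (q n) f2 s\<bar> \<le> K / pi" if "s \<in> insert x {-1..1}" for n s
    by (rule resolvent_deviation(2)[OF f(2) f0(2) K(1) K(3)[OF that] q])
  have \<Delta>b: "\<bar>\<Delta> n s\<bar> \<le> 2 * K / pi" if "s \<in> insert x {-1..1}" for n s
    using b1[OF that, of n] b2[OF that, of n] unfolding \<Delta>_def by (simp add: abs_le_iff)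
  have \<Delta>lim: "(\<lambda>n. \<Delta> n s) \<longlonglongrightarrow> - (L f1 s - L f2 s) / pi" if "s \<in> insert x {-1..1}" for s
  proof -
    have "(\<lambda>n. \<Delta> n s) \<longlonglongrightarrow> - L f1 s / pi - (- L f2 s / pi)"
      unfolding \<Delta>_def L_def by (intro tendsto_diff resolvent_deviation(3)[OF f(1) f0(1) K(1) K(2)[OF that] q q0] resolvent_deviation(3)[OF f(2) f0(2) K(1) K(3)[OF that] q q0])
    then show ?thesis by (simp add: diff_divide_distrib)
  qed
  let ?\<nu> = "\<lambda>n. hit_law (q n) B 0"
  have kp: "killed_potential (q n) B (\<lambda>z. ennreal (f1 (x + z))) = ennreal (\<Delta> n x - (\<integral>u. \<Delta> n (x + u) \<partial>?\<nu> n))" for n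
  proof -
    note P1 = cauchy_potential_deviation[OF \<Psi> q f(1) f0(1) fi(1) K(1) K(2), folded m_def]
    note P2 = cauchy_potential_deviation[OF \<Psi> q f(2) f0(2) fi(2) K(1) K(3), folded mass m_def]
    let ?V1 = "\<lambda>s. m * C n + resolvent_deviation (q n) f1 s"
    let ?V2 = "\<lambda>s. m * C n + resolvent_deviation (q n) f2 s"
    have C0: "0 \<le> m * C n" using m0 by (simp add: C_def cauchy_resolvent_nonneg)
    have bV1: "\<bar>?V1 s\<bar> \<le> m * C n + K / pi" and bV2: "\<bar>?V2 s\<bar> \<le> m * C n + K / pi" if "s \<in> {-1..1}" for s
      using b1[of s n] b2[of s n] that C0 abs_triangle_ineq[of "m * C n" "resolvent_deviation (q n) f1 s"] abs_triangle_ineq[of "m * C n" "resolvent_deviation (q n) f2 s"] by auto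
    have S: "x + u \<in> {-1..1}" if "u \<in> closure B" for u using that by (auto simp: clB)
    have V: "?V1 \<in> borel_measurable borel" "?V2 \<in> borel_measurable borel" by measurable
    have fm1: "(\<lambda>z. ennreal (f1 z)) \<in> borel_measurable borel" by measurable
    have pot1: "potential (q n) (\<lambda>z. ennreal (f1 z)) s = ennreal (?V1 s)" if "s \<in> insert x {-1..1}" for s
      unfolding C_def by (rule P1(1)[OF that])
    have V01: "0 \<le> ?V1 s" if "s \<in> insert x {-1..1}" for s
      unfolding C_def by (rule P1(2)[OF that])
    have D1: "integrable (?\<nu> n) (\<lambda>u. ?V1 (x + u))"
      "killed_potential (q n) B (\<lambda>z. ennreal (f1 (x + z))) = ennreal (?V1 x - (\<integral>u. ?V1 (x + u) \<partial>?\<nu> n))"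
      "(\<integral>u. ?V1 (x + u) \<partial>?\<nu> n) \<le> ?V1 x"
      by (rule hit_decomposition_real[OF B less_imp_le[OF q] fm1 V(1) S bV1 pot1 V01]; assumption)+
    have fm2: "(\<lambda>z. ennreal (f2 z)) \<in> borel_measurable borel" by measurable
    have pot2: "potential (q n) (\<lambda>z. ennreal (f2 z)) s = ennreal (?V2 s)" if "s \<in> insert x {-1..1}" for s
      unfolding C_def by (rule P2(1)[OF that])
    have V02: "0 \<le> ?V2 s" if "s \<in> insert x {-1..1}" for s
      unfolding C_def by (rule P2(2)[OF that])
    have D2: "integrable (?\<nu> n) (\<lambda>u. ?V2 (x + u))"
      "killed_potential (q n) B (\<lambda>z. ennreal (f2 (x + z))) = ennreal (?V2 x - (\<integral>u. ?V2 (x + u) \<partial>?\<nu> n))"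
      "(\<integral>u. ?V2 (x + u) \<partial>?\<nu> n) \<le> ?V2 x"
      by (rule hit_decomposition_real[OF B less_imp_le[OF q] fm2 V(2) S bV2 pot2 V02]; assumption)+
    have "killed_potential (q n) B (\<lambda>z. ennreal (f2 (x + z))) = 0"
      by (rule killed_potential_eq_0) (use supp in \<open>auto simp: B_def\<close>)
    with D2(2,3) have e: "?V2 x = (\<integral>u. ?V2 (x + u) \<partial>?\<nu> n)" by (simp add: ennreal_eq_0_iff)
    have d: "\<Delta> n s = ?V1 s - ?V2 s" for s by (simp add: \<Delta>_def)
    have "\<Delta> n x - (\<integral>u. \<Delta> n (x + u) \<partial>?\<nu> n) = ?V1 x - (\<integral>u. ?V1 (x + u) \<partial>?\<nu> n)"
      unfolding d Bochner_Integration.integral_diff[OF D1(1) D2(1)] e[symmetric] by simp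
    then show "killed_potential (q n) B (\<lambda>z. ennreal (f1 (x + z))) = ennreal (\<Delta> n x - (\<integral>u. \<Delta> n (x + u) \<partial>?\<nu> n))" using D1(2) by simp
  qed
  \<comment> \<open>Integrand and measure both vary with \<open>n\<close>. The error
    \<open>h\<close> is compared with its integral under the fixed law for \<open>q = 0\<close>,
    where dominated convergence applies, and the constant is multiplied by a mass that tends to
    one.\<close>
  have I: "(\<lambda>n. \<integral>u. \<Delta> n (x + u) \<partial>?\<nu> n) \<longlonglongrightarrow> - c / pi"
  proof -
    interpret H0: finite_measure "hit_law 0 B 0" by (rule finite_measure_hit_law[OF B order.refl order.refl])
    define h where "h = (\<lambda>n u. \<Delta> n (x + u) + c / pi)"
    define k where "k = 2 * K / pi + \<bar>c\<bar> / pi"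
    have [measurable]: "h n \<in> borel_measurable borel" for n unfolding h_def by measurable
    have hb: "\<bar>h n u\<bar> \<le> k" if "u \<in> closure B" for n u
      using \<Delta>b[of "x + u" n] that abs_triangle_ineq[of "\<Delta> n (x + u)" "c / pi"] unfolding clB h_def k_def by (auto simp: abs_divide)
    have hi: "integrable (hit_law p B 0) (h n)" if "0 \<le> p" for p n
    proof -
      interpret H: finite_measure "hit_law p B 0" by (rule finite_measure_hit_law[OF B order.refl that])
      show ?thesis
      proof (rule H.integrable_const_bound[where B=k])
        show "AE u in hit_law p B 0. norm (h n u) \<le> k"
          using emeasure_hit_law_closure[OF B that] by eventually_elim (simp add: hb)
      qed measurable
    qed
    have z: "(\<lambda>n. \<integral>u. \<bar>h n u\<bar> \<partial>hit_law 0 B 0) \<longlonglongrightarrow> (\<integral>u. 0 \<partial>hit_law 0 B 0)"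
    proof (rule integral_dominated_convergence[where w = "\<lambda>_. k"])
      show "AE u in hit_law 0 B 0. (\<lambda>n. \<bar>h n u\<bar>) \<longlonglongrightarrow> 0"
        using emeasure_hit_law_closure[OF B order.refl]
      proof eventually_elim
        case (elim u)
        then have s: "x + u \<in> {-1..1}" unfolding clB by auto
        have "(\<lambda>n. h n u) \<longlonglongrightarrow> - c / pi + c / pi"
          unfolding h_def const[OF s, symmetric] by (intro tendsto_add tendsto_const \<Delta>lim) (use s in auto)
        then show ?case by (intro tendsto_rabs_zero) simp
      qed
      show "AE u in hit_law 0 B 0. norm \<bar>h n u\<bar> \<le> k" for n
        using emeasure_hit_law_closure[OF B order.refl] by eventually_elim (simp add: hb)
    qed simp_all
    have le: "\<bar>\<integral>u. h n u \<partial>?\<nu> n\<bar> \<le> (\<integral>u. \<bar>h n u\<bar> \<partial>hit_law 0 B 0)" for n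
    proof -
      have q': "0 \<le> q n" using q[of n] by simp
      have "ennreal (\<integral>u. \<bar>h n u\<bar> \<partial>?\<nu> n) = (\<integral>\<^sup>+u. ennreal \<bar>h n u\<bar> \<partial>?\<nu> n)"
        by (rule nn_integral_eq_integral[symmetric]) (simp_all add: integrable_abs hi[OF q'])
      also have "\<dots> \<le> (\<integral>\<^sup>+u. ennreal \<bar>h n u\<bar> \<partial>hit_law 0 B 0)"
        by (rule nn_integral_hit_law_antimono[OF B q']) measurable
      also have "\<dots> = ennreal (\<integral>u. \<bar>h n u\<bar> \<partial>hit_law 0 B 0)"
        by (rule nn_integral_eq_integral) (simp_all add: integrable_abs hi)
      finally have "(\<integral>u. \<bar>h n u\<bar> \<partial>?\<nu> n) \<le> (\<integral>u. \<bar>h n u\<bar> \<partial>hit_law 0 B 0)"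
        by (simp add: ennreal_le_iff Bochner_Integration.integral_nonneg)
      with integral_abs_bound[of "?\<nu> n" "h n"] show ?thesis by (rule order_trans)
    qed
    have "(\<lambda>n. \<integral>u. h n u \<partial>?\<nu> n) \<longlonglongrightarrow> 0"
      by (rule Lim_null_comparison[OF always_eventually z[simplified]]) (simp add: le)
    moreover have "(\<lambda>n. c / pi * measure (?\<nu> n) UNIV) \<longlonglongrightarrow> c / pi * 1"
      unfolding B_def by (intro tendsto_mult tendsto_const hit_law_mass_tendsto_1[OF \<Psi> q q0])
    ultimately have "(\<lambda>n. (\<integral>u. h n u \<partial>?\<nu> n) - c / pi * measure (?\<nu> n) UNIV) \<longlonglongrightarrow> 0 - c / pi * 1" by (rule tendsto_diff)
    moreover have "(\<integral>u. h n u \<partial>?\<nu> n) - c / pi * measure (?\<nu> n) UNIV = (\<integral>u. \<Delta> n (x + u) \<partial>?\<nu> n)" for n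
    proof -
      have q': "0 \<le> q n" using q[of n] by simp
      interpret H: finite_measure "?\<nu> n" by (rule finite_measure_hit_law[OF B order.refl q'])
      have "(\<integral>u. \<Delta> n (x + u) \<partial>?\<nu> n) = (\<integral>u. h n u - c / pi \<partial>?\<nu> n)" by (simp add: h_def)
      also have "\<dots> = (\<integral>u. h n u \<partial>?\<nu> n) - (\<integral>u. c / pi \<partial>?\<nu> n)"
        by (rule Bochner_Integration.integral_diff[OF hi[OF q']]) simp
      finally show ?thesis by (simp add: mult.commute)
    qed
    ultimately show ?thesis by simp
  qed
  have "(\<lambda>n. \<Delta> n x - (\<integral>u. \<Delta> n (x + u) \<partial>?\<nu> n)) \<longlonglongrightarrow> - (L f1 x - L f2 x) / pi - (- c / pi)"
    by (intro tendsto_diff \<Delta>lim I) simp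
  then have "(\<lambda>n. killed_potential (q n) B (\<lambda>z. ennreal (f1 (x + z)))) \<longlonglongrightarrow> ennreal (- (L f1 x - L f2 x) / pi - (- c / pi))"
    unfolding kp by (rule tendsto_ennrealI)
  moreover have "(\<lambda>n. killed_potential (q n) B (\<lambda>z. ennreal (f1 (x + z)))) \<longlonglongrightarrow> killed_potential 0 B (\<lambda>z. ennreal (f1 (x + z)))"
    by (rule killed_potential_tendsto_0[OF B _ qd q0]) measurable
  ultimately have "killed_potential 0 B (\<lambda>z. ennreal (f1 (x + z))) = ennreal (- (L f1 x - L f2 x) / pi - (- c / pi))"
    by (rule LIMSEQ_unique[THEN sym])
  moreover have "- (L f1 x - L f2 x) / pi - (- c / pi) = (c - (L f1 x - L f2 x)) / pi" by (simp add: diff_divide_distrib)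
  ultimately show ?thesis unfolding B_def by simp
qed

end

text \<open>The result of sweeping Lebesgue measure on \<open>A\<close> onto the interval.\<close>
definition hit_mixture :: "real set \<Rightarrow> real \<Rightarrow> real" where
  "hit_mixture A z = indicator {-1<..<1} z * (\<integral>y. indicator A y * hit_kernel (1/2) (1/2) y z \<partial>lborel)"

lemma borel_measurable_hit_mixture [measurable]:
  assumes [measurable]: "A \<in> sets borel"
  shows "hit_mixture A \<in> borel_measurable borel"
  unfolding hit_mixture_def by measurable

section \<open>Sweeping Lebesgue measure on a bounded set at positive distance from the
  interval\<close>

context
  fixes A :: "real set" and \<delta> N :: real
  assumes A [measurable]: "A \<in> sets borel" and AN: "A \<subseteq> {1+\<delta>..N}" and \<delta>: "0 < \<delta>"
begin

lemma emeasure_bounded_set: "emeasure lborel A < \<infinity>"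
proof -
  have "emeasure lborel A \<le> emeasure lborel {1+\<delta>..N}" using AN by (intro emeasure_mono) auto
  also have "\<dots> < \<infinity>" by (simp add: emeasure_lborel_Icc_eq)
  finally show ?thesis .
qed

lemma integrable_indicator_set: "integrable lborel (indicator A :: real \<Rightarrow> real)"
  using emeasure_bounded_set by simp

text \<open>The distance \<open>\<delta>\<close> bounds the factor \<open>1 / (y - 1)\<close>, so
  that one multiple of the arcsine weight works for all \<open>y\<close> in
  \<open>A\<close>.\<close>

lemma hit_kernel_le_weight:
  assumes y: "y \<in> A" and z: "z \<in> {-1<..<1}"
  shows "hit_kernel (1/2) (1/2) y z \<le> (N+1)/\<delta> * (1-z\<^sup>2) powr (-1/2)"
proof -
  have y': "1 + \<delta> \<le> y" "y \<le> N" using AN y by auto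
  have "hit_kernel (1/2) (1/2) y z \<le> (y+1)/(y-1) * (1-z\<^sup>2) powr (-1/2)"
    by (rule hit_kernel_le_arcsine) (use y' \<delta> z in auto)
  also have "\<dots> \<le> (N+1)/\<delta> * (1-z\<^sup>2) powr (-1/2)"
    using y' \<delta> by (intro mult_right_mono frac_le) auto
  finally show ?thesis .
qed

lemma hit_kernel_nonneg_on:
  assumes y: "y \<in> A" and z: "z \<in> {-1<..<1}"
  shows "0 \<le> hit_kernel (1/2) (1/2) y z"
  using AN \<delta> y z by (intro hit_kernel_nonneg) auto

lemma hit_mixture_nonneg: "0 \<le> hit_mixture A z"
proof (cases "z \<in> {-1<..<1}")
  case True
  have "0 \<le> indicator A y * hit_kernel (1/2) (1/2) y z" for y
    using hit_kernel_nonneg_on[OF _ True, of y] by (simp add: indicator_def)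
  then have "0 \<le> (\<integral>y. indicator A y * hit_kernel (1/2) (1/2) y z \<partial>lborel)" by (rule Bochner_Integration.integral_nonneg)
  then show ?thesis using True by (simp add: hit_mixture_def)
qed (simp add: hit_mixture_def)

lemma hit_mixture_le:
  assumes z: "z \<in> {-1<..<1}"
  shows "hit_mixture A z \<le> (N+1)/\<delta> * (1-z\<^sup>2) powr (-1/2) * measure lborel A"
proof -
  let ?c = "(N+1)/\<delta> * (1-z\<^sup>2) powr (-1/2)"
  have b: "norm (indicator A y * hit_kernel (1/2) (1/2) y z) \<le> ?c * indicator A y" for y
    using hit_kernel_le_weight[OF _ z, of y] hit_kernel_nonneg_on[OF _ z, of y] by (auto simp: indicator_def)
  have i: "integrable lborel (\<lambda>y. ?c * indicator A y)" by (intro integrable_mult_right integrable_indicator_set)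
  have "norm (\<integral>y. indicator A y * hit_kernel (1/2) (1/2) y z \<partial>lborel) \<le> (\<integral>y. ?c * indicator A y \<partial>lborel)"
  proof (rule Bochner_Integration.integral_norm_bound_integral[OF _ i b])
    show "integrable lborel (\<lambda>y. indicator A y * hit_kernel (1/2) (1/2) y z)"
      by (rule Bochner_Integration.integrable_bound[OF i]) (measurable, rule AE_I2, rule order_trans[OF b], simp only: real_norm_def abs_ge_self)
  qed
  also have "\<dots> = ?c * measure lborel A" by simp
  finally show ?thesis using z by (simp add: hit_mixture_def)
qed

text \<open>An exchange of integrals, justified by the integrability of \<open>log_majorant\<close>
  against the arcsine weight and by the finite measure of \<open>A\<close>.\<close>

lemma hit_mixture_integral:
  fixes g :: "real \<Rightarrow> real" and s :: real
  assumes g [measurable]: "g \<in> borel_measurable borel"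
    and bound: "\<And>z. z \<noteq> s \<Longrightarrow> \<bar>g z\<bar> \<le> log_majorant \<bar>z - s\<bar>"
  shows "integrable lborel (\<lambda>y. indicator A y * (\<integral>z. indicator {-1<..<1} z * (hit_kernel (1/2) (1/2) y z * g z) \<partial>lborel))"
    and "(\<integral>z. hit_mixture A z * g z \<partial>lborel) = (\<integral>y. indicator A y * (\<integral>z. indicator {-1<..<1} z * (hit_kernel (1/2) (1/2) y z * g z) \<partial>lborel) \<partial>lborel)"
proof -
  let ?F = "\<lambda>y z. indicator A y * (indicator {-1<..<1} z * (hit_kernel (1/2) (1/2) y z * g z))"
  let ?W = "\<lambda>z. ennreal ((1-z\<^sup>2) powr (-1/2) * log_majorant \<bar>z - s\<bar>) * indicator {-1<..<1} z"
  obtain K where K: "\<forall>s\<in>{-\<bar>s\<bar>..\<bar>s\<bar>}. (\<integral>\<^sup>+z\<in>{-1<..<1}. ennreal ((1-z\<^sup>2) powr (-1/2) * log_majorant \<bar>z - s\<bar>) \<partial>lborel) \<le> ennreal K"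
    using log_weight_bounded_arcsine[of "\<bar>s\<bar>"] by auto
  have Ks: "(\<integral>\<^sup>+z. ?W z \<partial>lborel) \<le> ennreal K" by (rule bspec[OF K]) auto
  \<comment> \<open>\<open>\<bar>N\<bar>\<close> instead of \<open>N\<close>, because for empty
    \<open>A\<close> nothing is known about the sign of \<open>N\<close>.\<close>
  let ?c = "(\<bar>N\<bar>+1)/\<delta>"
  have c: "0 \<le> ?c" using \<delta> by simp
  have fin: "(\<integral>\<^sup>+y. (\<integral>\<^sup>+z. ennreal (norm (?F y z)) \<partial>lborel) \<partial>lborel) < \<infinity>"
  proof -
    have "(\<integral>\<^sup>+y. (\<integral>\<^sup>+z. ennreal (norm (?F y z)) \<partial>lborel) \<partial>lborel) \<le> (\<integral>\<^sup>+y. indicator A y * (ennreal ?c * ennreal K) \<partial>lborel)"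
    proof (rule nn_integral_mono)
      fix y :: real
      show "(\<integral>\<^sup>+z. ennreal (norm (?F y z)) \<partial>lborel) \<le> indicator A y * (ennreal ?c * ennreal K)"
      proof (cases "y \<in> A")
        case True
        have "(\<integral>\<^sup>+z. ennreal (norm (?F y z)) \<partial>lborel) \<le> (\<integral>\<^sup>+z. ennreal ?c * ?W z \<partial>lborel)"
        proof (rule nn_integral_mono_AE)
          have "AE z in lborel. z \<noteq> s" by (rule AE_lborel_singleton)
          then show "AE z in lborel. ennreal (norm (?F y z)) \<le> ennreal ?c * ?W z"
          proof eventually_elim
            case (elim z)
            show ?case
            proof (cases "z \<in> {-1<..<1}")
              case z: True
              have "(N+1)/\<delta> * (1-z\<^sup>2) powr (-1/2) \<le> ?c * (1-z\<^sup>2) powr (-1/2)"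
                using \<delta> by (intro mult_right_mono divide_right_mono) auto
              then have h: "hit_kernel (1/2) (1/2) y z \<le> ?c * (1-z\<^sup>2) powr (-1/2)" using hit_kernel_le_weight[OF True z] by linarith
              have "hit_kernel (1/2) (1/2) y z * \<bar>g z\<bar> \<le> ?c * (1-z\<^sup>2) powr (-1/2) * log_majorant \<bar>z - s\<bar>"
                by (intro mult_mono h bound[OF elim] mult_nonneg_nonneg c) auto
              then have "norm (?F y z) \<le> ?c * ((1-z\<^sup>2) powr (-1/2) * log_majorant \<bar>z - s\<bar>)"
                using True z hit_kernel_nonneg_on[OF True z] by (simp add: abs_mult mult.assoc)
              from ennreal_leI[OF this] show ?thesis using z by (simp only: ennreal_mult'[OF c]) simp
            qed simp
          qed
        qed
        also have "\<dots> = ennreal ?c * (\<integral>\<^sup>+z. ?W z \<partial>lborel)" by (rule nn_integral_cmult) measurable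
        also have "\<dots> \<le> ennreal ?c * ennreal K" by (rule mult_left_mono[OF Ks]) simp
        finally show ?thesis using True by simp
      qed simp
    qed
    also have "\<dots> = emeasure lborel A * (ennreal ?c * ennreal K)"
      by (subst nn_integral_multc) simp_all
    also have "\<dots> < \<infinity>" using emeasure_bounded_set by (simp add: ennreal_mult_less_top)
    finally show ?thesis .
  qed
  have Fm: "case_prod ?F \<in> borel_measurable (lborel \<Otimes>\<^sub>M lborel)" by measurable
  note FB = lborel_pair.Fubini_integral_bounded[OF Fm fin]
  have in1: "(\<integral>z. ?F y z \<partial>lborel) = indicator A y * (\<integral>z. indicator {-1<..<1} z * (hit_kernel (1/2) (1/2) y z * g z) \<partial>lborel)" for y
    by (rule integral_mult_right_zero)
  show "integrable lborel (\<lambda>y. indicator A y * (\<integral>z. indicator {-1<..<1} z * (hit_kernel (1/2) (1/2) y z * g z) \<partial>lborel))"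
    using lborel_pair.integrable_fst[OF FB(1)] unfolding in1 .
  have in2: "(\<integral>y. ?F y z \<partial>lborel) = hit_mixture A z * g z" for z
  proof -
    have "(\<integral>y. ?F y z \<partial>lborel) = (\<integral>y. indicator A y * hit_kernel (1/2) (1/2) y z * (indicator {-1<..<1} z * g z) \<partial>lborel)"
      by (intro Bochner_Integration.integral_cong refl) (simp add: mult_ac)
    also have "\<dots> = hit_mixture A z * g z" unfolding integral_mult_left_zero hit_mixture_def by (simp add: mult_ac)
    finally show ?thesis .
  qed
  show "(\<integral>z. hit_mixture A z * g z \<partial>lborel) = (\<integral>y. indicator A y * (\<integral>z. indicator {-1<..<1} z * (hit_kernel (1/2) (1/2) y z * g z) \<partial>lborel) \<partial>lborel)"
    using FB(2) unfolding in1 in2 by (rule sym)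
qed

lemma hit_mixture_weight_bound:
  assumes R: "0 \<le> R"
  shows "\<exists>K\<ge>0. \<forall>s\<in>{-R..R}. (\<integral>\<^sup>+z. ennreal (hit_mixture A z * log_majorant \<bar>z - s\<bar>) \<partial>lborel) \<le> ennreal K"
proof -
  from log_weight_bounded_arcsine[OF R]
  obtain K where K: "0 \<le> K" "\<forall>s\<in>{-R..R}. (\<integral>\<^sup>+z\<in>{-1<..<1}. ennreal ((1-z\<^sup>2) powr (-1/2) * log_majorant \<bar>z - s\<bar>) \<partial>lborel) \<le> ennreal K"
    by (elim exE conjE) (rule that)
  let ?c = "(\<bar>N\<bar>+1)/\<delta> * measure lborel A"
  have c: "0 \<le> ?c" using \<delta> by simp
  have "(\<integral>\<^sup>+z. ennreal (hit_mixture A z * log_majorant \<bar>z - s\<bar>) \<partial>lborel) \<le> ennreal (?c * K)" if s: "s \<in> {-R..R}" for s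
  proof -
    let ?w = "\<lambda>z. (1-z\<^sup>2) powr (-1/2) * log_majorant \<bar>z - s\<bar>"
    have "(\<integral>\<^sup>+z. ennreal (hit_mixture A z * log_majorant \<bar>z - s\<bar>) \<partial>lborel) \<le> (\<integral>\<^sup>+z. ennreal ?c * (ennreal (?w z) * indicator {-1<..<1} z) \<partial>lborel)"
    proof (rule nn_integral_mono)
      fix z :: real
      show "ennreal (hit_mixture A z * log_majorant \<bar>z - s\<bar>) \<le> ennreal ?c * (ennreal (?w z) * indicator {-1<..<1} z)"
        proof (cases "z \<in> {-1<..<1}")
          case True
          have "(N+1)/\<delta> * (1-z\<^sup>2) powr (-1/2) * measure lborel A \<le> (\<bar>N\<bar>+1)/\<delta> * (1-z\<^sup>2) powr (-1/2) * measure lborel A"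
            using \<delta> by (intro mult_right_mono divide_right_mono) auto
          then have "hit_mixture A z \<le> ?c * (1-z\<^sup>2) powr (-1/2)" using hit_mixture_le[OF True] by (simp only: mult_ac)
          then have "hit_mixture A z * log_majorant \<bar>z - s\<bar> \<le> ?c * (1-z\<^sup>2) powr (-1/2) * log_majorant \<bar>z - s\<bar>"
            by (rule mult_right_mono) simp
          then have "hit_mixture A z * log_majorant \<bar>z - s\<bar> \<le> ?c * ?w z" by (simp only: mult.assoc)
          from ennreal_leI[OF this] show ?thesis using True by (simp only: ennreal_mult'[OF c]) simp
        qed (simp add: hit_mixture_def)
    qed
    also have "\<dots> = ennreal ?c * (\<integral>\<^sup>+z. ennreal (?w z) * indicator {-1<..<1} z \<partial>lborel)" by (rule nn_integral_cmult) measurable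
    also have "\<dots> \<le> ennreal ?c * ennreal K" by (rule mult_left_mono[OF bspec[OF K(2) s]]) simp
    also have "\<dots> = ennreal (?c * K)" by (rule ennreal_mult'[OF c, symmetric])
    finally show ?thesis .
  qed
  then show ?thesis by (intro exI[of _ "?c * K"] conjI ballI mult_nonneg_nonneg c K(1))
qed

lemma hit_mixture_log_bound:
  assumes R: "0 \<le> R"
  shows "\<exists>K\<ge>0. \<forall>s\<in>{-R..R}. (\<integral>\<^sup>+z. ennreal (hit_mixture A z * \<bar>ln \<bar>z - s\<bar>\<bar>) \<partial>lborel) \<le> ennreal K"
proof -
  from hit_mixture_weight_bound[OF R]
  obtain K where K: "0 \<le> K" "\<forall>s\<in>{-R..R}. (\<integral>\<^sup>+z. ennreal (hit_mixture A z * log_majorant \<bar>z - s\<bar>) \<partial>lborel) \<le> ennreal K"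
    by (elim exE conjE) (rule that)
  have "(\<integral>\<^sup>+z. ennreal (hit_mixture A z * \<bar>ln \<bar>z - s\<bar>\<bar>) \<partial>lborel) \<le> (\<integral>\<^sup>+z. ennreal (hit_mixture A z * log_majorant \<bar>z - s\<bar>) \<partial>lborel)" for s
  proof (rule nn_integral_mono_AE)
    have "AE z in lborel. z \<noteq> s" by (rule AE_lborel_singleton)
    then show "AE z in lborel. ennreal (hit_mixture A z * \<bar>ln \<bar>z - s\<bar>\<bar>) \<le> ennreal (hit_mixture A z * log_majorant \<bar>z - s\<bar>)"
      by eventually_elim (intro ennreal_leI mult_left_mono abs_ln_le_powr hit_mixture_nonneg, simp)
  qed
  then show ?thesis by (intro exI[of _ K] conjI ballI K(1)) (rule order_trans, assumption, rule bspec[OF K(2)])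
qed

lemma indicator_log_bound:
  assumes R: "0 \<le> R"
  shows "\<exists>K\<ge>0. \<forall>s\<in>{-R..R}. (\<integral>\<^sup>+z. ennreal (indicator A z * \<bar>ln \<bar>z - s\<bar>\<bar>) \<partial>lborel) \<le> ennreal K"
proof -
  from log_weight_bounded_interval[OF R abs_ge_zero[of N]]
  obtain K where K: "0 \<le> K" "\<forall>s\<in>{-R..R}. (\<integral>\<^sup>+z\<in>{-\<bar>N\<bar>..\<bar>N\<bar>}. ennreal (log_majorant \<bar>z - s\<bar>) \<partial>lborel) \<le> ennreal K"
    by (elim exE conjE) (rule that)
  have "(\<integral>\<^sup>+z. ennreal (indicator A z * \<bar>ln \<bar>z - s\<bar>\<bar>) \<partial>lborel) \<le> ennreal K" if s: "s \<in> {-R..R}" for s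
  proof -
    have "(\<integral>\<^sup>+z. ennreal (indicator A z * \<bar>ln \<bar>z - s\<bar>\<bar>) \<partial>lborel) \<le> (\<integral>\<^sup>+z\<in>{-\<bar>N\<bar>..\<bar>N\<bar>}. ennreal (log_majorant \<bar>z - s\<bar>) \<partial>lborel)"
    proof (rule nn_integral_mono_AE)
      have "AE z in lborel. z \<noteq> s" by (rule AE_lborel_singleton)
      then show "AE z in lborel. ennreal (indicator A z * \<bar>ln \<bar>z - s\<bar>\<bar>) \<le> ennreal (log_majorant \<bar>z - s\<bar>) * indicator {-\<bar>N\<bar>..\<bar>N\<bar>} z"
      proof eventually_elim
        case (elim z)
        show ?case
        proof (cases "z \<in> A")
          case True
          then have "z \<in> {-\<bar>N\<bar>..\<bar>N\<bar>}" using AN \<delta> by force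
          then show ?thesis using True elim ennreal_leI[OF abs_ln_le_powr[of "\<bar>z - s\<bar>"]] by simp
        qed simp
      qed
    qed
    also have "\<dots> \<le> ennreal K" by (rule bspec[OF K(2) s])
    finally show ?thesis .
  qed
  then show ?thesis using K(1) by (intro exI[of _ K]) simp
qed

text \<open>Each kernel has mass one, and Fubini transfers this to the mixture. The constant
  function is handled with base point \<open>2\<close>, which lies outside the interval, where the
  mixture vanishes.\<close>

lemma hit_mixture_mass: "integrable lborel (hit_mixture A)" "integral\<^sup>L lborel (hit_mixture A) = integral\<^sup>L lborel (indicator A)"
proof -
  have m: "(\<integral>z. indicator {-1<..<1} z * hit_kernel (1/2) (1/2) y z \<partial>lborel) = 1" if y: "y \<in> A" for y
  proof -
    have y1: "1 < y" using y AN \<delta> by force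
    have i: "integrable lborel (\<lambda>z. indicator {-1<..<1} z * hit_kernel (1/2) (1/2) y z)" by (rule integrable_hit_kernel) (use y1 in auto)
    have nn: "0 \<le> indicator {-1<..<1} z * hit_kernel (1/2) (1/2) y z" for z
      using hit_kernel_nonneg_on[OF y, of z] by (simp add: indicator_def)
    have "ennreal (\<integral>z. indicator {-1<..<1} z * hit_kernel (1/2) (1/2) y z \<partial>lborel) = (\<integral>\<^sup>+z\<in>{-1<..<1}. ennreal (hit_kernel (1/2) (1/2) y z) \<partial>lborel)"
      unfolding nn_integral_eq_integral[OF i AE_I2[OF nn], symmetric] by (intro nn_integral_cong) (simp add: indicator_def)
    also have "\<dots> = ennreal 1" using nn_integral_hit_kernel_half[OF y1] by simp
    finally show ?thesis using Bochner_Integration.integral_nonneg[OF nn, of lborel] by simp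
  qed
  have "integral\<^sup>L lborel (hit_mixture A) = (\<integral>z. hit_mixture A z * 1 \<partial>lborel)" by simp
  also have "\<dots> = (\<integral>y. indicator A y * (\<integral>z. indicator {-1<..<1} z * (hit_kernel (1/2) (1/2) y z * 1) \<partial>lborel) \<partial>lborel)"
    by (rule hit_mixture_integral(2)[where s=2]) (simp, rule one_le_log_majorant)
  also have "\<dots> = integral\<^sup>L lborel (indicator A)"
    by (intro Bochner_Integration.integral_cong refl) (simp add: m split: split_indicator)
  finally show "integral\<^sup>L lborel (hit_mixture A) = integral\<^sup>L lborel (indicator A)" .
  show "integrable lborel (hit_mixture A)"
  proof (rule integrableI_nonneg)
    obtain K where K: "\<forall>s\<in>{-2..2}. (\<integral>\<^sup>+z. ennreal (hit_mixture A z * log_majorant \<bar>z - s\<bar>) \<partial>lborel) \<le> ennreal K"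
      using hit_mixture_weight_bound[of 2, OF zero_le_numeral] by (elim exE conjE) (rule that)
    have "(\<integral>\<^sup>+z. ennreal (hit_mixture A z) \<partial>lborel) \<le> (\<integral>\<^sup>+z. ennreal (hit_mixture A z * log_majorant \<bar>z - 2\<bar>) \<partial>lborel)"
    proof (rule nn_integral_mono)
      fix z :: real
      show "ennreal (hit_mixture A z) \<le> ennreal (hit_mixture A z * log_majorant \<bar>z - 2\<bar>)"
      proof (cases "z = 2")
        case False
        have "hit_mixture A z * 1 \<le> hit_mixture A z * log_majorant \<bar>z - 2\<bar>"
          by (rule mult_left_mono[OF one_le_log_majorant[OF False, unfolded abs_one] hit_mixture_nonneg])
        then show ?thesis by (intro ennreal_leI) simp
      qed (simp add: hit_mixture_def)
    qed
    also have "\<dots> \<le> ennreal K" by (rule bspec[OF K]) simp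
    finally show "(\<integral>\<^sup>+z. ennreal (hit_mixture A z) \<partial>lborel) < \<infinity>" by (rule le_less_trans) simp
  qed (simp_all add: hit_mixture_nonneg)
qed

end

text \<open>Applies \<open>cauchy_killed_potential\<close> to the indicator of \<open>A\<close> and
  to \<open>hit_mixture A\<close>. By Fubini the difference of their logarithmic integrals is the
  integral over \<open>A\<close> of \<open>ln \<bar>y - s\<bar> - hit_log y s\<close>; this
  integrand does not depend on \<open>s\<close> in the closed interval, and its value at
  \<open>x\<close> is smaller by \<open>pi\<close> times the Green density.\<close>

lemma occupation_density_cauchy:
  fixes M :: "'a measure" and X :: "real \<Rightarrow> 'a \<Rightarrow> real" and x \<delta> N :: real and A :: "real set"
  assumes st: "stable_levy_process M X 1 (1/2)" and x: "1 < x"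
    and A [measurable]: "A \<in> sets borel" and AN: "A \<subseteq> {1+\<delta>..N}" and \<delta>: "0 < \<delta>"
  shows "(\<integral>\<^sup>+\<omega>. occupation X x A \<omega> \<partial>M) = (\<integral>\<^sup>+y\<in>A. ennreal (green_density 1 (1/2) x y) \<partial>lborel)"
proof -
  interpret levy_process M X "char_exponent 1 (1/2)" using st by (rule levy_process_if_stable)
  have \<Psi>: "char_exponent 1 (1/2) \<xi> = complex_of_real \<bar>\<xi>\<bar>" for \<xi>
    using char_exponent_eq[of 1 "1/2" \<xi>] by (cases "\<xi> = 0") (simp_all add: admissible_def)
  have x0: "0 \<le> x" using x by simp
  note ctx = A AN \<delta>
  from indicator_log_bound[OF ctx x0]
  obtain K1 where K1: "0 \<le> K1" "\<forall>s\<in>{-x..x}. (\<integral>\<^sup>+z. ennreal (indicator A z * \<bar>ln \<bar>z - s\<bar>\<bar>) \<partial>lborel) \<le> ennreal K1"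
    by (elim exE conjE) (rule that)
  from hit_mixture_log_bound[OF ctx x0]
  obtain K2 where K2: "0 \<le> K2" "\<forall>s\<in>{-x..x}. (\<integral>\<^sup>+z. ennreal (hit_mixture A z * \<bar>ln \<bar>z - s\<bar>\<bar>) \<partial>lborel) \<le> ennreal K2"
    by (elim exE conjE) (rule that)
  define K where "K = max K1 K2"
  have K: "0 \<le> K" using K1(1) by (simp add: K_def)
  have sx: "s \<in> {-x..x}" if "s \<in> insert x {-1..1}" for s using that x by auto
  have b1: "(\<integral>\<^sup>+z. ennreal (indicator A z * \<bar>ln \<bar>z - s\<bar>\<bar>) \<partial>lborel) \<le> ennreal K" if "s \<in> insert x {-1..1}" for s
    by (rule order_trans[OF bspec[OF K1(2) sx[OF that]]]) (simp add: K_def ennreal_leI)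
  have b2: "(\<integral>\<^sup>+z. ennreal (hit_mixture A z * \<bar>ln \<bar>z - s\<bar>\<bar>) \<partial>lborel) \<le> ennreal K" if "s \<in> insert x {-1..1}" for s
    by (rule order_trans[OF bspec[OF K2(2) sx[OF that]]]) (simp add: K_def ennreal_leI)
  let ?L1 = "\<lambda>s. \<integral>z. indicator A z * ln \<bar>z - s\<bar> \<partial>lborel"
  let ?L2 = "\<lambda>s. \<integral>z. hit_mixture A z * ln \<bar>z - s\<bar> \<partial>lborel"
  let ?G = "\<lambda>s y. indicator A y * (ln \<bar>y - s\<bar> - hit_log y s)"
  have G: "integrable lborel (?G s)" and LG: "?L1 s - ?L2 s = (\<integral>y. ?G s y \<partial>lborel)" if s: "s \<in> insert x {-1..1}" for s
  proof -
    have gb: "\<bar>ln \<bar>z - s\<bar>\<bar> \<le> log_majorant \<bar>z - s\<bar>" if "z \<noteq> s" for z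
      by (rule abs_ln_le_powr) (use that in simp)
    have gm: "(\<lambda>z. ln \<bar>z - s\<bar>) \<in> borel_measurable borel" by measurable
    note H = hit_mixture_integral[OF ctx gm gb, folded hit_log_def]
    have i1: "integrable lborel (\<lambda>z. indicator A z * ln \<bar>z - s\<bar>)"
    proof (rule integrableI_bounded)
      have "(\<integral>\<^sup>+z. ennreal (norm (indicator A z * ln \<bar>z - s\<bar>)) \<partial>lborel) = (\<integral>\<^sup>+z. ennreal (indicator A z * \<bar>ln \<bar>z - s\<bar>\<bar>) \<partial>lborel)"
        by (intro nn_integral_cong) (simp add: abs_mult)
      then show "(\<integral>\<^sup>+z. ennreal (norm (indicator A z * ln \<bar>z - s\<bar>)) \<partial>lborel) < \<infinity>"
        using b1[OF s] by (simp add: le_less_trans)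
    qed measurable
    have e: "?G s y = indicator A y * ln \<bar>y - s\<bar> - indicator A y * hit_log y s" for y by (simp add: right_diff_distrib)
    have i2: "integrable lborel (\<lambda>y. indicator A y * hit_log y s)" by (rule H(1))
    show "integrable lborel (?G s)" unfolding e by (rule Bochner_Integration.integrable_diff[OF i1 i2])
    have "?L2 s = (\<integral>y. indicator A y * hit_log y s \<partial>lborel)" by (rule H(2))
    then show "?L1 s - ?L2 s = (\<integral>y. ?G s y \<partial>lborel)" unfolding e Bochner_Integration.integral_diff[OF i1 i2] by simp
  qed
  define c where "c = (\<integral>y. ?G 1 y \<partial>lborel)"
  have const: "?L1 s - ?L2 s = c" if s: "s \<in> {-1..1}" for s
  proof -
    have e: "?G s y = ?G 1 y" for y
    proof (cases "y \<in> A")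
      case True
      then have y: "1 < y" using AN \<delta> by force
      have "\<bar>s\<bar> \<le> 1" using s by auto
      then have "ln (y - s) - hit_log y s = ln (y - 1) - hit_log y 1" using hit_log_inside[OF y, of s] by linarith
      then show ?thesis using s y by simp
    qed simp
    have "?L1 s - ?L2 s = (\<integral>y. ?G s y \<partial>lborel)" by (rule LG) (use s in auto)
    also have "\<dots> = c" unfolding c_def by (intro Bochner_Integration.integral_cong refl) (rule e)
    finally show ?thesis .
  qed
  \<comment> \<open>The form with \<open>enn2real\<close> also shows that this integrand is
    nonnegative, as the conversion to a nonnegative integral requires.\<close>
  have gd: "(?G 1 y - ?G x y) / pi = enn2real (ennreal (green_density 1 (1/2) x y))" if "y \<in> A" "y \<noteq> x" for y
  proof -
    have y: "1 < y" using that(1) AN \<delta> by force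
    have "(ln (y - 1) - hit_log y 1) - (ln \<bar>y - x\<bar> - hit_log y x) = pi * enn2real (ennreal (green_density 1 (1/2) x y))"
      using hit_log_outside[OF x y that(2)[THEN not_sym]] by linarith
    then show ?thesis using that y by simp
  qed
  have "killed_potential 0 {-1-x<..<1-x} (\<lambda>z. ennreal (indicator A (x + z))) = ennreal ((c - (?L1 x - ?L2 x)) / pi)"
  proof (rule cauchy_killed_potential[OF \<Psi>])
    show "hit_mixture A z = 0" if "z \<notin> {-1<..<1}" for z using that by (simp add: hit_mixture_def)
    show "0 \<le> hit_mixture A z" for z by (rule hit_mixture_nonneg[OF ctx])
    show "integrable lborel (hit_mixture A)" by (rule hit_mixture_mass(1)[OF ctx])
    show "integral\<^sup>L lborel (indicator A) = integral\<^sup>L lborel (hit_mixture A)" by (rule hit_mixture_mass(2)[OF ctx, symmetric])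
    show "integrable lborel (indicator A :: real \<Rightarrow> real)" by (rule integrable_indicator_set[OF ctx])
  qed (use b1 b2 K const in \<open>simp_all add: hit_mixture_def\<close>)
  also have "(c - (?L1 x - ?L2 x)) / pi = (\<integral>y. (?G 1 y - ?G x y) / pi \<partial>lborel)"
    using G[of 1] G[of x] LG[of x] by (simp add: c_def)
  also have "ennreal (\<integral>y. (?G 1 y - ?G x y) / pi \<partial>lborel) = (\<integral>\<^sup>+y. ennreal ((?G 1 y - ?G x y) / pi) \<partial>lborel)"
  proof (rule nn_integral_eq_integral[symmetric])
    show "integrable lborel (\<lambda>y. (?G 1 y - ?G x y) / pi)" using G[of 1] G[of x] by simp
    have "AE y in lborel. y \<noteq> x" by (rule AE_lborel_singleton)
    then show "AE y in lborel. 0 \<le> (?G 1 y - ?G x y) / pi"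
    proof eventually_elim
      case (elim y)
      show ?case
      proof (cases "y \<in> A")
        case True
        show ?thesis unfolding gd[OF True elim] by simp
      qed simp
    qed
  qed
  also have "\<dots> = (\<integral>\<^sup>+y\<in>A. ennreal (green_density 1 (1/2) x y) \<partial>lborel)"
  proof (rule nn_integral_cong_AE)
    have "AE y in lborel. y \<noteq> x" by (rule AE_lborel_singleton)
    then show "AE y in lborel. ennreal ((?G 1 y - ?G x y) / pi) = ennreal (green_density 1 (1/2) x y) * indicator A y"
    proof eventually_elim
      case (elim y)
      show ?case
      proof (cases "y \<in> A")
        case True
        show ?thesis unfolding gd[OF True elim] using True by simp
      qed simp
    qed
  qed
  finally show ?thesis unfolding expectation_occupation by (simp add: ennreal_indicator)
qed

theorem theorem1p4:
  fixes M :: "'a measure" and X :: "real \<Rightarrow> 'a \<Rightarrow> real"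
    and \<alpha> \<rho> x :: real and A :: "real set"
  assumes "admissible \<alpha> \<rho>" and "\<alpha> \<le> 1"
    and "stable_levy_process M X \<alpha> \<rho>"
    and "x > 1"
    and "A \<in> sets borel" and "A \<subseteq> {1<..}"
  shows "(\<integral>\<^sup>+ \<omega>. occupation X x A \<omega> \<partial>M)
           = (\<integral>\<^sup>+ y\<in>A. ennreal (green_density \<alpha> \<rho> x y) \<partial>lborel)"
proof -
  interpret levy_process M X "char_exponent \<alpha> \<rho>" using assms(3) by (rule levy_process_if_stable)
  have ab: "0 < \<alpha> * \<rho>" "0 < \<alpha> * (1 - \<rho>)"
    using assms(1,2) by (auto simp: admissible_def)
  \<comment> \<open>Measurability of the Green density is available for \<open>y > 1\<close>, hence
    the cut-off.\<close>
  let ?g = "\<lambda>y. ennreal (green_density \<alpha> \<rho> x y) * indicator {1<..} y"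
  have "(\<integral>\<^sup>+ \<omega>. occupation X x A \<omega> \<partial>M) = (\<integral>\<^sup>+ y\<in>A. ?g y \<partial>lborel)"
  proof (rule expectation_occupation_exhaust[OF assms(5,6)])
    show "?g \<in> borel_measurable borel" by (rule borel_measurable_green_density[OF ab assms(4)])
    fix n
    let ?A = "A \<inter> {1 + 1/real (Suc n)..real n}"
    have m: "?A \<in> sets borel" using assms(5) by auto
    have "(\<integral>\<^sup>+ \<omega>. occupation X x ?A \<omega> \<partial>M) = (\<integral>\<^sup>+ y\<in>?A. ennreal (green_density \<alpha> \<rho> x y) \<partial>lborel)"
    proof (cases "\<alpha> < 1")
      case True
      show ?thesis
        by (rule occupation_density_subcritical[OF assms(1) True assms(3,4) m, where N="real n"]) (use assms(6) in auto)
    next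
      case False
      \<comment> \<open>At exponent one admissibility leaves only the symmetric process.\<close>
      then have "\<alpha> = 1" "\<rho> = 1/2" using assms(1,2) by (auto simp: admissible_def)
      with assms(3) have "stable_levy_process M X 1 (1/2)" by simp
      then show ?thesis unfolding \<open>\<alpha> = 1\<close> \<open>\<rho> = 1/2\<close>
        by (rule occupation_density_cauchy[OF _ assms(4) m, where \<delta>="1/real (Suc n)" and N="real n"]) auto
    qed
    also have "\<dots> = (\<integral>\<^sup>+ y\<in>?A. ?g y \<partial>lborel)"
      by (rule set_nn_integral_cong) (use assms(6) in auto)
    finally show "(\<integral>\<^sup>+ \<omega>. occupation X x ?A \<omega> \<partial>M) = (\<integral>\<^sup>+ y\<in>?A. ?g y \<partial>lborel)" .
  qed
  also have "\<dots> = (\<integral>\<^sup>+ y\<in>A. ennreal (green_density \<alpha> \<rho> x y) \<partial>lborel)"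
    by (rule set_nn_integral_cong) (use assms(6) in auto)
  finally show ?thesis .
qed

end
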